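(* For each of the tied six-blades $A1E2$, $A2E1$, $C1D3$, $C2D1$, $C3D2$, $C6D2$, the underlying projection is the same, up to homeomorphism of the sphere, as that of the standard three-crossing diagram of the trefoil; hence among the $8$ choices of over/under information at its three crossings, $6$ give a trivial knot and $2$ give a trefoil knot.
   Context: Six blades numbered $1,\dots,6$ are drawn as parallel horizontal segments stacked in order in the plane. The six left ends are tied in pairs and the six right ends are tied in pairs. A tying pattern on one side is a partition of $\{1,\dots,6\}$ into three pairs; writing $ij$ for $\{i,j\}$, the patterns used here are: $A1=\{12,34,56\}$, $A2=\{16,23,45\}$, $C1=\{12,35,46\}$, $C2=\{15,23,46\}$, $C3=\{15,26,34\}$, $C6=\{16,24,35\}$, $D1=\{14,26,35\}$, $D2=\{13,25,46\}$, $D3=\{15,24,36\}$, and $E1$, $E2$, both with pairs $\{14,25,36\}$. On the right side each pair $ij$ is drawn as a simple arc lying to the right of the blades and joining the right ends of blades $i$ and $j$; two arcs $ij$ and $kl$ cross transversally exactly once if their endpoints interleave, and are disjoint otherwise. $E1$ and $E2$ are the two different drawings of $\{14,25,36\}$: in $E1$, arc $14$ traversed from $1$ meets $25$ then $36$, arc $25$ traversed from $2$ meets $14$ then $36$, and arc $36$ traversed from $3$ meets $14$ then $25$; in $E2$ all these orders are reversed (arc $14$ from $1$ meets $36$ then $25$, arc $25$ from $2$ meets $36$ then $14$, arc $36$ from $3$ meets $25$ then $14$). Left ends are drawn in the same way, mirrored to the left side. The tied six-blade $XY$ is the closed plane projection obtained with left end $X$ and right end $Y$. At each crossing either of the two strands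 may be the upper one, and each choice gives a knot diagram. Projections are regarded on the sphere $S^2$, since an arc may be moved around the outside of the diagram. "Trefoil" means a trefoil of either handedness. *)

theory Defs
  imports "HOL-Analysis.Analysis"
begin

section \<open>Tying patterns\<close>

datatype tying = A1 | A2 | C1 | C2 | C3 | C6 | D1 | D2 | D3 | E1 | E2

fun pairs :: "tying \<Rightarrow> nat set set" where
  "pairs A1 = {{1,2}, {3,4}, {5,6}}"
| "pairs A2 = {{1,6}, {2,3}, {4,5}}"
| "pairs C1 = {{1,2}, {3,5}, {4,6}}"
| "pairs C2 = {{1,5}, {2,3}, {4,6}}"
| "pairs C3 = {{1,5}, {2,6}, {3,4}}"
| "pairs C6 = {{1,6}, {2,4}, {3,5}}"
| "pairs D1 = {{1,4}, {2,6}, {3,5}}"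
| "pairs D2 = {{1,3}, {2,5}, {4,6}}"
| "pairs D3 = {{1,5}, {2,4}, {3,6}}"
| "pairs E1 = {{1,4}, {2,5}, {3,6}}"
| "pairs E2 = {{1,4}, {2,5}, {3,6}}"

definition interleave :: "nat set \<Rightarrow> nat set \<Rightarrow> bool" where
  "interleave e e' \<longleftrightarrow> (\<exists>i k j l. i < k \<and> k < j \<and> j < l \<and>
     (e = {i, j} \<and> e' = {k, l} \<or> e = {k, l} \<and> e' = {i, j}))"


section \<open>Drawings in the plane\<close>

text \<open>The plane is the type of complex numbers.  The blades are normalised to have their left
  ends on the line \<open>Re z = -1\<close>, their right ends on \<open>Re z = 1\<close>, and blade \<open>i\<close> at height \<open>i\<close>.\<close>

definition blade :: "nat \<Rightarrow> complex set" where
  "blade i = closed_segment (Complex (- 1) (real i)) (Complex 1 (real i))"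

text \<open>Arcs are only assumed continuous, so transversality is meant topologically: near \<open>p\<close> the
  two sets look like two perpendicular diameters of a disc.\<close>

definition crosses_at :: "complex set \<Rightarrow> complex set \<Rightarrow> complex \<Rightarrow> bool" where
  "crosses_at A B p \<longleftrightarrow> (\<exists>U f g. open U \<and> p \<in> U \<and> homeomorphism U (ball (0::complex) 1) f g \<and> f p = 0 \<and>
     f ` (A \<inter> U) = {z \<in> ball 0 1. Im z = 0} \<and> f ` (B \<inter> U) = {z \<in> ball 0 1. Re z = 0})"

definition meets_in_order :: "(real \<Rightarrow> complex) \<Rightarrow> complex set \<Rightarrow> complex set \<Rightarrow> bool" where
  "meets_in_order \<gamma> A B \<longleftrightarrow> (\<exists>s t. 0 \<le> s \<and> s < t \<and> t \<le> 1 \<and> \<gamma> s \<in> A \<and> \<gamma> t \<in> B)"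

text \<open>The path \<open>R e\<close> draws the pair \<open>e\<close>, and is traversed from the end of the blade with the
  smaller number.  For the patterns other than \<open>E1\<close> and \<open>E2\<close> the order of the crossings along the
  arcs is forced by the other conditions.\<close>

definition right_drawing :: "tying \<Rightarrow> (nat set \<Rightarrow> real \<Rightarrow> complex) \<Rightarrow> bool" where
  "right_drawing Y R \<longleftrightarrow>
     (\<forall>e \<in> pairs Y. arc (R e) \<and>
        pathstart (R e) = Complex 1 (real (Min e)) \<and> pathfinish (R e) = Complex 1 (real (Max e)) \<and>
        (\<forall>t \<in> {0<..<1}. Re (R e t) > 1)) \<and>
     (\<forall>e \<in> pairs Y. \<forall>e' \<in> pairs Y. e \<noteq> e' \<longrightarrow>
        (if interleave e e'
         then \<exists>p. path_image (R e) \<inter> path_image (R e') = {p} \<and>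
                  crosses_at (path_image (R e)) (path_image (R e')) p
         else path_image (R e) \<inter> path_image (R e') = {})) \<and>
     (Y = E1 \<longrightarrow>
        meets_in_order (R {1,4}) (path_image (R {2,5})) (path_image (R {3,6})) \<and>
        meets_in_order (R {2,5}) (path_image (R {1,4})) (path_image (R {3,6})) \<and>
        meets_in_order (R {3,6}) (path_image (R {1,4})) (path_image (R {2,5}))) \<and>
     (Y = E2 \<longrightarrow>
        meets_in_order (R {1,4}) (path_image (R {3,6})) (path_image (R {2,5})) \<and>
        meets_in_order (R {2,5}) (path_image (R {3,6})) (path_image (R {1,4})) \<and>
        meets_in_order (R {3,6}) (path_image (R {2,5})) (path_image (R {1,4})))"

definition left_drawing :: "tying \<Rightarrow> (nat set \<Rightarrow> real \<Rightarrow> complex) \<Rightarrow> bool" where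
  "left_drawing X L \<longleftrightarrow> right_drawing X (\<lambda>e t. - cnj (L e t))"


section \<open>Tied six-blades\<close>

datatype strand = Blade nat | Left_Arc "nat set" | Right_Arc "nat set"

definition strands :: "tying \<Rightarrow> tying \<Rightarrow> strand set" where
  "strands X Y = Blade ` {1..6} \<union> Left_Arc ` pairs X \<union> Right_Arc ` pairs Y"

fun strand_curve ::
  "(nat set \<Rightarrow> real \<Rightarrow> complex) \<Rightarrow> (nat set \<Rightarrow> real \<Rightarrow> complex) \<Rightarrow> strand \<Rightarrow> complex set" where
  "strand_curve L R (Blade i) = blade i"
| "strand_curve L R (Left_Arc e) = path_image (L e)"
| "strand_curve L R (Right_Arc e) = path_image (R e)"

definition projection ::
  "tying \<Rightarrow> tying \<Rightarrow> (nat set \<Rightarrow> real \<Rightarrow> complex) \<Rightarrow> (nat set \<Rightarrow> real \<Rightarrow> complex) \<Rightarrow> complex set" where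
  "projection X Y L R = (\<Union>s \<in> strands X Y. strand_curve L R s)"

text \<open>A crossing is named by the set of the two strands that meet there.\<close>

definition crossings :: "tying \<Rightarrow> tying \<Rightarrow> strand set set" where
  "crossings X Y =
     {{Left_Arc e, Left_Arc e'} | e e'. e \<in> pairs X \<and> e' \<in> pairs X \<and> interleave e e'} \<union>
     {{Right_Arc e, Right_Arc e'} | e e'. e \<in> pairs Y \<and> e' \<in> pairs Y \<and> interleave e e'}"

text \<open>Over/under information: a choice of the upper strand at each crossing.\<close>

definition over_choices :: "tying \<Rightarrow> tying \<Rightarrow> (strand set \<Rightarrow> strand) set" where
  "over_choices X Y = (\<Pi>\<^sub>E x \<in> crossings X Y. x)"

text \<open>\<open>K\<close> is a knot in space having the diagram given by the projection and the choice \<open>c\<close>: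
  each strand is lifted by a continuous height function, the lifts agree where consecutive
  strands are joined, and at each crossing the chosen strand lies above the other one.\<close>

definition has_diagram ::
  "tying \<Rightarrow> tying \<Rightarrow> (nat set \<Rightarrow> real \<Rightarrow> complex) \<Rightarrow> (nat set \<Rightarrow> real \<Rightarrow> complex) \<Rightarrow>
   (strand set \<Rightarrow> strand) \<Rightarrow> (complex \<times> real) set \<Rightarrow> bool" where
  "has_diagram X Y L R c K \<longleftrightarrow> (\<exists>h :: strand \<Rightarrow> complex \<Rightarrow> real.
     (\<forall>s \<in> strands X Y. continuous_on (strand_curve L R s) (h s)) \<and>
     (\<forall>s \<in> strands X Y. \<forall>s' \<in> strands X Y. s \<noteq> s' \<longrightarrow>
        (\<forall>z \<in> strand_curve L R s \<inter> strand_curve L R s'.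
           if {s, s'} \<in> crossings X Y
           then (if c {s, s'} = s then h s z > h s' z else h s z < h s' z)
           else h s z = h s' z)) \<and>
     K = (\<Union>s \<in> strands X Y. (\<lambda>z. (z, h s z)) ` strand_curve L R s))"


section \<open>Projections on the sphere\<close>

text \<open>Inverse stereographic projection from the north pole.\<close>

definition to_sphere :: "complex \<Rightarrow> complex \<times> real" where
  "to_sphere z = ((2 / ((cmod z)\<^sup>2 + 1)) *\<^sub>R z, ((cmod z)\<^sup>2 - 1) / ((cmod z)\<^sup>2 + 1))"

definition same_on_sphere :: "complex set \<Rightarrow> complex set \<Rightarrow> bool" where
  "same_on_sphere P Q \<longleftrightarrow> (\<exists>f g.
     homeomorphism (sphere (0 :: complex \<times> real) 1) (sphere (0 :: complex \<times> real) 1) f g \<and>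
     f ` to_sphere ` P = to_sphere ` Q)"


section \<open>Knots in space\<close>

text \<open>Equivalence by arbitrary homeomorphisms of space, which may reverse the orientation, so that
  a knot and its mirror image are equivalent.\<close>

definition knot_equivalent :: "(complex \<times> real) set \<Rightarrow> (complex \<times> real) set \<Rightarrow> bool" where
  "knot_equivalent K K' \<longleftrightarrow>
     (\<exists>f g. homeomorphism (UNIV :: (complex \<times> real) set) (UNIV :: (complex \<times> real) set) f g \<and> f ` K = K')"

definition trivial_knot :: "(complex \<times> real) set \<Rightarrow> bool" where
  "trivial_knot K \<longleftrightarrow> knot_equivalent K (sphere 0 1 \<times> {0})"

text \<open>The torus knot winding twice around the vertical axis; its vertical projection is the standard
  three-crossing diagram, with crossings at the parameters where \<open>cos (3 * t) = 0\<close>.\<close>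

definition standard_trefoil :: "(complex \<times> real) set" where
  "standard_trefoil = range (\<lambda>t :: real. ((2 + cos (3 * t)) *\<^sub>R cis (2 * t), sin (3 * t)))"

definition trefoil_projection :: "complex set" where
  "trefoil_projection = fst ` standard_trefoil"

text \<open>A trefoil of either handedness.\<close>

definition trefoil_knot :: "(complex \<times> real) set \<Rightarrow> bool" where
  "trefoil_knot K \<longleftrightarrow> knot_equivalent K standard_trefoil"

end

theory Submission
  imports Defs "HOL-Complex_Analysis.Complex_Analysis" "HOL-Computational_Algebra.Fundamental_Theorem_Algebra"
begin

text \<open>Each of the six projections is a closed curve with three crossings, traversed in the cyclic order
  \<open>0, 1, 2, 0, 1, 2\<close>.  On the sphere the arc from the first to the second passage through \<open>0\<close> is a Jordan
  curve, and the crossings at \<open>1\<close> and \<open>2\<close> force the other three edges to alternate between its two sides;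
  by the Schoenflies theorem, applied to the resulting discs, any two such curves are
  equivalent under a homeomorphism of the sphere.  Regarding the height as the logarithm of a radius,
  homeomorphisms of the sphere act on the knots over the curve, and the knot depends only on the signs
  of the three crossings, hence can be compared with the standard trefoil or with an explicit unknot.
  The trefoil is knotted because its complement maps to the pairs \<open>(p, q)\<close> with \<open>p\<^sup>3 \<noteq> q\<^sup>2\<close>, over
  which the roots of \<open>x\<^sup>3 - 3 p x + 2 q\<close> form a threefold covering: the monodromy of a covering of the
  complement of an unknotted circle is cyclic, whereas two explicit loops around the trefoil permute
  the roots by permutations that do not commute.\<close>

section \<open>The Schoenflies theorem\<close>

text \<open>The arcs of a drawing are merely continuous, so the loops of the projection can be as
  wild as any Jordan curve; that its faces are discs rests on a purely topological Schoenflies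
  theorem. It comes from the boundary behaviour of the Riemann map: Koebe's lemma gives continuity,
  Lindelof's maximum principle gives injectivity, and an inversion reduces the outside to the
  inside. The cubic is natural because the trefoil is the link of the singularity
  \<open>p ^ 3 = q ^ 2\<close>, the discriminant locus of the cubics without quadratic term. An
  unknotting homeomorphism of space extends to infinity, so the map to the pairs
  \<open>(p, q)\<close> has to extend there as well; this is why it needs a limit, namely
  \<open>(0, 1)\<close>. Over the base point \<open>(1, 0)\<close> the roots are
  \<open>- sqrt 3\<close>, \<open>0\<close> and \<open>sqrt 3\<close>. The counts quantify
  existentially over \<open>K\<close>. They need that every choice has a diagram, that all knots
  over one choice are of the same kind, and that the trefoil is not trivial. With the six passages
  at the integers modulo 6, a choice amounts to three signs; a shift of the parameter by one moves
  them along and reverses the one that wraps around, which leaves two patterns to identify.\<close>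

lemma norm_cis_diff_le: "cmod (cis a - cis b) \<le> \<bar>a - b\<bar>"
proof -
  have "cis a - cis b = cis b * (cis (a - b) - 1)"
    by (simp add: right_diff_distrib cis_mult)
  then have "cmod (cis a - cis b) = cmod (exp (\<i> * of_real (a - b)) - 1)"
    by (simp add: norm_mult cis_conv_exp)
  also have "\<dots> = 2 * \<bar>sin ((a - b) / 2)\<bar>"
    by (rule dist_exp_i_1)
  also have "\<dots> \<le> \<bar>a - b\<bar>"
    using abs_sin_x_le_abs_x [of "(a - b) / 2"] by simp
  finally show ?thesis .
qed

text \<open>A winding number can be read off from any continuous logarithm of the path.
  \<open>q\<close> and the logarithm \<open>r\<close> obtained for \<open>exp \<circ> q\<close>
  differ by a continuous function with values in the multiples of \<open>2 * pi * \<i>\<close>,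
  hence by a constant, so both have the same increment. In Koebe's lemma this gives the winding
  number of a loop that is known only through its logarithm.\<close>

lemma winding_number_exp_path:
  assumes "path q"
  shows "2 * of_real pi * \<i> * winding_number (exp \<circ> q) 0 = pathfinish q - pathstart q"
proof -
  have pe: "path (exp \<circ> q)"
    using assms unfolding path_def o_def by (intro continuous_intros)
  have 0: "0 \<notin> path_image (exp \<circ> q)"
    by (auto simp: path_image_def)
  obtain r where r: "path r"
      "pathfinish r - pathstart r = 2 * of_real pi * \<i> * winding_number (exp \<circ> q) 0"
      "\<And>t. t \<in> {0..1} \<Longrightarrow> (exp \<circ> q) t = 0 + exp (r t)"
    using winding_number_as_continuous_log [OF pe 0] by metis
  let ?d = "\<lambda>t. Im (q t - r t) / (2 * pi)"
  have ex: "exp (q t - r t) = 1" if "t \<in> {0..1}" for t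
    using r(3) [OF that] by (simp add: exp_diff)
  have int: "?d t \<in> \<int> \<and> Re (q t - r t) = 0" if "t \<in> {0..1}" for t
    using ex [OF that] unfolding exp_eq_1 by (auto simp: field_simps Ints_def)
  have "?d constant_on {0..1}"
  proof (rule continuous_discrete_range_constant)
    show "connected {0..1::real}" by simp
    show "continuous_on {0..1} ?d"
      using assms r(1) unfolding path_def by (intro continuous_intros) auto
    show "\<exists>e>0. \<forall>y. y \<in> {0..1} \<and> ?d y \<noteq> ?d x \<longrightarrow> e \<le> norm (?d y - ?d x)"
      if x: "x \<in> {0..1}" for x
    proof (intro exI [of _ 1] conjI allI impI)
      fix y :: real assume y: "y \<in> {0..1} \<and> ?d y \<noteq> ?d x"
      then obtain a b :: int where "?d x = of_int a" "?d y = of_int b"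
        using int [of x] int [of y] x y unfolding Ints_def by blast
      then show "1 \<le> norm (?d y - ?d x)"
        using y by (auto simp flip: of_int_diff)
    qed auto
  qed
  then obtain y where "\<forall>t\<in>{0..1}. ?d t = y"
    unfolding constant_on_def by blast
  then have "?d 1 = ?d 0"
    by (metis atLeastAtMost_iff order_refl zero_le_one)
  then have "Im (q 1 - r 1) = Im (q 0 - r 0)"
    by simp
  moreover have "Re (q 1 - r 1) = Re (q 0 - r 0)"
    using int by auto
  ultimately have "q 1 - r 1 = q 0 - r 0"
    by (simp add: complex_eq_iff)
  then show ?thesis
    using r(2) by (simp add: pathfinish_def pathstart_def algebra_simps)
qed

text \<open>A quantitative form of Koebe's lemma: the reflected and rotated copies of the path separate
  \<open>0\<close> from the unit circle, and the product \<open>H\<close> of the corresponding copies of \<open>f - p\<close> is small on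
  all of them.\<close>

lemma Koebe_bound:
  fixes f :: "complex \<Rightarrow> complex"
  assumes hol: "f holomorphic_on ball 0 1"
    and M: "\<And>z. z \<in> ball 0 1 \<Longrightarrow> cmod (f z - p) \<le> M"
    and mu: "path \<mu>" "\<And>t. t \<in> {0..1} \<Longrightarrow> exp (\<mu> t) \<in> ball 0 1 \<and> cmod (f (exp (\<mu> t)) - p) \<le> \<epsilon>"
    and m: "m > 0"
    and im: "Im (pathstart \<mu>) = of_int k * pi / m" "Im (pathfinish \<mu>) = of_int (k + 1) * pi / m"
  shows "((cmod (f 0 - p))\<^sup>2) ^ card {u::complex. u ^ m = 1}
           \<le> \<epsilon> * M * (M\<^sup>2) ^ (card {u::complex. u ^ m = 1} - 1)"
proof -
  define R where "R = {u::complex. u ^ m = 1}"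
  have finR: "finite R"
    unfolding R_def using m by (intro finite_roots_unity) auto
  have nR: "cmod u = 1" if "u \<in> R" for u
  proof -
    have "cmod u ^ m = 1 ^ m"
      using that unfolding R_def by (simp flip: norm_power)
    then show ?thesis
      using m power_eq_iff_eq_base [of m "cmod u" 1] by simp
  qed
  \<comment> \<open>A sector of opening \<open>pi / m\<close> is opened by the \<open>m\<close>-th
    power to a half plane, so \<open>m * \<mu>\<close> makes half a turn between points over the
    real axis. Its mirror image run backwards makes the other half, and the shift by
    \<open>2 * (k + 1) * pi\<close> in \<open>D2\<close> fits the two logarithms together.\<close>
  define D1 where "D1 = (\<lambda>t. of_nat m * \<mu> t)"
  define D2 where "D2 = (\<lambda>t. of_nat m * cnj (\<mu> (1 - t)) + 2 * \<i> * of_int (k + 1) * pi)"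
  have p1: "path D1"
    unfolding D1_def using mu(1) unfolding path_def by (intro continuous_intros)
  have "continuous_on {0..1} (\<lambda>t. \<mu> (1 - t))"
    using path_reversepath [of \<mu>] mu(1) unfolding path_def reversepath_def by simp
  then have p2: "path D2"
    unfolding D2_def path_def by (intro continuous_intros)
  have fs: "pathfinish D1 = pathstart D2"
    using im(2) m unfolding D1_def D2_def pathfinish_def pathstart_def
    by (simp add: complex_eq_iff field_simps)
  define \<delta> where "\<delta> = exp \<circ> (D1 +++ D2)"
  have pD: "path (D1 +++ D2)"
    using p1 p2 fs by simp
  have "pathfinish (D1 +++ D2) - pathstart (D1 +++ D2) = 2 * pi * \<i>"
    using im(1) m unfolding D1_def D2_def pathfinish_join pathstart_join
    unfolding pathfinish_def pathstart_def
    by (simp add: complex_eq_iff field_simps)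
  then have diff: "pathfinish (D1 +++ D2) = pathstart (D1 +++ D2) + 2 * pi * \<i>"
    by (simp only: diff_eq_eq add.commute)
  have wn: "winding_number \<delta> 0 = 1"
    using winding_number_exp_path [OF pD] unfolding \<delta>_def diff by simp
  have loop: "pathfinish \<delta> = pathstart \<delta>"
    unfolding \<delta>_def pathfinish_compose pathstart_compose diff exp_add by simp
  have pd: "path \<delta>"
    unfolding \<delta>_def path_def o_def using pD unfolding path_def by (intro continuous_intros)
  have img: "\<exists>t\<in>{0..1}. w = exp (\<mu> t) ^ m \<or> w = cnj (exp (\<mu> t)) ^ m" if "w \<in> path_image \<delta>" for w
  proof -
    have "path_image \<delta> = exp ` (path_image D1 \<union> path_image D2)"
      unfolding \<delta>_def by (simp add: path_image_compose path_image_join fs)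
    then consider t where "t \<in> {0..1}" "w = exp (D1 t)" | t where "t \<in> {0..1}" "w = exp (D2 t)"
      using \<open>w \<in> path_image \<delta>\<close> by (auto simp: path_image_def)
    then show ?thesis
    proof cases
      case 1
      then show ?thesis unfolding D1_def by (auto simp: exp_of_nat_mult)
    next
      case 2
      have "exp (D2 t) = cnj (exp (\<mu> (1 - t))) ^ m * exp (2 * of_int (k+1) * pi * \<i>)"
        unfolding D2_def exp_add by (simp add: exp_of_nat_mult exp_cnj mult_ac)
      also have "exp (2 * of_int (k+1) * pi * \<i>) = (1::complex)"
        using exp_integer_2pi [of "of_int (k+1)"] by simp
      finally show ?thesis
        using 2 by (intro bexI [of _ "1-t"]) auto
    qed
  qed
  have small: "w \<in> ball 0 1" if "w \<in> path_image \<delta>" for w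
    using img [OF that] mu(2) m by (auto simp: norm_power power_Suc_less_one power_less_one_iff)
  have n0: "0 \<notin> path_image \<delta>"
    unfolding \<delta>_def path_image_def by auto
  \<comment> \<open>\<open>T\<close> consists of all rotated copies of the path and of its mirror
    image. It separates \<open>0\<close> from the unit circle because \<open>\<delta>\<close> winds
    once around \<open>0\<close> but not around points outside the disc, and the winding number is
    constant on the image of a component of the complement.\<close>
  define T where "T = {z. z ^ m \<in> path_image \<delta>}"
  have clT: "closed T"
  proof -
    have "closed ((\<lambda>z::complex. z ^ m) -` path_image \<delta>)"
      using closed_path_image [OF pd]
      by (intro continuous_closed_vimage) (auto intro!: continuous_intros)
    then show ?thesis
      unfolding T_def vimage_def by simp
  qed
  define W where "W = connected_component_set (- T) 0"
  have "0 \<notin> T"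
    unfolding T_def using n0 m by (simp add: power_0_left)
  then have W0: "0 \<in> W"
    unfolding W_def by simp
  have opW: "open W" and conW: "connected W" and WT: "W \<subseteq> - T"
    unfolding W_def using open_connected_component [OF open_Compl [OF clT]]
    by (auto simp: connected_component_subset)
  have Wb: "W \<subseteq> ball 0 1"
  proof (rule ccontr)
    assume "\<not> W \<subseteq> ball 0 1"
    then obtain z where "z \<in> W" "z \<notin> ball 0 1" by blast
    then have z: "z \<in> W" "cmod z \<ge> 1" by auto
    have con: "connected ((\<lambda>z. z ^ m) ` W)"
      by (intro connected_continuous_image continuous_intros conW)
    have "winding_number \<delta> constant_on ((\<lambda>z. z ^ m) ` W)"
      by (rule winding_number_constant [OF pd loop con]) (use WT in \<open>auto simp: T_def\<close>)
    moreover have "0 \<in> (\<lambda>z. z ^ m) ` W"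
      using W0 m by (intro image_eqI [of _ _ 0]) auto
    moreover have "z ^ m \<in> (\<lambda>z. z ^ m) ` W"
      using z by blast
    ultimately have "winding_number \<delta> (z ^ m) = winding_number \<delta> 0"
      unfolding constant_on_def by metis
    then have "winding_number \<delta> (z ^ m) = 1"
      using wn by simp
    moreover have "winding_number \<delta> (z ^ m) = 0"
      using z m small
      by (intro winding_number_zero_outside [OF pd convex_ball loop, of _ 0 1])
         (auto simp: norm_power not_less)
    ultimately show False by simp
  qed
  have frW: "frontier W \<subseteq> T"
    unfolding W_def
    by (metis clT frontier_complement frontier_of_connected_component_subset frontier_subset_closed
        order_trans)
  have Tb: "T \<subseteq> ball 0 1"
  proof
    fix z assume "z \<in> T"
    then have "cmod (z ^ m) < 1"
      unfolding T_def using small by auto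
    then show "z \<in> ball 0 1"
      by (metis dist_0_norm linorder_not_less mem_ball norm_power one_le_power)
  qed
  have clW: "closure W \<subseteq> ball 0 1"
    using frW Tb Wb by (metis Un_least closure_Un_frontier order_trans)
  \<comment> \<open>The factor \<open>cnj (f (cnj z) - p)\<close> is again holomorphic and is small
    on the mirror image of the path; with the product over all rotations in \<open>H\<close>, at
    least one factor is small at every point of \<open>T\<close>.\<close>
  define F where "F = (\<lambda>z. (f z - p) * cnj (f (cnj z) - p))"
  define H where "H = (\<lambda>z. \<Prod>u\<in>R. F (u * z))"
  have cb: "cnj ` ball 0 1 = ball 0 1"
  proof -
    have "z \<in> cnj ` ball 0 1" if "z \<in> ball 0 1" for z
      using that by (intro image_eqI [of _ _ "cnj z"]) auto
    then show ?thesis by auto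
  qed
  have "(cnj \<circ> (\<lambda>z. f z - p) \<circ> cnj) holomorphic_on ball 0 1"
    using hol by (intro holomorphic_on_compose_cnj_cnj holomorphic_intros) (auto simp: cb)
  then have "(\<lambda>z. cnj (f (cnj z) - p)) holomorphic_on ball 0 1"
    by (simp add: o_def)
  then have holF: "F holomorphic_on ball 0 1"
    unfolding F_def using hol by (intro holomorphic_intros)
  have holH: "H holomorphic_on ball 0 1"
    unfolding H_def
  proof (intro holomorphic_on_prod)
    fix u assume "u \<in> R"
    then have "(\<lambda>z. u * z) ` ball 0 1 \<subseteq> ball 0 1"
      using nR by (auto simp: norm_mult)
    then show "(\<lambda>z. F (u * z)) holomorphic_on ball 0 1"
      using holomorphic_on_compose_gen [of "\<lambda>z. u * z" "ball 0 1" F "ball 0 1"] holF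
      by (simp add: o_def holomorphic_on_linear)
  qed
  have M0: "M \<ge> 0"
    using M [of 0] by (smt (verit) centre_in_ball norm_ge_zero)
  have e0: "\<epsilon> \<ge> 0"
    using mu(2) [of 0] by (smt (verit) atLeastAtMost_iff norm_ge_zero)
  have bF: "cmod (F z) \<le> M\<^sup>2" if "z \<in> ball 0 1" for z
  proof -
    have "cmod (F z) = cmod (f z - p) * cmod (f (cnj z) - p)"
      unfolding F_def norm_mult complex_mod_cnj ..
    also have "\<dots> \<le> M * M"
      using that M0 by (intro mult_mono M) auto
    finally show ?thesis by (simp add: power2_eq_square)
  qed
  have HT: "cmod (H z) \<le> \<epsilon> * M * (M\<^sup>2) ^ (card R - 1)" if zT: "z \<in> T" for z
  proof -
    have zb: "z \<in> ball 0 1" using Tb zT by auto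
    obtain t where t: "t \<in> {0..1}" "z ^ m = exp (\<mu> t) ^ m \<or> z ^ m = cnj (exp (\<mu> t)) ^ m"
      using img [of "z^m"] zT unfolding T_def by blast
    have zn: "z \<noteq> 0"
      using t m by (auto simp: power_0_left)
    have fm: "cmod (f (exp (\<mu> t)) - p) \<le> \<epsilon>" and eb: "exp (\<mu> t) \<in> ball 0 1"
      using mu(2) t by auto
    have "\<exists>u\<in>R. cmod (F (u * z)) \<le> \<epsilon> * M"
    proof (cases "z ^ m = exp (\<mu> t) ^ m")
      case True
      have "cmod (F (exp (\<mu> t))) = cmod (f (exp (\<mu> t)) - p) * cmod (f (cnj (exp (\<mu> t))) - p)"
        unfolding F_def norm_mult complex_mod_cnj ..
      also have "\<dots> \<le> \<epsilon> * M"
        using eb fm e0 by (intro mult_mono M) (auto simp del: exp_cnj)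
      finally show ?thesis
        using True zn by (intro bexI [of _ "exp (\<mu> t) / z"]) (auto simp: R_def power_divide)
    next
      case False
      then have eq: "z ^ m = cnj (exp (\<mu> t)) ^ m" using t by simp
      have "cmod (F (cnj (exp (\<mu> t)))) = cmod (f (cnj (exp (\<mu> t))) - p) * cmod (f (exp (\<mu> t)) - p)"
        unfolding F_def norm_mult complex_mod_cnj by (simp del: exp_cnj)
      also have "\<dots> \<le> M * \<epsilon>"
        using eb fm M0 by (intro mult_mono M) (auto simp del: exp_cnj)
      finally show ?thesis
        using eq zn
        by (intro bexI [of _ "cnj (exp (\<mu> t)) / z"]) (auto simp: R_def power_divide mult.commute simp del: exp_cnj)
    qed
    then obtain u where u: "u \<in> R" "cmod (F (u * z)) \<le> \<epsilon> * M" by blast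
    have "cmod (H z) = (\<Prod>v\<in>R. cmod (F (v * z)))"
      unfolding H_def by (simp add: prod_norm)
    also have "\<dots> = cmod (F (u * z)) * (\<Prod>v\<in>R - {u}. cmod (F (v * z)))"
      using finR u by (simp add: prod.remove)
    also have "\<dots> \<le> (\<epsilon> * M) * (\<Prod>v\<in>R - {u}. M\<^sup>2)"
    proof (intro mult_mono u prod_mono conjI)
      fix v assume "v \<in> R - {u}"
      then show "cmod (F (v * z)) \<le> M\<^sup>2"
        using nR zb by (intro bF) (auto simp: norm_mult)
    qed (use e0 M0 in \<open>auto intro!: prod_nonneg\<close>)
    finally show ?thesis
      using u finR by (simp add: prod_constant)
  qed
  have "cmod (H 0) \<le> \<epsilon> * M * (M\<^sup>2) ^ (card R - 1)"
  proof (rule maximum_modulus_frontier [of H W])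
    show "H holomorphic_on interior W"
      using holH Wb by (meson holomorphic_on_subset interior_subset order_trans)
    show "continuous_on (closure W) H"
      using holH clW holomorphic_on_imp_continuous_on continuous_on_subset by blast
    show "bounded W" using Wb bounded_ball bounded_subset by blast
  qed (use HT frW W0 in auto)
  moreover have "cmod (H 0) = ((cmod (f 0 - p))\<^sup>2) ^ card R"
  proof -
    have "cmod (cnj (f 0) - cnj p) = cmod (f 0 - p)"
      by (metis complex_cnj_diff complex_mod_cnj)
    then show ?thesis
      unfolding H_def F_def by (simp add: prod_constant norm_power norm_mult power2_eq_square)
  qed
  ultimately show ?thesis
    unfolding R_def by simp
qed

section \<open>Boundary behaviour of the Riemann map of a Jordan curve\<close>

text \<open>Janiszewski's theorem for the curve and for \<open>T\<close>, the union of the part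
  \<open>A\<close> of the curve away from \<open>p\<close> with the circle of radius
  \<open>e\<close>. Neither separates \<open>x\<close> from \<open>y\<close>, and they meet in the
  connected arc \<open>A\<close>, because the rest of the curve stays in the open ball. So their
  union does not separate the points either, and a connected set avoiding it cannot leave the
  ball.\<close>

lemma Jordan_inside_locally_connected:
  fixes c :: "real \<Rightarrow> complex"
  assumes c: "simple_path c" "pathfinish c = pathstart c" and p: "p \<in> path_image c" and e: "e > 0"
  obtains d where "d > 0"
    "\<And>x y. \<lbrakk>x \<in> inside (path_image c); y \<in> inside (path_image c); dist p x < d; dist p y < d\<rbrakk>
       \<Longrightarrow> \<exists>\<gamma>. path \<gamma> \<and> path_image \<gamma> \<subseteq> inside (path_image c) \<inter> ball p e \<and>
            pathstart \<gamma> = x \<and> pathfinish \<gamma> = y"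
proof -
  note J = Jordan_inside_outside [OF c]
  obtain u where u: "u \<in> {0..1}" "c u = p"
    using p by (auto simp: path_image_def)
  define c' where "c' = shiftpath u c"
  have c': "simple_path c'" "path_image c' = path_image c" "c' 0 = p" "c' 1 = p"
    using u c simple_path_shiftpath [OF c, of u] path_image_shiftpath [of u c] unfolding c'_def
    by (auto simp: shiftpath_def pathstart_def pathfinish_def)
  have cont: "continuous_on {0..1} c'"
    using c'(1) by (simp add: simple_path_def path_def)
  obtain \<eta>0 where \<eta>0: "\<eta>0 > 0" "\<And>t. t \<in> {0..1} \<Longrightarrow> dist t 0 < \<eta>0 \<Longrightarrow> dist (c' t) p < e"
    using cont e c' unfolding continuous_on_iff by (metis atLeastAtMost_iff order_refl zero_le_one)
  obtain \<eta>1 where \<eta>1: "\<eta>1 > 0" "\<And>t. t \<in> {0..1} \<Longrightarrow> dist t 1 < \<eta>1 \<Longrightarrow> dist (c' t) p < e"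
    using cont e c' unfolding continuous_on_iff by (metis atLeastAtMost_iff order_refl zero_le_one)
  define \<eta> where "\<eta> = min (1/3) (min \<eta>0 \<eta>1 / 2)"
  have \<eta>: "0 < \<eta>" "\<eta> \<le> 1/3" "\<eta> < \<eta>0" "\<eta> < \<eta>1"
    unfolding \<eta>_def using \<eta>0 \<eta>1 by auto
  define A where "A = c' ` {\<eta>..1-\<eta>}"
  have A: "compact A" "connected A" "A \<subseteq> path_image c"
    unfolding A_def c'(2)[symmetric] using \<eta> cont
    by (auto intro!: compact_continuous_image connected_continuous_image continuous_on_subset [OF cont]
        simp: path_image_def)
  have pA: "p \<notin> A"
  proof
    assume "p \<in> A"
    then obtain t where t: "t \<in> {\<eta>..1-\<eta>}" "c' t = c' 0" unfolding A_def using c' by auto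
    then have "t = 0 \<or> t = 1"
      using c'(1) \<eta> unfolding simple_path_def loop_free_def by force
    then show False using t \<eta> by auto
  qed
  have JA: "path_image c - A \<subseteq> ball p e"
  proof
    fix x assume x: "x \<in> path_image c - A"
    then have "x \<in> c' ` {0..1}" "x \<notin> c' ` {\<eta>..1-\<eta>}"
      using c'(2) unfolding A_def path_image_def by auto
    then obtain t where t: "t \<in> {0..1}" "x = c' t" "t \<notin> {\<eta>..1-\<eta>}"
      by blast
    then consider "dist t 0 < \<eta>0" | "dist t 1 < \<eta>1"
      using \<eta> by (auto simp: dist_real_def)
    then show "x \<in> ball p e"
      using \<eta>0(2) \<eta>1(2) t by cases (auto simp: dist_commute)
  qed
  define T where "T = A \<union> sphere p e"
  have T: "closed T" "p \<notin> T"
    unfolding T_def using A pA e by (auto intro: compact_imp_closed)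
  obtain d where d: "d > 0" "ball p d \<subseteq> - T"
    using T by (metis ComplI open_Compl open_contains_ball)
  have ST: "path_image c \<inter> T = A"
    unfolding T_def using A JA by auto
  show ?thesis
  proof (rule that [of "min d e"])
    show "min d e > 0" using d e by simp
    fix x y assume x: "x \<in> inside (path_image c)" and y: "y \<in> inside (path_image c)"
      and xd: "dist p x < min d e" and yd: "dist p y < min d e"
    have "connected_component (- (path_image c \<union> T)) x y"
    proof (rule Janiszewski)
      show "compact (path_image c)" "closed T" "connected (path_image c \<inter> T)"
        using c T ST A by (auto simp: compact_simple_path_image)
      show "connected_component (- path_image c) x y"
        unfolding connected_component_def using J x y inside_no_overlap [of "path_image c"]
        by (intro exI [of _ "inside (path_image c)"]) blast
      show "connected_component (- T) x y"
        unfolding connected_component_def using d xd yd by (intro exI [of _ "ball p d"]) auto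
    qed
    then obtain t where t: "connected t" "t \<subseteq> - (path_image c \<union> T)" "x \<in> t" "y \<in> t"
      unfolding connected_component_def by blast
    have tb: "t \<subseteq> ball p e"
    proof (rule ccontr)
      assume "\<not> t \<subseteq> ball p e"
      then have "t \<inter> frontier (ball p e) \<noteq> {}"
        using t xd by (intro connected_Int_frontier) auto
      then show False using t e unfolding T_def by (auto simp: frontier_ball)
    qed
    have ti: "t \<subseteq> inside (path_image c)"
    proof (rule ccontr)
      assume "\<not> t \<subseteq> inside (path_image c)"
      then have "t \<inter> frontier (inside (path_image c)) \<noteq> {}"
        using t x by (intro connected_Int_frontier) auto
      then show False using t J by auto
    qed
    have "connected_component (inside (path_image c) \<inter> ball p e) x y"
      unfolding connected_component_def using t tb ti by blast
    then have "path_component (inside (path_image c) \<inter> ball p e) x y"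
      using J by (subst open_path_connected_component) auto
    then show "\<exists>\<gamma>. path \<gamma> \<and> path_image \<gamma> \<subseteq> inside (path_image c) \<inter> ball p e \<and>
            pathstart \<gamma> = x \<and> pathfinish \<gamma> = y"
      unfolding path_component_def by (auto simp: path_defs)
  qed
qed

text \<open>If points arbitrarily close to \<open>p\<close> had images under \<open>g\<close> at
  distance \<open>e\<close>, a path joining them near \<open>p\<close> would be mapped close to the
  unit circle and turn there through a fixed angle. Koebe's bound with \<open>\<epsilon>\<close>
  tending to 0 would force \<open>f 0 = p\<close>, but \<open>f 0\<close> lies inside the
  curve.\<close>

lemma Riemann_map_oscillation:
  fixes c :: "real \<Rightarrow> complex"
  assumes c: "simple_path c" "pathfinish c = pathstart c" and p: "p \<in> path_image c" and e: "e > 0"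
    and holf: "f holomorphic_on ball 0 1" and contg: "continuous_on (inside (path_image c)) g"
    and gf: "\<And>z. z \<in> inside (path_image c) \<Longrightarrow> g z \<in> ball 0 1 \<and> f (g z) = z"
    and fg: "\<And>z. z \<in> ball 0 1 \<Longrightarrow> f z \<in> inside (path_image c) \<and> g (f z) = z"
  shows "\<exists>d>0. \<forall>x\<in>inside (path_image c) \<inter> ball p d. \<forall>y\<in>inside (path_image c) \<inter> ball p d.
           dist (g x) (g y) < e"
proof (rule ccontr)
  assume neg: "\<not> ?thesis"
  note J = Jordan_inside_outside [OF c]
  let ?O = "inside (path_image c)"
  define e' where "e' = min e 1"
  have e': "0 < e'" "e' \<le> e" "e' \<le> 1" unfolding e'_def using e by auto
  \<comment> \<open>Near \<open>p\<close> a path avoids the compact set \<open>K\<close>, so its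
    image under \<open>g\<close> is within \<open>e' / 8\<close> of the unit circle; two such errors
    still leave an angle of at least \<open>e' / 2\<close> between the ends.\<close>
  define K where "K = f ` cball 0 (1 - e'/8)"
  have sub: "cball 0 (1 - e'/8) \<subseteq> ball (0::complex) 1"
    using e' by auto
  have K: "compact K" "K \<subseteq> ?O"
    unfolding K_def using sub fg holomorphic_on_imp_continuous_on [OF holf]
    by (auto intro!: compact_continuous_image intro: continuous_on_subset)
  have "p \<notin> K" using K p J by blast
  then obtain d0 where d0: "d0 > 0" "ball p d0 \<subseteq> - K"
    using K by (metis ComplI compact_imp_closed open_Compl open_contains_ball)
  obtain B where B: "\<And>z. z \<in> ?O \<Longrightarrow> cmod z \<le> B"
    using J bounded_iff by metis
  define M where "M = B + cmod p"
  have M: "cmod (z - p) \<le> M" if "z \<in> ?O" for z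
    unfolding M_def using B [OF that] norm_triangle_ineq4 [of z p] by linarith
  \<comment> \<open>\<open>m\<close> depends on \<open>e\<close> only, so \<open>N\<close> and
    \<open>C\<close> below are fixed before \<open>\<epsilon>\<close> tends to 0. An interval of
    length \<open>2 * pi / m\<close> contains two consecutive multiples of \<open>pi / m\<close>, as
    Koebe's bound requires.\<close>
  obtain m :: nat where m: "4 * pi / e' < m"
    using reals_Archimedean2 by blast
  have m0: "m > 0" using m e' pi_gt_zero
    by (metis divide_pos_pos mult_pos_pos neq0_conv of_nat_0 order_less_asym zero_less_numeral)
  have m2: "2 * pi / m < e' / 2"
    using m m0 e' by (simp add: field_simps)
  define N where "N = card {u::complex. u ^ m = 1}"
  define C where "C = M * (M\<^sup>2) ^ (N - 1)"
  have "M \<ge> 0" using M fg [of 0] by (smt (verit) centre_in_ball norm_ge_zero)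
  then have C0: "C \<ge> 0" unfolding C_def by simp
  have key: "((cmod (f 0 - p))\<^sup>2) ^ N \<le> \<epsilon> * C" if \<epsilon>: "0 < \<epsilon>" "\<epsilon> < d0" for \<epsilon>
  proof -
    obtain d where d: "d > 0"
      "\<And>x y. \<lbrakk>x \<in> ?O; y \<in> ?O; dist p x < d; dist p y < d\<rbrakk>
         \<Longrightarrow> \<exists>\<gamma>. path \<gamma> \<and> path_image \<gamma> \<subseteq> ?O \<inter> ball p \<epsilon> \<and> pathstart \<gamma> = x \<and> pathfinish \<gamma> = y"
      using Jordan_inside_locally_connected [OF c p \<epsilon>(1)] by blast
    obtain x y where xy: "x \<in> ?O" "y \<in> ?O" "dist p x < d" "dist p y < d" "dist (g x) (g y) \<ge> e"
      using neg d(1) by (force simp: not_less)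
    obtain \<gamma> where \<gamma>: "path \<gamma>" "path_image \<gamma> \<subseteq> ?O \<inter> ball p \<epsilon>" "pathstart \<gamma> = x" "pathfinish \<gamma> = y"
      using d(2) [OF xy(1-4)] by blast
    have gam: "\<gamma> t \<in> ?O" "dist p (\<gamma> t) < \<epsilon>" if "t \<in> {0..1}" for t
      using \<gamma>(2) that unfolding path_image_def by (auto simp del: dist_norm simp: subset_iff)
    have gn: "1 - e'/8 < cmod (g (\<gamma> t))" "cmod (g (\<gamma> t)) < 1" if "t \<in> {0..1}" for t
    proof -
      have "\<gamma> t \<notin> K" using gam [OF that] d0 \<epsilon> by (auto simp: subset_iff)
      then have "g (\<gamma> t) \<notin> cball 0 (1 - e'/8)"
        unfolding K_def using gf [OF gam(1) [OF that]] by (metis imageI)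
      then show "1 - e'/8 < cmod (g (\<gamma> t))" by auto
      show "cmod (g (\<gamma> t)) < 1" using gf gam that by auto
    qed
    have cg: "continuous_on {0..1} (\<lambda>t. g (\<gamma> t))"
      by (rule continuous_on_compose2 [OF contg]) (use \<gamma>(1) gam in \<open>auto simp: path_def\<close>)
    have gn0: "g (\<gamma> t) \<noteq> 0" if "t \<in> {0..1}" for t
      using gn(1) [OF that] e' by auto
    obtain lg where lg: "continuous_on {0..1} lg" "\<And>t. t \<in> {0..1} \<Longrightarrow> g (\<gamma> t) = exp (lg t)"
      using continuous_logarithm_on_contractible [OF cg _ gn0] convex_imp_contractible
      by (metis convex_real_interval(5))
    have near: "cmod (exp (lg t) - cis (Im (lg t))) \<le> e'/8" if "t \<in> {0..1}" for t
    proof -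
      have "exp (lg t) - cis (Im (lg t)) = (exp (Re (lg t)) - 1) * cis (Im (lg t))"
        by (simp add: exp_eq_polar algebra_simps)
      then have "cmod (exp (lg t) - cis (Im (lg t))) = \<bar>exp (Re (lg t)) - 1\<bar>"
        by (metis norm_mult norm_cis mult.right_neutral norm_of_real of_real_1 of_real_diff of_real_exp)
      moreover have "cmod (g (\<gamma> t)) = exp (Re (lg t))"
        using lg(2) [OF that] by simp
      ultimately show ?thesis using gn [OF that] by linarith
    qed
    have "e' \<le> cmod (exp (lg 0) - exp (lg 1))"
      using xy(5) e' \<gamma>(3,4) lg(2) [of 0] lg(2) [of 1] by (auto simp: dist_norm pathstart_def pathfinish_def)
    also have "\<dots> \<le> cmod (exp (lg 0) - cis (Im (lg 0))) + cmod (cis (Im (lg 0)) - cis (Im (lg 1)))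
                    + cmod (exp (lg 1) - cis (Im (lg 1)))"
      by (smt (verit) norm_minus_commute norm_diff_triangle_ineq norm_triangle_ineq2 norm_triangle_ineq4 norm_diff_triangle_le)
    also have "\<dots> \<le> e'/8 + cmod (cis (Im (lg 0)) - cis (Im (lg 1))) + e'/8"
      using near [of 0] near [of 1] by simp
    finally have "e' / 2 \<le> cmod (cis (Im (lg 0)) - cis (Im (lg 1)))"
      using e' by simp
    also have "\<dots> \<le> \<bar>Im (lg 0) - Im (lg 1)\<bar>"
      by (rule norm_cis_diff_le)
    finally have gap: "2 * pi / m < \<bar>Im (lg 0) - Im (lg 1)\<bar>"
      using m2 by linarith
    define lo where "lo = min (Im (lg 0)) (Im (lg 1))"
    define hi where "hi = max (Im (lg 0)) (Im (lg 1))"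
    have lohi: "lo + 2 * pi / m < hi" using gap unfolding lo_def hi_def by (auto simp: min_def max_def)
    define k where "k = \<lceil>lo * m / pi\<rceil>"
    have k1: "lo \<le> k * pi / m"
    proof -
      have "lo * m / pi \<le> k" unfolding k_def by simp
      then show ?thesis using m0 pi_gt_zero by (simp add: field_simps)
    qed
    have k2: "(k + 1) * pi / m \<le> hi"
    proof -
      have "k < lo * m / pi + 1" unfolding k_def by linarith
      then have "(k + 1) * pi \<le> lo * m + 2 * pi" using pi_gt_zero by (simp add: field_simps)
      then have "(k + 1) * pi / m \<le> (lo * m + 2 * pi) / m" by (intro divide_right_mono) auto
      also have "\<dots> = lo + 2 * pi / m" using m0 by (simp add: add_divide_distrib)
      finally show ?thesis using lohi by linarith
    qed
    have k12: "k * pi / m \<le> (k + 1) * pi / m"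
      using m0 by (simp add: divide_right_mono)
    have ico: "connected ((\<lambda>t. Im (lg t)) ` {0..1})"
      using lg(1) by (intro connected_continuous_image continuous_intros) auto
    have "lo \<in> (\<lambda>t. Im (lg t)) ` {0..1}" "hi \<in> (\<lambda>t. Im (lg t)) ` {0..1}"
      unfolding lo_def hi_def min_def max_def by auto
    then have "{lo..hi} \<subseteq> (\<lambda>t. Im (lg t)) ` {0..1}"
      by (rule connected_contains_Icc [OF ico])
    moreover have "k * pi / m \<in> {lo..hi}" "(k + 1) * pi / m \<in> {lo..hi}"
      using k1 k2 k12 by auto
    ultimately obtain a b where ab: "a \<in> {0..1}" "b \<in> {0..1}"
        "Im (lg a) = k * pi / m" "Im (lg b) = (k + 1) * pi / m"
      by (smt (verit) imageE subset_iff)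
    have rng: "\<exists>s\<in>{0..1}. subpath a b lg t = lg s" if "t \<in> {0..1}" for t
    proof -
      have "subpath a b lg t \<in> path_image (subpath a b lg)"
        using that by (auto simp: path_image_def)
      also have "\<dots> \<subseteq> path_image lg"
        by (rule path_image_subpath_subset) (use ab in auto)
      finally show ?thesis by (auto simp: path_image_def)
    qed
    have "((cmod (f 0 - p))\<^sup>2) ^ N \<le> \<epsilon> * M * (M\<^sup>2) ^ (N - 1)"
      unfolding N_def
    proof (rule Koebe_bound [OF holf _ _ _ m0])
      show "cmod (f z - p) \<le> M" if "z \<in> ball 0 1" for z
        using M fg that by blast
      show "path (subpath a b lg)"
        using lg(1) ab by (intro path_subpath) (auto simp: path_def)
      show "exp (subpath a b lg t) \<in> ball 0 1 \<and> cmod (f (exp (subpath a b lg t)) - p) \<le> \<epsilon>"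
        if t: "t \<in> {0..1}" for t
      proof -
        obtain s where s: "s \<in> {0..1}" "subpath a b lg t = lg s" using rng t by blast
        have "f (exp (lg s)) = \<gamma> s"
          using gf [OF gam(1) [OF s(1)]] lg(2) [OF s(1)] by simp
        then show ?thesis
          using gn(2) [OF s(1)] gam(2) [OF s(1)] lg(2) [OF s(1)] s(2) by (simp add: dist_norm norm_minus_commute)
      qed
      show "Im (pathstart (subpath a b lg)) = of_int k * pi / m"
        "Im (pathfinish (subpath a b lg)) = of_int (k + 1) * pi / m"
        using ab by auto
    qed
    then show ?thesis unfolding C_def by (simp add: mult.assoc)
  qed
  have "((cmod (f 0 - p))\<^sup>2) ^ N = 0"
  proof (rule ccontr)
    let ?L = "((cmod (f 0 - p))\<^sup>2) ^ N"
    assume "?L \<noteq> 0"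
    then have L: "?L > 0" by (metis norm_ge_zero order_le_less zero_le_power)
    define \<epsilon> where "\<epsilon> = min (d0/2) (?L / (2 * (C + 1)))"
    have "\<epsilon> \<le> d0 / 2" unfolding \<epsilon>_def by (rule min.cobounded1)
    then have "\<epsilon> < d0" using d0 by linarith
    moreover have "0 < \<epsilon>" unfolding \<epsilon>_def using d0 L C0 by auto
    ultimately have "?L \<le> \<epsilon> * C" by (intro key)
    also have "\<dots> \<le> ?L / (2 * (C + 1)) * C"
      unfolding \<epsilon>_def using C0 by (intro mult_right_mono) auto
    also have "\<dots> < ?L"
    proof -
      have "?L * C < ?L * (2 * (C + 1))"
        using L C0 by (intro mult_strict_left_mono) auto
      then show ?thesis using C0 by (simp add: field_simps)
    qed
    finally show False by simp
  qed
  then have "f 0 = p" by simp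
  moreover have "f 0 \<in> ?O" using fg [of 0] by simp
  ultimately show False using p inside_no_overlap [of "path_image c"] by blast
qed

text \<open>Cut the loop open at a point outside \<open>F\<close>. The preimage of \<open>F\<close>
  is then a connected set of parameters with two different elements, so it contains an interval, and
  the curve point over its midpoint has positive distance from the rest of the loop.\<close>

lemma connected_subset_loop_interior:
  fixes c :: "real \<Rightarrow> complex"
  assumes c: "simple_path c" "pathfinish c = pathstart c"
    and F: "F \<subseteq> path_image c" "compact F" "connected F" "p \<in> F" "q \<in> F" "p \<noteq> q"
  obtains p0 r where "p0 \<in> path_image c" "r > 0" "path_image c \<inter> ball p0 r \<subseteq> F"
proof (cases "F = path_image c")
  case True
  then show ?thesis using that [of p 1] F by auto
next
  case False
  then obtain x0 where x0: "x0 \<in> path_image c" "x0 \<notin> F" using F by blast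
  then obtain u where u: "u \<in> {0..1}" "c u = x0"
    by (auto simp: path_image_def)
  define c' where "c' = shiftpath u c"
  have c': "simple_path c'" "path_image c' = path_image c" "c' 0 = x0" "c' 1 = x0"
    using u c simple_path_shiftpath [OF c, of u] path_image_shiftpath [of u c] unfolding c'_def
    by (auto simp: shiftpath_def pathstart_def pathfinish_def)
  have cont: "continuous_on {0..1} c'"
    using c'(1) by (simp add: simple_path_def path_def)
  have inj: "s = t" if "s \<in> {0<..<1}" "t \<in> {0..1}" "c' s = c' t" for s t
    using c'(1) that unfolding simple_path_def loop_free_def by force
  define I where "I = {0..1} \<inter> c' -` F"
  have I01: "I \<subseteq> {0<..<1}"
  proof
    fix t assume t: "t \<in> I"
    then have "t \<noteq> 0" "t \<noteq> 1" using c' x0 unfolding I_def by auto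
    then show "t \<in> {0<..<1}" using t unfolding I_def by auto
  qed
  have "closed I"
    unfolding I_def using F by (intro continuous_closed_preimage cont) (auto intro: compact_imp_closed)
  then have "compact I"
    unfolding I_def by (metis compact_Icc compact_Int_closed inf.left_idem)
  moreover have "c' ` I = F"
  proof -
    have "F \<subseteq> c' ` {0..1}" using F(1) c'(2) unfolding path_image_def by simp
    then show ?thesis unfolding I_def by blast
  qed
  moreover have "inj_on c' I"
    using inj I01 unfolding inj_on_def by (auto simp: I_def)
  moreover have "continuous_on I c'"
    using cont unfolding I_def by (rule continuous_on_subset) auto
  ultimately obtain g where g: "homeomorphism I F c' g"
    using homeomorphism_compact by blast
  then have conI: "connected I"
    using F by (metis connected_continuous_image homeomorphism_def)
  obtain s t where st: "s \<in> I" "t \<in> I" "c' s = p" "c' t = q"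
    using F \<open>c' ` I = F\<close> by (metis imageE)
  define a where "a = min s t"
  define b where "b = max s t"
  have "s \<noteq> t" using st F by auto
  then have ab: "a < b" "a \<in> I" "b \<in> I" unfolding a_def b_def using st by (auto simp: min_def max_def)
  have abI: "{a..b} \<subseteq> I" using connected_contains_Icc conI ab by blast
  define p0 where "p0 = c' ((a+b)/2)"
  define D where "D = c' ` ({0..a} \<union> {b..1})"
  have a0: "0 < a" "b < 1" using ab I01 by auto
  have "closed D"
    unfolding D_def using a0 ab
    by (intro compact_imp_closed compact_continuous_image continuous_on_subset [OF cont]) auto
  moreover have "p0 \<notin> D"
  proof
    assume "p0 \<in> D"
    then obtain x where x: "x \<in> {0..a} \<union> {b..1}" "c' ((a+b)/2) = c' x"
      unfolding D_def p0_def by blast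
    then have "(a+b)/2 = x"
      using a0 ab by (intro inj) auto
    then show False using x ab by auto
  qed
  ultimately obtain r where r: "r > 0" "ball p0 r \<subseteq> - D"
    by (metis ComplI open_Compl open_contains_ball)
  show ?thesis
  proof (rule that [of p0 r])
    show "p0 \<in> path_image c"
    proof -
      have "p0 \<in> c' ` {0..1}" unfolding p0_def using a0 ab by (intro imageI) auto
      then show ?thesis using c'(2) unfolding path_image_def by simp
    qed
    show "r > 0" by (rule r)
    show "path_image c \<inter> ball p0 r \<subseteq> F"
    proof
      fix x assume x: "x \<in> path_image c \<inter> ball p0 r"
      then have "x \<in> path_image c'" "x \<notin> D" using c'(2) r by auto
      then obtain t where t: "t \<in> {0..1}" "x = c' t" "t \<notin> {0..a} \<union> {b..1}"
        unfolding D_def path_image_def by blast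
      then have "t \<in> I" using abI by auto
      then show "x \<in> F" using t unfolding I_def by auto
    qed
  qed
qed

text \<open>Lindelof's maximum principle: a product of rotated copies of \<open>g - \<zeta>\<close> about a point close to
  \<open>p0\<close> vanishes on the whole frontier of a region around that point.\<close>

lemma constant_boundary_value_attained:
  fixes c :: "real \<Rightarrow> complex"
  assumes c: "simple_path c" "pathfinish c = pathstart c"
    and contg: "continuous_on (closure (inside (path_image c))) g"
    and holg: "g holomorphic_on inside (path_image c)"
    and p0: "p0 \<in> path_image c" "r > 0"
    and const: "\<And>x. x \<in> path_image c \<inter> ball p0 r \<Longrightarrow> g x = \<zeta>"
  obtains z where "z \<in> inside (path_image c)" "g z = \<zeta>"
proof -
  note J = Jordan_inside_outside [OF c]
  let ?O = "inside (path_image c)"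
  have clO: "closure ?O = ?O \<union> path_image c"
    using J by (metis closure_Un_frontier)
  have "p0 \<in> closure (outside (path_image c))" "p0 \<in> closure ?O"
    using J p0 by (metis UnCI closure_Un_frontier)+
  then obtain o' z0 where oz: "o' \<in> outside (path_image c)" "dist o' p0 < r/4"
      "z0 \<in> ?O" "dist z0 p0 < r/4"
    using p0 unfolding closure_approachable by (metis zero_less_divide_iff zero_less_numeral)
  define \<rho> where "\<rho> = dist z0 o'"
  have \<rho>: "0 < \<rho>" "\<rho> < r/2"
  proof -
    have "z0 \<noteq> o'" using oz J by blast
    then show "0 < \<rho>" "\<rho> < r/2"
      unfolding \<rho>_def using oz dist_triangle2 [of z0 o' p0] by auto
  qed
  obtain \<eta> where \<eta>: "\<eta> > 0" "ball o' \<eta> \<subseteq> outside (path_image c)"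
    using J oz open_contains_ball by metis
  \<comment> \<open>\<open>n\<close> is so large that every point of the circle of radius
    \<open>\<rho>\<close> around \<open>z0\<close> is brought, by some rotation through a multiple
    of \<open>2 * pi / n\<close>, into the ball around \<open>o'\<close> that lies outside the
    curve.\<close>
  obtain n :: nat where n: "2 * pi * \<rho> / \<eta> < n"
    using reals_Archimedean2 by blast
  then have n0: "n > 0" using \<eta> \<rho> pi_gt_zero
    by (metis divide_pos_pos mult_pos_pos neq0_conv of_nat_0 order_less_asym zero_less_numeral)
  have n2: "2 * pi / n * \<rho> < \<eta>"
    using n n0 \<eta> by (simp add: field_simps)
  define R where "R = {u::complex. u ^ n = 1}"
  have finR: "finite R"
    unfolding R_def using n0 by (intro finite_roots_unity) auto
  have nR: "cmod u = 1" if "u \<in> R" for u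
  proof -
    have "cmod u ^ n = 1 ^ n"
      using that unfolding R_def by (simp flip: norm_power)
    then show ?thesis
      using n0 power_eq_iff_eq_base [of n "cmod u" 1] by simp
  qed
  have oneR: "1 \<in> R" unfolding R_def by simp
  have rot: "\<exists>u\<in>R. z0 + u * (z - z0) \<in> ball o' \<eta>" if z: "dist z0 z = \<rho>" for z
  proof -
    define w where "w = (o' - z0) / (z - z0)"
    have zz: "z - z0 \<noteq> 0" using z \<rho> by auto
    have "cmod w = 1"
      unfolding w_def using z \<rho> by (simp add: norm_divide \<rho>_def dist_norm norm_minus_commute)
    then obtain \<phi> where \<phi>: "w = cis \<phi>"
      by (metis cis_Arg_unique mult_1 norm_zero of_real_1 rcis_cmod_Arg rcis_def zero_neq_one)
    define k where "k = \<lfloor>\<phi> * n / (2 * pi)\<rfloor>"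
    define u where "u = cis (2 * pi * k / n)"
    have "u ^ n = cis (real n * (2 * pi * k / n))"
      unfolding u_def by (rule Complex.DeMoivre)
    also have "real n * (2 * pi * k / n) = 2 * pi * k"
      using n0 by simp
    also have "cis (2 * pi * k) = 1"
      by (simp add: cis_multiple_2pi)
    finally have "u \<in> R" unfolding R_def by simp
    have "k \<le> \<phi> * n / (2 * pi)" "\<phi> * n / (2 * pi) < k + 1"
      unfolding k_def by linarith+
    then have "\<bar>2 * pi * k - \<phi> * n\<bar> \<le> 2 * pi"
      using pi_gt_zero by (simp add: field_simps abs_le_iff)
    then have "\<bar>2 * pi * k - \<phi> * n\<bar> / n \<le> 2 * pi / n"
      by (intro divide_right_mono) auto
    moreover have "2 * pi * k / n - \<phi> = (2 * pi * k - \<phi> * n) / n"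
      using n0 by (simp add: field_simps)
    ultimately have "\<bar>2 * pi * k / n - \<phi>\<bar> \<le> 2 * pi / n"
      by simp
    then have "cmod (u - w) \<le> 2 * pi / n"
      unfolding u_def \<phi> using norm_cis_diff_le order_trans by blast
    moreover have "z0 + u * (z - z0) - o' = (u - w) * (z - z0)"
      unfolding w_def using zz by (simp add: field_simps)
    ultimately have "dist (z0 + u * (z - z0)) o' \<le> 2 * pi / n * \<rho>"
      using z \<rho> mult_right_mono [of "cmod (u - w)" "2 * pi / n" \<rho>]
      by (simp add: dist_norm norm_mult norm_minus_commute)
    then show ?thesis
      using n2 \<open>u \<in> R\<close> by (intro bexI [of _ u]) (auto simp: dist_commute)
  qed
  \<comment> \<open>At a frontier point of \<open>V\<close> some rotated copy leaves the region. It
    cannot leave through the circle, by the choice of \<open>n\<close>, so it lies on the curve near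
    \<open>p0\<close>, where the corresponding factor of \<open>h\<close> is zero.\<close>
  define V where "V = (\<Inter>u\<in>R. (\<lambda>z. z0 + u * (z - z0)) -` (?O \<inter> ball z0 \<rho>))"
  have opV: "open V"
    unfolding V_def using finR J
    by (intro open_INT ballI continuous_open_vimage) (auto intro!: continuous_intros)
  have z0V: "z0 \<in> V" unfolding V_def using oz \<rho> by auto
  have VO: "V \<subseteq> ball z0 \<rho>" unfolding V_def using oneR by force
  have clV: "z0 + u * (z - z0) \<in> closure ?O \<inter> cball z0 \<rho>" if "z \<in> closure V" "u \<in> R" for z u
  proof -
    have "closed ((\<lambda>z. z0 + u * (z - z0)) -` (closure ?O \<inter> cball z0 \<rho>))"
      by (intro continuous_closed_vimage) (auto intro!: continuous_intros)
    moreover have "V \<subseteq> (\<lambda>z. z0 + u * (z - z0)) -` (closure ?O \<inter> cball z0 \<rho>)"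
      unfolding V_def using that closure_subset [of ?O] by fastforce
    ultimately have "closure V \<subseteq> (\<lambda>z. z0 + u * (z - z0)) -` (closure ?O \<inter> cball z0 \<rho>)"
      by (metis closure_minimal)
    then show ?thesis using that by blast
  qed
  define h where "h = (\<lambda>z. \<Prod>u\<in>R. g (z0 + u * (z - z0)) - \<zeta>)"
  have "cmod (h z0) \<le> 0"
  proof (rule maximum_modulus_frontier [of h V])
    have "(\<lambda>z. g (z0 + u * (z - z0))) holomorphic_on V" if "u \<in> R" for u
    proof -
      have "(g \<circ> (\<lambda>z. z0 + u * (z - z0))) holomorphic_on V"
        by (rule holomorphic_on_compose_gen [OF _ holg])
           (use that in \<open>auto intro!: holomorphic_intros simp: V_def\<close>)
      then show ?thesis by (simp add: o_def)
    qed
    then show "h holomorphic_on interior V"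
      unfolding h_def interior_open [OF opV] by (intro holomorphic_intros)
    show "continuous_on (closure V) h"
      unfolding h_def
    proof (intro continuous_intros)
      fix u assume "u \<in> R"
      then show "continuous_on (closure V) (\<lambda>z. g (z0 + u * (z - z0)))"
        using clV by (intro continuous_on_compose2 [OF contg]) (auto intro!: continuous_intros)
    qed
    show "bounded V" using VO bounded_ball bounded_subset by blast
    show "z0 \<in> V" by (rule z0V)
    fix z assume z: "z \<in> frontier V"
    then have zc: "z \<in> closure V" and zV: "z \<notin> V"
      using opV by (auto simp: frontier_def interior_open)
    have "dist z0 z \<le> \<rho>" using clV [OF zc oneR] by simp
    moreover have "dist z0 z \<noteq> \<rho>"
    proof
      assume "dist z0 z = \<rho>"
      then obtain u where u: "u \<in> R" "z0 + u * (z - z0) \<in> ball o' \<eta>" using rot by blast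
      then have "z0 + u * (z - z0) \<in> outside (path_image c)" using \<eta> by blast
      moreover have "z0 + u * (z - z0) \<in> ?O \<union> path_image c" using clV [OF zc u(1)] clO by blast
      ultimately show False
        using J outside_no_overlap [of "path_image c"] by blast
    qed
    ultimately have d: "dist z0 z < \<rho>" by simp
    obtain u where u: "u \<in> R" "z0 + u * (z - z0) \<notin> ?O \<inter> ball z0 \<rho>"
      using zV unfolding V_def by blast
    have du: "dist z0 (z0 + u * (z - z0)) < \<rho>"
      using d nR [OF u(1)] by (simp add: dist_norm norm_mult norm_minus_commute)
    then have "z0 + u * (z - z0) \<in> path_image c"
      using u clV [OF zc u(1)] clO by auto
    moreover have "dist p0 (z0 + u * (z - z0)) < r"
      using du oz \<rho> dist_triangle [of p0 "z0 + u * (z - z0)" z0] by (simp add: dist_commute)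
    ultimately have "g (z0 + u * (z - z0)) = \<zeta>"
      using const by auto
    then show "cmod (h z) \<le> 0"
      unfolding h_def using finR u(1) by (auto intro!: prod_zero)
  qed
  then have "(g z0 - \<zeta>) ^ card R = 0"
    unfolding h_def by (simp add: prod_constant)
  then show ?thesis using that [of z0] oz by simp
qed

text \<open>Caratheodory's argument. Vanishing oscillation makes the inverse Riemann map
  \<open>g\<close> uniformly continuous, so it extends to the closure. The extension
  \<open>gh\<close> is injective on the curve because the fibre of a boundary value is connected:
  with two points it would contain an arc of the curve, and a value of modulus 1 would then be
  attained inside.\<close>

theorem Schoenflies:
  fixes c :: "real \<Rightarrow> complex"
  assumes c: "simple_path c" "pathfinish c = pathstart c"
  obtains h k where "homeomorphism (path_image c \<union> inside (path_image c)) (cball 0 1) h k"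
    "h ` path_image c = sphere (0::complex) 1"
proof -
  note J = Jordan_inside_outside [OF c]
  let ?O = "inside (path_image c)"
  let ?J = "path_image c"
  have clO: "closure ?O = ?J \<union> ?O"
    using J by (metis closure_Un_frontier sup_commute)
  have "?O \<noteq> UNIV" using J by (metis bounded_any_center not_bounded_UNIV)
  then obtain g f where g: "g holomorphic_on ?O" and f: "f holomorphic_on ball 0 1"
    and gf: "\<And>z. z \<in> ?O \<Longrightarrow> g z \<in> ball 0 1 \<and> f (g z) = z"
    and fg: "\<And>z. z \<in> ball 0 1 \<Longrightarrow> f z \<in> ?O \<and> g (f z) = z"
    using Riemann_mapping_theorem [of ?O] J simply_connected_inside_simple_path [OF c(1)] by metis
  have cg: "continuous_on ?O g" using g holomorphic_on_imp_continuous_on by blast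
  have osc: "\<exists>d>0. \<forall>x\<in>?O \<inter> ball p d. \<forall>y\<in>?O \<inter> ball p d. dist (g x) (g y) < e"
    if p: "p \<in> closure ?O" and e: "e > 0" for p e
  proof (cases "p \<in> ?J")
    case True
    show ?thesis by (rule Riemann_map_oscillation [OF c True e f cg gf fg])
  next
    case False
    then have "p \<in> ?O" using p clO by auto
    then obtain d where d: "d > 0" "\<And>x. x \<in> ?O \<Longrightarrow> dist x p < d \<Longrightarrow> dist (g x) (g p) < e/2"
      using cg [unfolded continuous_on_iff, rule_format, of p "e/2"] e by auto
    have "dist (g x) (g y) < e" if "x \<in> ?O \<inter> ball p d" "y \<in> ?O \<inter> ball p d" for x y
    proof -
      have "dist (g x) (g p) < e/2" "dist (g y) (g p) < e/2"
        using that d(2) [of x] d(2) [of y] by (auto simp: dist_commute)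
      then show ?thesis using dist_triangle2 [of "g x" "g y" "g p"] by linarith
    qed
    then show ?thesis
      using d(1) by (intro exI [of _ d] conjI ballI)
  qed
  have cO: "compact (closure ?O)" using J by (simp add: compact_closure)
  have "uniformly_continuous_on ?O g"
  proof (rule ccontr)
    define P where "P = (\<lambda>e d. \<forall>x\<in>?O. \<forall>x'\<in>?O. dist x' x < d \<longrightarrow> dist (g x') (g x) < e)"
    assume "\<not> uniformly_continuous_on ?O g"
    then have "\<exists>e>0. \<forall>d>0. \<not> P e d"
      unfolding P_def uniformly_continuous_on_def by (simp only: not_all not_imp not_ex de_Morgan_conj) blast
    then obtain e where e: "e > 0" "\<And>d. d > 0 \<Longrightarrow> \<not> P e d"
      by blast
    have "\<forall>n::nat. \<exists>x x'. x \<in> ?O \<and> x' \<in> ?O \<and> dist x' x < inverse (real (Suc n)) \<and> \<not> dist (g x') (g x) < e"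
    proof
      fix n :: nat
      have "\<not> P e (inverse (real (Suc n)))" by (intro e) simp
      then show "\<exists>x x'. x \<in> ?O \<and> x' \<in> ?O \<and> dist x' x < inverse (real (Suc n)) \<and> \<not> dist (g x') (g x) < e"
        unfolding P_def by blast
    qed
    then obtain X Y where XY: "\<And>n. X n \<in> ?O" "\<And>n. Y n \<in> ?O" "\<And>n. dist (Y n) (X n) < inverse (real (Suc n))"
        "\<And>n. \<not> dist (g (Y n)) (g (X n)) < e"
      by metis
    have "X n \<in> closure ?O" for n using XY(1) closure_subset by blast
    then obtain p r where p: "p \<in> closure ?O" "strict_mono r" "(X \<circ> r) \<longlonglongrightarrow> p"
      using cO unfolding compact_def by blast
    obtain d where d: "d > 0" "\<forall>x\<in>?O \<inter> ball p d. \<forall>y\<in>?O \<inter> ball p d. dist (g x) (g y) < e"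
      using osc [OF p(1) e(1)] by blast
    have "\<forall>\<^sub>F n in sequentially. dist ((X \<circ> r) n) p < d/2"
      using tendstoD [OF p(3), of "d/2"] d(1) by simp
    moreover have "\<forall>\<^sub>F n in sequentially. inverse (real (Suc n)) < d/2"
      using d(1) LIMSEQ_inverse_real_of_nat by (intro order_tendstoD) auto
    ultimately have "\<forall>\<^sub>F n in sequentially. dist ((X \<circ> r) n) p < d/2 \<and> inverse (real (Suc n)) < d/2"
      by (rule eventually_conj)
    then obtain n where n: "dist (X (r n)) p < d/2" "inverse (real (Suc n)) < d/2"
      unfolding eventually_sequentially by auto
    have "inverse (real (Suc (r n))) \<le> inverse (real (Suc n))"
      using seq_suble [OF p(2), of n] by (intro le_imp_inverse_le) auto
    then have "dist (Y (r n)) (X (r n)) < d/2"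
      using XY(3) [of "r n"] n(2) by linarith
    then have "dist p (Y (r n)) < d" "dist p (X (r n)) < d"
      using n(1) d(1) dist_triangle [of p "Y (r n)" "X (r n)"] by (auto simp: dist_commute)
    then show False
      using d(2) [rule_format, of "X (r n)" "Y (r n)"] XY(1,2,4) [of "r n"] by (auto simp: dist_commute)
  qed
  then obtain gh where "uniformly_continuous_on (closure ?O) gh" and ghg: "\<And>x. x \<in> ?O \<Longrightarrow> g x = gh x"
    using uniformly_continuous_on_extension_on_closure [of ?O g] by metis
  then have cgh: "continuous_on (closure ?O) gh"
    using uniformly_continuous_imp_continuous by blast
  have into: "gh ` closure ?O \<subseteq> cball 0 1"
  proof (rule image_closure_subset [OF cgh])
    show "gh ` ?O \<subseteq> cball 0 1" using ghg gf by (force simp: less_imp_le)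
  qed auto
  have bdry: "gh p \<in> sphere 0 1" if p: "p \<in> ?J" for p
  proof (rule ccontr)
    assume ne: "gh p \<notin> sphere 0 1"
    have pc: "p \<in> closure ?O" using p clO by simp
    then have gb: "gh p \<in> ball 0 1" using ne into by (force simp: less_le)
    obtain X where X: "\<And>n. X n \<in> ?O" "X \<longlonglongrightarrow> p"
      using pc unfolding closure_sequential by blast
    have "(\<lambda>n. gh (X n)) \<longlonglongrightarrow> gh p"
      using cgh X pc closure_subset [of ?O] unfolding continuous_on_sequentially by (auto simp: o_def)
    then have "(\<lambda>n. f (gh (X n))) \<longlonglongrightarrow> f (gh p)"
      using f gb holomorphic_on_imp_continuous_on
      by (metis continuous_on_eq_continuous_at isCont_tendsto_compose open_ball)
    moreover have "f (gh (X n)) = X n" for n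
      using X(1) ghg gf by metis
    ultimately have "f (gh p) = p"
      using X(2) LIMSEQ_unique by simp
    then have "p \<in> ?O" using fg [OF gb] by simp
    then show False using p inside_no_overlap [of ?J] by blast
  qed
  have onto: "gh ` closure ?O = cball 0 1"
  proof
    have "ball 0 1 \<subseteq> gh ` closure ?O"
    proof
      fix w :: complex assume "w \<in> ball 0 1"
      then show "w \<in> gh ` closure ?O"
        using fg [of w] ghg [of "f w"] closure_subset [of ?O] by (intro image_eqI [of _ _ "f w"]) auto
    qed
    moreover have "closed (gh ` closure ?O)"
      using compact_continuous_image [OF cgh cO] compact_imp_closed by blast
    ultimately show "cball 0 1 \<subseteq> gh ` closure ?O"
      by (metis closure_ball closure_minimal zero_less_one)
  qed (rule into)
  have inj: "p = q" if pq: "p \<in> ?J" "q \<in> ?J" "gh p = gh q" for p q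
  proof (rule ccontr)
    assume ne: "p \<noteq> q"
    define \<zeta> where "\<zeta> = gh p"
    have \<zeta>: "cmod \<zeta> = 1" unfolding \<zeta>_def using bdry pq by auto
    \<comment> \<open>The fibre \<open>F\<close> is the intersection of these decreasing compact
      sets. Each is connected, since the intersection of two balls is convex, and connectedness
      passes to the nested intersection.\<close>
    define S where "S = (\<lambda>n::nat. closure (f ` (ball 0 1 \<inter> ball \<zeta> (inverse (real (Suc n))))))"
    define F where "F = {x \<in> closure ?O. gh x = \<zeta>}"
    have Fi: "F = \<Inter> (range S)"
    proof (intro equalityI subsetI)
      fix x assume x: "x \<in> F"
      then have xc: "x \<in> closure ?O" "gh x = \<zeta>" unfolding F_def by auto
      obtain X where X: "\<And>n. X n \<in> ?O" "X \<longlonglongrightarrow> x"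
        using xc unfolding closure_sequential by blast
      have lim: "(\<lambda>n. gh (X n)) \<longlonglongrightarrow> \<zeta>"
        using cgh X xc closure_subset [of ?O] unfolding continuous_on_sequentially by (auto simp: o_def)
      show "x \<in> \<Inter> (range S)"
      proof (rule InterI, clarsimp)
        fix n
        have "\<forall>\<^sub>F i in sequentially. dist (gh (X i)) \<zeta> < inverse (real (Suc n))"
          using lim by (auto simp: tendsto_iff)
        then have "\<forall>\<^sub>F i in sequentially. X i \<in> f ` (ball 0 1 \<inter> ball \<zeta> (inverse (real (Suc n))))"
        proof eventually_elim
          case (elim i)
          then show ?case
            using gf [OF X(1) [of i]] ghg [OF X(1) [of i]]
            by (intro image_eqI [of _ _ "gh (X i)"]) (auto simp: dist_commute)
        qed
        then show "x \<in> S n"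
          unfolding S_def using X(2)
          by (intro Lim_in_closed_set [OF closed_closure _ _ X(2)])
             (auto elim!: eventually_mono intro: subsetD [OF closure_subset])
      qed
    next
      fix x assume x: "x \<in> \<Inter> (range S)"
      have sub: "S n \<subseteq> {x \<in> closure ?O. dist (gh x) \<zeta> \<le> inverse (real (Suc n))}" for n
        unfolding S_def
      proof (rule closure_minimal)
        show "f ` (ball 0 1 \<inter> ball \<zeta> (inverse (real (Suc n))))
               \<subseteq> {x \<in> closure ?O. dist (gh x) \<zeta> \<le> inverse (real (Suc n))}"
        proof clarify
          fix w :: complex assume w: "w \<in> ball 0 1" "w \<in> ball \<zeta> (inverse (real (Suc n)))"
          then show "f w \<in> closure ?O \<and> dist (gh (f w)) \<zeta> \<le> inverse (real (Suc n))"
            using fg [OF w(1)] ghg [of "f w"] closure_subset [of ?O] by (auto simp: dist_commute)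
        qed
        have "closed (closure ?O \<inter> gh -` cball \<zeta> (inverse (real (Suc n))))"
          by (intro continuous_closed_preimage cgh) auto
        then show "closed {x \<in> closure ?O. dist (gh x) \<zeta> \<le> inverse (real (Suc n))}"
          by (simp add: Int_def vimage_def dist_commute)
      qed
      have "x \<in> closure ?O" "\<And>n. dist (gh x) \<zeta> \<le> inverse (real (Suc n))"
        using x sub by blast+
      moreover have "dist (gh x) \<zeta> \<le> 0"
        using calculation(2) LIMSEQ_inverse_real_of_nat by (meson LIMSEQ_le_const)
      ultimately show "x \<in> F" unfolding F_def by simp
    qed
    have conF: "connected F"
      unfolding Fi
    proof (rule connected_nest)
      fix m n :: nat
      have "bounded ?O" using J by simp
      then show "compact (S n)"
        unfolding S_def using fg by (auto intro!: bounded_subset [of ?O] simp: compact_closure)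
      show "connected (S n)"
        unfolding S_def using holomorphic_on_imp_continuous_on [OF f]
        by (intro connected_imp_connected_closure connected_continuous_image convex_connected convex_Int)
           (auto intro: continuous_on_subset)
      assume "m \<le> n"
      then have "inverse (real (Suc n)) \<le> inverse (real (Suc m))" by (intro le_imp_inverse_le) auto
      then show "S n \<subseteq> S m"
        unfolding S_def by (intro closure_mono image_mono Int_mono subset_ball order_refl)
    qed
    have "compact F"
    proof -
      have "closed (closure ?O \<inter> gh -` {\<zeta>})"
        by (intro continuous_closed_preimage cgh) auto
      then have "closed F" unfolding F_def by (simp add: Int_def vimage_def)
      then show ?thesis
        using cO unfolding F_def by (metis (no_types, lifting) closed_Int_compact inf.absorb_iff1 mem_Collect_eq subsetI)
    qed
    moreover have "F \<subseteq> ?J"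
    proof
      fix x assume "x \<in> F"
      then have x: "x \<in> ?J \<union> ?O" "gh x = \<zeta>" unfolding F_def clO by auto
      have "x \<notin> ?O"
      proof
        assume "x \<in> ?O"
        then have "\<zeta> \<in> ball 0 1" using gf ghg x(2) by metis
        then show False using \<zeta> by simp
      qed
      then show "x \<in> ?J" using x by blast
    qed
    moreover have "p \<in> F" "q \<in> F" unfolding F_def \<zeta>_def using pq clO by auto
    ultimately obtain p0 r where pr: "p0 \<in> ?J" "r > 0" "?J \<inter> ball p0 r \<subseteq> F"
      using connected_subset_loop_interior [OF c] conF ne by metis
    have "gh holomorphic_on ?O" by (rule holomorphic_transform [OF g ghg])
    then obtain z where "z \<in> ?O" "gh z = \<zeta>"
      using constant_boundary_value_attained [OF c cgh _ pr(1,2), of \<zeta>] pr(3) unfolding F_def by blast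
    then show False using gf ghg \<zeta> by force
  qed
  have "inj_on gh (closure ?O)"
  proof (rule inj_onI)
    fix x y assume xy: "x \<in> closure ?O" "y \<in> closure ?O" "gh x = gh y"
    have ins: "z \<in> ?O \<longleftrightarrow> gh z \<in> ball 0 1" if "z \<in> closure ?O" for z
    proof
      show "gh z \<in> ball 0 1" if "z \<in> ?O" using gf [OF that] ghg [OF that] by simp
      show "z \<in> ?O" if "gh z \<in> ball 0 1"
        using bdry [of z] \<open>z \<in> closure ?O\<close> that unfolding clO by auto
    qed
    show "x = y"
    proof (cases "x \<in> ?O")
      case True
      then show ?thesis using xy ins gf ghg by metis
    next
      case False
      then show ?thesis using xy ins [OF xy(1)] ins [OF xy(2)] inj clO by (metis Un_iff)
    qed
  qed
  then obtain k where k: "homeomorphism (closure ?O) (cball 0 1) gh k"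
    using homeomorphism_compact [OF cO cgh onto] by blast
  have "gh ` ?J = sphere 0 1"
  proof
    show "gh ` ?J \<subseteq> sphere 0 1" using bdry by blast
    show "sphere 0 1 \<subseteq> gh ` ?J"
    proof
      fix w :: complex assume w: "w \<in> sphere 0 1"
      then have "w \<in> gh ` closure ?O" using onto by simp
      then obtain x where x: "x \<in> closure ?O" "w = gh x" by blast
      then have "x \<notin> ?O" using w gf ghg by force
      then show "w \<in> gh ` ?J" using x clO by auto
    qed
  qed
  then show ?thesis using that k clO by metis
qed

section \<open>The trefoil is knotted\<close>

text \<open>The root \<open>x\<close> of the cubic \<open>x\<^sup>3 - 3 p x + 2 q\<close>, which has a double root iff
  \<open>p\<^sup>3 = q\<^sup>2\<close>, as a function of \<open>e = (p, q)\<close>.\<close>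

definition cubic :: "complex \<times> complex \<Rightarrow> complex \<Rightarrow> complex" where
  "cubic e x = x ^ 3 - 3 * fst e * x + 2 * snd e"

definition cubic_base :: "(complex \<times> complex) set" where
  "cubic_base = {e. fst e ^ 3 \<noteq> snd e ^ 2}"

definition cubic_cover :: "(complex \<times> complex \<times> complex) set" where
  "cubic_cover = {z. snd z \<in> cubic_base \<and> cubic (snd z) (fst z) = 0}"

text \<open>One root exists by algebraic closedness; the other two solve the quadratic
  \<open>x ^ 2 + r1 * x + (r1 ^ 2 - 3 * p)\<close>. A double root \<open>x\<close> forces
  \<open>p = x ^ 2\<close> and \<open>q = x ^ 3\<close>, which \<open>cubic_base\<close>
  excludes.\<close>

lemma cubic_factors:
  obtains r1 r2 r3 where "\<And>x. cubic e x = (x - r1) * (x - r2) * (x - r3)"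
    "e \<in> cubic_base \<Longrightarrow> distinct [r1, r2, r3]"
proof -
  obtain p q where e: "e = (p, q)" by fastforce
  have "degree [:2 * q, -3 * p, 0, 1:] > 0" by simp
  then obtain r1 where "poly [:2 * q, -3 * p, 0, 1:] r1 = 0"
    using alg_closed_imp_poly_has_root [of "[:2 * q, -3 * p, 0, 1:]"] by blast
  then have "2 * q + r1 * (- (3 * p) + r1 * r1) = 0" by simp
  then have "2 * q = - (r1 * (- (3 * p) + r1 * r1))" by (simp only: eq_neg_iff_add_eq_0)
  then have r1: "2 * q = 3 * p * r1 - r1 ^ 3"
    by (simp add: algebra_simps power3_eq_cube)
  define d where "d = csqrt (12 * p - 3 * r1 ^ 2)"
  have d: "d ^ 2 = 12 * p - 3 * r1 ^ 2" unfolding d_def by simp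
  define r2 where "r2 = (- r1 + d) / 2"
  define r3 where "r3 = (- r1 - d) / 2"
  have s: "r2 + r3 = - r1" "r2 * r3 = r1 ^ 2 - 3 * p"
    unfolding r2_def r3_def using d by (auto simp: field_simps power2_eq_square)
  have fac: "cubic e x = (x - r1) * (x - r2) * (x - r3)" for x
  proof -
    have "(x - r2) * (x - r3) = x ^ 2 - (r2 + r3) * x + r2 * r3"
      by (simp add: algebra_simps power2_eq_square)
    also have "\<dots> = x ^ 2 + r1 * x + (r1 ^ 2 - 3 * p)"
      by (simp add: s)
    finally have "(x - r1) * (x - r2) * (x - r3) = (x - r1) * (x ^ 2 + r1 * x + (r1 ^ 2 - 3 * p))"
      by (simp add: mult.assoc)
    also have "\<dots> = x ^ 3 - 3 * p * x + (3 * p * r1 - r1 ^ 3)"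
      by (simp add: algebra_simps power2_eq_square power3_eq_cube)
    finally show ?thesis
      unfolding cubic_def e r1 [symmetric] by simp
  qed
  moreover have "distinct [r1, r2, r3]" if "e \<in> cubic_base"
  proof -
    have ne: "p ^ 3 \<noteq> q ^ 2" using that unfolding cubic_base_def e by simp
    have crit: False if "p = x ^ 2" "2 * q = 2 * x ^ 3" for x
    proof -
      have "q = x ^ 3" using that(2) by simp
      then have "p ^ 3 = q ^ 2" unfolding that(1) by (simp add: power_mult [symmetric])
      then show False using ne by simp
    qed
    have a: "r1 \<noteq> r2"
    proof
      assume eq: "r1 = r2"
      have "r3 = - r1 - r2" using s(1) by (metis add_diff_cancel_left')
      then have "r3 = - 2 * r1" unfolding eq by simp
      then have "p = r1 ^ 2" using s(2) eq by (simp add: power2_eq_square field_simps)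
      moreover from this have "2 * q = 2 * r1 ^ 3"
        unfolding r1 by (simp add: power2_eq_square power3_eq_cube)
      ultimately show False using crit by blast
    qed
    have b: "r1 \<noteq> r3"
    proof
      assume eq: "r1 = r3"
      have "r2 = - r1 - r3" using s(1) by (metis add_diff_cancel_right')
      then have "r2 = - 2 * r1" unfolding eq by simp
      then have "p = r1 ^ 2" using s(2) eq by (simp add: power2_eq_square field_simps)
      moreover from this have "2 * q = 2 * r1 ^ 3"
        unfolding r1 by (simp add: power2_eq_square power3_eq_cube)
      ultimately show False using crit by blast
    qed
    have c: "r2 \<noteq> r3"
    proof
      assume "r2 = r3"
      then have "d = 0" unfolding r2_def r3_def by simp
      then have p: "p = (- r1 / 2) ^ 2" using d by (simp add: power2_eq_square field_simps)
      moreover have "2 * q = 2 * (- r1 / 2) ^ 3"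
        unfolding r1 p by (simp add: power2_eq_square power3_eq_cube)
      ultimately show False using crit by blast
    qed
    show ?thesis using a b c by simp
  qed
  ultimately show ?thesis using that by blast
qed

lemma card_cubic_roots:
  assumes "e \<in> cubic_base"
  shows "card {x. cubic e x = 0} = 3"
proof -
  obtain r1 r2 r3 where "\<And>x. cubic e x = (x - r1) * (x - r2) * (x - r3)" "distinct [r1, r2, r3]"
    using cubic_factors [of e] assms by metis
  then have "{x. cubic e x = 0} = {r1, r2, r3}" "card {r1, r2, r3} = 3" by auto
  then show ?thesis by simp
qed

text \<open>The modulus of the cubic at \<open>r\<close> is the product of the distances from
  \<open>r\<close> to its three roots. The bound is used twice: roots persist under small changes of
  \<open>e\<close>, and they move continuously.\<close>

lemma cubic_root_near:
  assumes "cmod (cubic e r) < \<delta> ^ 3" "\<delta> > 0"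
  obtains x where "cubic e x = 0" "dist r x < \<delta>"
proof -
  obtain r1 r2 r3 where f: "\<And>x. cubic e x = (x - r1) * (x - r2) * (x - r3)"
    using cubic_factors [of e] by metis
  have "cmod (r - r1) < \<delta> \<or> cmod (r - r2) < \<delta> \<or> cmod (r - r3) < \<delta>"
  proof (rule ccontr)
    assume "\<not> ?thesis"
    then have "\<delta> * \<delta> * \<delta> \<le> cmod (r - r1) * cmod (r - r2) * cmod (r - r3)"
      using assms(2) by (intro mult_mono) auto
    then show False using assms(1) unfolding f by (simp add: norm_mult power3_eq_cube)
  qed
  then show ?thesis using that f by (auto simp: dist_norm)
qed

lemma continuous_on_cubic [continuous_intros]:
  assumes "continuous_on S f" "continuous_on S g"
  shows "continuous_on S (\<lambda>z. cubic (f z) (g z))"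
  unfolding cubic_def by (intro continuous_intros assms)

text \<open>The discs of radius \<open>\<delta>\<close>, at most half the least distance between the
  roots over \<open>e0\<close>, are disjoint. Each nearby cubic has a root in every disc, hence
  exactly one by counting, so the sheets \<open>V r\<close> are graphs of the root functions
  \<open>f\<close>.\<close>

lemma covering_space_cubic: "covering_space cubic_cover snd cubic_base"
proof
  show "continuous_on cubic_cover snd" by (intro continuous_intros)
  show "snd ` cubic_cover = cubic_base"
  proof
    show "cubic_base \<subseteq> snd ` cubic_cover"
    proof
      fix e assume e: "e \<in> cubic_base"
      then obtain x where "cubic e x = 0"
        using card_cubic_roots [of e] by (metis (mono_tags, lifting) card.empty empty_Collect_eq zero_neq_numeral)
      then show "e \<in> snd ` cubic_cover"
        using e by (intro image_eqI [of _ _ "(x, e)"]) (auto simp: cubic_cover_def)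
    qed
  qed (auto simp: cubic_cover_def)
  fix e0 assume e0: "e0 \<in> cubic_base"
  define R where "R = {x. cubic e0 x = 0}"
  have cR: "card R = 3" unfolding R_def using e0 by (rule card_cubic_roots)
  then have finR: "finite R" by (metis card.infinite zero_neq_numeral)
  obtain d where d: "d > 0" "\<And>r r'. r \<in> R \<Longrightarrow> r' \<in> R \<Longrightarrow> r \<noteq> r' \<Longrightarrow> d \<le> dist r r'"
  proof -
    define Ds where "Ds = (\<lambda>(r, r'). dist r r') ` {(r, r'). r \<in> R \<and> r' \<in> R \<and> r \<noteq> r'}"
    have "finite {(r, r'). r \<in> R \<and> r' \<in> R \<and> r \<noteq> r'}"
      by (rule finite_subset [of _ "R \<times> R"]) (use finR in auto)
    then have fD: "finite (insert 1 Ds)" unfolding Ds_def by simp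
    show ?thesis
    proof (rule that [of "Min (insert 1 Ds)"])
      show "Min (insert 1 Ds) > 0" using fD by (subst Min_gr_iff) (auto simp: Ds_def)
      fix r r' assume "r \<in> R" "r' \<in> R" "r \<noteq> r'"
      then have "dist r r' \<in> insert 1 Ds" unfolding Ds_def by force
      then show "Min (insert 1 Ds) \<le> dist r r'" by (rule Min_le [OF fD])
    qed
  qed
  define \<delta> where "\<delta> = d / 2"
  have \<delta>: "\<delta> > 0" unfolding \<delta>_def using d by simp
  have disj: "r = r'" if "r \<in> R" "r' \<in> R" "dist r x < \<delta>" "dist r' x < \<delta>" for r r' x
  proof (rule ccontr)
    assume "r \<noteq> r'"
    then have "d \<le> dist r r'" using d that by blast
    then show False using that dist_triangle2 [of r r' x] unfolding \<delta>_def by linarith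
  qed
  define T where "T = {e \<in> cubic_base. \<forall>r\<in>R. cmod (cubic e r) < \<delta> ^ 3}"
  have near: "\<exists>x. cubic e x = 0 \<and> dist r x < \<delta>" if "e \<in> T" "r \<in> R" for e r
    using that \<delta> cubic_root_near [of e r \<delta>] unfolding T_def by auto
  define f where "f = (\<lambda>e r. SOME x. cubic e x = 0 \<and> dist r x < \<delta>)"
  have f: "cubic e (f e r) = 0" "dist r (f e r) < \<delta>" if "e \<in> T" "r \<in> R" for e r
    using someI_ex [OF near [OF that]] unfolding f_def by auto
  have fonto: "\<exists>r\<in>R. x = f e r" if "e \<in> T" "cubic e x = 0" for e x
  proof -
    have c3: "card {x. cubic e x = 0} = 3"
      using that T_def by (intro card_cubic_roots) auto
    then have fin: "finite {x. cubic e x = 0}" by (metis card.infinite zero_neq_numeral)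
    have "inj_on (f e) R"
      using f(2) that(1) disj by (metis inj_onI)
    then have "card (f e ` R) = 3" using cR by (simp add: card_image)
    moreover have "f e ` R \<subseteq> {x. cubic e x = 0}" using f(1) [OF that(1)] by auto
    ultimately have "f e ` R = {x. cubic e x = 0}" using c3 fin by (metis card_subset_eq)
    then show ?thesis using that by blast
  qed
  have funiq: "x = f e r" if "e \<in> T" "r \<in> R" "cubic e x = 0" "dist r x < \<delta>" for e r x
    using fonto [OF that(1,3)] f(2) [OF that(1)] that disj by metis
  have contf: "continuous_on T (\<lambda>e. f e r)" if r: "r \<in> R" for r
    unfolding continuous_on_def tendsto_iff
  proof (intro ballI allI impI)
    fix e1 and \<epsilon> :: real assume e1: "e1 \<in> T" and \<epsilon>: "\<epsilon> > 0"
    define \<eta> where "\<eta> = min \<epsilon> (\<delta> - dist r (f e1 r))"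
    have \<eta>: "\<eta> > 0" unfolding \<eta>_def using f(2) [OF e1 r] \<epsilon> by simp
    have "((\<lambda>e. cmod (cubic e (f e1 r))) \<longlongrightarrow> cmod (cubic e1 (f e1 r))) (at e1 within T)"
    proof -
      have "continuous_on T (\<lambda>e. cmod (cubic e (f e1 r)))" by (intro continuous_intros)
      then show ?thesis using e1 unfolding continuous_on_def by blast
    qed
    moreover have "cmod (cubic e1 (f e1 r)) < \<eta> ^ 3" using f(1) [OF e1 r] \<eta> by simp
    ultimately have "\<forall>\<^sub>F e in at e1 within T. cmod (cubic e (f e1 r)) < \<eta> ^ 3"
      by (rule order_tendstoD)
    moreover have "\<forall>\<^sub>F e in at e1 within T. e \<in> T"
      by (simp add: eventually_at_filter)
    ultimately show "\<forall>\<^sub>F e in at e1 within T. dist (f e r) (f e1 r) < \<epsilon>"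
    proof eventually_elim
      case (elim e)
      obtain x where x: "cubic e x = 0" "dist (f e1 r) x < \<eta>"
        using cubic_root_near [OF elim(1) \<eta>] .
      then have "dist r x < \<delta>"
        using dist_triangle [of r x "f e1 r"] unfolding \<eta>_def by simp
      then have "x = f e r" using funiq [OF elim(2) r x(1)] by simp
      then show ?case using x(2) unfolding \<eta>_def by (simp add: dist_commute)
    qed
  qed
  define V where "V = (\<lambda>r. {z \<in> cubic_cover. snd z \<in> T \<and> dist r (fst z) < \<delta>})"
  have oT: "openin (top_of_set cubic_base) T"
  proof -
    have "open (\<Inter>r\<in>R. {e. cmod (cubic e r) < \<delta> ^ 3})"
      using finR by (intro open_INT ballI open_Collect_less continuous_intros)
    then have "openin (top_of_set cubic_base) (cubic_base \<inter> (\<Inter>r\<in>R. {e. cmod (cubic e r) < \<delta> ^ 3}))"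
      by (rule openin_open_Int)
    moreover have "cubic_base \<inter> (\<Inter>r\<in>R. {e. cmod (cubic e r) < \<delta> ^ 3}) = T"
      unfolding T_def by auto
    ultimately show ?thesis by simp
  qed
  show "\<exists>T. e0 \<in> T \<and> openin (top_of_set cubic_base) T \<and>
          (\<exists>v. \<Union> v = cubic_cover \<inter> snd -` T \<and> (\<forall>u\<in>v. openin (top_of_set cubic_cover) u) \<and>
               pairwise disjnt v \<and> (\<forall>u\<in>v. \<exists>q. homeomorphism u T snd q))"
  proof (intro exI [of _ T] conjI exI [of _ "V ` R"] ballI)
    show "e0 \<in> T" unfolding T_def R_def using e0 \<delta> by simp
    show "openin (top_of_set cubic_base) T" by (rule oT)
    show "\<Union> (V ` R) = cubic_cover \<inter> snd -` T"
    proof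
      show "cubic_cover \<inter> snd -` T \<subseteq> \<Union> (V ` R)"
      proof
        fix z assume z: "z \<in> cubic_cover \<inter> snd -` T"
        then obtain r where "r \<in> R" "fst z = f (snd z) r"
          using fonto [of "snd z" "fst z"] unfolding cubic_cover_def by auto
        then show "z \<in> \<Union> (V ` R)"
          using z f(2) [of "snd z" r] unfolding V_def by auto
      qed
    qed (auto simp: V_def)
    show "pairwise disjnt (V ` R)"
      using disj unfolding pairwise_def disjnt_def V_def by fastforce
    fix u assume "u \<in> V ` R"
    then obtain r where r: "r \<in> R" "u = V r" by blast
    have "openin (top_of_set cubic_cover) (cubic_cover \<inter> snd -` T)"
      by (rule continuous_openin_preimage [OF _ _ oT]) (auto intro!: continuous_intros simp: cubic_cover_def)
    moreover have "openin (top_of_set cubic_cover) (cubic_cover \<inter> (\<lambda>z. dist r (fst z)) -` {..<\<delta>})"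
      by (intro continuous_openin_preimage_gen continuous_intros)
    moreover have "V r = (cubic_cover \<inter> snd -` T) \<inter> (cubic_cover \<inter> (\<lambda>z. dist r (fst z)) -` {..<\<delta>})"
      unfolding V_def by auto
    ultimately show "openin (top_of_set cubic_cover) u"
      unfolding r by (metis openin_Int)
    show "\<exists>q. homeomorphism u T snd q"
    proof (intro exI [of _ "\<lambda>e. (f e r, e)"] homeomorphismI)
      show "continuous_on u snd" by (intro continuous_intros)
      show "continuous_on T (\<lambda>e. (f e r, e))" by (intro continuous_intros contf r)
      show "snd ` u \<subseteq> T" unfolding r V_def by auto
      show "(\<lambda>e. (f e r, e)) ` T \<subseteq> u"
        unfolding r V_def cubic_cover_def using f r oT openin_imp_subset by fastforce
      show "(f (snd z) r, snd z) = z" if "z \<in> u" for z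
        using that funiq [of "snd z" r "fst z"] r unfolding V_def cubic_cover_def
        by (auto simp: prod_eq_iff)
    qed auto
  qed
qed

section \<open>Coordinates on the complement of the trefoil\<close>

text \<open>The complement of the trefoil is mapped to the pairs \<open>(p, q)\<close> with \<open>p\<^sup>3 \<noteq> q\<^sup>2\<close>:
  near the core circle \<open>cmod z = 2\<close>, \<open>t = 0\<close> of the torus carrying the knot, \<open>p\<close> is the longitude
  angle and \<open>q\<close> is the meridian coordinate; the damping factors only serve to make \<open>p\<close> continuous
  on the axis and to give a limit at infinity.\<close>

definition half_plane :: "complex \<times> real \<Rightarrow> complex" where
  "half_plane x = Complex (cmod (fst x)) (snd x)"

definition merid :: "complex \<times> real \<Rightarrow> complex" where
  "merid x = half_plane x - 2"

text \<open>The threshold 3/2 lies strictly between 1, the radius of the torus around the core that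
  carries the knot, and 2, the distance from the core to the axis. Within that distance of the core
  the factor is 1 and the coordinates are undistorted.\<close>

definition damp :: "complex \<times> real \<Rightarrow> real" where
  "damp x = (3/2) / max (cmod (merid x)) (3/2)"

text \<open>With \<open>r = cmod (fst x)\<close>, the factor \<open>2 / max 1 (2 * r)\<close> is
  \<open>1 / r\<close> for \<open>r \<ge> 1/2\<close>: the direction is normalised on the solid
  torus and still extends continuously over the axis.\<close>

definition longitude_coord :: "complex \<times> real \<Rightarrow> complex" where
  "longitude_coord x = fst x * of_real (2 / max 1 (2 * cmod (fst x)) * (damp x)\<^sup>2)"

text \<open>Far out the damping factor tends to 0, and numerator and denominator both grow like
  \<open>half_plane x\<close>, so the quotient tends to 1. The denominator never vanishes because
  the real part of \<open>half_plane x\<close> is nonnegative.\<close>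

definition meridian_coord :: "complex \<times> real \<Rightarrow> complex" where
  "meridian_coord x = merid x / (1 + of_real (1 - damp x) * half_plane x)"

lemma damp_bounds: "0 < damp x" "damp x \<le> 1"
  unfolding damp_def by auto

lemma meridian_denominator: "1 + of_real (1 - damp x) * half_plane x \<noteq> 0"
proof
  assume "1 + of_real (1 - damp x) * half_plane x = 0"
  then have "1 + (1 - damp x) * cmod (fst x) = 0"
    unfolding half_plane_def complex_eq_iff by simp
  moreover have "(1 - damp x) * cmod (fst x) \<ge> 0"
    using damp_bounds by (intro mult_nonneg_nonneg) auto
  ultimately show False by simp
qed

lemma continuous_half_plane [continuous_intros]: "continuous_on S half_plane"
  unfolding half_plane_def Complex_eq by (intro continuous_intros)

lemma continuous_merid [continuous_intros]: "continuous_on S merid"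
  unfolding merid_def by (intro continuous_intros)

lemma continuous_damp [continuous_intros]: "continuous_on S damp"
  unfolding damp_def by (intro continuous_intros) auto

lemma continuous_longitude_coord: "continuous_on S longitude_coord"
  unfolding longitude_coord_def by (intro continuous_intros) auto

lemma continuous_meridian_coord: "continuous_on S meridian_coord"
  unfolding meridian_coord_def using meridian_denominator by (intro continuous_intros) auto

lemma cmod_half_plane: "cmod (half_plane x) = norm x"
  unfolding half_plane_def by (simp add: norm_prod_def cmod_def)

lemma coords_on_solid_torus:
  assumes "cmod w \<le> 3/2"
  shows "longitude_coord ((2 + Re w) *\<^sub>R cis \<theta>, Im w) = cis \<theta>"
    "meridian_coord ((2 + Re w) *\<^sub>R cis \<theta>, Im w) = w"
proof -
  let ?x = "((2 + Re w) *\<^sub>R cis \<theta>, Im w)"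
  have r: "2 + Re w \<ge> 1/2" using assms abs_Re_le_cmod [of w] by linarith
  then have c: "cmod (fst ?x) = 2 + Re w" by (simp add: norm_mult)
  have m: "merid ?x = w" unfolding merid_def half_plane_def c by (simp add: complex_eq_iff)
  have d: "damp ?x = 1" unfolding damp_def m using assms by simp
  have c': "cmod (complex_of_real (2 + Re w) * cis \<theta>) = 2 + Re w"
    using r by (simp add: norm_mult del: of_real_add)
  have m2: "max 1 (2 * (2 + Re w)) = 2 * (2 + Re w)" using r by simp
  have "longitude_coord ?x = of_real (2 + Re w) * cis \<theta> * of_real (2 / (2 * (2 + Re w)))"
    unfolding longitude_coord_def d unfolding fst_conv scaleR_conv_of_real c' m2 by (simp only: power_one mult_1_right)
  also have "\<dots> = (of_real (2 + Re w) * of_real (2 / (2 * (2 + Re w)))) * cis \<theta>"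
    by (simp only: mult_ac)
  also have "\<dots> = of_real ((2 + Re w) * (2 / (2 * (2 + Re w)))) * cis \<theta>"
    by (simp only: of_real_mult)
  also have "(2 + Re w) * (2 / (2 * (2 + Re w))) = 1" using r by simp
  finally show "longitude_coord ?x = cis \<theta>" by simp
  show "meridian_coord ?x = w"
    unfolding meridian_coord_def d m by simp
qed

text \<open>On the solid torus the equation reads \<open>cis (3 * \<theta>) = w ^ 2\<close> for the
  longitude \<open>\<theta>\<close> and the meridian coordinate \<open>w\<close>, and this describes
  the knot. Beyond it the damping makes the cube of the longitude coordinate strictly smaller in
  modulus than the square of the meridian coordinate.\<close>

lemma coords_trefoil:
  "longitude_coord x ^ 3 = meridian_coord x ^ 2 \<longleftrightarrow> x \<in> standard_trefoil"
proof
  assume "x \<in> standard_trefoil"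
  then obtain t where x: "x = ((2 + cos (3 * t)) *\<^sub>R cis (2 * t), sin (3 * t))"
    unfolding standard_trefoil_def by auto
  have "longitude_coord x = cis (2 * t)" "meridian_coord x = cis (3 * t)"
    using coords_on_solid_torus [of "cis (3 * t)" "2 * t"] unfolding x by simp_all
  then show "longitude_coord x ^ 3 = meridian_coord x ^ 2"
    by (simp add: Complex.DeMoivre)
next
  assume eq: "longitude_coord x ^ 3 = meridian_coord x ^ 2"
  define M where "M = cmod (merid x)"
  define \<rho> where "\<rho> = cmod (fst x)"
  have hp: "half_plane x = merid x + 2" unfolding merid_def by simp
  have rM: "\<bar>\<rho> - 2\<bar> \<le> M"
    using abs_Re_le_cmod [of "merid x"] unfolding M_def \<rho>_def merid_def half_plane_def by simp
  show "x \<in> standard_trefoil"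
  proof (cases "M \<le> 3/2")
    case False
    define b where "b = 3 / 2 / M"
    have b: "damp x = b" "0 < b" "b < 1"
      using False unfolding damp_def b_def M_def [symmetric] by (auto simp: max_def field_simps)
    have "cmod (longitude_coord x) = (\<rho> * 2 / max 1 (2 * \<rho>)) * b\<^sup>2"
      unfolding longitude_coord_def b by (simp add: norm_mult norm_divide norm_power \<rho>_def)
    also have "\<dots> \<le> 1 * b\<^sup>2"
      by (intro mult_right_mono) (auto simp: divide_le_eq max_def)
    finally have "cmod (longitude_coord x) ^ 3 \<le> (b\<^sup>2) ^ 3"
      by (intro power_mono) auto
    then have 1: "cmod (meridian_coord x) ^ 2 \<le> (b ^ 3) ^ 2"
      using arg_cong [OF eq, of cmod] by (simp add: norm_power power_mult [symmetric])
    have "cmod (1 + of_real (1 - damp x) * half_plane x) \<le> 1 + (1 - b) * (M + 2)"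
    proof -
      have "cmod (half_plane x) \<le> M + 2" unfolding hp M_def by (metis norm_numeral norm_triangle_ineq)
      then have "(1 - b) * cmod (half_plane x) \<le> (1 - b) * (M + 2)"
        using b by (intro mult_left_mono) auto
      moreover have "cmod (1 + of_real (1 - damp x) * half_plane x) \<le> 1 + (1 - b) * cmod (half_plane x)"
        using norm_triangle_ineq [of 1 "of_real (1 - damp x) * half_plane x"] b
        by (simp add: norm_mult del: of_real_diff)
      ultimately show ?thesis by linarith
    qed
    also have "1 + (1 - b) * (M + 2) = M + 3/2 - 3 / M"
      unfolding b_def using False by (simp add: field_simps)
    finally have den: "cmod (1 + of_real (1 - damp x) * half_plane x) \<le> M + 3/2 - 3 / M" .
    \<comment> \<open>With \<open>b = 3 / 2 / M\<close>, clearing denominators leaves the polynomial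
      inequality shown next. For \<open>M\<close> up to 2 the constant 81/8 absorbs the linear term;
      beyond 2 the power \<open>M ^ 5\<close> dominates.\<close>
    have "b ^ 3 * (M + 3/2 - 3 / M) < M"
    proof -
      have "27 / 8 * M\<^sup>2 + 81 / 16 * M < M ^ 5 + 81 / 8"
      proof (cases "M \<le> 2")
        case True
        have "(3/2) ^ 3 * M\<^sup>2 < M ^ 3 * M\<^sup>2"
          using False by (intro mult_strict_right_mono power_strict_mono) auto
        moreover have "M ^ 3 * M\<^sup>2 = M ^ 5" by (simp add: power_add [symmetric])
        moreover have "(3/2) ^ 3 = (27/8 :: real)" by (simp add: power3_eq_cube)
        ultimately have "27 / 8 * M\<^sup>2 < M ^ 5" by (simp only:)
        then show ?thesis using True by linarith
      next
        case F2: False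
        have "2 ^ 3 * M\<^sup>2 \<le> M ^ 3 * M\<^sup>2"
          using F2 by (intro mult_right_mono power_mono) auto
        then have "8 * M\<^sup>2 \<le> M ^ 5" by (simp add: power_add [symmetric])
        moreover have "2 * M \<le> M\<^sup>2" using F2 by (simp add: power2_eq_square)
        ultimately show ?thesis using F2 by linarith
      qed
      moreover have "M * (27 / 8 * (M + 3/2 - 3 / M)) = 27 / 8 * M\<^sup>2 + 81 / 16 * M - 81 / 8"
        using False by (simp add: field_simps power2_eq_square)
      moreover have M5: "M ^ 5 = M * M ^ 4" by (simp add: numeral_eq_Suc)
      ultimately have "M * (27 / 8 * (M + 3/2 - 3 / M)) < M * M ^ 4" by linarith
      then have "27 / 8 * (M + 3/2 - 3 / M) < M ^ 4"
        using False by (simp only: mult_less_cancel_left_pos)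
      then have "27 / 8 * (M + 3/2 - 3 / M) / M ^ 3 < M ^ 4 / M ^ 3"
        using False by (intro divide_strict_right_mono) auto
      moreover have "b ^ 3 * (M + 3/2 - 3 / M) = 27 / 8 * (M + 3/2 - 3 / M) / M ^ 3"
        unfolding b_def by (simp add: power_divide power3_eq_cube)
      moreover have "M ^ 4 = M * M ^ 3" by (simp add: numeral_eq_Suc)
      ultimately show ?thesis
        using False by simp
    qed
    moreover have "b ^ 3 * cmod (1 + of_real (1 - damp x) * half_plane x) \<le> b ^ 3 * (M + 3/2 - 3 / M)"
      using den b by (intro mult_left_mono) auto
    ultimately have "b ^ 3 * cmod (1 + of_real (1 - damp x) * half_plane x) < cmod (merid x)"
      unfolding M_def by linarith
    then have "b ^ 3 < cmod (meridian_coord x)"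
      unfolding meridian_coord_def norm_divide using meridian_denominator [of x]
      by (simp add: pos_less_divide_eq)
    then have "(b ^ 3) ^ 2 < cmod (meridian_coord x) ^ 2"
      using b by (intro power_strict_mono) auto
    then show ?thesis using 1 by simp
  next
    case True
    have \<rho>: "\<rho> \<ge> 1/2" using rM True by linarith
    have x: "x = ((2 + Re (merid x)) *\<^sub>R cis (Arg (fst x)), Im (merid x))"
      using rcis_cmod_Arg [of "fst x"] unfolding merid_def half_plane_def rcis_def
      by (simp add: prod_eq_iff scaleR_conv_of_real)
    have PQ: "longitude_coord x = cis (Arg (fst x))" "meridian_coord x = merid x"
      using coords_on_solid_torus [of "merid x" "Arg (fst x)"] True x M_def by metis+
    have "M ^ 2 = 1"
      using arg_cong [OF eq, of cmod] unfolding PQ M_def by (simp add: norm_power)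
    then have "M = 1" using power2_eq_imp_eq [of M 1] unfolding M_def by simp
    then obtain \<mu> where \<mu>: "merid x = cis \<mu>"
      using rcis_cmod_Arg [of "merid x"] unfolding M_def rcis_def by (metis mult_1 of_real_1)
    define \<theta> where "\<theta> = Arg (fst x)"
    have "cis (3 * \<theta>) = cis (2 * \<mu>)"
      using eq unfolding PQ \<mu> \<theta>_def by (simp add: Complex.DeMoivre)
    then have c: "cis (3 * \<theta>) / cis (2 * \<mu>) = 1" by simp
    \<comment> \<open>This solves \<open>2 * t = \<theta>\<close> and \<open>3 * t = \<mu>\<close>
      by subtraction; both hold modulo full turns because \<open>3 * \<theta>\<close> and
      \<open>2 * \<mu>\<close> agree modulo full turns.\<close>
    define t where "t = \<mu> - \<theta>"
    have "cis (2 * t) = cis \<theta> / (cis (3 * \<theta>) / cis (2 * \<mu>))"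
      unfolding t_def cis_divide by (simp add: algebra_simps)
    then have 2: "cis (2 * t) = cis \<theta>" unfolding c by simp
    have "cis (3 * t) = cis \<mu> / (cis (3 * \<theta>) / cis (2 * \<mu>))"
      unfolding t_def cis_divide by (simp add: algebra_simps)
    then have 3: "cis (3 * t) = cis \<mu>" unfolding c by simp
    have "x = ((2 + cos (3 * t)) *\<^sub>R cis (2 * t), sin (3 * t))"
      using x 2 3 unfolding \<mu> \<theta>_def by (metis cis.simps)
    then show ?thesis unfolding standard_trefoil_def by blast
  qed
qed

text \<open>The longitude coordinate is bounded by the square of the damping factor. For the
  meridian coordinate, numerator and denominator are divided by \<open>half_plane x\<close>, whose
  modulus is the norm of \<open>x\<close>.\<close>

lemma coords_at_infinity:
  "((\<lambda>x. (longitude_coord x, meridian_coord x)) \<longlongrightarrow> (0, 1)) at_infinity"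
proof (intro tendsto_intros)
  have n: "filterlim (norm :: complex \<times> real \<Rightarrow> real) at_top at_infinity"
    by (rule filterlim_norm_at_top)
  have "filterlim half_plane at_infinity at_infinity"
    by (subst filterlim_norm_at_top_imp_at_infinity) (simp_all add: cmod_half_plane n filterlim_norm_at_top_imp_at_infinity)
  then have hi: "((\<lambda>x. inverse (half_plane x)) \<longlongrightarrow> 0) at_infinity"
    using tendsto_inverse_0 filterlim_compose by blast
  have "filterlim (\<lambda>x. -2 + norm (x :: complex \<times> real)) at_top at_infinity"
    by (rule filterlim_tendsto_add_at_top [OF tendsto_const n])
  then have Mi: "filterlim (\<lambda>x. cmod (merid x)) at_top at_infinity"
  proof (rule filterlim_at_top_mono)
    show "\<forall>\<^sub>F x in at_infinity. -2 + norm x \<le> cmod (merid x)"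
      using norm_triangle_ineq2 [of "half_plane x" 2 for x]
      by (intro always_eventually allI) (simp add: merid_def cmod_half_plane [symmetric] algebra_simps)
  qed
  have d0: "(damp \<longlongrightarrow> 0) at_infinity"
  proof -
    have "filterlim (\<lambda>x. max (cmod (merid x)) (3/2)) at_top at_infinity"
      by (rule filterlim_at_top_mono [OF Mi]) auto
    then have "((\<lambda>x. inverse (max (cmod (merid x)) (3/2))) \<longlongrightarrow> 0) at_infinity"
      by (rule tendsto_inverse_0_at_top)
    then have "((\<lambda>x. (3/2) * inverse (max (cmod (merid x)) (3/2))) \<longlongrightarrow> (3/2) * 0) at_infinity"
      by (intro tendsto_intros)
    moreover have "damp = (\<lambda>x. (3/2) * inverse (max (cmod (merid x)) (3/2)))"
      unfolding damp_def by (intro ext) (simp only: divide_inverse)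
    ultimately show ?thesis by (simp only: mult_zero_right)
  qed
  show "(longitude_coord \<longlongrightarrow> 0) at_infinity"
  proof (rule Lim_null_comparison)
    show "\<forall>\<^sub>F x in at_infinity. norm (longitude_coord x) \<le> (damp x)\<^sup>2"
    proof (intro always_eventually allI)
      fix x :: "complex \<times> real"
      have "norm (longitude_coord x) = (cmod (fst x) * 2 / max 1 (2 * cmod (fst x))) * (damp x)\<^sup>2"
        unfolding longitude_coord_def by (simp add: norm_mult norm_divide norm_power)
      also have "\<dots> \<le> 1 * (damp x)\<^sup>2"
        by (intro mult_right_mono) (auto simp: divide_le_eq max_def)
      finally show "norm (longitude_coord x) \<le> (damp x)\<^sup>2" by simp
    qed
    show "((\<lambda>x. (damp x)\<^sup>2) \<longlongrightarrow> 0) at_infinity"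
      using tendsto_power [OF d0, of 2] by simp
  qed
  have "((\<lambda>x. (1 - 2 * inverse (half_plane x)) / (inverse (half_plane x) + of_real (1 - damp x)))
          \<longlongrightarrow> (1 - 2 * 0) / (0 + of_real (1 - 0))) at_infinity"
    by (intro tendsto_intros hi d0) auto
  moreover have "\<forall>\<^sub>F x in at_infinity. (1 - 2 * inverse (half_plane x)) / (inverse (half_plane x) + of_real (1 - damp x))
      = meridian_coord x"
  proof -
    have "\<forall>\<^sub>F x in at_infinity. half_plane x \<noteq> 0"
    proof -
      have "\<forall>\<^sub>F x in at_infinity. norm (x :: complex \<times> real) \<ge> 1"
        unfolding eventually_at_infinity by blast
      then show ?thesis
        by eventually_elim (metis cmod_half_plane norm_zero not_one_le_zero)
    qed
    then show ?thesis
    proof eventually_elim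
      case (elim x)
      have "meridian_coord x = (half_plane x * (1 - 2 * inverse (half_plane x))) /
              (half_plane x * (inverse (half_plane x) + of_real (1 - damp x)))"
        using elim unfolding meridian_coord_def merid_def by (simp add: algebra_simps)
      then show ?case using elim by simp
    qed
  qed
  ultimately show "(meridian_coord \<longlongrightarrow> 1) at_infinity"
    by (simp add: tendsto_cong)
qed

section \<open>The universal covering of the complement of a circle\<close>

text \<open>Stereographic projection identifies the complement of the unit circle in space, together with
  the point at infinity, with the complement of a great circle in the three-sphere; its universal
  covering is given by the angle \<open>s\<close> around the circle and a second coordinate \<open>w\<close>.\<close>

definition circle_cover :: "real \<times> complex \<Rightarrow> complex \<times> real" where
  "circle_cover z = (let N = sqrt (1 + (cmod (snd z))\<^sup>2) in
     (1 / (N - cos (fst z))) *\<^sub>R (snd z, sin (fst z)))"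

definition over_infinity :: "(real \<times> complex) set" where
  "over_infinity = {z. snd z = 0 \<and> cos (fst z) = 1}"

abbreviation unit_circle :: "(complex \<times> real) set" where
  "unit_circle \<equiv> sphere 0 1 \<times> {0}"

text \<open>\<open>sphere_u\<close> and \<open>sphere_v\<close> are the complex coordinates of the
  point of the three-sphere that projects to \<open>x\<close> from the pole \<open>(1, 0)\<close>.
  The unit circle is where \<open>sphere_u\<close> vanishes, and \<open>circle_cover (s, w)\<close>
  is the projection of \<open>(cis s, w)\<close> divided by its norm \<open>N\<close>.\<close>

definition sphere_u :: "complex \<times> real \<Rightarrow> complex" where
  "sphere_u x = Complex ((norm x)\<^sup>2 - 1) (2 * snd x) / of_real ((norm x)\<^sup>2 + 1)"

definition sphere_v :: "complex \<times> real \<Rightarrow> complex" where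
  "sphere_v x = 2 * fst x / of_real ((norm x)\<^sup>2 + 1)"

lemma norm_pair_sq: "(norm (x :: complex \<times> real))\<^sup>2 = (cmod (fst x))\<^sup>2 + (snd x)\<^sup>2"
  by (cases x) (simp add: norm_prod_def)

lemma unit_circleI:
  assumes "(norm x)\<^sup>2 = 1" "snd x = 0"
  shows "x \<in> unit_circle"
proof -
  have "(cmod (fst x))\<^sup>2 = 1\<^sup>2" using assms by (simp add: norm_pair_sq)
  then have "cmod (fst x) = 1" by (rule power2_eq_imp_eq) auto
  then show ?thesis using assms(2) by (cases x) simp
qed

lemma circle_cover_denominator:
  assumes "z \<notin> over_infinity"
  shows "sqrt (1 + (cmod (snd z))\<^sup>2) - cos (fst z) > 0"
proof (cases "snd z = 0")
  case True
  then have "cos (fst z) \<noteq> 1" using assms unfolding over_infinity_def by simp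
  then show ?thesis using True by (simp add: less_le)
next
  case False
  then have "1 < sqrt (1 + (cmod (snd z))\<^sup>2)" by simp
  then show ?thesis using cos_le_one [of "fst z"] by linarith
qed

lemma norm_circle_cover:
  assumes "z \<notin> over_infinity"
  defines "N \<equiv> sqrt (1 + (cmod (snd z))\<^sup>2)"
  shows "(norm (circle_cover z))\<^sup>2 = (N + cos (fst z)) / (N - cos (fst z))"
proof -
  have d: "N - cos (fst z) > 0" unfolding N_def using assms(1) by (rule circle_cover_denominator)
  have "N\<^sup>2 = 1 + (cmod (snd z))\<^sup>2" unfolding N_def by simp
  then have n: "(cmod (snd z))\<^sup>2 + (sin (fst z))\<^sup>2 = (N + cos (fst z)) * (N - cos (fst z))"
    using sin_cos_squared_add [of "fst z"] by (simp add: algebra_simps power2_eq_square)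
  have "(norm (circle_cover z))\<^sup>2 = (1 / (N - cos (fst z)))\<^sup>2 * (norm (snd z, sin (fst z)))\<^sup>2"
    unfolding circle_cover_def Let_def N_def [symmetric] by (simp only: norm_scaleR power_mult_distrib power2_abs)
  also have "\<dots> = (1 / (N - cos (fst z)))\<^sup>2 * ((N + cos (fst z)) * (N - cos (fst z)))"
    by (simp add: norm_pair_sq n)
  also have "\<dots> = (N + cos (fst z)) / (N - cos (fst z))"
    using d by (simp add: power2_eq_square)
  finally show ?thesis .
qed

lemma sphere_uv_circle_cover:
  assumes "z \<notin> over_infinity"
  defines "N \<equiv> sqrt (1 + (cmod (snd z))\<^sup>2)"
  shows "sphere_u (circle_cover z) = (1 / N) *\<^sub>R cis (fst z)"
    "sphere_v (circle_cover z) = (1 / N) *\<^sub>R snd z"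
proof -
  have d: "N - cos (fst z) > 0" unfolding N_def using assms(1) by (rule circle_cover_denominator)
  have N: "N > 0" unfolding N_def by (simp add: add_pos_nonneg)
  have n1: "(norm (circle_cover z))\<^sup>2 + 1 = 2 * N / (N - cos (fst z))"
    "(norm (circle_cover z))\<^sup>2 - 1 = 2 * cos (fst z) / (N - cos (fst z))"
    unfolding norm_circle_cover [OF assms(1), folded N_def] using d by (auto simp: field_simps)
  have fs: "fst (circle_cover z) = (1 / (N - cos (fst z))) *\<^sub>R snd z"
    "snd (circle_cover z) = sin (fst z) / (N - cos (fst z))"
    unfolding circle_cover_def Let_def N_def by auto
  show "sphere_u (circle_cover z) = (1 / N) *\<^sub>R cis (fst z)"
    unfolding sphere_u_def n1 fs using d N by (simp add: complex_eq_iff)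
  show "sphere_v (circle_cover z) = (1 / N) *\<^sub>R snd z"
    unfolding sphere_v_def n1 fs using d N
    by (simp add: complex_eq_iff)
qed

lemma circle_cover_not_circle:
  assumes "z \<notin> over_infinity"
  shows "circle_cover z \<notin> unit_circle"
proof
  assume "circle_cover z \<in> unit_circle"
  then have "snd (circle_cover z) = 0" "cmod (fst (circle_cover z)) = 1" by auto
  then have "(norm (circle_cover z))\<^sup>2 = 1" by (simp add: norm_pair_sq)
  then have "sphere_u (circle_cover z) = 0"
    unfolding sphere_u_def using \<open>snd (circle_cover z) = 0\<close> by (simp add: complex_eq_iff)
  moreover have "sqrt (1 + (cmod (snd z))\<^sup>2) > 0" by (simp add: add_pos_nonneg)
  ultimately show False
    unfolding sphere_uv_circle_cover [OF assms] by auto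
qed

text \<open>Let \<open>u\<close>, \<open>v\<close> be the coordinates of \<open>x\<close> on the
  three-sphere. The squares of their moduli add up to 1, so for \<open>w = v / cmod u\<close> the
  norm of \<open>(cis s, w)\<close> is \<open>1 / cmod u\<close>; any argument \<open>s\<close> of
  \<open>u\<close> then gives a preimage of \<open>x\<close>.\<close>

lemma circle_cover_inverse:
  assumes x: "x \<notin> unit_circle" and s: "sphere_u x = of_real (cmod (sphere_u x)) * cis s"
    and w: "w = sphere_v x / of_real (cmod (sphere_u x))"
  shows "(s, w) \<notin> over_infinity" "circle_cover (s, w) = x"
proof -
  define D where "D = (norm x)\<^sup>2 + 1"
  have D: "D > 0" unfolding D_def by (simp add: add_nonneg_pos)
  define u where "u = sphere_u x"
  define v where "v = sphere_v x"
  have uv: "(cmod u)\<^sup>2 + (cmod v)\<^sup>2 = 1"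
  proof -
    have "(cmod u)\<^sup>2 = (((norm x)\<^sup>2 - 1)\<^sup>2 + (2 * snd x)\<^sup>2) / D\<^sup>2"
      unfolding u_def sphere_u_def D_def norm_divide power_divide by (simp add: cmod_def del: of_real_add)
    moreover have "(cmod v)\<^sup>2 = 4 * (cmod (fst x))\<^sup>2 / D\<^sup>2"
      unfolding v_def sphere_v_def D_def norm_divide power_divide
      by (simp add: norm_mult power_mult_distrib del: of_real_add)
    ultimately have "(cmod u)\<^sup>2 + (cmod v)\<^sup>2 = ((D - 2)\<^sup>2 + 4 * (norm x)\<^sup>2) / D\<^sup>2"
      unfolding D_def norm_pair_sq by (simp add: add_divide_distrib power_mult_distrib algebra_simps)
    also have "(D - 2)\<^sup>2 + 4 * (norm x)\<^sup>2 = D\<^sup>2"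
      unfolding D_def by (simp add: power2_eq_square algebra_simps)
    finally show ?thesis using D by simp
  qed
  have u0: "u \<noteq> 0"
  proof
    assume "u = 0"
    then have "Re (u * of_real D) = 0" "Im (u * of_real D) = 0" by simp_all
    then have "(norm x)\<^sup>2 = 1" "snd x = 0"
      using D unfolding u_def sphere_u_def D_def by (simp_all add: del: of_real_add)
    then have "x \<in> unit_circle" by (rule unit_circleI)
    then show False using x by blast
  qed
  define c where "c = cmod u"
  have c: "c > 0" unfolding c_def using u0 by simp
  have "1 + (cmod w)\<^sup>2 = (1 / c)\<^sup>2"
    using uv c unfolding w u_def [symmetric] v_def [symmetric] c_def [symmetric]
    by (simp add: norm_divide power_divide field_simps)
  then have N: "sqrt (1 + (cmod w)\<^sup>2) = 1 / c" using c by simp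
  have us: "u = of_real c * cis s" using s unfolding u_def c_def .
  then have re: "Re u = c * cos s" "Im u = c * sin s" by simp_all
  have Ru: "1 - Re u = 2 / D" "Im u = 2 * snd x / D"
    using D unfolding u_def sphere_u_def D_def [symmetric]
    by (simp_all add: field_simps D_def)
  have den: "1 / c - cos s = (2 / D) / c"
    using re(1) Ru(1) c by (simp add: field_simps)
  have den0: "1 / c - cos s > 0" unfolding den using D c by simp
  show "(s, w) \<notin> over_infinity"
  proof
    assume "(s, w) \<in> over_infinity"
    then have "w = 0" "cos s = 1" unfolding over_infinity_def by auto
    then show False using N den0 by simp
  qed
  have 1: "(1 / (1 / c - cos s)) *\<^sub>R w = fst x"
    unfolding den w u_def [symmetric] c_def [symmetric] sphere_v_def D_def [symmetric] using D c
    by (simp add: scaleR_conv_of_real field_simps)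
  have 2: "(1 / (1 / c - cos s)) * sin s = snd x"
  proof -
    have "c * sin s = 2 * snd x / D" using re(2) Ru(2) by simp
    then show ?thesis unfolding den using D c by (simp add: field_simps)
  qed
  show "circle_cover (s, w) = x"
    unfolding circle_cover_def Let_def using 1 2 N by (simp add: prod_eq_iff)
qed

lemma circle_cover_periodic:
  "circle_cover (s + 2 * pi * of_int n, w) = circle_cover (s, w)"
  "(s + 2 * pi * of_int n, w) \<in> over_infinity \<longleftrightarrow> (s, w) \<in> over_infinity"
proof -
  have "sin (s + 2 * pi * of_int n) = sin s" "cos (s + 2 * pi * of_int n) = cos s"
    using sin.plus_of_int [of s n] cos.plus_of_int [of s n] by (simp_all add: mult_ac)
  then show "circle_cover (s + 2 * pi * of_int n, w) = circle_cover (s, w)"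
    "(s + 2 * pi * of_int n, w) \<in> over_infinity \<longleftrightarrow> (s, w) \<in> over_infinity"
    unfolding circle_cover_def over_infinity_def by simp_all
qed

lemma circle_cover_eqD:
  assumes "z \<notin> over_infinity" "z' \<notin> over_infinity" "circle_cover z = circle_cover z'"
  obtains n :: int where "fst z' = fst z + 2 * pi * n" "snd z' = snd z"
proof -
  define N where "N = sqrt (1 + (cmod (snd z))\<^sup>2)"
  define N' where "N' = sqrt (1 + (cmod (snd z'))\<^sup>2)"
  have N: "N > 0" "N' > 0" unfolding N_def N'_def by (simp_all add: add_pos_nonneg)
  have e: "(1 / N) *\<^sub>R cis (fst z) = (1 / N') *\<^sub>R cis (fst z')" "(1 / N) *\<^sub>R snd z = (1 / N') *\<^sub>R snd z'"
    using sphere_uv_circle_cover [OF assms(1)] sphere_uv_circle_cover [OF assms(2)] assms(3)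
    unfolding N_def N'_def by metis+
  have "1 / N = 1 / N'"
    using arg_cong [OF e(1), of cmod] N by simp
  then have "N = N'" using N by simp
  then have "cis (fst z') = cis (fst z)" "snd z' = snd z"
    using e N by auto
  moreover from this obtain n :: int where "fst z' = fst z + 2 * pi * n"
    using sin_cos_eq_iff [of "fst z'" "fst z"] by (auto simp: complex_eq_iff)
  ultimately show ?thesis using that by blast
qed

lemma continuous_circle_cover: "continuous_on (- over_infinity) circle_cover"
  unfolding circle_cover_def Let_def using circle_cover_denominator
  by (intro continuous_intros) force

lemma circle_cover_at_infinity:
  assumes z: "z \<in> over_infinity"
  shows "filterlim circle_cover at_infinity (at z within - over_infinity)"
proof -
  define N where "N = (\<lambda>z :: real \<times> complex. sqrt (1 + (cmod (snd z))\<^sup>2))"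
  have cN: "continuous_on UNIV N" unfolding N_def by (intro continuous_intros)
  have z1: "N z = 1" "cos (fst z) = 1" using z unfolding N_def over_infinity_def by auto
  let ?F = "at z within - over_infinity"
  have tN: "(N \<longlongrightarrow> 1) ?F"
    using cN z1(1) by (metis UNIV_I continuous_on_def tendsto_within_subset top_greatest)
  have tc: "((\<lambda>z. cos (fst z)) \<longlongrightarrow> 1) ?F"
  proof -
    have "((\<lambda>z. cos (fst z)) \<longlongrightarrow> cos (fst z)) ?F" by (intro tendsto_intros)
    then show ?thesis using z1 by simp
  qed
  have "filterlim (\<lambda>z. (N z + cos (fst z)) / (N z - cos (fst z))) at_top ?F"
  proof (rule LIM_at_top_divide [of _ 2])
    show "((\<lambda>z. N z + cos (fst z)) \<longlongrightarrow> 2) ?F" using tendsto_add [OF tN tc] by simp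
    show "((\<lambda>z. N z - cos (fst z)) \<longlongrightarrow> 0) ?F" using tendsto_diff [OF tN tc] by simp
    show "\<forall>\<^sub>F z in ?F. 0 < N z - cos (fst z)"
      unfolding N_def using circle_cover_denominator by (auto simp: eventually_at_filter)
  qed simp
  moreover have "\<forall>\<^sub>F z in ?F. (N z + cos (fst z)) / (N z - cos (fst z)) = (norm (circle_cover z))\<^sup>2"
    unfolding N_def using norm_circle_cover by (auto simp: eventually_at_filter)
  ultimately have "filterlim (\<lambda>z. (norm (circle_cover z))\<^sup>2) at_top ?F"
    by (simp add: filterlim_cong)
  then have "filterlim (\<lambda>z. sqrt ((norm (circle_cover z))\<^sup>2)) at_top ?F"
    by (rule filterlim_compose [OF sqrt_at_top])
  then show ?thesis
    by (intro filterlim_norm_at_top_imp_at_infinity) simp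
qed

text \<open>Homeomorphisms are proper: the preimage of a closed ball is the image of a compact set
  under \<open>g\<close>. This is what extends an unknotting homeomorphism to the point at
  infinity.\<close>

lemma homeomorphism_at_infinity:
  fixes f :: "'a::euclidean_space \<Rightarrow> 'b::euclidean_space"
  assumes "homeomorphism UNIV UNIV f g"
  shows "filterlim f at_infinity at_infinity"
  unfolding filterlim_at_infinity [OF order_refl] eventually_at_infinity
proof (intro allI impI)
  fix r :: real
  have "compact (g ` cball 0 r)"
    using homeomorphism_cont2 [OF assms] by (intro compact_continuous_image compact_cball) (auto intro: continuous_on_subset)
  then obtain b where b: "\<And>x. x \<in> g ` cball 0 r \<Longrightarrow> norm x \<le> b"
    using compact_imp_bounded bounded_iff by metis
  show "\<exists>b. \<forall>x. b \<le> norm x \<longrightarrow> r \<le> norm (f x)"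
  proof (intro exI allI impI)
    fix x :: 'a assume x: "b + 1 \<le> norm x"
    show "r \<le> norm (f x)"
    proof (rule ccontr)
      assume "\<not> r \<le> norm (f x)"
      then have "x \<in> g ` cball 0 r"
        using assms by (intro image_eqI [of _ _ "f x"]) (auto simp: homeomorphism_def)
      then show False using b x by force
    qed
  qed
qed

text \<open>The angle along the path is the imaginary part of a continuous logarithm of
  \<open>sphere_u\<close>, which has no zero off the unit circle; a multiple of
  \<open>2 * pi\<close> then adjusts the starting point to \<open>z\<close>.\<close>

lemma lift_circle_cover:
  fixes \<gamma> :: "real \<Rightarrow> complex \<times> real"
  assumes "continuous_on {0..1} \<gamma>" "\<And>t. t \<in> {0..1} \<Longrightarrow> \<gamma> t \<notin> unit_circle"
    and z: "z \<notin> over_infinity" "circle_cover z = \<gamma> 0"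
  obtains \<sigma> where "continuous_on {0..1} \<sigma>" "\<sigma> 0 = z"
    "\<And>t. t \<in> {0..1} \<Longrightarrow> \<sigma> t \<notin> over_infinity \<and> circle_cover (\<sigma> t) = \<gamma> t"
proof -
  have cu: "continuous_on {0..1} (\<lambda>t. sphere_u (\<gamma> t))" and cv: "continuous_on {0..1} (\<lambda>t. sphere_v (\<gamma> t))"
    unfolding sphere_u_def sphere_v_def Complex_eq using assms(1)
    by (intro continuous_intros; simp add: add_nonneg_eq_0_iff flip: of_real_add)+
  have u0: "sphere_u (\<gamma> t) \<noteq> 0" if "t \<in> {0..1}" for t
  proof
    assume "sphere_u (\<gamma> t) = 0"
    have D: "(norm (\<gamma> t))\<^sup>2 + 1 \<noteq> 0" by (metis add_nonneg_pos less_irrefl zero_le_power2 zero_less_one)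
    then have "Complex ((norm (\<gamma> t))\<^sup>2 - 1) (2 * snd (\<gamma> t)) = 0"
      using \<open>sphere_u (\<gamma> t) = 0\<close> unfolding sphere_u_def by (simp del: of_real_add)
    then have "(norm (\<gamma> t))\<^sup>2 = 1" "snd (\<gamma> t) = 0" by (simp_all add: complex_eq_iff)
    then have "\<gamma> t \<in> unit_circle" by (rule unit_circleI)
    then show False by (rule notE [OF assms(2) [OF that]])
  qed
  obtain l where l: "continuous_on {0..1} l" "\<And>t. t \<in> {0..1} \<Longrightarrow> sphere_u (\<gamma> t) = exp (l t)"
    using continuous_logarithm_on_contractible [OF cu _ u0] convex_imp_contractible
    by (metis convex_real_interval(5))
  define \<tau> where "\<tau> = (\<lambda>t. (Im (l t), sphere_v (\<gamma> t) / of_real (cmod (sphere_u (\<gamma> t)))))"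
  have ct: "continuous_on {0..1} \<tau>"
    unfolding \<tau>_def using u0 by (intro continuous_intros l cu cv) auto
  have \<tau>: "\<tau> t \<notin> over_infinity" "circle_cover (\<tau> t) = \<gamma> t" if t: "t \<in> {0..1}" for t
  proof -
    have "sphere_u (\<gamma> t) = of_real (cmod (sphere_u (\<gamma> t))) * cis (Im (l t))"
      unfolding l(2) [OF t] by (simp add: exp_eq_polar norm_mult)
    from circle_cover_inverse [OF assms(2) [OF t] this refl]
    show "\<tau> t \<notin> over_infinity" "circle_cover (\<tau> t) = \<gamma> t" unfolding \<tau>_def by auto
  qed
  obtain n :: int where n: "fst z = fst (\<tau> 0) + 2 * pi * n" "snd z = snd (\<tau> 0)"
    using circle_cover_eqD [of "\<tau> 0" z] \<tau> [of 0] z by auto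
  show ?thesis
  proof (rule that [of "\<lambda>t. (fst (\<tau> t) + 2 * pi * of_int n, snd (\<tau> t))"])
    show "continuous_on {0..1} (\<lambda>t. (fst (\<tau> t) + 2 * pi * of_int n, snd (\<tau> t)))"
      by (intro continuous_intros ct)
    show "(fst (\<tau> 0) + 2 * pi * of_int n, snd (\<tau> 0)) = z"
      using n by (simp add: prod_eq_iff)
  qed (use \<tau> circle_cover_periodic in auto)
qed

text \<open>An unknotting homeomorphism would yield a map \<open>\<Psi>\<close> from the simply
  connected space of pairs \<open>(s, w)\<close> to \<open>cubic_base\<close>, invariant under
  translation of \<open>s\<close> by \<open>2 * pi\<close> and liftable to a choice of roots. Loops
  around the trefoil lift to paths between translates of \<open>z0\<close>, and translations
  commute. From the root \<open>- sqrt 3\<close>, however, \<open>\<alpha>\<close> followed by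
  \<open>\<beta>\<close> leads to \<open>0\<close>, and \<open>\<beta>\<close> followed by
  \<open>\<alpha>\<close> leads to \<open>sqrt 3\<close>.\<close>

theorem trefoil_not_trivial: "\<not> trivial_knot standard_trefoil"
proof
  assume "trivial_knot standard_trefoil"
  then obtain F H where FH: "homeomorphism UNIV UNIV F H" and Fim: "F ` standard_trefoil = unit_circle"
    unfolding trivial_knot_def knot_equivalent_def by blast
  have FHx: "F (H x) = x" "H (F x) = x" for x
    using homeomorphism_apply1 [OF FH] homeomorphism_apply2 [OF FH] by simp_all
  have contF: "continuous_on S F" and contH: "continuous_on S H" for S
    using FH unfolding homeomorphism_def by (auto intro: continuous_on_subset)
  have HF: "homeomorphism UNIV UNIV H F" using FH by (rule homeomorphism_symD)
  have HT: "H x \<in> standard_trefoil \<longleftrightarrow> x \<in> unit_circle" for x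
    using Fim FHx by (metis image_eqI imageE)
  define \<Theta> where "\<Theta> = (\<lambda>x. (longitude_coord x, meridian_coord x))"
  have \<Theta>b: "\<Theta> x \<in> cubic_base \<longleftrightarrow> x \<notin> standard_trefoil" for x
    unfolding \<Theta>_def cubic_base_def using coords_trefoil by simp
  have c\<Theta>: "continuous_on S \<Theta>" for S
    unfolding \<Theta>_def by (intro continuous_intros continuous_longitude_coord continuous_meridian_coord)
  \<comment> \<open>The value \<open>(0, 1)\<close> is the limit of the coordinates at infinity, so
    \<open>\<Psi>\<close> is continuous across the points lying over infinity.\<close>
  define \<Psi> where "\<Psi> = (\<lambda>z. if z \<in> over_infinity then (0, 1) else \<Theta> (H (circle_cover z)))"
  have \<Psi>b: "\<Psi> z \<in> cubic_base" for z
    unfolding \<Psi>_def using HT \<Theta>b circle_cover_not_circle by (auto simp: cubic_base_def)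
  have per: "\<Psi> (s + 2 * pi * of_int n, w) = \<Psi> (s, w)" for s n w
    unfolding \<Psi>_def using circle_cover_periodic by simp
  have clD: "closed over_infinity"
    unfolding over_infinity_def by (intro closed_Collect_conj closed_Collect_eq continuous_intros)
  have c\<Psi>: "continuous_on UNIV \<Psi>"
    unfolding continuous_on_def
  proof
    fix z :: "real \<times> complex"
    show "(\<Psi> \<longlongrightarrow> \<Psi> z) (at z)"
    proof (cases "z \<in> over_infinity")
      case True
      have "filterlim (\<lambda>z. H (circle_cover z)) at_infinity (at z within - over_infinity)"
        by (rule filterlim_compose [OF homeomorphism_at_infinity [OF HF] circle_cover_at_infinity [OF True]])
      then have "((\<lambda>z. \<Theta> (H (circle_cover z))) \<longlongrightarrow> (0, 1)) (at z within - over_infinity)"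
        unfolding \<Theta>_def by (rule filterlim_compose [OF coords_at_infinity])
      then have 1: "(\<Psi> \<longlongrightarrow> (0, 1)) (at z within - over_infinity)"
        by (rule Lim_transform_eventually) (auto simp: eventually_at_filter \<Psi>_def)
      have 2: "(\<Psi> \<longlongrightarrow> (0, 1)) (at z within over_infinity)"
        by (rule tendsto_eventually) (auto simp: eventually_at_filter \<Psi>_def)
      show ?thesis
        using Lim_Un_univ [OF 1 2] True unfolding \<Psi>_def by auto
    next
      case False
      have "continuous_on (- over_infinity) (\<lambda>z. \<Theta> (H (circle_cover z)))"
        by (rule continuous_on_compose2 [OF c\<Theta> continuous_on_compose2 [OF contH continuous_circle_cover]]) auto
      then have "continuous_on (- over_infinity) \<Psi>"
        by (rule continuous_on_eq) (auto simp: \<Psi>_def)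
      then have "isCont \<Psi> z"
        using False clD continuous_on_eq_continuous_at open_Compl by blast
      then show ?thesis unfolding isCont_def .
    qed
  qed
  \<comment> \<open>\<open>\<alpha>\<close> is the core circle of the solid torus;
    \<open>\<beta>\<close> below is a loop in a meridian disc around one of the two points where the
    disc meets the trefoil. Both begin over \<open>(1, 0)\<close>.\<close>
  define \<alpha> where "\<alpha> = (\<lambda>t::real. (2 *\<^sub>R cis (2 * pi * t), 0::real))"
  \<comment> \<open>A path of roots from \<open>sqrt 3\<close> to \<open>0\<close>, with
    \<open>Q\<close> chosen to make \<open>X t\<close> a root of the cubic for
    \<open>(1, Q t)\<close>. The straight path would pass through the double root 1, where
    \<open>Q = 1\<close> is on the knot. The bump avoids it through the upper half plane, and the
    divisor 20 keeps \<open>Q\<close> within the radius 3/2 of undistorted coordinates.\<close>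
  define X where "X = (\<lambda>t. let u = sqrt 3 * (1 - t) in Complex u (u * (sqrt 3 - u) / 20))"
  define Q where "Q = (\<lambda>t. (3 * X t - X t ^ 3) / 2)"
  define \<beta> where "\<beta> = (\<lambda>t::real. ((2 + Re (Q t)) *\<^sub>R cis 0, Im (Q t)))"
  have s3: "sqrt 3 * sqrt 3 = (3::real)" by simp
  have s3b: "1 < sqrt (3::real)" "sqrt (3::real) < 2" by (auto intro: real_less_lsqrt)
  have cX: "continuous_on {0..1} X" unfolding X_def Let_def Complex_eq by (intro continuous_intros) auto
  have cQ: "continuous_on {0..1} Q" unfolding Q_def by (intro continuous_intros cX) auto
  have \<Theta>\<alpha>: "\<Theta> (\<alpha> t) = (cis (2 * pi * t), 0)" for t
    using coords_on_solid_torus [of 0 "2 * pi * t"] unfolding \<alpha>_def \<Theta>_def by simp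
  have Q2: "2 * Q t = 3 * X t - X t ^ 3" for t unfolding Q_def by simp
  have X01: "X 0 = sqrt 3" "X 1 = 0" unfolding X_def by (simp_all add: complex_eq_iff)
  have Q01: "Q 0 = 0" "Q 1 = 0" unfolding Q_def X01
    by (simp_all add: complex_eq_iff power3_eq_cube flip: of_real_mult of_real_power)
  have Xb: "Im (X t) > 0 \<or> X t = 0 \<or> X t = sqrt 3" "\<bar>Re (X t)\<bar> \<le> sqrt 3" "\<bar>Im (X t)\<bar> \<le> 3/80" "0 \<le> Re (X t)" "0 \<le> Im (X t)"
    if t: "t \<in> {0..1}" for t
  proof -
    define u where "u = sqrt 3 * (1 - t)"
    have u: "0 \<le> u" "u \<le> sqrt 3" unfolding u_def using t by (auto simp: mult_le_cancel_left1)
    have Xu: "X t = Complex u (u * (sqrt 3 - u) / 20)" unfolding X_def u_def Let_def ..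
    have am: "u * (sqrt 3 - u) \<le> 3/4"
    proof -
      have "0 \<le> (u - sqrt 3 / 2)\<^sup>2" by simp
      then show ?thesis using s3 by (simp add: power2_eq_square algebra_simps)
    qed
    have nn: "0 \<le> u * (sqrt 3 - u)" using u by simp
    show "\<bar>Re (X t)\<bar> \<le> sqrt 3" "0 \<le> Re (X t)" using Xu u by auto
    show "\<bar>Im (X t)\<bar> \<le> 3/80" "0 \<le> Im (X t)" using Xu am nn by auto
    show "Im (X t) > 0 \<or> X t = 0 \<or> X t = sqrt 3"
    proof (cases "u = 0 \<or> u = sqrt 3")
      case False
      then have "0 < u * (sqrt 3 - u)" using u by (intro mult_pos_pos) auto
      then show ?thesis using Xu by simp
    qed (auto simp: Xu complex_eq_iff)
  qed
  have Qb: "cmod (Q t) \<le> 3/2" if t: "t \<in> {0..1}" for t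
  proof -
    define u where "u = Re (X t)"
    define v where "v = Im (X t)"
    have uv: "0 \<le> u" "u \<le> sqrt 3" "0 \<le> v" "v \<le> 3/80" using Xb [OF t] unfolding u_def v_def by auto
    have u2: "u\<^sup>2 \<le> 3" using uv by (metis power_mono real_sqrt_pow2 zero_le_numeral)
    have "X t ^ 3 = Complex (u ^ 3 - 3 * u * v\<^sup>2) (3 * u\<^sup>2 * v - v ^ 3)"
      unfolding complex_eq_iff u_def v_def by (simp add: power2_eq_square power3_eq_cube algebra_simps)
    then have Q: "Re (Q t) = (3 * u - u ^ 3) / 2 + 3 * u * v\<^sup>2 / 2" "Im (Q t) = v * (3 - 3 * u\<^sup>2) / 2 + v ^ 3 / 2"
      unfolding Q_def by (simp_all add: u_def v_def field_simps)
    have 1: "\<bar>(3 * u - u ^ 3) / 2\<bar> \<le> 1"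
    proof -
      have "(3 * u - u ^ 3) / 2 = u * (3 - u\<^sup>2) / 2" by (simp add: power2_eq_square power3_eq_cube algebra_simps)
      moreover have "0 \<le> u * (3 - u\<^sup>2)" using uv u2 by simp
      moreover have "2 - (3 * u - u ^ 3) = (u - 1)\<^sup>2 * (u + 2)" by (simp add: power2_eq_square power3_eq_cube algebra_simps)
      moreover have "0 \<le> (u - 1)\<^sup>2 * (u + 2)" using uv by simp
      ultimately show ?thesis by (simp add: abs_le_iff)
    qed
    have 2: "\<bar>v * (3 - 3 * u\<^sup>2) / 2\<bar> \<le> 9/80"
    proof -
      have "\<bar>3 - 3 * u\<^sup>2\<bar> \<le> 6" using u2 zero_le_power2 [of u] by linarith
      then have "\<bar>v\<bar> * \<bar>3 - 3 * u\<^sup>2\<bar> \<le> 3/80 * 6" using uv by (intro mult_mono) auto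
      then show ?thesis by (simp add: abs_mult)
    qed
    have v2: "v\<^sup>2 \<le> (3/80)\<^sup>2" "v ^ 3 \<le> (3/80) ^ 3" using uv by (auto intro!: power_mono)
    have "u * v\<^sup>2 \<le> 2 * (3/80)\<^sup>2" using uv s3b v2 by (intro mult_mono) auto
    then have 3: "\<bar>3 * u * v\<^sup>2 / 2\<bar> \<le> 1/80" using uv by (simp add: power2_eq_square)
    have 4: "\<bar>v ^ 3 / 2\<bar> \<le> 1/80" using uv v2 by (simp add: power3_eq_cube)
    have "cmod (Q t) \<le> \<bar>Re (Q t)\<bar> + \<bar>Im (Q t)\<bar>" by (rule cmod_le)
    then show ?thesis using 1 2 3 4 unfolding Q by linarith
  qed
  have \<Theta>\<beta>: "\<Theta> (\<beta> t) = (1, Q t)" if "t \<in> {0..1}" for t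
    using coords_on_solid_torus [OF Qb [OF that], of 0] unfolding \<beta>_def \<Theta>_def by simp
  have \<alpha>T: "\<alpha> t \<notin> standard_trefoil" for t
    using \<Theta>b [of "\<alpha> t"] unfolding \<Theta>\<alpha> cubic_base_def by simp
  have \<beta>T: "\<beta> t \<notin> standard_trefoil" if t: "t \<in> {0..1}" for t
  proof -
    have "Q t ^ 2 \<noteq> 1"
    proof
      assume "Q t ^ 2 = 1"
      then have "Q t = 1 \<or> Q t = -1" by (simp add: power2_eq_1_iff)
      moreover have "2 * Q t - 2 = - ((X t - 1) ^ 2 * (X t + 2))" "2 * Q t + 2 = - ((X t + 1) ^ 2 * (X t - 2))"
        unfolding Q2 by (simp_all add: power2_eq_square power3_eq_cube algebra_simps)
      ultimately have "X t - 1 = 0 \<or> X t + 2 = 0 \<or> X t + 1 = 0 \<or> X t - 2 = 0"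
        by (metis add.left_inverse diff_self mult_eq_0_iff mult_1_right mult_minus1_right neg_equal_0_iff_equal power_eq_0_iff)
      then have "Im (X t) = 0" "Re (X t) = 1 \<or> Re (X t) = -2 \<or> Re (X t) = -1 \<or> Re (X t) = 2"
        by (auto simp: complex_eq_iff)
      moreover from this have "Re (X t) = 0 \<or> Re (X t) = sqrt 3"
        using Xb(1) [OF t] by auto
      ultimately show False using s3b by (smt (verit))
    qed
    then show ?thesis using \<Theta>b [of "\<beta> t"] unfolding \<Theta>\<beta> [OF t] cubic_base_def by simp
  qed
  have c\<alpha>: "continuous_on {0..1} \<alpha>" and c\<beta>: "continuous_on {0..1} \<beta>"
    unfolding \<alpha>_def \<beta>_def cis_conv_exp using cQ by (intro continuous_intros; simp)+
  have ends: "\<alpha> 0 = \<beta> 0" "\<alpha> 1 = \<alpha> 0" "\<beta> 1 = \<beta> 0"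
    unfolding \<alpha>_def \<beta>_def Q01 by (simp_all add: scaleR_conv_of_real)
  have nc: "F x \<notin> unit_circle" if "x \<notin> standard_trefoil" for x
    using HT [of "F x"] FHx that by simp
  obtain z0 where z0: "z0 \<notin> over_infinity" "circle_cover z0 = F (\<alpha> 0)"
  proof -
    let ?u = "sphere_u (F (\<alpha> 0))"
    have "?u = of_real (cmod ?u) * cis (Arg ?u)" using rcis_cmod_Arg [of ?u] by (simp add: rcis_def)
    then show ?thesis
      using circle_cover_inverse [OF nc [OF \<alpha>T] _ refl] that by metis
  qed
  obtain \<sigma> where \<sigma>: "continuous_on {0..1} \<sigma>" "\<sigma> 0 = z0"
    "\<And>t. t \<in> {0..1} \<Longrightarrow> \<sigma> t \<notin> over_infinity \<and> circle_cover (\<sigma> t) = F (\<alpha> t)"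
    using lift_circle_cover [OF continuous_on_compose2 [OF contF c\<alpha> subset_UNIV] nc [OF \<alpha>T] z0] by blast
  obtain \<tau> where \<tau>: "continuous_on {0..1} \<tau>" "\<tau> 0 = z0"
    "\<And>t. t \<in> {0..1} \<Longrightarrow> \<tau> t \<notin> over_infinity \<and> circle_cover (\<tau> t) = F (\<beta> t)"
    using lift_circle_cover [OF continuous_on_compose2 [OF contF c\<beta> subset_UNIV] nc [OF \<beta>T] z0(1)] z0(2)
    unfolding ends(1) by blast
  obtain n :: int where n: "fst (\<sigma> 1) = fst z0 + 2 * pi * n" "snd (\<sigma> 1) = snd z0"
    using circle_cover_eqD [of z0 "\<sigma> 1"] z0 \<sigma>(3) [of 1] ends by auto
  obtain k :: int where k: "fst (\<tau> 1) = fst z0 + 2 * pi * k" "snd (\<tau> 1) = snd z0"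
    using circle_cover_eqD [of z0 "\<tau> 1"] z0 \<tau>(3) [of 1] ends by auto
  \<comment> \<open>Translation by whole turns: the deck transformations of the covering of the
    circle complement form a cyclic group, so the paths over \<open>\<alpha>\<close> and
    \<open>\<beta>\<close> end at the same point in either order.\<close>
  define sh where "sh = (\<lambda>(n::int) z::real \<times> complex. (fst z + 2 * pi * of_int n, snd z))"
  have csh: "continuous_on {0..1} (\<lambda>t. sh n (\<gamma> t))" if "continuous_on {0..1} \<gamma>" for n \<gamma>
    unfolding sh_def using that by (intro continuous_intros)
  have sh0: "sh 0 z = z" "sh n z0 = \<sigma> 1" "sh k z0 = \<tau> 1" "sh m (sh m' z) = sh (m + m') z" for z m m'
    unfolding sh_def using n k by (auto simp: prod_eq_iff algebra_simps)
  have \<Psi>\<sigma>: "\<Psi> (sh m (\<sigma> t)) = (cis (2 * pi * t), 0)" if "t \<in> {0..1}" for t m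
    using \<sigma>(3) [OF that] per [of "fst (\<sigma> t)" m "snd (\<sigma> t)"] \<Theta>\<alpha> FHx unfolding sh_def \<Psi>_def by simp
  have \<Psi>\<tau>: "\<Psi> (sh m (\<tau> t)) = (1, Q t)" if "t \<in> {0..1}" for t m
    using \<tau>(3) [OF that] per [of "fst (\<tau> t)" m "snd (\<tau> t)"] \<Theta>\<beta> [OF that] FHx unfolding sh_def \<Psi>_def by simp
  have "cubic (\<Psi> z0) (- sqrt 3) = 0"
    using \<Psi>\<sigma> [of 0 0] \<sigma>(2) unfolding sh0 cubic_def
    by (simp add: power3_eq_cube flip: of_real_mult)
  then have inC: "(complex_of_real (- sqrt 3), \<Psi> z0) \<in> cubic_cover"
    unfolding cubic_cover_def using \<Psi>b by simp
  obtain g where g: "continuous_on UNIV g" "g \<in> UNIV \<rightarrow> cubic_cover" "g z0 = (complex_of_real (- sqrt 3), \<Psi> z0)"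
      "\<And>z. snd (g z) = \<Psi> z"
    by (rule covering_space_lift_strong [OF covering_space_cubic inC, of z0 UNIV \<Psi>])
       (use \<Psi>b c\<Psi> in \<open>auto intro: convex_imp_simply_connected convex_imp_locally_path_connected\<close>)
  text \<open>Unique path lifting: a continuous choice of roots along a path is a lift of that path.\<close>
  have trans: "fst (g (\<gamma> 1)) = r 1"
    if "continuous_on {0..1} \<gamma>" "continuous_on {0..1} r" "\<And>t. t \<in> {0..1} \<Longrightarrow> cubic (\<Psi> (\<gamma> t)) (r t) = 0"
      "fst (g (\<gamma> 0)) = r 0" for \<gamma> :: "real \<Rightarrow> real \<times> complex" and r
  proof -
    have "(\<lambda>t. (r t, \<Psi> (\<gamma> t))) 1 = (\<lambda>t. g (\<gamma> t)) 1"
    proof (rule covering_space_lift_unique [OF covering_space_cubic, of _ 0 _ "{0..1}" "\<lambda>t. \<Psi> (\<gamma> t)"])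
      show "continuous_on {0..1} (\<lambda>t. \<Psi> (\<gamma> t))"
        by (rule continuous_on_compose2 [OF c\<Psi> that(1)]) auto
      then show "continuous_on {0..1} (\<lambda>t. (r t, \<Psi> (\<gamma> t)))"
        by (intro continuous_intros that(2))
      show "continuous_on {0..1} (\<lambda>t. g (\<gamma> t))"
        by (rule continuous_on_compose2 [OF g(1) that(1)]) auto
      show "(r 0, \<Psi> (\<gamma> 0)) = g (\<gamma> 0)" using that(4) g(4) by (simp add: prod_eq_iff)
      show "(\<lambda>t. (r t, \<Psi> (\<gamma> t))) \<in> {0..1} \<rightarrow> cubic_cover"
        using that(3) \<Psi>b unfolding cubic_cover_def by auto
    qed (use \<Psi>b g in auto)
    then show ?thesis by (metis fst_conv)
  qed
  have rootX: "cubic (1, Q t) (X t) = 0" for t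
    unfolding cubic_def fst_conv snd_conv Q2 by simp
  \<comment> \<open>The root that starts and ends at \<open>- sqrt 3\<close>. Division of the cubic
    by \<open>x - X t\<close> leaves a quadratic with discriminant \<open>12 - 3 * X t ^ 2\<close>,
    whose real part is positive, so \<open>csqrt\<close> is continuous along the path.\<close>
  define Y where "Y = (\<lambda>t. (- X t - csqrt (12 - 3 * X t ^ 2)) / 2)"
  have rootY: "cubic (1, Q t) (Y t) = 0" for t
  proof -
    have c: "(csqrt (12 - 3 * X t ^ 2)) ^ 2 = 12 - 3 * X t ^ 2" by simp
    have "cubic (1, Q t) y = (y - X t) * (y ^ 2 + X t * y + X t ^ 2 - 3)" for y
      unfolding cubic_def fst_conv snd_conv Q2 by (simp add: power2_eq_square power3_eq_cube algebra_simps)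
    moreover have "Y t ^ 2 + X t * Y t + X t ^ 2 - 3 = 0"
    proof -
      have "4 * (Y t ^ 2 + X t * Y t + X t ^ 2 - 3) = (csqrt (12 - 3 * X t ^ 2)) ^ 2 - (12 - 3 * X t ^ 2)"
        unfolding Y_def by (simp add: power2_eq_square field_simps)
      then have "4 * (Y t ^ 2 + X t * Y t + X t ^ 2 - 3) = 0" unfolding c by (simp only: diff_self)
      then show ?thesis by (metis mult_eq_0_iff zero_neq_numeral)
    qed
    ultimately show ?thesis by simp
  qed
  have cY: "continuous_on {0..1} Y"
    unfolding Y_def
  proof (intro continuous_intros cX continuous_on_compose2 [OF continuous_on_csqrt])
    show "(\<lambda>t. 12 - 3 * X t ^ 2) ` {0..1} \<subseteq> - \<real>\<^sub>\<le>\<^sub>0"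
    proof clarify
      fix t :: real assume t: "t \<in> {0..1}" and "12 - 3 * X t ^ 2 \<in> \<real>\<^sub>\<le>\<^sub>0"
      then have "Re (12 - 3 * X t ^ 2) \<le> 0" by (simp add: complex_nonpos_Reals_iff)
      moreover have "Re (X t ^ 2) = (Re (X t))\<^sup>2 - (Im (X t))\<^sup>2" by (simp add: power2_eq_square)
      moreover have "(Re (X t))\<^sup>2 \<le> 3"
        using Xb(2) [OF t] by (metis abs_le_square_iff abs_of_nonneg real_sqrt_ge_zero real_sqrt_pow2 zero_le_numeral)
      moreover have "0 \<le> (Im (X t))\<^sup>2" by simp
      ultimately show False by simp
    qed
  qed auto
  have Y01: "Y 0 = - sqrt 3" "Y 1 = - sqrt 3"
  proof -
    have "csqrt 3 = sqrt 3" "csqrt 12 = 2 * sqrt 3"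
      using csqrt_of_real_nonneg [of 3] csqrt_of_real_nonneg [of 12] real_sqrt_mult [of 4 3] by auto
    moreover have "12 - 3 * (complex_of_real (sqrt 3)) ^ 2 = 3"
      by (simp add: flip: of_real_power)
    ultimately show "Y 0 = - sqrt 3" "Y 1 = - sqrt 3" unfolding Y_def X01 by simp_all
  qed
  \<comment> \<open>Along \<open>\<alpha>\<close> the nonzero roots satisfy
    \<open>x ^ 2 = 3 * cis (2 * pi * t)\<close>; they make half a turn, which exchanges
    \<open>- sqrt 3\<close> and \<open>sqrt 3\<close>.\<close>
  define A where "A = (\<lambda>t::real. - sqrt 3 * cis (pi * t))"
  have rootA: "cubic (cis (2 * pi * t), 0) (A t) = 0" for t
  proof -
    have "(A t) ^ 2 = 3 * cis (2 * pi * t)"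
      unfolding A_def power_mult_distrib Complex.DeMoivre by (simp add: mult_ac flip: of_real_power)
    then show ?thesis unfolding cubic_def by (simp add: power3_eq_cube power2_eq_square algebra_simps)
  qed
  have cA: "continuous_on {0..1} A" unfolding A_def cis_conv_exp by (intro continuous_intros)
  have A01: "A 0 = - sqrt 3" "A 1 = sqrt 3" unfolding A_def by simp_all
  have \<Psi>0: "\<Psi> (\<sigma> t) = (cis (2 * pi * t), 0)" "\<Psi> (\<tau> t) = (1, Q t)" if "t \<in> {0..1}" for t
    using \<Psi>\<sigma> [OF that, of 0] \<Psi>\<tau> [OF that, of 0] unfolding sh0(1) .
  have "fst (g (\<sigma> 1)) = A 1"
    by (rule trans [OF \<sigma>(1) cA]) (use \<Psi>0 rootA g(3) \<sigma>(2) A01 in auto)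
  then have 1: "fst (g (sh n z0)) = sqrt 3" using A01 sh0 by simp
  have "fst (g (sh n (\<tau> 1))) = X 1"
    by (rule trans [OF csh [OF \<tau>(1)] cX]) (use \<Psi>\<tau> rootX 1 \<tau>(2) X01 in auto)
  then have 2: "fst (g (sh (n + k) z0)) = 0" using X01 sh0 by metis
  have "fst (g (\<tau> 1)) = Y 1"
    by (rule trans [OF \<tau>(1) cY]) (use \<Psi>0 rootY g(3) \<tau>(2) Y01 in auto)
  then have 3: "fst (g (sh k z0)) = - sqrt 3" using Y01 sh0 by simp
  have "fst (g (sh k (\<sigma> 1))) = A 1"
    by (rule trans [OF csh [OF \<sigma>(1)] cA]) (use \<Psi>\<sigma> rootA 3 \<sigma>(2) A01 in auto)
  then have "fst (g (sh (k + n) z0)) = sqrt 3" using A01 sh0 by metis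
  then show False using 2 by (simp add: add.commute)
qed

section \<open>Closed curves on the sphere with three double points\<close>

text \<open>A disc is recorded together with its boundary, as a subset of any metric space, so that
  the same lemmas apply in the plane and on the sphere.\<close>

definition closed_disc :: "'a::metric_space set \<Rightarrow> 'a set \<Rightarrow> bool" where
  "closed_disc B C \<longleftrightarrow> (\<exists>h k. homeomorphism B (cball (0::complex) 1) h k \<and> h ` C = sphere 0 1 \<and> C \<subseteq> B)"

lemma closed_disc_compact: "closed_disc B C \<Longrightarrow> compact B"
  unfolding closed_disc_def
  by (metis compact_cball compact_continuous_image homeomorphism_def)

lemma closed_disc_subset: "closed_disc B C \<Longrightarrow> C \<subseteq> B"
  unfolding closed_disc_def by blast

lemma closed_disc_homeomorphic_image:
  assumes "closed_disc B C" "homeomorphism B B' f g" "f ` C = C'"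
  shows "closed_disc B' C'"
proof -
  obtain h k where h: "homeomorphism B (cball (0::complex) 1) h k" "h ` C = sphere 0 1" "C \<subseteq> B"
    using assms(1) unfolding closed_disc_def by blast
  have "homeomorphism B' (cball 0 1) (h \<circ> g) (f \<circ> k)"
    using homeomorphism_compose [OF homeomorphism_symD [OF assms(2)] h(1)] .
  moreover have "g ` C' = C"
    using assms(2,3) h(3) unfolding homeomorphism_def by (force simp: image_iff subset_iff)
  then have "(h \<circ> g) ` C' = sphere 0 1" by (metis image_comp h(2))
  moreover have "C' \<subseteq> B'" using assms(2,3) h(3) unfolding homeomorphism_def by blast
  ultimately show ?thesis unfolding closed_disc_def by blast
qed

text \<open>Radial extension: every concentric circle is mapped like the unit circle and the centre
  is fixed. Continuity at the centre holds because moduli are preserved.\<close>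

lemma homeomorphism_circle_extends:
  fixes \<theta> :: "complex \<Rightarrow> complex"
  assumes "homeomorphism (sphere 0 1) (sphere 0 1) \<theta> \<theta>'"
  obtains \<Phi> \<Psi> where "homeomorphism (cball 0 1) (cball 0 1) \<Phi> \<Psi>" "\<And>x. x \<in> sphere 0 1 \<Longrightarrow> \<Phi> x = \<theta> x"
proof -
  define ext :: "(complex \<Rightarrow> complex) \<Rightarrow> complex \<Rightarrow> complex"
    where "ext = (\<lambda>\<theta> z. if z = 0 then 0 else of_real (cmod z) * \<theta> (sgn z))"
  have ext: "continuous_on (cball 0 1) (ext \<theta>)" "\<And>z. z \<in> cball 0 1 \<Longrightarrow> ext \<theta> z \<in> cball 0 1"
     if h: "homeomorphism (sphere 0 1) (sphere 0 1) \<theta> \<theta>'" for \<theta> \<theta>'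
  proof -
    have ct: "continuous_on (sphere 0 1) \<theta>" using h by (simp add: homeomorphism_def)
    have ns: "cmod (\<theta> (sgn z)) = 1" if "z \<noteq> 0" for z
    proof -
      have "sgn z \<in> sphere 0 1" using that by (simp add: norm_sgn)
      then have "\<theta> (sgn z) \<in> sphere 0 1" using h unfolding homeomorphism_def by blast
      then show ?thesis by simp
    qed
    have n: "cmod (ext \<theta> z) = cmod z" for z
      unfolding ext_def using ns by (simp add: norm_mult)
    then show "ext \<theta> z \<in> cball 0 1" if "z \<in> cball 0 1" for z using that by simp
    have "continuous (at z within cball 0 1) (ext \<theta>)" for z
    proof (cases "z = 0")
      case True
      have "((\<lambda>w::complex. cmod w) \<longlongrightarrow> 0) (at 0 within cball 0 1)"
        using tendsto_norm [OF tendsto_ident_at [of "0::complex" "cball 0 1"]] by simp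
      then have "(ext \<theta> \<longlongrightarrow> 0) (at 0 within cball 0 1)"
        by (rule Lim_null_comparison [rotated]) (simp add: n)
      then show ?thesis using True by (simp add: continuous_within ext_def)
    next
      case False
      have "continuous_on (- {0}) (\<lambda>z. of_real (cmod z) * \<theta> (sgn z))"
        by (intro continuous_intros continuous_on_compose2 [OF ct] continuous_on_sgn)
           (auto simp: norm_sgn split: if_splits)
      then have "continuous_on (- {0}) (ext \<theta>)"
        by (rule continuous_on_eq) (auto simp: ext_def)
      then show ?thesis
        using False by (meson ComplI continuous_at_imp_continuous_at_within continuous_on_eq_continuous_at
            finite.emptyI finite.insertI finite_imp_closed open_Compl singletonD)
    qed
    then show "continuous_on (cball 0 1) (ext \<theta>)"
      by (simp add: continuous_on_eq_continuous_within)
  qed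
  have inv: "ext \<theta>' (ext \<theta> z) = z" if h: "homeomorphism (sphere 0 1) (sphere 0 1) \<theta> \<theta>'" for \<theta> \<theta>' z
  proof (cases "z = 0")
    case False
    then have "sgn z \<in> sphere 0 1" by (simp add: norm_sgn)
    then have t: "\<theta> (sgn z) \<in> sphere 0 1" "\<theta>' (\<theta> (sgn z)) = sgn z"
      using h unfolding homeomorphism_def by blast+
    then have e: "ext \<theta> z \<noteq> 0" "cmod (ext \<theta> z) = cmod z" using False unfolding ext_def by (auto simp: norm_mult)
    have "ext \<theta> z = of_real (cmod z) * \<theta> (sgn z)" using False by (simp add: ext_def)
    then have "sgn (ext \<theta> z) = of_real (inverse (cmod z)) * (of_real (cmod z) * \<theta> (sgn z))"
      unfolding sgn_div_norm [of "ext \<theta> z"] e scaleR_conv_of_real by (simp only:)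
    also have "\<dots> = of_real (inverse (cmod z) * cmod z) * \<theta> (sgn z)"
      by (simp only: of_real_mult mult.assoc)
    finally have "sgn (ext \<theta> z) = \<theta> (sgn z)" using False by simp
    then have "ext \<theta>' (ext \<theta> z) = of_real (cmod z) * sgn z"
      using e t(2) by (simp add: ext_def)
    then show ?thesis
      using False by (simp add: sgn_div_norm scaleR_conv_of_real)
  qed (simp add: ext_def)
  have h2: "homeomorphism (sphere 0 1) (sphere 0 1) \<theta>' \<theta>" using assms by (rule homeomorphism_symD)
  show ?thesis
  proof (rule that [of "ext \<theta>" "ext \<theta>'"])
    show "homeomorphism (cball 0 1) (cball 0 1) (ext \<theta>) (ext \<theta>')"
      using ext [OF assms] ext [OF h2] inv [OF assms] inv [OF h2] by (intro homeomorphismI) auto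
    show "ext \<theta> x = \<theta> x" if "x \<in> sphere 0 1" for x
      using that unfolding ext_def by (auto simp: sgn_div_norm)
  qed
qed

lemma closed_disc_extend:
  assumes "closed_disc B C" "closed_disc B' C'" "homeomorphism C C' \<theta> \<theta>'"
  obtains \<Phi> \<Psi> where "homeomorphism B B' \<Phi> \<Psi>" "\<And>x. x \<in> C \<Longrightarrow> \<Phi> x = \<theta> x"
proof -
  obtain h k where h: "homeomorphism B (cball (0::complex) 1) h k" "h ` C = sphere 0 1" "C \<subseteq> B"
    using assms(1) unfolding closed_disc_def by blast
  obtain h' k' where h': "homeomorphism B' (cball (0::complex) 1) h' k'" "h' ` C' = sphere 0 1" "C' \<subseteq> B'"
    using assms(2) unfolding closed_disc_def by blast
  have hC: "homeomorphism C (sphere 0 1) h k" and hC': "homeomorphism C' (sphere 0 1) h' k'"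
    by (rule homeomorphism_of_subsets [OF h(1) h(3) order_refl h(2)])
       (rule homeomorphism_of_subsets [OF h'(1) h'(3) order_refl h'(2)])
  have "homeomorphism (sphere 0 1) (sphere 0 1) (h' \<circ> (\<theta> \<circ> k)) ((h \<circ> \<theta>') \<circ> k')"
    using homeomorphism_compose [OF homeomorphism_compose [OF homeomorphism_symD [OF hC] assms(3)] hC']
    by (simp add: o_assoc)
  then obtain F G where F: "homeomorphism (cball 0 1) (cball 0 1) F G"
      "\<And>x. x \<in> sphere 0 1 \<Longrightarrow> F x = (h' \<circ> (\<theta> \<circ> k)) x"
    by (rule homeomorphism_circle_extends) blast
  have "homeomorphism B B' (k' \<circ> (F \<circ> h)) ((k \<circ> G) \<circ> h')"
    using homeomorphism_compose [OF homeomorphism_compose [OF h(1) F(1)] homeomorphism_symD [OF h'(1)]]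
    by (simp add: o_assoc)
  moreover have "(k' \<circ> (F \<circ> h)) x = \<theta> x" if x: "x \<in> C" for x
  proof -
    have 1: "h x \<in> sphere 0 1" using h(2) x by blast
    have 2: "k (h x) = x" using h x by (metis homeomorphism_apply1 subsetD)
    have "\<theta> x \<in> C'" using assms(3) x by (metis homeomorphism_image1 imageI)
    then have 3: "k' (h' (\<theta> x)) = \<theta> x" using h' by (metis homeomorphism_apply1 subsetD)
    show ?thesis using F(2) [OF 1] 2 3 by simp
  qed
  ultimately show ?thesis using that by blast
qed

text \<open>The condition on the image of the overlap makes the two inverses agree on
  \<open>X' \<inter> Y'\<close>, so they paste to an inverse.\<close>

lemma homeomorphism_paste:
  assumes F: "homeomorphism X X' F F'" and G: "homeomorphism Y Y' G G'"
    and cl: "closed X" "closed Y" "closed X'" "closed Y'"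
    and eq: "\<And>x. x \<in> X \<inter> Y \<Longrightarrow> F x = G x" and im: "F ` (X \<inter> Y) = X' \<inter> Y'"
  obtains H K where "homeomorphism (X \<union> Y) (X' \<union> Y') H K"
    "\<And>x. x \<in> X \<Longrightarrow> H x = F x" "\<And>x. x \<in> Y \<Longrightarrow> H x = G x"
proof -
  define H where "H = (\<lambda>x. if x \<in> X then F x else G x)"
  define K where "K = (\<lambda>x. if x \<in> X' then F' x else G' x)"
  have HY: "H x = G x" if "x \<in> Y" for x using that eq unfolding H_def by auto
  have eq': "F' y = G' y" if y: "y \<in> X' \<inter> Y'" for y
  proof -
    obtain x where x: "x \<in> X \<inter> Y" "y = F x" using y im by blast
    then have "F' y = x" "G' y = x" using F G eq by (metis IntD1 IntD2 homeomorphism_apply1)+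
    then show ?thesis by simp
  qed
  have KY: "K x = G' x" if "x \<in> Y'" for x using that eq' unfolding K_def by auto
  have cH: "continuous_on (X \<union> Y) H"
    unfolding H_def using F G cl eq
    by (intro continuous_on_cases) (auto simp: homeomorphism_def)
  have cK: "continuous_on (X' \<union> Y') K"
    unfolding K_def using F G cl eq'
    by (intro continuous_on_cases) (auto simp: homeomorphism_def)
  have HX: "H x \<in> X' \<and> K (H x) = x" if "x \<in> X" for x
    using that F unfolding H_def K_def homeomorphism_def by auto
  have HY2: "H x \<in> Y' \<and> K (H x) = x" if "x \<in> Y" for x
    using that G KY unfolding HY [OF that] homeomorphism_def by auto
  have KX: "K y \<in> X \<and> H (K y) = y" if "y \<in> X'" for y
    using that F unfolding H_def K_def homeomorphism_def by auto
  have KY2: "K y \<in> Y \<and> H (K y) = y" if "y \<in> Y'" for y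
    using that G HY unfolding KY [OF that] homeomorphism_def by auto
  have "homeomorphism (X \<union> Y) (X' \<union> Y') H K"
    using cH cK HX HY2 KX KY2 by (intro homeomorphismI) auto
  then show ?thesis using that HY unfolding H_def by auto
qed

text \<open>Carried to the unit disc, the three arcs form a theta curve. The chord divides the
  inside of the circle into the insides of two loops, and the Schoenflies theorem shows that each of
  them with its boundary is a disc.\<close>

lemma closed_disc_split:
  fixes f c1 c2 :: "real \<Rightarrow> 'a::metric_space"
  assumes B: "closed_disc B (path_image c1 \<union> path_image c2)"
    and arcs: "arc c1" "arc c2" "arc f"
    and ends: "pathstart c1 = u" "pathfinish c1 = v" "pathstart c2 = u" "pathfinish c2 = v"
      "pathstart f = u" "pathfinish f = v"
    and c12: "path_image c1 \<inter> path_image c2 = {u, v}"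
    and f: "path_image f \<subseteq> B" "path_image f \<inter> (path_image c1 \<union> path_image c2) = {u, v}"
  obtains B1 B2 where "closed_disc B1 (path_image c1 \<union> path_image f)"
    "closed_disc B2 (path_image c2 \<union> path_image f)" "B1 \<union> B2 = B" "B1 \<inter> B2 = path_image f"
proof -
  let ?C = "path_image c1 \<union> path_image c2"
  obtain h k where h: "homeomorphism B (cball (0::complex) 1) h k" "h ` ?C = sphere 0 1" "?C \<subseteq> B"
    using B unfolding closed_disc_def by blast
  have inj: "inj_on h B" using h(1) by (metis homeomorphism_def inj_on_def)
  have cont: "continuous_on B h" using h(1) by (simp add: homeomorphism_def)
  have kh: "k ` h ` S = S" if "S \<subseteq> B" for S
  proof -
    have "k ` h ` S = (\<lambda>x. x) ` S"
      unfolding image_image using h(1) that by (intro image_cong) (auto simp: homeomorphism_def)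
    then show ?thesis by simp
  qed
  have arc_h: "arc (h \<circ> p)" if "arc p" "path_image p \<subseteq> B" for p
    using that cont inj unfolding arc_def
    by (metis comp_inj_on continuous_on_subset inj_on_subset path_continuous_image path_image_def)
  have a: "arc (h \<circ> c1)" "arc (h \<circ> c2)" "arc (h \<circ> f)"
    using arc_h arcs f(1) h(3) by auto
  have uv: "u \<in> B" "v \<in> B" "u \<noteq> v"
    using h(3) ends arc_distinct_ends [OF arcs(3)] by auto
  have huv: "h u \<noteq> h v" using inj uv by (auto simp: inj_on_def)
  have int: "h ` S \<inter> h ` T = h ` (S \<inter> T)" if "S \<subseteq> B" "T \<subseteq> B" for S T
    using inj that by (metis inj_on_image_Int)
  have i12: "path_image (h \<circ> c1) \<inter> path_image (h \<circ> c2) = {h u, h v}"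
    and i1f: "path_image (h \<circ> c1) \<inter> path_image (h \<circ> f) = {h u, h v}"
    and i2f: "path_image (h \<circ> c2) \<inter> path_image (h \<circ> f) = {h u, h v}"
  proof -
    have "path_image c1 \<inter> path_image f = {u, v}" "path_image c2 \<inter> path_image f = {u, v}"
      using f(2) c12 by blast+
    then show "path_image (h \<circ> c1) \<inter> path_image (h \<circ> c2) = {h u, h v}"
        "path_image (h \<circ> c1) \<inter> path_image (h \<circ> f) = {h u, h v}"
        "path_image (h \<circ> c2) \<inter> path_image (h \<circ> f) = {h u, h v}"
      unfolding path_image_compose using c12 h(3) f(1) by (auto simp: int)
  qed
  have circ: "path_image (h \<circ> c1) \<union> path_image (h \<circ> c2) = sphere 0 1"
    using h(2) by (simp add: path_image_compose image_Un)
  have ins: "inside (sphere (0::complex) 1) = ball 0 1"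
    by (simp add: inside_frontier_eq_interior [of "cball (0::complex) 1", simplified] bounded_cball)
  have fcb: "path_image (h \<circ> f) \<subseteq> cball 0 1"
    using f(1) h(1) by (metis homeomorphism_image1 image_mono path_image_compose)
  have fb: "path_image (h \<circ> f) - {h u, h v} \<subseteq> ball 0 1"
  proof -
    have "path_image (h \<circ> f) \<inter> sphere 0 1 = {h u, h v}"
      using i1f i2f circ by blast
    moreover have "cball 0 1 - sphere 0 1 = ball (0::complex) 1" by auto
    ultimately show ?thesis using fcb by blast
  qed
  have pe: "pathstart (h \<circ> c1) = h u" "pathfinish (h \<circ> c1) = h v" "pathstart (h \<circ> c2) = h u" "pathfinish (h \<circ> c2) = h v"
    "pathstart (h \<circ> f) = h u" "pathfinish (h \<circ> f) = h v"
    using ends by (simp_all add: pathstart_compose pathfinish_compose)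
  have ne: "path_image (h \<circ> f) \<inter> inside (path_image (h \<circ> c1) \<union> path_image (h \<circ> c2)) \<noteq> {}"
  proof -
    have "path_image (h \<circ> f) - {h u, h v} \<noteq> {}"
      using nonempty_simple_path_endless [OF arc_imp_simple_path [OF a(3)]] unfolding pe .
    then show ?thesis using fb unfolding circ ins by blast
  qed
  let ?I1 = "inside (path_image (h \<circ> c1) \<union> path_image (h \<circ> f))"
  let ?I2 = "inside (path_image (h \<circ> c2) \<union> path_image (h \<circ> f))"
  obtain d: "?I1 \<inter> ?I2 = {}" and U: "?I1 \<union> ?I2 \<union> (path_image (h \<circ> f) - {h u, h v}) = ball 0 1"
    using split_inside_simple_closed_curve
      [OF arc_imp_simple_path [OF a(1)] pe(1,2) arc_imp_simple_path [OF a(2)] pe(3,4)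
        arc_imp_simple_path [OF a(3)] pe(5,6) huv i12 i1f i2f ne]
    unfolding circ ins by blast
  have disc: "closed_disc (k ` (path_image (h \<circ> c) \<union> path_image (h \<circ> f) \<union> inside (path_image (h \<circ> c) \<union> path_image (h \<circ> f))))
      (path_image c \<union> path_image f)"
    if c: "arc (h \<circ> c)" "pathstart (h \<circ> c) = h u" "pathfinish (h \<circ> c) = h v"
      "path_image (h \<circ> c) \<inter> path_image (h \<circ> f) = {h u, h v}"
      "inside (path_image (h \<circ> c) \<union> path_image (h \<circ> f)) \<subseteq> ball 0 1" "path_image c \<subseteq> B" for c
  proof -
    define g where "g = (h \<circ> c) +++ reversepath (h \<circ> f)"
    have g: "simple_path g" "pathfinish g = pathstart g"
      unfolding g_def using c a(3) pe by (auto intro!: simple_path_join_loop simp: arc_reversepath)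
    have pg: "path_image g = path_image (h \<circ> c) \<union> path_image (h \<circ> f)"
      unfolding g_def using c pe by (simp add: path_image_join)
    obtain H K where H: "homeomorphism (path_image g \<union> inside (path_image g)) (cball 0 1) H K"
      "H ` path_image g = sphere (0::complex) 1"
      using Schoenflies [OF g] by blast
    let ?S = "path_image g \<union> inside (path_image g)"
    have "path_image g \<subseteq> cball 0 1"
      unfolding pg path_image_compose using c(6) f(1) h(1) by (auto simp: homeomorphism_def)
    then have sub: "?S \<subseteq> cball 0 1" using c(5) unfolding pg by auto
    have "closed_disc ?S (path_image g)" unfolding closed_disc_def using H by blast
    moreover have "homeomorphism ?S (k ` ?S) k h"
      by (rule homeomorphism_of_subsets [OF homeomorphism_symD [OF h(1)] sub order_refl refl])
    moreover have "k ` path_image g = path_image c \<union> path_image f"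
    proof -
      show ?thesis unfolding pg path_image_compose image_Un using c(6) f(1) by (simp add: kh)
    qed
    ultimately have "closed_disc (k ` ?S) (path_image c \<union> path_image f)"
      by (rule closed_disc_homeomorphic_image)
    then show ?thesis unfolding pg .
  qed
  let ?B1 = "k ` (path_image (h \<circ> c1) \<union> path_image (h \<circ> f) \<union> ?I1)"
  let ?B2 = "k ` (path_image (h \<circ> c2) \<union> path_image (h \<circ> f) \<union> ?I2)"
  have sb: "?I1 \<subseteq> ball 0 1" "?I2 \<subseteq> ball 0 1" using U by auto
  have sph: "path_image (h \<circ> c1) \<subseteq> sphere 0 1" "path_image (h \<circ> c2) \<subseteq> sphere 0 1" using circ by auto
  have kim: "k ` cball 0 1 = B" "inj_on k (cball 0 1)"
    by (rule homeomorphism_image2 [OF h(1)]) (rule inj_on_inverseI [of _ h], rule homeomorphism_apply2 [OF h(1)])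
  have bs: "ball 0 1 \<inter> sphere 0 1 = ({} :: complex set)" by auto
  show ?thesis
  proof (rule that [of ?B1 ?B2])
    show "closed_disc ?B1 (path_image c1 \<union> path_image f)"
      by (rule disc [OF a(1) pe(1,2) i1f sb(1)]) (use h(3) in auto)
    show "closed_disc ?B2 (path_image c2 \<union> path_image f)"
      by (rule disc [OF a(2) pe(3,4) i2f sb(2)]) (use h(3) in auto)
    have "(path_image (h \<circ> c1) \<union> path_image (h \<circ> f) \<union> ?I1) \<union> (path_image (h \<circ> c2) \<union> path_image (h \<circ> f) \<union> ?I2) = cball 0 1"
    proof -
      have "{h u, h v} \<subseteq> sphere 0 1" using i12 sph by blast
      then have "(?I1 \<union> ?I2 \<union> (path_image (h \<circ> f) - {h u, h v})) \<union> sphere 0 1 = (path_image (h \<circ> c1) \<union> path_image (h \<circ> f) \<union> ?I1) \<union> (path_image (h \<circ> c2) \<union> path_image (h \<circ> f) \<union> ?I2)"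
        unfolding circ [symmetric] by blast
      moreover have "ball 0 1 \<union> sphere 0 1 = cball (0::complex) 1" by auto
      ultimately show ?thesis unfolding U by simp
    qed
    then show "?B1 \<union> ?B2 = B"
      unfolding image_Un [symmetric] by (simp only: kim)
    have "(path_image (h \<circ> c1) \<union> path_image (h \<circ> f) \<union> ?I1) \<inter> (path_image (h \<circ> c2) \<union> path_image (h \<circ> f) \<union> ?I2) = path_image (h \<circ> f)"
      using i12 i1f i2f d sb sph bs inside_no_overlap [of "path_image (h \<circ> c1) \<union> path_image (h \<circ> f)"]
        inside_no_overlap [of "path_image (h \<circ> c2) \<union> path_image (h \<circ> f)"] by blast
    moreover have "?B1 \<inter> ?B2 = k ` ((path_image (h \<circ> c1) \<union> path_image (h \<circ> f) \<union> ?I1) \<inter> (path_image (h \<circ> c2) \<union> path_image (h \<circ> f) \<union> ?I2))"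
    proof (rule inj_on_image_Int [OF kim(2), symmetric])
      show "path_image (h \<circ> c1) \<union> path_image (h \<circ> f) \<union> ?I1 \<subseteq> cball 0 1"
        "path_image (h \<circ> c2) \<union> path_image (h \<circ> f) \<union> ?I2 \<subseteq> cball 0 1"
        using sb sph fcb ball_subset_cball sphere_cball by blast+
    qed
    moreover have "k ` path_image (h \<circ> f) = path_image f"
      using f(1) by (simp add: path_image_compose kh)
    ultimately show "?B1 \<inter> ?B2 = path_image f" by simp
  qed
qed

definition arc_set :: "'a::topological_space set \<Rightarrow> 'a \<Rightarrow> 'a \<Rightarrow> bool" where
  "arc_set A u v \<longleftrightarrow> (\<exists>p. arc p \<and> path_image p = A \<and> pathstart p = u \<and> pathfinish p = v)"

lemma arc_set_sym: "arc_set A u v \<Longrightarrow> arc_set A v u"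
  unfolding arc_set_def by (metis arc_reversepath path_image_reversepath pathfinish_reversepath pathstart_reversepath)

lemma arc_set_join:
  assumes "arc_set A u v" "arc_set B v w" "A \<inter> B = {v}"
  shows "arc_set (A \<union> B) u w"
proof -
  obtain p q where "arc p" "path_image p = A" "pathstart p = u" "pathfinish p = v"
    "arc q" "path_image q = B" "pathstart q = v" "pathfinish q = w"
    using assms unfolding arc_set_def by blast
  then show ?thesis
    unfolding arc_set_def using assms(3)
    by (intro exI [of _ "p +++ q"]) (simp add: arc_join path_image_join)
qed

lemma arc_set_ends: "arc_set A u v \<Longrightarrow> u \<in> A \<and> v \<in> A"
  unfolding arc_set_def by auto

lemma arc_set_connected_delete:
  fixes A :: "'a::t2_space set"
  assumes "arc_set A u v" shows "connected (A - {v})"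
proof -
  obtain p where p: "arc p" "path_image p = A" "pathfinish p = v"
    using assms unfolding arc_set_def by blast
  have "A - {v} = p ` {0..<1}"
  proof -
    have "p t \<noteq> v" if "t \<in> {0..<1}" for t
      using p(1,3) that unfolding arc_def inj_on_def pathfinish_def by force
    then have "v \<notin> p ` {0..<1}" by blast
    moreover have "{0..1} = insert 1 {0..<1::real}" by auto
    then have "A = insert v (p ` {0..<1})"
      using p(2,3) unfolding path_image_def pathfinish_def by (metis image_insert)
    ultimately show ?thesis by blast
  qed
  moreover have "continuous_on {0..<1} p"
    using p(1) unfolding arc_def path_def by (rule continuous_on_subset [OF conjunct1]) auto
  ultimately show ?thesis
    by (simp add: connected_continuous_image)
qed

lemma closed_disc_split_set:
  fixes B :: "'a::metric_space set"
  assumes "closed_disc B (S1 \<union> S2)" "arc_set S1 u v" "arc_set S2 u v" "arc_set F u v"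
    "S1 \<inter> S2 = {u, v}" "F \<subseteq> B" "F \<inter> (S1 \<union> S2) = {u, v}"
  obtains B1 B2 where "closed_disc B1 (S1 \<union> F)" "closed_disc B2 (S2 \<union> F)" "B1 \<union> B2 = B" "B1 \<inter> B2 = F"
proof -
  obtain c1 where c1: "arc c1" "path_image c1 = S1" "pathstart c1 = u" "pathfinish c1 = v"
    using assms(2) unfolding arc_set_def by blast
  obtain c2 where c2: "arc c2" "path_image c2 = S2" "pathstart c2 = u" "pathfinish c2 = v"
    using assms(3) unfolding arc_set_def by blast
  obtain f where f: "arc f" "path_image f = F" "pathstart f = u" "pathfinish f = v"
    using assms(4) unfolding arc_set_def by blast
  show ?thesis
    by (rule closed_disc_split [of B c1 c2 f u v]) (use c1 c2 f assms that in auto)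
qed

lemma closed_disc_closed: "closed_disc B C \<Longrightarrow> closed (B :: 'a::metric_space set)"
  by (simp add: closed_disc_compact compact_imp_closed)

lemma homeomorphism_restrict:
  assumes "homeomorphism X X' \<theta> \<theta>'" "S \<subseteq> X" "\<theta> ` S = S'"
  shows "homeomorphism S S' \<theta> \<theta>'"
  by (rule homeomorphism_of_subsets [OF assms(1,2) order_refl assms(3)])

text \<open>Both discs are split along their chords, the map is extended over corresponding halves,
  and the two extensions agree on the chord.\<close>

lemma closed_disc_chord_extend:
  fixes B :: "'a::metric_space set" and B' :: "'b::metric_space set"
  assumes B: "closed_disc B (S1 \<union> S2)" "arc_set S1 u v" "arc_set S2 u v" "arc_set F u v"
    "S1 \<inter> S2 = {u, v}" "F \<subseteq> B" "F \<inter> (S1 \<union> S2) = {u, v}"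
    and B': "closed_disc B' (S1' \<union> S2')" "arc_set S1' u' v'" "arc_set S2' u' v'" "arc_set F' u' v'"
    "S1' \<inter> S2' = {u', v'}" "F' \<subseteq> B'" "F' \<inter> (S1' \<union> S2') = {u', v'}"
    and \<theta>: "homeomorphism X X' \<theta> \<theta>'" "S1 \<union> S2 \<union> F \<subseteq> X" "\<theta> ` S1 = S1'" "\<theta> ` S2 = S2'" "\<theta> ` F = F'"
  obtains \<Phi> \<Psi> where "homeomorphism B B' \<Phi> \<Psi>" "\<And>x. x \<in> S1 \<union> S2 \<union> F \<Longrightarrow> \<Phi> x = \<theta> x"
proof -
  obtain B1 B2 where s: "closed_disc B1 (S1 \<union> F)" "closed_disc B2 (S2 \<union> F)" "B1 \<union> B2 = B" "B1 \<inter> B2 = F"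
    using closed_disc_split_set [OF B] by blast
  obtain B1' B2' where s': "closed_disc B1' (S1' \<union> F')" "closed_disc B2' (S2' \<union> F')" "B1' \<union> B2' = B'" "B1' \<inter> B2' = F'"
    using closed_disc_split_set [OF B'] by blast
  have h1: "homeomorphism (S1 \<union> F) (S1' \<union> F') \<theta> \<theta>'"
    by (rule homeomorphism_restrict [OF \<theta>(1)]) (use \<theta> in auto)
  have h2: "homeomorphism (S2 \<union> F) (S2' \<union> F') \<theta> \<theta>'"
    by (rule homeomorphism_restrict [OF \<theta>(1)]) (use \<theta> in auto)
  obtain P1 Q1 where P1: "homeomorphism B1 B1' P1 Q1" "\<And>x. x \<in> S1 \<union> F \<Longrightarrow> P1 x = \<theta> x"
    using closed_disc_extend [OF s(1) s'(1) h1] by blast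
  obtain P2 Q2 where P2: "homeomorphism B2 B2' P2 Q2" "\<And>x. x \<in> S2 \<union> F \<Longrightarrow> P2 x = \<theta> x"
    using closed_disc_extend [OF s(2) s'(2) h2] by blast
  have im: "P1 ` (B1 \<inter> B2) = B1' \<inter> B2'"
    unfolding s(4) s'(4) \<theta>(5) [symmetric] using P1(2) by (intro image_cong) auto
  have eq: "P1 x = P2 x" if "x \<in> B1 \<inter> B2" for x
    using that P1(2) P2(2) unfolding s(4) by simp
  obtain H K where H: "homeomorphism (B1 \<union> B2) (B1' \<union> B2') H K"
    "\<And>x. x \<in> B1 \<Longrightarrow> H x = P1 x" "\<And>x. x \<in> B2 \<Longrightarrow> H x = P2 x"
    using homeomorphism_paste [OF P1(1) P2(1) closed_disc_closed [OF s(1)] closed_disc_closed [OF s(2)]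
        closed_disc_closed [OF s'(1)] closed_disc_closed [OF s'(2)] eq im] by blast
  show ?thesis
  proof (rule that [of H K])
    show "homeomorphism B B' H K" using H(1) s(3) s'(3) by simp
    show "H x = \<theta> x" if "x \<in> S1 \<union> S2 \<union> F" for x
    proof (cases "x \<in> S1 \<union> F")
      case True
      then have "x \<in> B1" using closed_disc_subset [OF s(1)] by blast
      then show ?thesis using H(2) P1(2) [OF True] by simp
    next
      case False
      then have x: "x \<in> S2 \<union> F" using that by blast
      then have "x \<in> B2" using closed_disc_subset [OF s(2)] by blast
      then show ?thesis using H(3) P2(2) [OF x] by simp
    qed
  qed
qed

text \<open>A sphere drawn as two discs \<open>D\<close>, \<open>D'\<close> glued along the triangle of the edges
  \<open>E 0\<close>, \<open>E 1\<close>, \<open>E 2\<close>, with each edge doubled by an edge parallel to it: \<open>E 4\<close> inside \<open>D\<close>,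
  \<open>E 3\<close> and \<open>E 5\<close> inside \<open>D'\<close>.\<close>

definition doubled_triangle ::
  "'a::metric_space set \<Rightarrow> 'a set \<Rightarrow> (nat \<Rightarrow> 'a set) \<Rightarrow> 'a \<Rightarrow> 'a \<Rightarrow> 'a \<Rightarrow> bool" where
  "doubled_triangle D D' E a b c \<longleftrightarrow>
     distinct [a, b, c] \<and>
     arc_set (E 0) a b \<and> arc_set (E 1) b c \<and> arc_set (E 2) c a \<and>
     arc_set (E 3) a b \<and> arc_set (E 4) b c \<and> arc_set (E 5) c a \<and>
     E 0 \<inter> E 1 = {b} \<and> E 1 \<inter> E 2 = {c} \<and> E 0 \<inter> E 2 = {a} \<and>
     E 0 \<inter> E 3 = {a, b} \<and> E 1 \<inter> E 3 = {b} \<and> E 2 \<inter> E 3 = {a} \<and>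
     E 0 \<inter> E 4 = {b} \<and> E 1 \<inter> E 4 = {b, c} \<and> E 2 \<inter> E 4 = {c} \<and>
     E 0 \<inter> E 5 = {a} \<and> E 1 \<inter> E 5 = {c} \<and> E 2 \<inter> E 5 = {a, c} \<and> E 3 \<inter> E 5 = {a} \<and>
     closed_disc D (E 0 \<union> E 1 \<union> E 2) \<and> closed_disc D' (E 0 \<union> E 1 \<union> E 2) \<and>
     D \<inter> D' = E 0 \<union> E 1 \<union> E 2 \<and> E 4 \<subseteq> D \<and> E 3 \<subseteq> D' \<and> E 5 \<subseteq> D'"

text \<open>\<open>E 3\<close> cuts \<open>D'\<close> into a digon with sides \<open>E 0\<close>,
  \<open>E 3\<close> and a triangle \<open>B2\<close>. The edge \<open>E 5\<close> without its end
  \<open>a\<close> is connected, misses the cut and contains \<open>c\<close>, so it lies in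
  \<open>B2\<close>.\<close>

lemma doubled_triangle_split:
  assumes "doubled_triangle D D' E a b c"
  obtains B1 B2 where "closed_disc B1 (E 0 \<union> E 3)" "closed_disc B2 (E 2 \<union> (E 1 \<union> E 3))"
    "B1 \<union> B2 = D'" "B1 \<inter> B2 = E 3" "E 5 \<subseteq> B2"
proof -
  note d = assms [unfolded doubled_triangle_def]
  have j: "arc_set (E 1 \<union> E 2) a b"
    using d by (intro arc_set_sym [OF arc_set_join [of _ b c]]) auto
  obtain B1 B2 where B: "closed_disc B1 (E 0 \<union> E 3)" "closed_disc B2 ((E 1 \<union> E 2) \<union> E 3)"
    "B1 \<union> B2 = D'" "B1 \<inter> B2 = E 3"
    by (rule closed_disc_split_set [of D' "E 0" "E 1 \<union> E 2" a b "E 3"])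
       (use d j in \<open>auto simp: Un_assoc\<close>)
  have c5: "connected (E 5 - {a})"
    using d by (intro arc_set_connected_delete [of _ c a]) auto
  have cB2: "c \<in> B2" "c \<in> E 5 - {a}"
    using d closed_disc_subset [OF B(2)] arc_set_ends [of "E 1" b c] arc_set_ends [of "E 5" c a] by auto
  have e: "(E 5 - {a}) \<inter> (B1 \<inter> B2) = {}"
    using d B(4) by auto
  have "E 5 - {a} \<subseteq> B2"
  proof (rule ccontr)
    assume n: "\<not> E 5 - {a} \<subseteq> B2"
    have "closed B1" "closed B2" using B closed_disc_closed by blast+
    moreover have "E 5 - {a} \<subseteq> B1 \<union> B2" using d B(3) by blast
    ultimately show False
      using c5 n cB2 e unfolding connected_closed by blast
  qed
  moreover have "a \<in> B2"
    using d closed_disc_subset [OF B(2)] arc_set_ends [of "E 2" c a] by auto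
  ultimately have "E 5 \<subseteq> B2" by blast
  moreover have "(E 1 \<union> E 2) \<union> E 3 = E 2 \<union> (E 1 \<union> E 3)" by blast
  ultimately show ?thesis using that B by metis
qed

lemma doubled_triangle_inner:
  assumes "doubled_triangle D D' E a b c"
  shows "closed_disc D (E 1 \<union> (E 0 \<union> E 2))" "arc_set (E 1) b c" "arc_set (E 0 \<union> E 2) b c" "arc_set (E 4) b c"
    "E 1 \<inter> (E 0 \<union> E 2) = {b, c}" "E 4 \<subseteq> D" "E 4 \<inter> (E 1 \<union> (E 0 \<union> E 2)) = {b, c}"
proof -
  note d = assms [unfolded doubled_triangle_def]
  have "E 1 \<union> (E 0 \<union> E 2) = E 0 \<union> E 1 \<union> E 2" by blast
  then show "closed_disc D (E 1 \<union> (E 0 \<union> E 2))" using d by simp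
  show "arc_set (E 1) b c" "arc_set (E 4) b c" "E 4 \<subseteq> D" using d by simp_all
  have "arc_set (E 0) a b" "arc_set (E 2) c a" and 0: "E 0 \<inter> E 2 = {a}" using d by simp_all
  then have 1: "arc_set (E 0) b a" "arc_set (E 2) a c" "E 0 \<inter> E 2 = {a}" using arc_set_sym by blast+
  show "arc_set (E 0 \<union> E 2) b c" by (rule arc_set_join [OF 1])
  have i: "E 0 \<inter> E 1 = {b}" "E 1 \<inter> E 2 = {c}" "E 0 \<inter> E 4 = {b}" "E 1 \<inter> E 4 = {b, c}" "E 2 \<inter> E 4 = {c}"
    using d by simp_all
  show "E 1 \<inter> (E 0 \<union> E 2) = {b, c}" using i(1,2) by blast
  show "E 4 \<inter> (E 1 \<union> (E 0 \<union> E 2)) = {b, c}" using i(3-5) by blast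
qed

lemma doubled_triangle_outer:
  assumes "doubled_triangle D D' E a b c"
  shows "arc_set (E 2) c a" "arc_set (E 1 \<union> E 3) c a" "arc_set (E 5) c a"
    "E 2 \<inter> (E 1 \<union> E 3) = {c, a}" "E 5 \<inter> (E 2 \<union> (E 1 \<union> E 3)) = {c, a}"
proof -
  note d = assms [unfolded doubled_triangle_def]
  show "arc_set (E 2) c a" "arc_set (E 5) c a" using d by simp_all
  have "arc_set (E 1) b c" "arc_set (E 3) a b" and 0: "E 1 \<inter> E 3 = {b}" using d by simp_all
  then have 1: "arc_set (E 1) c b" "arc_set (E 3) b a" "E 1 \<inter> E 3 = {b}" using arc_set_sym by blast+
  show "arc_set (E 1 \<union> E 3) c a" by (rule arc_set_join [OF 1])
  have i: "E 1 \<inter> E 2 = {c}" "E 2 \<inter> E 3 = {a}" "E 1 \<inter> E 5 = {c}" "E 2 \<inter> E 5 = {a, c}" "E 3 \<inter> E 5 = {a}"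
    using d by simp_all
  show "E 2 \<inter> (E 1 \<union> E 3) = {c, a}" using i(1,2) by blast
  show "E 5 \<inter> (E 2 \<union> (E 1 \<union> E 3)) = {c, a}" using i(3-5) by blast
qed

text \<open>Three vertices and six edges leave five faces: \<open>D\<close> is cut by
  \<open>E 4\<close>, and \<open>D'\<close> by \<open>E 3\<close> and then by \<open>E 5\<close>.
  The map is extended over the faces and pasted along the edges.\<close>

lemma doubled_triangle_extend:
  fixes D :: "'a::metric_space set" and Z :: "'b::metric_space set"
  assumes D: "doubled_triangle D D' E a b c" and Z: "doubled_triangle Z Z' G a' b' c'"
    and \<theta>: "homeomorphism X X' \<theta> \<theta>'" "\<And>i. i < 6 \<Longrightarrow> E i \<subseteq> X \<and> \<theta> ` E i = G i"
  obtains \<Phi> \<Psi> where "homeomorphism (D \<union> D') (Z \<union> Z') \<Phi> \<Psi>"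
    "\<And>i x. i < 6 \<Longrightarrow> x \<in> E i \<Longrightarrow> \<Phi> x = \<theta> x"
proof -
  note d = D [unfolded doubled_triangle_def] and z = Z [unfolded doubled_triangle_def]
  have t: "E 0 \<subseteq> X" "E 1 \<subseteq> X" "E 2 \<subseteq> X" "E 3 \<subseteq> X" "E 4 \<subseteq> X" "E 5 \<subseteq> X"
    "\<theta> ` E 0 = G 0" "\<theta> ` E 1 = G 1" "\<theta> ` E 2 = G 2" "\<theta> ` E 3 = G 3" "\<theta> ` E 4 = G 4" "\<theta> ` E 5 = G 5"
    using \<theta>(2) by auto
  have X4: "E 1 \<union> (E 0 \<union> E 2) \<union> E 4 \<subseteq> X" "\<theta> ` (E 0 \<union> E 2) = G 0 \<union> G 2"
    using t by (auto simp: image_Un)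
  obtain P Q where P: "homeomorphism D Z P Q" "\<And>x. x \<in> E 1 \<union> (E 0 \<union> E 2) \<union> E 4 \<Longrightarrow> P x = \<theta> x"
    using closed_disc_chord_extend [OF doubled_triangle_inner [OF D] doubled_triangle_inner [OF Z] \<theta>(1)
        X4(1) t(8) X4(2) t(11)] by blast
  obtain B1 B2 where B: "closed_disc B1 (E 0 \<union> E 3)" "closed_disc B2 (E 2 \<union> (E 1 \<union> E 3))"
    "B1 \<union> B2 = D'" "B1 \<inter> B2 = E 3" "E 5 \<subseteq> B2"
    using doubled_triangle_split [OF D] .
  obtain Y1 Y2 where Y: "closed_disc Y1 (G 0 \<union> G 3)" "closed_disc Y2 (G 2 \<union> (G 1 \<union> G 3))"
    "Y1 \<union> Y2 = Z'" "Y1 \<inter> Y2 = G 3" "G 5 \<subseteq> Y2"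
    using doubled_triangle_split [OF Z] .
  have "homeomorphism (E 0 \<union> E 3) (G 0 \<union> G 3) \<theta> \<theta>'"
    by (rule homeomorphism_restrict [OF \<theta>(1)]) (use t in auto)
  then obtain P1 Q1 where P1: "homeomorphism B1 Y1 P1 Q1" "\<And>x. x \<in> E 0 \<union> E 3 \<Longrightarrow> P1 x = \<theta> x"
    using closed_disc_extend [OF B(1) Y(1)] by blast
  have X5: "E 2 \<union> (E 1 \<union> E 3) \<union> E 5 \<subseteq> X" "\<theta> ` (E 1 \<union> E 3) = G 1 \<union> G 3"
    using t by (auto simp: image_Un)
  obtain P2 Q2 where P2: "homeomorphism B2 Y2 P2 Q2"
      "\<And>x. x \<in> E 2 \<union> (E 1 \<union> E 3) \<union> E 5 \<Longrightarrow> P2 x = \<theta> x"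
    using closed_disc_chord_extend [OF B(2) doubled_triangle_outer(1-4) [OF D] B(5) doubled_triangle_outer(5) [OF D]
        Y(2) doubled_triangle_outer(1-4) [OF Z] Y(5) doubled_triangle_outer(5) [OF Z] \<theta>(1)
        X5(1) t(9) X5(2) t(12)] by blast
  have im12: "P1 ` (B1 \<inter> B2) = Y1 \<inter> Y2"
    unfolding B(4) Y(4) t(10) [symmetric] using P1(2) by (intro image_cong) auto
  have eq12: "P1 x = P2 x" if "x \<in> B1 \<inter> B2" for x
    using that P1(2) P2(2) unfolding B(4) by simp
  obtain P' Q' where P': "homeomorphism (B1 \<union> B2) (Y1 \<union> Y2) P' Q'"
    "\<And>x. x \<in> B1 \<Longrightarrow> P' x = P1 x" "\<And>x. x \<in> B2 \<Longrightarrow> P' x = P2 x"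
    using homeomorphism_paste [OF P1(1) P2(1) closed_disc_closed [OF B(1)] closed_disc_closed [OF B(2)]
        closed_disc_closed [OF Y(1)] closed_disc_closed [OF Y(2)] eq12 im12] by blast
  have P'\<theta>: "P' x = \<theta> x" if "x \<in> E 0 \<union> E 1 \<union> E 2 \<union> E 3 \<union> E 5" for x
  proof (cases "x \<in> E 0 \<union> E 3")
    case True
    then have "x \<in> B1" using closed_disc_subset [OF B(1)] by blast
    then show ?thesis using P'(2) P1(2) [OF True] by simp
  next
    case False
    then have x: "x \<in> E 2 \<union> (E 1 \<union> E 3) \<union> E 5" using that by blast
    then have "x \<in> B2" using closed_disc_subset [OF B(2)] B(5) by blast
    then show ?thesis using P'(3) P2(2) [OF x] by simp
  qed
  have C: "D \<inter> D' = E 0 \<union> E 1 \<union> E 2" "Z \<inter> Z' = G 0 \<union> G 1 \<union> G 2" using d z by simp_all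
  have "P ` (D \<inter> D') = \<theta> ` (D \<inter> D')"
    using P(2) unfolding C by (intro image_cong) auto
  also have "\<dots> = Z \<inter> Z'" unfolding C image_Un t ..
  finally have im: "P ` (D \<inter> D') = Z \<inter> Z'" .
  have eq: "P x = P' x" if "x \<in> D \<inter> D'" for x
    using that P(2) P'\<theta> unfolding C by auto
  have cl: "closed D" "closed D'" "closed Z" "closed Z'"
    using d z by (auto intro: closed_disc_closed)
  obtain H K where H: "homeomorphism (D \<union> D') (Z \<union> Z') H K"
    "\<And>x. x \<in> D \<Longrightarrow> H x = P x" "\<And>x. x \<in> D' \<Longrightarrow> H x = P' x"
    using homeomorphism_paste [OF P(1) P'(1) [unfolded B(3) Y(3)] cl eq im] by blast
  show ?thesis
  proof (rule that [OF H(1)])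
    fix i :: nat and x assume "i < 6" and x: "x \<in> E i"
    then consider "i = 0" | "i = 1" | "i = 2" | "i = 3" | "i = 4" | "i = 5" by linarith
    then show "H x = \<theta> x"
    proof cases
      case 5
      then show ?thesis using x H(2) P(2) d by auto
    next
      case 4
      then have "x \<in> D'" using x d by blast
      then show ?thesis using x H(3) P'\<theta> 4 by auto
    next
      case 6
      then have "x \<in> D'" using x d by blast
      then show ?thesis using x H(3) P'\<theta> 6 by auto
    next
      case 1
      then have "x \<in> D'" using x C(1) by blast
      then show ?thesis using x H(3) P'\<theta> 1 by auto
    next
      case 2
      then have "x \<in> D'" using x C(1) by blast
      then show ?thesis using x H(3) P'\<theta> 2 by auto
    next
      case 3
      then have "x \<in> D'" using x C(1) by blast
      then show ?thesis using x H(3) P'\<theta> 3 by auto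
    qed
  qed
qed

section \<open>Stereographic projection and Jordan curves on the sphere\<close>

definition north_pole :: "complex \<times> real" where
  "north_pole = (0, 1)"

definition from_sphere :: "complex \<times> real \<Rightarrow> complex" where
  "from_sphere x = fst x / of_real (1 - snd x)"

abbreviation sphere2 :: "(complex \<times> real) set" where
  "sphere2 \<equiv> sphere 0 1"

lemma from_to_sphere [simp]: "from_sphere (to_sphere z) = z"
proof -
  have D: "(cmod z)\<^sup>2 + 1 > 0" by (simp add: add_nonneg_pos)
  have "1 - ((cmod z)\<^sup>2 - 1) / ((cmod z)\<^sup>2 + 1) = 2 / ((cmod z)\<^sup>2 + 1)"
    using D by (simp add: field_simps)
  then have "from_sphere (to_sphere z) = of_real (2 / ((cmod z)\<^sup>2 + 1)) * z / of_real (2 / ((cmod z)\<^sup>2 + 1))"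
    unfolding from_sphere_def to_sphere_def fst_conv snd_conv scaleR_conv_of_real by simp
  also have "\<dots> = z" using D by (intro nonzero_mult_div_cancel_left) (simp only: of_real_eq_0_iff divide_eq_0_iff, simp)
  finally show ?thesis .
qed

lemma sphere2_iff: "x \<in> sphere2 \<longleftrightarrow> (cmod (fst x))\<^sup>2 + (snd x)\<^sup>2 = 1"
  by (cases x) (simp add: norm_prod_def)

lemma to_sphere_in: "to_sphere z \<in> sphere2" "to_sphere z \<noteq> north_pole"
proof -
  define r where "r = (cmod z)\<^sup>2"
  have r: "r + 1 > 0" unfolding r_def by (simp add: add_nonneg_pos)
  have "(cmod (fst (to_sphere z)))\<^sup>2 + (snd (to_sphere z))\<^sup>2 = (4 * r + (r - 1)\<^sup>2) / (r + 1)\<^sup>2"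
    unfolding to_sphere_def r_def by (simp add: power_mult_distrib power_divide add_divide_distrib)
  also have "4 * r + (r - 1)\<^sup>2 = (r + 1)\<^sup>2" by (simp add: power2_eq_square algebra_simps)
  finally show "to_sphere z \<in> sphere2" unfolding sphere2_iff using r by simp
  have "snd (to_sphere z) \<noteq> 1" unfolding to_sphere_def r_def [symmetric] using r by (simp add: field_simps)
  then show "to_sphere z \<noteq> north_pole" unfolding north_pole_def by auto
qed

lemma to_from_sphere:
  assumes "x \<in> sphere2" "x \<noteq> north_pole"
  shows "to_sphere (from_sphere x) = x"
proof -
  obtain w h where x: "x = (w, h)" by fastforce
  have s: "(cmod w)\<^sup>2 + h\<^sup>2 = 1" using assms(1) unfolding sphere2_iff x by simp
  have h1: "h \<noteq> 1"
  proof
    assume "h = 1"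
    then have "w = 0" using s by simp
    then show False using assms(2) \<open>h = 1\<close> unfolding x north_pole_def by simp
  qed
  have "(cmod (from_sphere x))\<^sup>2 = (cmod w)\<^sup>2 / (1 - h)\<^sup>2"
    unfolding from_sphere_def x by (simp add: norm_divide power_divide del: of_real_diff)
  also have "(cmod w)\<^sup>2 = (1 - h) * (1 + h)" using s by (simp add: power2_eq_square algebra_simps)
  finally have n: "(cmod (from_sphere x))\<^sup>2 = (1 + h) / (1 - h)"
    using h1 by (simp add: power2_eq_square)
  have a: "(cmod (from_sphere x))\<^sup>2 + 1 = 2 / (1 - h)" "(cmod (from_sphere x))\<^sup>2 - 1 = 2 * h / (1 - h)"
    unfolding n using h1 by (simp_all add: field_simps)
  have "(1 - h) *\<^sub>R from_sphere x = w"
    unfolding from_sphere_def x scaleR_conv_of_real using h1 by (simp del: of_real_diff)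
  moreover have "to_sphere (from_sphere x) = ((1 - h) *\<^sub>R from_sphere x, h)"
    unfolding to_sphere_def a using h1 by simp
  ultimately show ?thesis
    using x by simp
qed

lemma continuous_to_sphere: "continuous_on S to_sphere"
  unfolding to_sphere_def
  by (intro continuous_intros) (simp_all add: add_nonneg_eq_0_iff)

lemma inj_to_sphere: "inj to_sphere"
  by (metis from_to_sphere injI)

lemma range_to_sphere: "range to_sphere = sphere2 - {north_pole}"
proof (intro equalityI subsetI)
  fix x assume "x \<in> sphere2 - {north_pole}"
  then have "to_sphere (from_sphere x) = x" by (intro to_from_sphere) auto
  then show "x \<in> range to_sphere" by (metis rangeI)
next
  fix x assume "x \<in> range to_sphere"
  then obtain z where "x = to_sphere z" by blast
  then show "x \<in> sphere2 - {north_pole}" using to_sphere_in [of z] by simp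
qed

lemma to_sphere_at_infinity: "(to_sphere \<longlongrightarrow> north_pole) at_infinity"
proof -
  have n: "filterlim (\<lambda>z::complex. 1 + (cmod z)\<^sup>2) at_top at_infinity"
    by (intro filterlim_tendsto_add_at_top [OF tendsto_const] filterlim_pow_at_top filterlim_norm_at_top) auto
  then have i: "((\<lambda>z::complex. inverse (1 + (cmod z)\<^sup>2)) \<longlongrightarrow> 0) at_infinity"
    by (rule tendsto_inverse_0_at_top)
  have 2: "((\<lambda>z. snd (to_sphere z)) \<longlongrightarrow> 1) at_infinity"
  proof -
    have "((\<lambda>z::complex. 1 - 2 * inverse (1 + (cmod z)\<^sup>2)) \<longlongrightarrow> 1 - 2 * 0) at_infinity"
      by (intro tendsto_intros i)
    moreover have "snd (to_sphere z) = 1 - 2 * inverse (1 + (cmod z)\<^sup>2)" for z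
    proof -
      have "(cmod z)\<^sup>2 + 1 \<noteq> 0" by (metis add_nonneg_pos less_irrefl zero_le_power2 zero_less_one)
      then show ?thesis unfolding to_sphere_def by (simp add: field_simps)
    qed
    ultimately show ?thesis by simp
  qed
  have "((\<lambda>z. sqrt (1 - (snd (to_sphere z))\<^sup>2)) \<longlongrightarrow> sqrt (1 - 1\<^sup>2)) at_infinity"
    by (intro tendsto_intros 2)
  moreover have "norm (fst (to_sphere z)) = sqrt (1 - (snd (to_sphere z))\<^sup>2)" for z
  proof -
    have "(cmod (fst (to_sphere z)))\<^sup>2 = 1 - (snd (to_sphere z))\<^sup>2"
      using to_sphere_in(1) [of z] unfolding sphere2_iff by simp
    then show ?thesis by (metis norm_ge_zero real_sqrt_unique)
  qed
  ultimately have "((\<lambda>z. norm (fst (to_sphere z))) \<longlongrightarrow> 0) at_infinity"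
    by simp
  then have "((\<lambda>z. fst (to_sphere z)) \<longlongrightarrow> 0) at_infinity"
    by (rule tendsto_norm_zero_cancel)
  from tendsto_Pair [OF this 2] show ?thesis
    unfolding north_pole_def by simp
qed

text \<open>The image of the inside without \<open>a\<close> is connected, unbounded and off the new
  curve, so it lies outside that curve; the image of the outside together with \<open>0\<close> is
  connected and has to be the whole inside. This opens the outer region to the Schoenflies
  theorem.\<close>

lemma outside_inversion:
  fixes c :: "real \<Rightarrow> complex"
  assumes c: "simple_path c" "pathfinish c = pathstart c" and a: "a \<in> inside (path_image c)"
  defines "ivs \<equiv> (\<lambda>z. 1 / (z - a))"
  shows "simple_path (ivs \<circ> c)" "pathfinish (ivs \<circ> c) = pathstart (ivs \<circ> c)"
    "inside (path_image (ivs \<circ> c)) = insert 0 (ivs ` outside (path_image c))"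
proof -
  note J = Jordan_inside_outside [OF c]
  let ?J = "path_image c"
  have aJ: "a \<notin> ?J" using a inside_no_overlap [of ?J] by blast
  have inj: "inj_on ivs (- {a})" unfolding ivs_def inj_on_def by auto
  have ci: "continuous_on (- {a}) ivs" unfolding ivs_def by (intro continuous_intros) auto
  have sub: "?J \<subseteq> - {a}" using aJ by blast
  show sp: "simple_path (ivs \<circ> c)"
    by (rule simple_path_continuous_image [OF c(1)]) (use ci inj sub in \<open>auto intro: continuous_on_subset inj_on_subset\<close>)
  show lp: "pathfinish (ivs \<circ> c) = pathstart (ivs \<circ> c)"
    using c(2) by (simp add: pathfinish_compose pathstart_compose)
  note K = Jordan_inside_outside [OF sp lp]
  let ?K = "path_image (ivs \<circ> c)"
  have Kim: "?K = ivs ` ?J" by (rule path_image_compose)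
  define W where "W = insert 0 (ivs ` outside ?J)"
  define V where "V = ivs ` (inside ?J - {a})"
  have aO: "a \<notin> outside ?J" using a J by blast
  have io: "inside ?J \<inter> outside ?J = {}" "inside ?J \<inter> ?J = {}" "outside ?J \<inter> ?J = {}"
    "inside ?J \<union> outside ?J \<union> ?J = UNIV"
    using inside_no_overlap [of ?J] outside_no_overlap [of ?J] inside_Int_outside [of ?J]
      inside_Un_outside [of ?J] by auto
  have inv_in: "ivs z \<in> ivs ` S \<longleftrightarrow> z \<in> S" if "z \<noteq> a" "a \<notin> S" for z S
    using inj that unfolding inj_on_def by auto
  have inv0: "ivs z \<noteq> 0" if "z \<noteq> a" for z using that unfolding ivs_def by simp
  have WK: "W \<inter> ?K = {}"
  proof -
    have "ivs ` outside ?J \<inter> ?K = ivs ` (outside ?J \<inter> ?J)"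
      unfolding Kim by (rule inj_on_image_Int [OF inj, symmetric]) (use sub aO in auto)
    moreover have "0 \<notin> ?K" unfolding Kim using inv0 aJ by force
    ultimately show ?thesis unfolding W_def using io(3) by simp
  qed
  have VK: "V \<inter> ?K = {}"
  proof -
    have "V \<inter> ?K = ivs ` ((inside ?J - {a}) \<inter> ?J)"
      unfolding V_def Kim by (rule inj_on_image_Int [OF inj, symmetric]) (use sub in auto)
    then show ?thesis using io(2) by blast
  qed
  have cov: "W \<union> V \<union> ?K = UNIV"
  proof -
    have "w \<in> W \<union> V \<union> ?K" for w
    proof (cases "w = 0")
      case False
      define z where "z = a + 1 / w"
      have z: "w = ivs z" "z \<noteq> a" unfolding z_def ivs_def using False by auto
      have "z \<in> inside ?J \<union> outside ?J \<union> ?J" using io by simp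
      then show ?thesis unfolding z(1) W_def V_def Kim using z(2) by blast
    qed (simp add: W_def)
    then show ?thesis by blast
  qed
  have conV: "connected V"
    unfolding V_def using J
    by (intro connected_continuous_image continuous_on_subset [OF ci] connected_open_delete) auto
  have unbV: "\<not> bounded V"
  proof
    assume "bounded V"
    then obtain B where B: "\<And>v. v \<in> V \<Longrightarrow> cmod v \<le> B" unfolding bounded_iff by blast
    obtain e where e: "e > 0" "ball a e \<subseteq> inside ?J"
      using J a open_contains_ball by metis
    define d where "d = min (e/2) (1 / (\<bar>B\<bar> + 1))"
    have d: "0 < d" "d < e" "d \<le> 1 / (\<bar>B\<bar> + 1)" unfolding d_def using e by (auto simp: min_def)
    have "a + of_real d \<in> inside ?J - {a}" using d e by (auto simp: dist_norm subset_iff)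
    then have "cmod (ivs (a + of_real d)) \<le> B" unfolding V_def using B V_def by blast
    moreover have "cmod (ivs (a + of_real d)) = 1 / d" unfolding ivs_def using d by (simp add: norm_divide)
    moreover have "\<bar>B\<bar> + 1 \<le> 1 / d" using d by (simp add: field_simps)
    ultimately show False by linarith
  qed
  have Vout: "V \<subseteq> outside ?K"
  proof
    fix v assume v: "v \<in> V"
    have "V \<subseteq> connected_component_set (- ?K) v"
      using v conV VK by (intro connected_component_maximal) auto
    then have "\<not> bounded (connected_component_set (- ?K) v)" using unbV bounded_subset by blast
    then show "v \<in> outside ?K" unfolding outside_def using v VK by auto
  qed
  have conW: "connected W"
  proof (rule connected_intermediate_closure [of "ivs ` outside ?J"])
    show "connected (ivs ` outside ?J)"
      using J aO by (intro connected_continuous_image continuous_on_subset [OF ci]) auto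
    show "ivs ` outside ?J \<subseteq> W" unfolding W_def by blast
    have "0 \<in> closure (ivs ` outside ?J)"
      unfolding closure_approachable
    proof (intro allI impI)
      fix e :: real assume e: "e > 0"
      have "\<not> bounded (outside ?J)" using J by blast
      then obtain z where z: "z \<in> outside ?J" "cmod z > cmod a + 1 / e"
        unfolding bounded_iff by (metis linorder_not_le)
      have "cmod (z - a) > 1 / e" using z(2) norm_triangle_ineq2 [of z a] by linarith
      then have "1 / cmod (z - a) < e" using e
        by (metis divide_less_eq divide_pos_pos mult.commute less_trans pos_divide_less_eq zero_less_one)
      then show "\<exists>y\<in>ivs ` outside ?J. dist y 0 < e"
        using z(1) by (intro bexI [of _ "ivs z"]) (auto simp: ivs_def norm_divide)
    qed
    then show "W \<subseteq> closure (ivs ` outside ?J)" unfolding W_def using closure_subset by simp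
  qed
  have inW: "inside ?K \<subseteq> W"
    using cov Vout inside_no_overlap [of ?K] inside_Int_outside [of ?K] by blast
  have "W \<subseteq> inside ?K"
  proof (rule ccontr)
    assume "\<not> W \<subseteq> inside ?K"
    moreover have "W \<subseteq> inside ?K \<union> outside ?K" using WK inside_Un_outside [of ?K] by blast
    ultimately have "outside ?K \<inter> W \<noteq> {}" by blast
    moreover have "inside ?K \<inter> W \<noteq> {}" using inW K by blast
    ultimately show False
      using connectedD [OF conW, of "inside ?K" "outside ?K"] K \<open>W \<subseteq> inside ?K \<union> outside ?K\<close>
        inside_Int_outside [of ?K] by blast
  qed
  then show "inside ?K = insert 0 (ivs ` outside ?J)" using inW unfolding W_def by blast
qed

lemma sphere_split_Jordan:
  fixes c :: "real \<Rightarrow> complex"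
  assumes c: "simple_path c" "pathfinish c = pathstart c"
  obtains D D' where "closed_disc D (to_sphere ` path_image c)" "closed_disc D' (to_sphere ` path_image c)"
    "D \<union> D' = sphere2" "D \<inter> D' = to_sphere ` path_image c"
    "to_sphere ` inside (path_image c) \<subseteq> D" "to_sphere ` outside (path_image c) \<subseteq> D'"
proof -
  note J = Jordan_inside_outside [OF c]
  let ?J = "path_image c"
  have disc: "closed_disc (Q ` (path_image g \<union> inside (path_image g))) (Q ` path_image g)"
    if g: "simple_path g" "pathfinish g = pathstart g" and Q: "continuous_on UNIV Q" "inj Q"
    for g :: "real \<Rightarrow> complex" and Q :: "complex \<Rightarrow> complex \<times> real"
  proof -
    let ?S = "path_image g \<union> inside (path_image g)"
    obtain h k where h: "homeomorphism ?S (cball 0 1) h k" "h ` path_image g = sphere (0::complex) 1"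
      using Schoenflies [OF g] by blast
    then have d: "closed_disc ?S (path_image g)" unfolding closed_disc_def by blast
    have "compact ?S" using d by (rule closed_disc_compact)
    then obtain Q' where "homeomorphism ?S (Q ` ?S) Q Q'"
      using homeomorphism_compact [of ?S Q] Q by (metis continuous_on_subset inj_on_subset subset_UNIV)
    then show ?thesis using closed_disc_homeomorphic_image [OF d] by blast
  qed
  obtain a where a: "a \<in> inside ?J" using J by blast
  define ivs where "ivs = (\<lambda>z. 1 / (z - a))"
  note oi = outside_inversion [OF c a, folded ivs_def]
  \<comment> \<open>A chart of the sphere around the north pole: \<open>Q\<close> undoes the
    inversion and sends \<open>0\<close> to the pole, so it carries the disc of the inverted curve
    onto the outer disc on the sphere.\<close>
  define Q where "Q = (\<lambda>w. if w = 0 then north_pole else to_sphere (a + 1 / w))"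
  have Qinv: "Q (ivs z) = to_sphere z" if "z \<noteq> a" for z
    using that unfolding Q_def ivs_def by simp
  have iQ: "inj Q"
  proof (rule injI)
    fix x y assume "Q x = Q y"
    then show "x = y"
      using to_sphere_in(2) inj_to_sphere unfolding Q_def inj_def
      by (auto split: if_splits) (metis to_sphere_in(2), metis add_left_cancel inverse_eq_divide inverse_eq_iff_eq)
  qed
  have cQ: "continuous_on UNIV Q"
    unfolding continuous_on_def
  proof
    fix w :: complex
    show "(Q \<longlongrightarrow> Q w) (at w)"
    proof (cases "w = 0")
      case True
      have "filterlim (\<lambda>w::complex. a + inverse w) at_infinity (at 0)"
        by (rule tendsto_add_filterlim_at_infinity [OF tendsto_const filterlim_inverse_at_infinity])
      then have "((\<lambda>w. to_sphere (a + inverse w)) \<longlongrightarrow> north_pole) (at 0)"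
        by (rule filterlim_compose [OF to_sphere_at_infinity])
      then have "(Q \<longlongrightarrow> north_pole) (at 0)"
        by (rule Lim_transform_eventually) (auto simp: eventually_at_filter Q_def inverse_eq_divide)
      then show ?thesis using True by (simp add: Q_def)
    next
      case False
      have "continuous_on (- {0}) (\<lambda>w. to_sphere (a + 1 / w))"
        by (intro continuous_on_compose2 [OF continuous_to_sphere [of UNIV]] continuous_intros) auto
      then have "continuous_on (- {0}) Q"
        by (rule continuous_on_eq) (auto simp: Q_def)
      then have "isCont Q w"
        using False by (simp add: continuous_on_eq_continuous_at open_Compl)
      then show ?thesis unfolding isCont_def .
    qed
  qed
  have dQ: "closed_disc (Q ` (path_image (ivs \<circ> c) \<union> inside (path_image (ivs \<circ> c)))) (Q ` path_image (ivs \<circ> c))"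
    by (rule disc [OF oi(1,2) cQ iQ])
  have na: "z \<noteq> a" if "z \<in> ?J \<union> outside ?J" for z
    using that a inside_no_overlap [of ?J] inside_Int_outside [of ?J] by blast
  have QJ: "Q ` path_image (ivs \<circ> c) = to_sphere ` ?J"
    unfolding path_image_compose image_image using na by (intro image_cong) (auto simp: Qinv)
  have QO: "Q ` inside (path_image (ivs \<circ> c)) = insert north_pole (to_sphere ` outside ?J)"
  proof -
    have "Q ` ivs ` outside ?J = to_sphere ` outside ?J"
      unfolding image_image using na by (intro image_cong) (auto simp: Qinv)
    moreover have "Q 0 = north_pole" by (simp add: Q_def)
    ultimately show ?thesis unfolding oi(3) by (simp only: image_insert)
  qed
  define D where "D = to_sphere ` (?J \<union> inside ?J)"
  define D' where "D' = to_sphere ` ?J \<union> insert north_pole (to_sphere ` outside ?J)"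
  show ?thesis
  proof (rule that [of D D'])
    show "closed_disc D (to_sphere ` ?J)"
      unfolding D_def by (rule disc [OF c continuous_to_sphere inj_to_sphere])
    show "closed_disc D' (to_sphere ` ?J)"
      using dQ unfolding D'_def image_Un QJ QO .
    have "range to_sphere = to_sphere ` (?J \<union> inside ?J \<union> outside ?J)"
      using inside_Un_outside [of ?J] by (intro arg_cong [of _ _ "image to_sphere"]) blast
    then have "D \<union> D' = insert north_pole (range to_sphere)"
      unfolding D_def D'_def image_Un by blast
    then show "D \<union> D' = sphere2"
      unfolding range_to_sphere by (simp add: north_pole_def insert_absorb)
    have "to_sphere ` (?J \<union> inside ?J) \<inter> to_sphere ` outside ?J = to_sphere ` ((?J \<union> inside ?J) \<inter> outside ?J)"
      by (rule image_Int [OF inj_to_sphere, symmetric])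
    also have "(?J \<union> inside ?J) \<inter> outside ?J = {}"
      using inside_Int_outside [of ?J] outside_no_overlap [of ?J] by blast
    finally have "D \<inter> to_sphere ` outside ?J = {}" unfolding D_def by simp
    moreover have "north_pole \<notin> D" unfolding D_def by (metis imageE to_sphere_in(2))
    moreover have "to_sphere ` ?J \<subseteq> D" unfolding D_def by blast
    ultimately show "D \<inter> D' = to_sphere ` ?J"
      unfolding D'_def by blast
    show "to_sphere ` inside ?J \<subseteq> D" "to_sphere ` outside ?J \<subseteq> D'"
      unfolding D_def D'_def by auto
  qed
qed

section \<open>Curves traversed like the trefoil projection\<close>

text \<open>Closed curves traversed as in the trefoil projection: the parameter has period \<open>6\<close>, the double
  points are at the integers modulo \<open>3\<close>.  The last clause expresses that the curve crosses itself at
  the double points \<open>n + 1\<close> and \<open>n + 2\<close>: the arc from \<open>n\<close> to \<open>n + 3\<close> is a closed curve,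
  and the rest of the curve changes sides there.\<close>

definition trefoil_curve :: "(real \<Rightarrow> complex) \<Rightarrow> bool" where
  "trefoil_curve \<kappa> \<longleftrightarrow> continuous_on UNIV \<kappa> \<and>
     (\<forall>s t::real. \<kappa> s = \<kappa> t \<longleftrightarrow> (\<exists>n::int. s - t = 6 * real_of_int n) \<or> (s \<in> \<int> \<and> t \<in> \<int> \<and> (\<exists>n::int. s - t = 3 * real_of_int n))) \<and>
     (\<forall>n::int. \<forall>j\<in>{1, 2::real}.
        \<not> connected_component (- (\<kappa> ` {of_int n..of_int n + 3})) (\<kappa> (n + j + 5/2)) (\<kappa> (n + j + 7/2)))"

lemma trefoil_curve_continuous: "trefoil_curve \<kappa> \<Longrightarrow> continuous_on S \<kappa>"
  unfolding trefoil_curve_def by (meson continuous_on_subset subset_UNIV)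

lemma trefoil_curve_eq_iff:
  "trefoil_curve \<kappa> \<Longrightarrow> \<kappa> s = \<kappa> t \<longleftrightarrow>
     (\<exists>n::int. s - t = 6 * real_of_int n) \<or> (s \<in> \<int> \<and> t \<in> \<int> \<and> (\<exists>n::int. s - t = 3 * real_of_int n))"
  unfolding trefoil_curve_def by blast

lemma trefoil_curve_separates:
  "trefoil_curve \<kappa> \<Longrightarrow> j \<in> {1, 2} \<Longrightarrow>
     \<not> connected_component (- (\<kappa> ` {of_int n..of_int n + 3})) (\<kappa> (n + j + 5/2)) (\<kappa> (n + j + 7/2))"
  unfolding trefoil_curve_def by blast

lemma trefoil_curve_periodic:
  assumes "trefoil_curve \<kappa>" shows "\<kappa> (t + 6 * of_int n) = \<kappa> t"
  unfolding trefoil_curve_eq_iff [OF assms] by (intro disjI1 exI [of _ n]) simp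

text \<open>Any passage can serve as the starting point; patterns of signs at the double points are
  normalised in this way.\<close>

lemma trefoil_curve_shift:
  assumes "trefoil_curve \<kappa>"
  shows "trefoil_curve (\<lambda>t. \<kappa> (t + of_int k))"
proof -
  have im: "(\<lambda>t. \<kappa> (t + of_int k)) ` {of_int n..of_int n + 3} = \<kappa> ` {of_int (n + k)..of_int (n + k) + 3}" for n
  proof -
    have "(\<lambda>t. t + of_int k) ` {of_int n..of_int n + 3} = {of_int (n + k)..of_int (n + k) + (3::real)}"
      by (simp add: algebra_simps)
    then show ?thesis by (metis (no_types, lifting) image_cong image_image)
  qed
  show ?thesis
    unfolding trefoil_curve_def
  proof (intro conjI allI ballI)
    show "continuous_on UNIV (\<lambda>t. \<kappa> (t + of_int k))"
      by (rule continuous_on_compose2 [OF trefoil_curve_continuous [OF assms, of UNIV]]) (auto intro: continuous_intros)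
    show "\<kappa> (s + of_int k) = \<kappa> (t + of_int k) \<longleftrightarrow>
        (\<exists>n::int. s - t = 6 * real_of_int n) \<or> (s \<in> \<int> \<and> t \<in> \<int> \<and> (\<exists>n::int. s - t = 3 * real_of_int n))" for s t
      unfolding trefoil_curve_eq_iff [OF assms] by simp
    fix n :: int and j :: real assume "j \<in> {1, 2}"
    then show "\<not> connected_component (- (\<lambda>t. \<kappa> (t + of_int k)) ` {of_int n..of_int n + 3})
        (\<kappa> (n + j + 5/2 + of_int k)) (\<kappa> (n + j + 7/2 + of_int k))"
      using trefoil_curve_separates [OF assms, of j "n + k"] unfolding im by (simp add: algebra_simps)
  qed
qed

lemma trefoil_curve_of_int_eq_iff:
  assumes \<kappa>: "trefoil_curve \<kappa>"
  shows "\<kappa> (of_int i) = \<kappa> (of_int j) \<longleftrightarrow> i mod 3 = j mod 3"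
proof -
  have "real_of_int i - real_of_int j = real_of_int m * real_of_int n \<longleftrightarrow> i - j = m * n" for m n
    by (metis of_int_diff of_int_eq_iff of_int_mult)
  from this [of 6] this [of 3]
  have "\<kappa> (real_of_int i) = \<kappa> (real_of_int j) \<longleftrightarrow> (\<exists>n. i - j = 6 * n) \<or> (\<exists>n. i - j = 3 * n)"
    unfolding trefoil_curve_eq_iff [OF \<kappa>] by simp
  also have "\<dots> \<longleftrightarrow> 6 dvd i - j \<or> 3 dvd i - j" by (simp only: dvd_def)
  also have "\<dots> \<longleftrightarrow> 3 dvd i - j" by presburger
  finally show ?thesis by (simp add: mod_eq_dvd_iff)
qed

text \<open>A continuous map from a compact set to a Hausdorff space is closed, hence a quotient map
  onto its image, and maps that are constant on its fibres descend.\<close>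

lemma continuous_on_factor:
  fixes \<kappa> :: "'a::topological_space \<Rightarrow> 'b::t2_space" and \<kappa>' :: "'a \<Rightarrow> 'c::topological_space"
  assumes "compact K" "continuous_on K \<kappa>" "continuous_on K \<kappa>'"
    and eq: "\<And>s t. \<lbrakk>s \<in> K; t \<in> K; \<kappa> s = \<kappa> t\<rbrakk> \<Longrightarrow> \<kappa>' s = \<kappa>' t"
  obtains \<theta> where "continuous_on (\<kappa> ` K) \<theta>" "\<And>t. t \<in> K \<Longrightarrow> \<theta> (\<kappa> t) = \<kappa>' t"
proof -
  define \<theta> where "\<theta> = (\<lambda>x. \<kappa>' (SOME t. t \<in> K \<and> \<kappa> t = x))"
  have \<theta>: "\<theta> (\<kappa> t) = \<kappa>' t" if "t \<in> K" for t
  proof -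
    have "(SOME s. s \<in> K \<and> \<kappa> s = \<kappa> t) \<in> K \<and> \<kappa> (SOME s. s \<in> K \<and> \<kappa> s = \<kappa> t) = \<kappa> t"
      using someI [of "\<lambda>s. s \<in> K \<and> \<kappa> s = \<kappa> t" t] that by blast
    then show ?thesis unfolding \<theta>_def using eq that by blast
  qed
  have "compact (\<kappa> ` K)" using assms by (intro compact_continuous_image)
  then have cl: "closed (\<kappa> ` K)" by (rule compact_imp_closed)
  have "continuous_on (\<kappa> ` K) \<theta>"
    unfolding continuous_on_closed_vimage [OF cl]
  proof (intro allI impI)
    fix T :: "'c set" assume T: "closed T"
    obtain A where A: "closed A" "A \<inter> K = \<kappa>' -` T \<inter> K"
      using assms(3) T unfolding continuous_on_closed_invariant by blast
    have "\<theta> -` T \<inter> \<kappa> ` K = \<kappa> ` (K \<inter> A)"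
      using \<theta> A(2) by auto
    moreover have "compact (\<kappa> ` (K \<inter> A))"
      using assms(1,2) A(1) by (intro compact_continuous_image compact_Int_closed) (auto intro: continuous_on_subset)
    ultimately show "closed (\<theta> -` T \<inter> \<kappa> ` K)" by (simp add: compact_imp_closed)
  qed
  then show ?thesis using that \<theta> by blast
qed

lemma trefoil_curve_range:
  assumes "trefoil_curve \<kappa>" shows "range \<kappa> = \<kappa> ` {0..6}"
proof -
  have "\<kappa> t \<in> \<kappa> ` {0..6}" for t
  proof -
    define n where "n = \<lfloor>t / 6\<rfloor>"
    have "of_int n \<le> t / 6" "t / 6 < of_int n + 1" unfolding n_def by linarith+
    then have "t - 6 * n \<in> {0..6}" by auto
    moreover have "\<kappa> t = \<kappa> (t - 6 * n)" using trefoil_curve_periodic [OF assms, of "t - 6 * n" n] by simp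
    ultimately show ?thesis by blast
  qed
  then show ?thesis by blast
qed

text \<open>By induction the hypotheses give agreement at all parameters that the curve identifies.
  The lemma is applied to a second curve of the same kind and to corrections of height
  functions.\<close>

lemma trefoil_curve_factor:
  fixes \<kappa>' :: "real \<Rightarrow> 'c::topological_space"
  assumes "trefoil_curve \<kappa>" "continuous_on UNIV \<kappa>'" "\<And>t. \<kappa>' (t + 6) = \<kappa>' t" "\<And>i::int. \<kappa>' (of_int i) = \<kappa>' (of_int i + 3)"
  obtains \<theta> where "continuous_on (range \<kappa>) \<theta>" "\<And>t. \<theta> (\<kappa> t) = \<kappa>' t"
proof -
  have p6: "\<kappa>' (t + 6 * of_int n) = \<kappa>' t" for t and n :: int
  proof (induction n)
    case (nonneg n)
    show ?case
    proof (induction n)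
      case (Suc n)
      then show ?case using assms(3) [of "t + 6 * real n"] by (simp add: algebra_simps)
    qed simp
  next
    case (neg n)
    show ?case
    proof (induction n)
      case 0
      show ?case using assms(3) [of "t - 6"] by simp
    next
      case (Suc n)
      then show ?case using assms(3) [of "t - 6 * (real n + 2)"] by (simp add: algebra_simps)
    qed
  qed
  have p3: "\<kappa>' (i + 3 * of_int n) = \<kappa>' (of_int i)" for i n :: int
  proof (induction n)
    case (nonneg n)
    show ?case
    proof (induction n)
      case (Suc n)
      then show ?case using assms(4) [of "i + 3 * int n"] by (simp add: algebra_simps)
    qed simp
  next
    case (neg n)
    show ?case
    proof (induction n)
      case 0
      show ?case using assms(4) [of "i - 3"] by simp
    next
      case (Suc n)
      then show ?case using assms(4) [of "i - 3 * (int n + 2)"] by (simp add: algebra_simps)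
    qed
  qed
  have eq: "\<kappa>' s = \<kappa>' t" if st: "\<kappa> s = \<kappa> t" for s t
  proof -
    consider n :: int where "s - t = 6 * real_of_int n" | n :: int where "t \<in> \<int>" "s - t = 3 * real_of_int n"
      using st unfolding trefoil_curve_eq_iff [OF assms(1)] by blast
    then show ?thesis
    proof cases
      case (1 n)
      then have "s = t + 6 * real_of_int n" by simp
      then show ?thesis using p6 by simp
    next
      case (2 n)
      then obtain i :: int where "t = i" by (auto elim: Ints_cases)
      moreover from this 2 have "s = real_of_int i + 3 * real_of_int n" by simp
      ultimately show ?thesis using p3 by simp
    qed
  qed
  have c: "continuous_on {0..6} \<kappa>" "continuous_on {0..6} \<kappa>'"
    by (rule trefoil_curve_continuous [OF assms(1)], rule continuous_on_subset [OF assms(2)]) simp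
  have eq': "\<kappa>' s = \<kappa>' t" if "s \<in> {0..6}" "t \<in> {0..6}" "\<kappa> s = \<kappa> t" for s t using eq that by blast
  have "\<exists>\<theta>. continuous_on (\<kappa> ` {0..6}) \<theta> \<and> (\<forall>t\<in>{0..6}. \<theta> (\<kappa> t) = \<kappa>' t)"
    by (rule continuous_on_factor [OF compact_Icc c eq']) blast+
  then obtain \<theta> where \<theta>: "continuous_on (\<kappa> ` {0..6}) \<theta>" "\<And>t. t \<in> {0..6} \<Longrightarrow> \<theta> (\<kappa> t) = \<kappa>' t"
    by blast
  have "\<theta> (\<kappa> t) = \<kappa>' t" for t
  proof -
    have "\<kappa> t \<in> \<kappa> ` {0..6}" using trefoil_curve_range [OF assms(1)] by blast
    then obtain s where "s \<in> {0..6}" "\<kappa> t = \<kappa> s" by blast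
    then show ?thesis using \<theta>(2) [of s] eq by metis
  qed
  then show ?thesis using that \<theta>(1) trefoil_curve_range [OF assms(1)] by metis
qed

lemma trefoil_curve_edges_Int:
  assumes \<kappa>: "trefoil_curve \<kappa>" and ij: "i < j" "j < 6"
  shows "\<kappa> ` {real i..real i + 1} \<inter> \<kappa> ` {real j..real j + 1}
       = {\<kappa> i, \<kappa> (real i + 1)} \<inter> {\<kappa> j, \<kappa> (real j + 1)}"
proof -
  have unit: "s = real k \<or> s = real k + 1" if "s \<in> \<int>" "real k \<le> s" "s \<le> real k + 1" for s k
  proof -
    obtain n :: int where n: "s = n" using \<open>s \<in> \<int>\<close> by (auto elim: Ints_cases)
    then have "int k \<le> n" "n \<le> int k + 1" using that by linarith+
    then have "n = int k \<or> n = int k + 1" by linarith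
    then show ?thesis using n by auto
  qed
  have *: "(s = i \<or> s = real i + 1) \<and> (t = j \<or> t = real j + 1)"
    if st: "real i \<le> s" "s \<le> real i + 1" "real j \<le> t" "t \<le> real j + 1" "\<kappa> s = \<kappa> t" for s t
  proof -
    consider n :: int where "s - t = 6 * real_of_int n" | "s \<in> \<int>" "t \<in> \<int>"
      using st(5) unfolding trefoil_curve_eq_iff [OF \<kappa>] by blast
    then show ?thesis
    proof cases
      case (1 n)
      have ij': "real i + 1 \<le> real j" "real j \<le> 5" using ij by linarith+
      have "6 * real_of_int n \<le> 0" "6 * real_of_int n \<ge> -6" using 1 st ij' by linarith+
      then have "n = 0 \<or> n = -1" by linarith
      then show ?thesis
      proof
        assume "n = 0"
        then have "s = t" using 1 by simp
        then show ?thesis using st ij' by auto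
      next
        assume "n = -1"
        then have "s = t - 6" using 1 by simp
        then show ?thesis using st ij' by auto
      qed
    next
      case 2
      then show ?thesis using unit st by blast
    qed
  qed
  show ?thesis
  proof (intro equalityI subsetI)
    fix x assume "x \<in> \<kappa> ` {real i..real i + 1} \<inter> \<kappa> ` {real j..real j + 1}"
    then obtain s t where st: "real i \<le> s" "s \<le> real i + 1" "real j \<le> t" "t \<le> real j + 1"
      "x = \<kappa> s" "x = \<kappa> t" by auto
    then have "(s = i \<or> s = real i + 1) \<and> (t = j \<or> t = real j + 1)" by (intro *) auto
    then show "x \<in> {\<kappa> i, \<kappa> (real i + 1)} \<inter> {\<kappa> j, \<kappa> (real j + 1)}"
      using st(5,6) by blast
  qed auto
qed

lemma trefoil_curve_arc:
  assumes "trefoil_curve \<kappa>" "b > 0" "b < 3"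
  shows "arc (\<lambda>t. \<kappa> (a + b * t))"
  unfolding arc_def path_def inj_on_def
proof (intro conjI ballI impI)
  show "continuous_on {0..1} (\<lambda>t. \<kappa> (a + b * t))"
    by (rule continuous_on_compose2 [OF trefoil_curve_continuous [OF assms(1), of UNIV]]) (auto intro!: continuous_intros)
  fix s t assume st: "s \<in> {0..1::real}" "t \<in> {0..1::real}" "\<kappa> (a + b * s) = \<kappa> (a + b * t)"
  have "\<bar>s - t\<bar> \<le> 1" using st by auto
  then have "b * \<bar>s - t\<bar> \<le> b * 1" using assms by (intro mult_left_mono) auto
  then have "b * \<bar>s - t\<bar> < 3" using assms(3) by linarith
  then have lt: "\<bar>(a + b * s) - (a + b * t)\<bar> < 3"
    using assms(2) by (simp add: abs_mult right_diff_distrib [symmetric])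
  have "(a + b * s) - (a + b * t) = 0"
  proof -
    consider n :: int where "(a + b * s) - (a + b * t) = 6 * real_of_int n" | n :: int where "(a + b * s) - (a + b * t) = 3 * real_of_int n"
      using st(3) unfolding trefoil_curve_eq_iff [OF assms(1)] by blast
    then show ?thesis
    proof cases
      case (1 n)
      then have "n = 0" using lt by linarith
      then show ?thesis using 1 by simp
    next
      case (2 n)
      then have "n = 0" using lt by linarith
      then show ?thesis using 2 by simp
    qed
  qed
  then show "s = t" using assms by simp
qed

text \<open>The loop over \<open>{0..3}\<close> is the triangle. By the separation clause the three
  open edges between 3 and 6 lie alternately on its two sides; the side of the middle edge only
  decides which of the two discs is called \<open>D\<close>.\<close>

lemma trefoil_curve_doubled_triangle:
  assumes \<kappa>: "trefoil_curve \<kappa>"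
  obtains D D' where
    "doubled_triangle D D' (\<lambda>i. to_sphere ` \<kappa> ` {real i..real i + 1}) (to_sphere (\<kappa> 0)) (to_sphere (\<kappa> 1)) (to_sphere (\<kappa> 2))"
    "D \<union> D' = sphere2"
proof -
  note int3 = trefoil_curve_of_int_eq_iff [OF \<kappa>]
  have v: "\<kappa> 3 = \<kappa> 0" "\<kappa> 4 = \<kappa> 1" "\<kappa> 5 = \<kappa> 2" "\<kappa> 6 = \<kappa> 0" "\<kappa> 0 \<noteq> \<kappa> 1" "\<kappa> 1 \<noteq> \<kappa> 2" "\<kappa> 0 \<noteq> \<kappa> 2"
    using int3 [of 3 0] int3 [of 4 1] int3 [of 5 2] int3 [of 6 0] int3 [of 0 1] int3 [of 1 2] int3 [of 0 2] by auto
  have inj: "to_sphere x = to_sphere y \<longleftrightarrow> x = y" for x y using inj_to_sphere by (auto simp: inj_def)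
  define E where "E = (\<lambda>i::nat. to_sphere ` \<kappa> ` {real i..real i + 1})"
  define a where "a = to_sphere (\<kappa> 0)"
  define b where "b = to_sphere (\<kappa> 1)"
  define c where "c = to_sphere (\<kappa> 2)"
  have abc: "a \<noteq> b" "b \<noteq> c" "a \<noteq> c" "b \<noteq> a" "c \<noteq> b" "c \<noteq> a" unfolding a_def b_def c_def inj using v by auto
  have Eint: "E i \<inter> E j = {to_sphere (\<kappa> i), to_sphere (\<kappa> (real i + 1))} \<inter> {to_sphere (\<kappa> j), to_sphere (\<kappa> (real j + 1))}"
    if "i < j" "j < 6" for i j
  proof -
    have "E i \<inter> E j = to_sphere ` (\<kappa> ` {real i..real i + 1} \<inter> \<kappa> ` {real j..real j + 1})"
      unfolding E_def using inj_to_sphere by (simp add: image_Int)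
    also have "\<dots> = to_sphere ` ({\<kappa> i, \<kappa> (real i + 1)} \<inter> {\<kappa> j, \<kappa> (real j + 1)})"
      by (simp only: trefoil_curve_edges_Int [OF \<kappa> that])
    also have "\<dots> = to_sphere ` {\<kappa> i, \<kappa> (real i + 1)} \<inter> to_sphere ` {\<kappa> j, \<kappa> (real j + 1)}"
      using inj_to_sphere by (rule image_Int)
    finally show ?thesis by simp
  qed
  have Earc: "arc_set (E i) (to_sphere (\<kappa> i)) (to_sphere (\<kappa> (real i + 1)))" for i
    unfolding arc_set_def
  proof (intro exI conjI)
    let ?p = "to_sphere \<circ> (\<lambda>t. \<kappa> (real i + 1 * t))"
    have "arc (\<lambda>t. \<kappa> (real i + 1 * t))" by (rule trefoil_curve_arc [OF \<kappa>]) auto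
    then show "arc ?p"
      unfolding arc_def using inj_to_sphere
      by (metis comp_inj_on continuous_to_sphere inj_on_subset path_continuous_image subset_UNIV)
    have "path_image ?p = to_sphere ` \<kappa> ` (\<lambda>t. real i + 1 * t) ` {0..1}"
      by (simp only: path_image_def image_image o_def)
    also have "(\<lambda>t. real i + 1 * t) ` {0..1} = {real i..real i + 1}" by simp
    finally show "path_image ?p = E i" unfolding E_def .
    show "pathstart ?p = to_sphere (\<kappa> i)" "pathfinish ?p = to_sphere (\<kappa> (real i + 1))"
      by (simp_all add: pathstart_def pathfinish_def)
  qed
  define g where "g = (\<lambda>t. \<kappa> (3 * t))"
  have pg: "path_image g = \<kappa> ` {0..3}"
  proof -
    have "(\<lambda>t::real. 3 * t) ` {0..1} = {0..3}" by simp
    then show ?thesis unfolding path_image_def g_def by (simp only: image_image [of \<kappa> "\<lambda>t. 3 * t", symmetric])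
  qed
  have sg: "simple_path g"
    unfolding simple_path_def loop_free_def path_def
  proof (intro conjI ballI impI)
    show "continuous_on {0..1} g"
      unfolding g_def
      by (rule continuous_on_compose2 [OF trefoil_curve_continuous [OF \<kappa>, of UNIV]]) (auto intro!: continuous_intros)
    fix s t assume st: "s \<in> {0..1::real}" "t \<in> {0..1::real}" "g s = g t"
    consider n :: int where "3 * s - 3 * t = 6 * real_of_int n" | n :: int where "3 * s - 3 * t = 3 * real_of_int n"
      using st(3) unfolding g_def trefoil_curve_eq_iff [OF \<kappa>] by blast
    then show "s = t \<or> s = 0 \<and> t = 1 \<or> s = 1 \<and> t = 0"
    proof cases
      case (1 n)
      then have "n = 0" using st by auto
      then show ?thesis using 1 by simp
    next
      case (2 n)
      then have "s - t = n" by simp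
      moreover from this have "n = 0 \<or> n = 1 \<or> n = -1" using st by auto
      ultimately show ?thesis using st by auto
    qed
  qed
  have lg: "pathfinish g = pathstart g" unfolding g_def pathfinish_def pathstart_def using v by simp
  note J = Jordan_inside_outside [OF sg lg]
  let ?C = "path_image g"
  have io: "inside ?C \<union> outside ?C = - ?C" using inside_Un_outside by blast
  have open_edge: "\<kappa> ` {i<..<i + 1} \<inter> ?C = {}" if "i \<in> {3, 4, 5}" for i :: real
  proof -
    have False if st: "i < s" "s < i + 1" "0 \<le> t" "t \<le> 3" "\<kappa> s = \<kappa> t" for s t
    proof -
      have ns: "s \<notin> \<int>"
      proof
        assume "s \<in> \<int>"
        then obtain m :: int where "s = m" by (auto elim: Ints_cases)
        moreover obtain m' :: int where "i = m'" using \<open>i \<in> {3, 4, 5}\<close> by (metis insert_iff of_int_numeral singletonD)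
        ultimately have "m' < m" "m < m' + 1" using st by linarith+
        then show False by linarith
      qed
      then obtain n :: int where "s - t = 6 * real_of_int n" using st(5) unfolding trefoil_curve_eq_iff [OF \<kappa>] by blast
      moreover have "0 < s - t" "s - t < 6" using st that \<open>i \<in> {3, 4, 5}\<close> by auto
      ultimately have "0 < n" "n < 1" by linarith+
      then show False by linarith
    qed
    then show ?thesis unfolding pg by force
  qed
  have side: "\<kappa> ` {i<..<i + 1} \<subseteq> S"
    if "i \<in> {3, 4, 5}" "\<kappa> (i + 1/2) \<in> S" "frontier S = ?C" for i :: real and S
  proof (rule ccontr)
    assume "\<not> ?thesis"
    moreover have "\<kappa> (i + 1/2) \<in> \<kappa> ` {i<..<i + 1}" by auto
    moreover have "connected (\<kappa> ` {i<..<i + 1})"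
      using trefoil_curve_continuous [OF \<kappa>] by (intro connected_continuous_image) auto
    ultimately have "\<kappa> ` {i<..<i + 1} \<inter> frontier S \<noteq> {}"
      using that(2) by (intro connected_Int_frontier) blast+
    then show False using open_edge that by auto
  qed
  have pt: "\<kappa> (i + 1/2) \<in> inside ?C \<or> \<kappa> (i + 1/2) \<in> outside ?C" if "i \<in> {3, 4, 5}" for i :: real
  proof -
    have "\<kappa> (i + 1/2) \<in> \<kappa> ` {i<..<i + 1}" by simp
    then show ?thesis using open_edge [OF that] io by blast
  qed
  have same: "connected_component (- ?C) x y" if "x \<in> S" "y \<in> S" "S = inside ?C \<or> S = outside ?C" for x y S
  proof -
    have "connected S" using J that(3) by blast
    moreover have "S \<subseteq> - ?C" using io that(3) by blast
    ultimately show ?thesis unfolding connected_component_def using that(1,2) by blast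
  qed
  have sep: "\<not> connected_component (- ?C) (\<kappa> (7/2)) (\<kappa> (9/2))" "\<not> connected_component (- ?C) (\<kappa> (9/2)) (\<kappa> (11/2))"
    using trefoil_curve_separates [OF \<kappa>, of 1 0] trefoil_curve_separates [OF \<kappa>, of 2 0] unfolding pg by simp_all
  obtain Z Z' where Z: "closed_disc Z (to_sphere ` ?C)" "closed_disc Z' (to_sphere ` ?C)"
    "Z \<union> Z' = sphere2" "Z \<inter> Z' = to_sphere ` ?C"
    "to_sphere ` inside ?C \<subseteq> Z" "to_sphere ` outside ?C \<subseteq> Z'"
    using sphere_split_Jordan [OF sg lg] by blast
  have Cim: "to_sphere ` ?C = E 0 \<union> E 1 \<union> E 2"
  proof -
    have "{0..3} = {0..1} \<union> {1..2} \<union> {2..3::real}" by auto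
    then show ?thesis unfolding pg E_def by (simp add: image_Un)
  qed
  have edge: "E i \<subseteq> X" if "i \<in> {3, 4, 5}" "\<kappa> (real i + 1/2) \<in> S" "frontier S = ?C" "to_sphere ` S \<subseteq> X" "to_sphere ` ?C \<subseteq> X"
    for i :: nat and S X
  proof -
    have "\<kappa> ` {real i<..<real i + 1} \<subseteq> S" by (rule side) (use that in auto)
    moreover have "\<kappa> i \<in> ?C" "\<kappa> (real i + 1) \<in> ?C"
      unfolding pg using that(1) v by auto
    moreover have "{real i..real i + 1} = {real i<..<real i + 1} \<union> {real i, real i + 1}" by auto
    ultimately show ?thesis
      unfolding E_def using that(4,5) by (auto simp: image_Un)
  qed
  have main: "doubled_triangle D D' E a b c"
    if "closed_disc D (to_sphere ` ?C)" "closed_disc D' (to_sphere ` ?C)" "D \<inter> D' = to_sphere ` ?C" "E 4 \<subseteq> D" "E 3 \<subseteq> D'" "E 5 \<subseteq> D'"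
    for D D'
    unfolding doubled_triangle_def
    using that abc Earc [of 0] Earc [of 1] Earc [of 2] Earc [of 3] Earc [of 4] Earc [of 5]
      Eint [of 0 1] Eint [of 1 2] Eint [of 0 2] Eint [of 0 3] Eint [of 1 3] Eint [of 2 3]
      Eint [of 0 4] Eint [of 1 4] Eint [of 2 4] Eint [of 0 5] Eint [of 1 5] Eint [of 2 5] Eint [of 3 5]
    unfolding Cim by (simp add: v a_def [symmetric] b_def [symmetric] c_def [symmetric] insert_commute)
  have sub: "to_sphere ` ?C \<subseteq> Z" "to_sphere ` ?C \<subseteq> Z'" using Z(4) by auto
  have fr: "frontier (inside ?C) = ?C" "frontier (outside ?C) = ?C" using J by auto
  show ?thesis
  proof (cases "\<kappa> (9/2) \<in> inside ?C")
    case True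
    then have "\<kappa> (7/2) \<in> outside ?C" "\<kappa> (11/2) \<in> outside ?C"
      using sep same pt [of 3] pt [of 5] by auto
    then have "E 4 \<subseteq> Z" "E 3 \<subseteq> Z'" "E 5 \<subseteq> Z'"
      using edge [of 4 "inside ?C" Z] edge [of 3 "outside ?C" Z'] edge [of 5 "outside ?C" Z']
        True fr Z(5,6) sub by simp_all
    with Z(1,2,4) have "doubled_triangle Z Z' E a b c" by (rule main)
    then show ?thesis using that Z unfolding E_def a_def b_def c_def by blast
  next
    case False
    then have F: "\<kappa> (9/2) \<in> outside ?C" using pt [of 4] by auto
    then have "\<kappa> (7/2) \<in> inside ?C" "\<kappa> (11/2) \<in> inside ?C"
      using sep same pt [of 3] pt [of 5] by auto
    then have "E 4 \<subseteq> Z'" "E 3 \<subseteq> Z" "E 5 \<subseteq> Z"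
      using edge [of 4 "outside ?C" Z'] edge [of 3 "inside ?C" Z] edge [of 5 "inside ?C" Z]
        F fr Z(5,6) sub by simp_all
    moreover have "Z' \<inter> Z = to_sphere ` ?C" using Z(4) by (simp add: Int_commute)
    ultimately have "doubled_triangle Z' Z E a b c" using Z(1,2) by (intro main)
    then have dt: "doubled_triangle Z' Z (\<lambda>i. to_sphere ` \<kappa> ` {real i..real i + 1}) (to_sphere (\<kappa> 0)) (to_sphere (\<kappa> 1)) (to_sphere (\<kappa> 2))"
      unfolding E_def a_def b_def c_def .
    show ?thesis by (rule that [OF dt]) (use Z(3) in blast)
  qed
qed

text \<open>Both curves identify the same parameters, so matching parameters is a homeomorphism
  between them; it is extended over the five faces.\<close>

theorem trefoil_curves_equivalent:
  assumes \<kappa>: "trefoil_curve \<kappa>" and \<kappa>': "trefoil_curve \<kappa>'"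
  obtains \<Phi> \<Psi> where "homeomorphism sphere2 sphere2 \<Phi> \<Psi>" "\<And>t. \<Phi> (to_sphere (\<kappa> t)) = to_sphere (\<kappa>' t)"
proof -
  have fac: "\<exists>\<theta>. continuous_on (range \<kappa>) \<theta> \<and> (\<forall>t. \<theta> (\<kappa> t) = \<kappa>' t)"
    if "trefoil_curve \<kappa>" "trefoil_curve \<kappa>'" for \<kappa> \<kappa>'
  proof -
    have p: "\<kappa>' (t + 6) = \<kappa>' t" for t
      using trefoil_curve_periodic [OF that(2), of t 1] by simp
    have q: "\<kappa>' (real_of_int i) = \<kappa>' (real_of_int i + 3)" for i
      unfolding trefoil_curve_eq_iff [OF that(2)] by (intro disjI2 conjI exI [of _ "-1"]) auto
    show ?thesis
      by (rule trefoil_curve_factor [OF that(1) trefoil_curve_continuous [OF that(2)]]) (simp add: p, rule q, blast)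
  qed
  obtain \<theta> where \<theta>: "continuous_on (range \<kappa>) \<theta>" "\<And>t. \<theta> (\<kappa> t) = \<kappa>' t" using fac [OF \<kappa> \<kappa>'] by blast
  obtain \<eta> where \<eta>: "continuous_on (range \<kappa>') \<eta>" "\<And>t. \<eta> (\<kappa>' t) = \<kappa> t" using fac [OF \<kappa>' \<kappa>] by blast
  have cfs: "continuous_on (to_sphere ` S) from_sphere" for S
  proof -
    have "snd (to_sphere z) \<noteq> 1" for z
    proof
      assume "snd (to_sphere z) = 1"
      then have "to_sphere z = north_pole"
        using to_sphere_in(1) [of z] unfolding sphere2_iff north_pole_def by (simp add: prod_eq_iff)
      then show False using to_sphere_in(2) by blast
    qed
    then show ?thesis unfolding from_sphere_def by (intro continuous_intros) auto
  qed
  have h: "homeomorphism (to_sphere ` range \<kappa>) (to_sphere ` range \<kappa>')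
      (\<lambda>x. to_sphere (\<theta> (from_sphere x))) (\<lambda>x. to_sphere (\<eta> (from_sphere x)))"
  proof (rule homeomorphismI)
    show "continuous_on (to_sphere ` range \<kappa>) (\<lambda>x. to_sphere (\<theta> (from_sphere x)))"
      by (intro continuous_on_compose2 [OF continuous_to_sphere [of UNIV]] continuous_on_compose2 [OF \<theta>(1)] cfs) auto
    show "continuous_on (to_sphere ` range \<kappa>') (\<lambda>x. to_sphere (\<eta> (from_sphere x)))"
      by (intro continuous_on_compose2 [OF continuous_to_sphere [of UNIV]] continuous_on_compose2 [OF \<eta>(1)] cfs) auto
  qed (auto simp: \<theta> \<eta>)
  obtain D D' where D: "doubled_triangle D D' (\<lambda>i. to_sphere ` \<kappa> ` {real i..real i + 1}) (to_sphere (\<kappa> 0)) (to_sphere (\<kappa> 1)) (to_sphere (\<kappa> 2))"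
    "D \<union> D' = sphere2" using trefoil_curve_doubled_triangle [OF \<kappa>] .
  obtain Z Z' where Z: "doubled_triangle Z Z' (\<lambda>i. to_sphere ` \<kappa>' ` {real i..real i + 1}) (to_sphere (\<kappa>' 0)) (to_sphere (\<kappa>' 1)) (to_sphere (\<kappa>' 2))"
    "Z \<union> Z' = sphere2" using trefoil_curve_doubled_triangle [OF \<kappa>'] .
  have im: "to_sphere ` \<kappa> ` {real i..real i + 1} \<subseteq> to_sphere ` range \<kappa> \<and>
      (\<lambda>x. to_sphere (\<theta> (from_sphere x))) ` to_sphere ` \<kappa> ` {real i..real i + 1} = to_sphere ` \<kappa>' ` {real i..real i + 1}" for i
    by (auto simp: image_image \<theta>)
  obtain \<Phi> \<Psi> where P: "homeomorphism (D \<union> D') (Z \<union> Z') \<Phi> \<Psi>"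
    "\<And>i x. i < 6 \<Longrightarrow> x \<in> to_sphere ` \<kappa> ` {real i..real i + 1} \<Longrightarrow> \<Phi> x = to_sphere (\<theta> (from_sphere x))"
    using doubled_triangle_extend [OF D(1) Z(1) h im] by metis
  show ?thesis
  proof (rule that)
    show "homeomorphism sphere2 sphere2 \<Phi> \<Psi>" using P(1) D(2) Z(2) by simp
    fix t
    have "\<kappa> t \<in> \<kappa> ` {0..6}" using trefoil_curve_range [OF \<kappa>] by blast
    then obtain s where s: "0 \<le> s" "s \<le> 6" "\<kappa> t = \<kappa> s" by auto
    have "\<exists>i<6. s \<in> {real i..real i + 1}"
    proof (cases "s = 6")
      case True
      then show ?thesis by (intro exI [of _ 5]) auto
    next
      case False
      have "real (nat \<lfloor>s\<rfloor>) \<le> s" "s \<le> real (nat \<lfloor>s\<rfloor>) + 1" "nat \<lfloor>s\<rfloor> < 6"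
        using s False by linarith+
      then show ?thesis by (intro exI [of _ "nat \<lfloor>s\<rfloor>"]) auto
    qed
    then obtain i where "i < 6" "s \<in> {real i..real i + 1}" by blast
    then have "\<Phi> (to_sphere (\<kappa> s)) = to_sphere (\<theta> (\<kappa> s))" using P(2) [of i "to_sphere (\<kappa> s)"] by simp
    then show "\<Phi> (to_sphere (\<kappa> t)) = to_sphere (\<kappa>' t)" using s(3) \<theta>(2) by metis
  qed
qed

section \<open>Knots over a curve with three double points\<close>

text \<open>Coning from the origin: each concentric sphere is mapped like the unit sphere, so radii,
  which encode heights later, are preserved.\<close>

lemma homeomorphism_sphere_radial:
  fixes \<Phi> :: "'a::euclidean_space \<Rightarrow> 'a"
  assumes "homeomorphism (sphere 0 1) (sphere 0 1) \<Phi> \<Psi>"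
  obtains F G where "homeomorphism UNIV UNIV F G" "\<And>r x. x \<in> sphere 0 1 \<Longrightarrow> r > 0 \<Longrightarrow> F (r *\<^sub>R x) = r *\<^sub>R \<Phi> x"
proof -
  define ext :: "('a \<Rightarrow> 'a) \<Rightarrow> 'a \<Rightarrow> 'a" where "ext = (\<lambda>\<Phi> x. norm x *\<^sub>R \<Phi> (sgn x))"
  have sgs: "sgn x \<in> sphere 0 1" if "x \<noteq> 0" for x :: 'a using that by (simp add: norm_sgn)
  have nrm: "norm (ext \<Phi> x) = norm x" if h: "homeomorphism (sphere 0 1) (sphere 0 1) \<Phi> \<Psi>" for \<Phi> \<Psi> x
  proof (cases "x = 0")
    case False
    then have "\<Phi> (sgn x) \<in> sphere 0 1" using h sgs homeomorphism_image1 by blast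
    then show ?thesis unfolding ext_def by simp
  qed (simp add: ext_def)
  have cont: "continuous_on UNIV (ext \<Phi>)" if h: "homeomorphism (sphere 0 1) (sphere 0 1) \<Phi> \<Psi>" for \<Phi> \<Psi>
    unfolding continuous_on_def
  proof
    fix x
    show "(ext \<Phi> \<longlongrightarrow> ext \<Phi> x) (at x)"
    proof (cases "x = 0")
      case True
      have "((\<lambda>y::'a. norm y) \<longlongrightarrow> 0) (at 0)"
        using tendsto_norm [OF tendsto_ident_at [of "0::'a" UNIV]] by simp
      then have "(ext \<Phi> \<longlongrightarrow> 0) (at 0)"
        by (rule Lim_null_comparison [rotated]) (simp add: nrm [OF h])
      then show ?thesis using True by (simp add: ext_def)
    next
      case False
      have "continuous_on (- {0}) (ext \<Phi>)"
        unfolding ext_def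
        by (intro continuous_intros continuous_on_compose2 [OF homeomorphism_cont1 [OF h]] continuous_on_sgn)
           (auto simp: norm_sgn split: if_split_asm)
      then have "isCont (ext \<Phi>) x" using False by (simp add: continuous_on_eq_continuous_at open_Compl)
      then show ?thesis unfolding isCont_def .
    qed
  qed
  have inv: "ext \<Psi> (ext \<Phi> x) = x" if h: "homeomorphism (sphere 0 1) (sphere 0 1) \<Phi> \<Psi>" for \<Phi> \<Psi> x
  proof (cases "x = 0")
    case False
    have p: "\<Phi> (sgn x) \<in> sphere 0 1" "\<Psi> (\<Phi> (sgn x)) = sgn x"
      using h sgs [OF False] homeomorphism_image1 homeomorphism_apply1 by blast+
    have "sgn (ext \<Phi> x) = \<Phi> (sgn x)"
    proof -
      have "sgn (ext \<Phi> x) = sgn (norm x) *\<^sub>R sgn (\<Phi> (sgn x))" unfolding ext_def by (rule sgn_scaleR)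
      also have "\<dots> = \<Phi> (sgn x)" using p(1) False by (simp add: sgn_div_norm [of "\<Phi> _"])
      finally show ?thesis .
    qed
    then show ?thesis
      using p(2) nrm [OF h, of x] False unfolding ext_def [THEN fun_cong, THEN fun_cong, of \<Psi>] 
      by (simp add: ext_def sgn_div_norm)
  qed (simp add: ext_def)
  have h2: "homeomorphism (sphere 0 1) (sphere 0 1) \<Psi> \<Phi>" using assms by (rule homeomorphism_symD)
  show ?thesis
  proof (rule that [of "ext \<Phi>" "ext \<Psi>"])
    show "homeomorphism UNIV UNIV (ext \<Phi>) (ext \<Psi>)"
      using cont [OF assms] cont [OF h2] inv [OF assms] inv [OF h2] by (intro homeomorphismI) auto
    show "ext \<Phi> (r *\<^sub>R x) = r *\<^sub>R \<Phi> x" if "x \<in> sphere 0 1" "r > 0" for r x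
      using that unfolding ext_def by (simp add: sgn_div_norm)
  qed
qed

section \<open>Heights as logarithms of radii\<close>

text \<open>Space minus a closed ray is homeomorphic to space, by a homeomorphism that is the identity on a
  given compact set: points close to the ray are pushed along it.\<close>

definition ray :: "(complex \<times> real) set" where
  "ray = {x. fst x = 0 \<and> snd x \<ge> 0}"

text \<open>\<open>s / (1 + s / \<epsilon>)\<close> squeezes the numbers \<open>s \<ge> 0\<close> to
  those below \<open>\<epsilon>\<close>, so on the axis the heights above \<open>-\<epsilon>\<close>
  are pressed below 0. The weight \<open>l\<close> blends this into the identity at distance
  \<open>\<epsilon>\<close> from the axis, and nothing moves below the height
  \<open>-\<epsilon>\<close>.\<close>

definition push_off_ray :: "real \<Rightarrow> complex \<times> real \<Rightarrow> complex \<times> real" where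
  "push_off_ray \<epsilon> x = (let s = max 0 (snd x + \<epsilon>); l = min 1 (cmod (fst x) / \<epsilon>) in
     (fst x, min (snd x) (-\<epsilon>) + ((1 - l) * (s / (1 + s / \<epsilon>)) + l * s)))"

lemma push_off_ray:
  assumes e: "\<epsilon> > 0"
  shows "continuous_on UNIV (push_off_ray \<epsilon>)" "inj (push_off_ray \<epsilon>)"
    "range (push_off_ray \<epsilon>) = - ray"
    "snd x \<le> -\<epsilon> \<or> cmod (fst x) \<ge> \<epsilon> \<Longrightarrow> push_off_ray \<epsilon> x = x"
proof -
  define q where "q = (\<lambda>l s. (1 - l) * (s / (1 + s / \<epsilon>)) + l * s :: real)"
  define lam where "lam = (\<lambda>w :: complex. min 1 (cmod w / \<epsilon>))"
  have p: "push_off_ray \<epsilon> x = (fst x, min (snd x) (-\<epsilon>) + q (lam (fst x)) (max 0 (snd x + \<epsilon>)))" for x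
    unfolding push_off_ray_def q_def lam_def Let_def ..
  have lam: "0 \<le> lam w" "lam w \<le> 1" "lam w = 0 \<longleftrightarrow> w = 0" for w
    unfolding lam_def using e by (auto simp: min_def)
  have den: "1 + s / \<epsilon> > 0" if "s \<ge> 0" for s using that e by (simp add: add_pos_nonneg)
  have den': "1 + s / \<epsilon> \<noteq> 0" if "s \<ge> 0" for s using den [OF that] by simp
  have s1: "s / (1 + s / \<epsilon>) = \<epsilon> * s / (\<epsilon> + s)" if "s \<ge> 0" for s using that e by (simp add: field_simps)
  have mono1: "s / (1 + s / \<epsilon>) < t / (1 + t / \<epsilon>)" if "0 \<le> s" "s < t" for s t
    using that e unfolding s1 [OF that(1)] s1 [OF order.trans [OF that(1) less_imp_le [OF that(2)]]]
    by (simp add: field_simps)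
  have qmono: "q l s < q l t" if "0 \<le> l" "l \<le> 1" "0 \<le> s" "s < t" for l s t
  proof (cases "l = 0")
    case True
    then show ?thesis unfolding q_def using mono1 that by simp
  next
    case False
    have "(1 - l) * (s / (1 + s / \<epsilon>)) \<le> (1 - l) * (t / (1 + t / \<epsilon>))"
      using that by (intro mult_left_mono less_imp_le [OF mono1]) auto
    moreover have "l * s < l * t" using that False by simp
    ultimately show ?thesis unfolding q_def by linarith
  qed
  have q0: "q l 0 = 0" for l unfolding q_def by simp
  have contq: "continuous_on {0..} (q l)" for l
    unfolding q_def using e den' by (intro continuous_intros) auto
  show "continuous_on UNIV (push_off_ray \<epsilon>)"
    unfolding push_off_ray_def Let_def using e den
    by (intro continuous_intros) (auto simp: add_nonneg_eq_0_iff)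
  show "inj (push_off_ray \<epsilon>)"
  proof (rule injI)
    fix x y assume eq: "push_off_ray \<epsilon> x = push_off_ray \<epsilon> y"
    then have f: "fst x = fst y" unfolding p by simp
    define g where "g = (\<lambda>t. min t (-\<epsilon>) + q (lam (fst x)) (max 0 (t + \<epsilon>)))"
    have gm: "g t < g t'" if "t < t'" for t t'
    proof (cases "t' \<le> -\<epsilon>")
      case True
      then have "max 0 (t + \<epsilon>) = 0" "max 0 (t' + \<epsilon>) = 0" using that by auto
      then show ?thesis using True that unfolding g_def by (simp add: q0)
    next
      case False
      then have "q (lam (fst x)) (max 0 (t + \<epsilon>)) < q (lam (fst x)) (max 0 (t' + \<epsilon>))"
        using that lam by (intro qmono) auto
      then show ?thesis using that unfolding g_def by linarith
    qed
    have "g (snd x) = g (snd y)" using eq f unfolding p g_def by simp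
    then have "snd x = snd y" using gm by (metis less_irrefl linorder_neqE)
    then show "x = y" using f by (simp add: prod_eq_iff)
  qed
  have qlt: "q 0 s < \<epsilon>" if "s \<ge> 0" for s
    using that e unfolding q_def by (simp add: s1 field_simps)
  show "push_off_ray \<epsilon> x = x" if "snd x \<le> -\<epsilon> \<or> cmod (fst x) \<ge> \<epsilon>" for x
    using that
  proof
    assume "snd x \<le> -\<epsilon>"
    then show ?thesis unfolding p by (simp add: q0 max_absorb1 prod_eq_iff)
  next
    assume "cmod (fst x) \<ge> \<epsilon>"
    then have "lam (fst x) = 1" unfolding lam_def using e by simp
    then show ?thesis unfolding p q_def by (simp add: prod_eq_iff min_def max_def)
  qed
  show "range (push_off_ray \<epsilon>) = - ray"
  proof (intro equalityI subsetI)
    fix y assume "y \<in> range (push_off_ray \<epsilon>)"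
    then obtain x where y: "y = push_off_ray \<epsilon> x" by blast
    show "y \<in> - ray"
    proof (cases "fst x = 0")
      case True
      then have "snd y < 0" unfolding y p using qlt [of "max 0 (snd x + \<epsilon>)"] by (simp add: lam_def)
      then show ?thesis unfolding ray_def by simp
    qed (simp add: y p ray_def)
  next
    fix y :: "complex \<times> real" assume y: "y \<in> - ray"
    define l where "l = lam (fst y)"
    show "y \<in> range (push_off_ray \<epsilon>)"
    proof (cases "snd y \<le> -\<epsilon>")
      case True
      then have "push_off_ray \<epsilon> y = y" unfolding p by (simp add: q0 max_absorb1 prod_eq_iff)
      then show ?thesis by (metis rangeI)
    next
      case False
      define v where "v = snd y + \<epsilon>"
      have v: "v > 0" unfolding v_def using False by simp
      have "\<exists>s\<ge>0. v \<le> q l s"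
      proof (cases "fst y = 0")
        case True
        then have "snd y < 0" using y unfolding ray_def by simp
        then have ve: "v < \<epsilon>" unfolding v_def by simp
        have "l = 0" unfolding l_def lam_def using True by simp
        then have "q l (\<epsilon> * v / (\<epsilon> - v)) = v"
          unfolding q_def using s1 [of "\<epsilon> * v / (\<epsilon> - v)"] e v ve by (simp add: field_simps)
        then show ?thesis using e v ve by (intro exI [of _ "\<epsilon> * v / (\<epsilon> - v)"]) auto
      next
        case False
        then have l: "l > 0" "l \<le> 1" unfolding l_def using lam [of "fst y"] by linarith+
        have "0 \<le> (1 - l) * ((v / l) / (1 + (v / l) / \<epsilon>))"
          using l v e by (intro mult_nonneg_nonneg divide_nonneg_nonneg) auto
        then have "v \<le> q l (v / l)" unfolding q_def using l by simp
        then show ?thesis using l v by (intro exI [of _ "v / l"]) auto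
      qed
      then obtain s1 where s1: "s1 \<ge> 0" "v \<le> q l s1" by blast
      obtain s where s: "0 \<le> s" "s \<le> s1" "q l s = v"
        using IVT' [of "q l" 0 v s1] s1 v q0 contq by (metis atLeastAtMost_iff atLeast_iff continuous_on_subset less_imp_le subsetI)
      have "s > 0" using s q0 v by (metis less_eq_real_def less_irrefl)
      then have "push_off_ray \<epsilon> (fst y, s - \<epsilon>) = y"
        unfolding p using s unfolding l_def v_def by (simp add: prod_eq_iff)
      then show ?thesis by (metis rangeI)
    qed
  qed
qed

text \<open>The pole is not the projection of any point and the radius is positive, so the values
  missed are the nonnegative multiples of the north pole, that is the set
  \<open>ray\<close>.\<close>

definition polar_lift :: "complex \<times> real \<Rightarrow> complex \<times> real" where
  "polar_lift x = exp (snd x) *\<^sub>R to_sphere (fst x)"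

lemma continuous_polar_lift: "continuous_on S polar_lift"
  unfolding polar_lift_def
  by (intro continuous_intros continuous_on_compose2 [OF continuous_to_sphere [of UNIV]]) auto

lemma polar_lift: "inj polar_lift" "range polar_lift = - ray"
proof -
  have n: "norm (polar_lift x) = exp (snd x)" for x
    unfolding polar_lift_def using to_sphere_in(1) [of "fst x"] by simp
  show "inj polar_lift"
  proof (rule injI)
    fix x y assume eq: "polar_lift x = polar_lift y"
    then have "exp (snd x) = exp (snd y)" using n by metis
    then have s: "snd x = snd y" by simp
    then have "to_sphere (fst x) = to_sphere (fst y)" using eq unfolding polar_lift_def by simp
    then show "x = y" using s inj_to_sphere by (simp add: prod_eq_iff inj_def)
  qed
  show "range polar_lift = - ray"
  proof (intro equalityI subsetI)
    fix y assume "y \<in> range polar_lift"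
    then obtain x where y: "y = polar_lift x" by blast
    show "y \<in> - ray"
    proof
      assume r: "y \<in> ray"
      then have "fst (to_sphere (fst x)) = 0" "snd (to_sphere (fst x)) \<ge> 0"
        unfolding y ray_def polar_lift_def by (auto simp: zero_le_mult_iff)
      then have "to_sphere (fst x) = north_pole"
        using to_sphere_in(1) [of "fst x"] unfolding sphere2_iff north_pole_def
        by (auto simp: prod_eq_iff power2_eq_1_iff)
      then show False using to_sphere_in(2) by blast
    qed
  next
    fix y assume y: "y \<in> - ray"
    then have y0: "y \<noteq> 0" unfolding ray_def by (auto simp: prod_eq_iff)
    have "sgn y \<in> sphere2" using y0 by (simp add: norm_sgn)
    moreover have "sgn y \<noteq> north_pole"
    proof
      assume "sgn y = north_pole"
      then have "y = norm y *\<^sub>R north_pole" using y0 by (metis div_by_1 norm_sgn scaleR_one sgn_div_norm scaleR_scaleR right_inverse norm_eq_zero)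
      then have "fst y = 0" "snd y \<ge> 0" unfolding north_pole_def by (metis fst_scaleR fst_conv scaleR_zero_right, metis snd_scaleR snd_conv norm_ge_zero real_scaleR_def mult.right_neutral)
      then show False using y unfolding ray_def by simp
    qed
    ultimately have "to_sphere (from_sphere (sgn y)) = sgn y" by (rule to_from_sphere)
    then have "polar_lift (from_sphere (sgn y), ln (norm y)) = y"
      unfolding polar_lift_def using y0 by (simp add: sgn_div_norm)
    then show "y \<in> range polar_lift" by (metis rangeI)
  qed
qed

lemma knot_equivalent_sym:
  assumes "knot_equivalent K K'" shows "knot_equivalent K' K"
proof -
  obtain f g where fg: "homeomorphism UNIV UNIV f g" "f ` K = K'"
    using assms unfolding knot_equivalent_def by blast
  have "g ` K' = (\<lambda>x. x) ` K"
    unfolding fg(2) [symmetric] image_image using fg(1) by (intro image_cong) (auto simp: homeomorphism_def)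
  then show ?thesis
    unfolding knot_equivalent_def using homeomorphism_symD [OF fg(1)] by auto
qed

lemma knot_equivalent_trans:
  assumes "knot_equivalent K K'" "knot_equivalent K' K''" shows "knot_equivalent K K''"
proof -
  obtain f g where fg: "homeomorphism UNIV UNIV f g" "f ` K = K'"
    using assms(1) unfolding knot_equivalent_def by blast
  obtain f' g' where fg': "homeomorphism UNIV UNIV f' g'" "f' ` K' = K''"
    using assms(2) unfolding knot_equivalent_def by blast
  have "(f' \<circ> f) ` K = K''" using fg(2) fg'(2) by (metis image_comp)
  then show ?thesis
    unfolding knot_equivalent_def using homeomorphism_compose [OF fg(1) fg'(1)] by blast
qed

text \<open>By invariance of domain both injections are homeomorphisms onto the common range;
  \<open>F\<close> is the first followed by the inverse of the second.\<close>

lemma homeomorphism_UNIV_of_common_range: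
  fixes f g :: "'a::euclidean_space \<Rightarrow> 'a"
  assumes f: "continuous_on UNIV f" "inj f" and g: "continuous_on UNIV g" "inj g" and r: "range f = range g"
  obtains F G where "homeomorphism UNIV UNIV F G" "\<And>x. g (F x) = f x"
proof -
  obtain f' where f': "homeomorphism UNIV (range f) f f'"
    using invariance_of_domain_homeomorphism [of UNIV f] f by auto
  obtain g' where g': "homeomorphism UNIV (range g) g g'"
    using invariance_of_domain_homeomorphism [of UNIV g] g by auto
  have "homeomorphism UNIV UNIV (g' \<circ> f) (f' \<circ> g)"
    using homeomorphism_compose [OF f'] homeomorphism_symD [OF g'] r by metis
  moreover have "g ((g' \<circ> f) x) = f x" for x
    using homeomorphism_apply2 [OF g', of "f x"] r by (metis comp_apply rangeI)
  ultimately show ?thesis using that by blast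
qed

text \<open>The first coordinate becomes a point of the sphere and the height becomes the logarithm of the
  radius, so that homeomorphisms of the sphere act on knots.\<close>

lemma knot_equivalent_polar_lift:
  assumes K: "compact K"
  shows "knot_equivalent K (polar_lift ` K)"
proof -
  let ?L = "polar_lift ` K"
  have cL: "compact ?L" using K continuous_polar_lift by (intro compact_continuous_image)
  have "closed ray"
  proof -
    have rv: "ray = fst -` {0} \<inter> snd -` {0..}" unfolding ray_def by auto
    show ?thesis
      unfolding rv by (intro closed_Int closed_vimage_fst closed_vimage_snd closed_singleton closed_atLeast)
  qed
  moreover have "?L \<inter> ray = {}" using polar_lift(2) by blast
  ultimately have "\<exists>d>0. \<forall>x\<in>?L. \<forall>y\<in>ray. d \<le> dist x y" by (rule separate_compact_closed [OF cL])
  then obtain d where d: "d > 0" "\<And>x y. x \<in> ?L \<Longrightarrow> y \<in> ray \<Longrightarrow> d \<le> dist x y" by blast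
  define \<epsilon> where "\<epsilon> = d / 2"
  have e: "\<epsilon> > 0" unfolding \<epsilon>_def using d by simp
  have away: "snd x \<le> -\<epsilon> \<or> cmod (fst x) \<ge> \<epsilon>" if x: "x \<in> ?L" for x
  proof (rule ccontr)
    assume n: "\<not> ?thesis"
    define y :: "complex \<times> real" where "y = (0, max 0 (snd x))"
    have "y \<in> ray" unfolding y_def ray_def by simp
    then have "d \<le> dist x y" using d x by blast
    also have "dist x y = sqrt ((cmod (fst x))\<^sup>2 + (snd x - max 0 (snd x))\<^sup>2)"
      unfolding y_def by (cases x) (simp add: dist_prod_def dist_norm power2_commute)
    also have "\<dots> \<le> cmod (fst x) + \<bar>snd x - max 0 (snd x)\<bar>"
      using sqrt_sum_squares_le_sum_abs [of "cmod (fst x)" "snd x - max 0 (snd x)"] by simp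
    also have "\<dots> < \<epsilon> + \<epsilon>" using n e by (auto simp: max_def not_le)
    finally show False unfolding \<epsilon>_def by simp
  qed
  \<comment> \<open>Both maps have the complement of the ray as range. The resulting homeomorphism
    of all of space agrees with \<open>polar_lift\<close> on \<open>K\<close>, because
    \<open>push_off_ray \<epsilon>\<close> fixes the lifted knot.\<close>
  obtain F G where F: "homeomorphism UNIV UNIV F G" "\<And>x. push_off_ray \<epsilon> (F x) = polar_lift x"
    using homeomorphism_UNIV_of_common_range [OF continuous_polar_lift polar_lift(1) push_off_ray(1,2) [OF e]]
      polar_lift(2) push_off_ray(3) [OF e] by metis
  have "F x = polar_lift x" if "x \<in> K" for x
  proof -
    have "push_off_ray \<epsilon> (polar_lift x) = polar_lift x"
      using away that by (intro push_off_ray(4) [OF e]) auto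
    then show ?thesis using F(2) push_off_ray(2) [OF e] by (metis injD)
  qed
  then have "F ` K = ?L" by (rule image_cong [OF refl])
  then show ?thesis unfolding knot_equivalent_def using F(1) by blast
qed

section \<open>Knots given by a curve and a height function\<close>

definition curve_knot :: "(real \<Rightarrow> complex) \<Rightarrow> (real \<Rightarrow> real) \<Rightarrow> (complex \<times> real) set" where
  "curve_knot \<kappa> \<eta> = range (\<lambda>t. (\<kappa> t, \<eta> t))"

lemma curve_knot_shift: "curve_knot (\<lambda>t. \<kappa> (t + a)) (\<lambda>t. \<eta> (t + a)) = curve_knot \<kappa> \<eta>"
proof -
  have "range (\<lambda>t. (\<kappa> (t + a), \<eta> (t + a))) = (\<lambda>t. (\<kappa> t, \<eta> t)) ` range (\<lambda>t. t + a)"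
    by (simp only: image_image)
  also have "range (\<lambda>t. t + a) = UNIV" by (metis diff_add_cancel surjI)
  finally show ?thesis unfolding curve_knot_def .
qed

text \<open>\<open>i\<close> and \<open>i + 3\<close> are the two passages through one double point;
  different heights there keep the strands apart.\<close>

definition height_function :: "(real \<Rightarrow> real) \<Rightarrow> bool" where
  "height_function \<eta> \<longleftrightarrow> continuous_on UNIV \<eta> \<and> (\<forall>t. \<eta> (t + 6) = \<eta> t) \<and> (\<forall>i::int. \<eta> i \<noteq> \<eta> (i + 3))"

lemma height_function_shift:
  assumes "height_function \<eta>" shows "height_function (\<lambda>t. \<eta> (t + of_int k))"
  unfolding height_function_def
proof (intro conjI allI)
  show "continuous_on UNIV (\<lambda>t. \<eta> (t + of_int k))"
    using assms unfolding height_function_def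
    by (intro continuous_on_compose2 [of UNIV \<eta> UNIV "\<lambda>t. t + of_int k"] continuous_intros) auto
  show "\<eta> (t + 6 + of_int k) = \<eta> (t + of_int k)" for t
    using assms unfolding height_function_def by (metis add.assoc add.commute)
  show "\<eta> (real_of_int i + of_int k) \<noteq> \<eta> (real_of_int i + 3 + of_int k)" for i
    using assms unfolding height_function_def by (metis add.assoc add.commute of_int_add)
qed

lemma compact_curve_knot:
  assumes \<kappa>: "trefoil_curve \<kappa>" and \<eta>: "height_function \<eta>"
  shows "compact (curve_knot \<kappa> \<eta>)"
proof -
  have per: "\<eta> (t + 6 * of_int n) = \<eta> t" for t and n :: int
  proof (induction n)
    case (nonneg n)
    show ?case
    proof (induction n)
      case (Suc n)
      moreover have "\<eta> (t + 6 * real n + 6) = \<eta> (t + 6 * real n)" using \<eta> unfolding height_function_def by blast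
      ultimately show ?case by (simp add: algebra_simps)
    qed simp
  next
    case (neg n)
    show ?case
    proof (induction n)
      case 0
      have "\<eta> (t - 6 + 6) = \<eta> (t - 6)" using \<eta> unfolding height_function_def by blast
      then show ?case by simp
    next
      case (Suc n)
      moreover have "\<eta> (t - 6 * (real n + 2) + 6) = \<eta> (t - 6 * (real n + 2))" using \<eta> unfolding height_function_def by blast
      ultimately show ?case by (simp add: algebra_simps)
    qed
  qed
  have "curve_knot \<kappa> \<eta> = (\<lambda>t. (\<kappa> t, \<eta> t)) ` {0..6}"
  proof
    show "curve_knot \<kappa> \<eta> \<subseteq> (\<lambda>t. (\<kappa> t, \<eta> t)) ` {0..6}"
      unfolding curve_knot_def
    proof clarify
      fix t :: real
      define n where "n = \<lfloor>t / 6\<rfloor>"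
      have "of_int n \<le> t / 6" "t / 6 < of_int n + 1" unfolding n_def by linarith+
      then have "t - 6 * n \<in> {0..6}" by auto
      moreover have "\<kappa> t = \<kappa> (t - 6 * n)" "\<eta> t = \<eta> (t - 6 * n)"
        using trefoil_curve_periodic [OF \<kappa>, of "t - 6 * n" n] per [of "t - 6 * n" n] by simp_all
      ultimately show "(\<kappa> t, \<eta> t) \<in> (\<lambda>t. (\<kappa> t, \<eta> t)) ` {0..6}" by auto
    qed
  qed (auto simp: curve_knot_def)
  moreover have "compact \<dots>"
    using trefoil_curve_continuous [OF \<kappa>] \<eta> unfolding height_function_def
    by (intro compact_continuous_image continuous_intros) (auto intro: continuous_on_subset)
  ultimately show ?thesis by simp
qed

lemma curve_knot_change_curve:
  assumes \<kappa>: "trefoil_curve \<kappa>" and \<kappa>': "trefoil_curve \<kappa>'" and \<eta>: "height_function \<eta>"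
  shows "knot_equivalent (curve_knot \<kappa> \<eta>) (curve_knot \<kappa>' \<eta>)"
proof -
  obtain \<Phi> \<Psi> where P: "homeomorphism sphere2 sphere2 \<Phi> \<Psi>" "\<And>t. \<Phi> (to_sphere (\<kappa> t)) = to_sphere (\<kappa>' t)"
    using trefoil_curves_equivalent [OF \<kappa> \<kappa>'] by blast
  obtain F G where F: "homeomorphism UNIV UNIV F G" "\<And>r x. x \<in> sphere2 \<Longrightarrow> r > 0 \<Longrightarrow> F (r *\<^sub>R x) = r *\<^sub>R \<Phi> x"
    using homeomorphism_sphere_radial [OF P(1)] by blast
  have "F (polar_lift (\<kappa> t, \<eta> t)) = polar_lift (\<kappa>' t, \<eta> t)" for t
    unfolding polar_lift_def using F(2) [OF to_sphere_in(1)] P(2) by simp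
  then have "F ` polar_lift ` curve_knot \<kappa> \<eta> = polar_lift ` curve_knot \<kappa>' \<eta>"
    unfolding curve_knot_def image_image by simp
  then have "knot_equivalent (polar_lift ` curve_knot \<kappa> \<eta>) (polar_lift ` curve_knot \<kappa>' \<eta>)"
    unfolding knot_equivalent_def using F(1) by blast
  then show ?thesis
    using knot_equivalent_polar_lift [OF compact_curve_knot [OF \<kappa> \<eta>]]
      knot_equivalent_polar_lift [OF compact_curve_knot [OF \<kappa>' \<eta>]]
    by (meson knot_equivalent_sym knot_equivalent_trans)
qed

text \<open>Heights with the same order at the double points are related by a homeomorphism of the form
  \<open>(z, r) \<mapsto> (z, a z * r + b z)\<close>: the two conditions at a double point determine \<open>a\<close> there.\<close>

lemma curve_knot_change_heights:
  assumes \<kappa>: "trefoil_curve \<kappa>" and \<eta>: "height_function \<eta>" and \<eta>': "height_function \<eta>'"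
    and sg: "\<And>i::int. \<eta> i > \<eta> (i + 3) \<longleftrightarrow> \<eta>' i > \<eta>' (i + 3)"
  shows "knot_equivalent (curve_knot \<kappa> \<eta>) (curve_knot \<kappa> \<eta>')"
proof -
  \<comment> \<open>The ratio of the two height gaps at a double point. It is positive because the
    gaps have the same sign, and it does not change under \<open>i + 3\<close>, where both gaps
    change sign.\<close>
  define Q where "Q = (\<lambda>i::int. (\<eta>' i - \<eta>' (i + 3)) / (\<eta> i - \<eta> (i + 3)))"
  have ne: "\<eta> i - \<eta> (i + 3) \<noteq> 0" "\<eta>' i - \<eta>' (i + 3) \<noteq> 0" for i :: int
    using \<eta> \<eta>' unfolding height_function_def by auto
  have Qp: "Q i > 0" for i
  proof (cases "\<eta> i > \<eta> (i + 3)")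
    case True
    then show ?thesis unfolding Q_def using sg [of i] by simp
  next
    case False
    then have "\<eta>' i < \<eta>' (i + 3)" "\<eta> i < \<eta> (i + 3)" using sg [of i] ne [of i] by auto
    then show ?thesis unfolding Q_def by (simp add: divide_neg_neg)
  qed
  define P where "P = {\<kappa> 0, \<kappa> 1, \<kappa> 2}"
  \<comment> \<open>The factor is prescribed through its logarithm, so that its Tietze extension
    stays positive after exponentiation.\<close>
  define A0 where "A0 = (\<lambda>z. ln (Q (if z = \<kappa> 0 then 0 else if z = \<kappa> 1 then 1 else 2)))"
  have "finite P" unfolding P_def by simp
  then have "continuous_on P A0" "closed P"
    by (auto intro: finite_imp_closed continuous_on_finite)
  then obtain A where A: "continuous_on UNIV A" "\<And>z. z \<in> P \<Longrightarrow> A z = A0 z"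
    using Tietze_unbounded [of P A0 UNIV] by auto
  define a where "a = (\<lambda>z. exp (A z))"
  have ca: "continuous_on UNIV a" unfolding a_def by (intro continuous_intros A)
  have ap: "a z > 0" for z unfolding a_def by simp
  have d3: "\<kappa> 0 \<noteq> \<kappa> 1" "\<kappa> 0 \<noteq> \<kappa> 2" "\<kappa> 1 \<noteq> \<kappa> 2"
    using trefoil_curve_of_int_eq_iff [OF \<kappa>, of 0 1] trefoil_curve_of_int_eq_iff [OF \<kappa>, of 0 2]
      trefoil_curve_of_int_eq_iff [OF \<kappa>, of 1 2] by simp_all
  have a012: "a (\<kappa> 0) = Q 0" "a (\<kappa> 1) = Q 1" "a (\<kappa> 2) = Q 2"
    using A(2) d3 Qp unfolding a_def P_def A0_def by auto
  have e6: "\<eta> (t + 6) = \<eta> t" "\<eta>' (t + 6) = \<eta>' t" for t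
    using \<eta> \<eta>' unfolding height_function_def by auto
  have Q3: "Q (i + 3) = Q i" for i
  proof -
    have "\<eta> (real_of_int (i + 3) + 3) = \<eta> i" "\<eta>' (real_of_int (i + 3) + 3) = \<eta>' i"
      using e6 [of "real_of_int i"] by (simp_all add: add.assoc)
    then show ?thesis
      unfolding Q_def by (simp add: minus_divide_left [symmetric] minus_divide_right [symmetric]) (metis minus_diff_eq minus_divide_divide)
  qed
  have aQ: "a (\<kappa> i) = Q i" for i :: int
  proof -
    have Q3n: "Q (j + 3 * n) = Q j" for j n
    proof (induction n)
      case (nonneg n)
      show ?case
      proof (induction n)
        case (Suc n) then show ?case using Q3 [of "j + 3 * int n"] by (simp add: algebra_simps)
      qed simp
    next
      case (neg n)
      show ?case
      proof (induction n)
        case 0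
        show ?case using Q3 [of "j - 3"] by simp
      next
        case (Suc n)
        then show ?case using Q3 [of "j - 3 * (int n + 2)"] by (simp add: algebra_simps)
      qed
    qed
    define r where "r = i mod 3"
    have i: "i = r + 3 * (i div 3)" unfolding r_def by simp
    have "\<kappa> i = \<kappa> r"
      unfolding trefoil_curve_of_int_eq_iff [OF \<kappa>] r_def by simp
    moreover have "Q i = Q r" using Q3n [of r "i div 3"] i by simp
    moreover have "r = 0 \<or> r = 1 \<or> r = 2" unfolding r_def by presburger
    ultimately show ?thesis using a012 by auto
  qed
  \<comment> \<open>With this \<open>a\<close> the difference of \<open>\<eta>'\<close> and
    \<open>a\<close> times \<open>\<eta>\<close> has equal values at the two passages through each
    double point, so it is a function on the curve.\<close>
  have "\<exists>b. continuous_on (range \<kappa>) b \<and> (\<forall>t. b (\<kappa> t) = \<eta>' t - a (\<kappa> t) * \<eta> t)"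
  proof -
    have c: "continuous_on UNIV (\<lambda>t. \<eta>' t - a (\<kappa> t) * \<eta> t)"
      using \<eta> \<eta>' unfolding height_function_def
      by (intro continuous_intros continuous_on_compose2 [OF ca trefoil_curve_continuous [OF \<kappa>]]) auto
    have p: "\<eta>' (t + 6) - a (\<kappa> (t + 6)) * \<eta> (t + 6) = \<eta>' t - a (\<kappa> t) * \<eta> t" for t
      using e6 trefoil_curve_periodic [OF \<kappa>, of t 1] by simp
    have q: "\<eta>' (of_int i) - a (\<kappa> (of_int i)) * \<eta> (of_int i)
        = \<eta>' (of_int i + 3) - a (\<kappa> (of_int i + 3)) * \<eta> (of_int i + 3)" for i
    proof -
      have "a (\<kappa> (real_of_int i + 3)) = Q i" using aQ [of "i + 3"] Q3 [of i] by simp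
      moreover have "Q i * (\<eta> i - \<eta> (i + 3)) = \<eta>' i - \<eta>' (i + 3)"
        unfolding Q_def using ne [of i] by simp
      ultimately show ?thesis using aQ [of i] by (simp add: algebra_simps)
    qed
    show ?thesis by (rule trefoil_curve_factor [OF \<kappa> c p q]) blast
  qed
  then obtain b0 where b0: "continuous_on (range \<kappa>) b0" "\<And>t. b0 (\<kappa> t) = \<eta>' t - a (\<kappa> t) * \<eta> t" by blast
  have "compact (range \<kappa>)"
    unfolding trefoil_curve_range [OF \<kappa>] by (intro compact_continuous_image trefoil_curve_continuous [OF \<kappa>]) auto
  then have "closed (range \<kappa>)" by (rule compact_imp_closed)
  then obtain b where b: "continuous_on UNIV b" "\<And>z. z \<in> range \<kappa> \<Longrightarrow> b z = b0 z"
    using Tietze_unbounded [of "range \<kappa>" b0 UNIV] b0(1) by auto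
  define F where "F = (\<lambda>x :: complex \<times> real. (fst x, a (fst x) * snd x + b (fst x)))"
  define G where "G = (\<lambda>x :: complex \<times> real. (fst x, (snd x - b (fst x)) / a (fst x)))"
  have an: "a z \<noteq> 0" for z using ap [of z] by simp
  have cab: "continuous_on UNIV (\<lambda>x :: complex \<times> real. a (fst x))" "continuous_on UNIV (\<lambda>x :: complex \<times> real. b (fst x))"
    by (rule continuous_on_compose2 [OF ca] continuous_on_compose2 [OF b(1)]; auto intro!: continuous_intros)+
  have "homeomorphism UNIV UNIV F G"
  proof (rule homeomorphismI)
    show "continuous_on UNIV F" unfolding F_def by (intro continuous_intros cab)
    show "continuous_on UNIV G" unfolding G_def using an by (intro continuous_intros cab) auto
  qed (use an in \<open>auto simp: F_def G_def\<close>)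
  moreover have "F ` curve_knot \<kappa> \<eta> = curve_knot \<kappa> \<eta>'"
  proof -
    have "F (\<kappa> t, \<eta> t) = (\<kappa> t, \<eta>' t)" for t
      unfolding F_def using b(2) [of "\<kappa> t"] b0(2) [of t] by simp
    then show ?thesis unfolding curve_knot_def image_image by simp
  qed
  ultimately show ?thesis unfolding knot_equivalent_def by blast
qed

lemma curve_knot_equivalent:
  assumes "trefoil_curve \<kappa>" "trefoil_curve \<kappa>'" "height_function \<eta>" "height_function \<eta>'"
    and "\<And>i::int. \<eta> i > \<eta> (i + 3) \<longleftrightarrow> \<eta>' i > \<eta>' (i + 3)"
  shows "knot_equivalent (curve_knot \<kappa> \<eta>) (curve_knot \<kappa>' \<eta>')"
  using curve_knot_change_curve [OF assms(1,2,3)] curve_knot_change_heights [OF assms(2,3,4,5)]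
  by (rule knot_equivalent_trans)

section \<open>The standard trefoil as a curve with heights\<close>

text \<open>The projection of \<open>standard_trefoil\<close> at the parameter
  \<open>pi/6 + pi * t / 3\<close>: the crossings move to the integers and the period becomes
  6.\<close>

definition trefoil_path :: "real \<Rightarrow> complex" where
  "trefoil_path t = (2 - sin (pi * t)) *\<^sub>R cis (pi/3 + 2 * pi * t / 3)"

lemma curve_knot_standard_trefoil: "curve_knot trefoil_path (\<lambda>t. cos (pi * t)) = standard_trefoil"
proof -
  let ?f = "\<lambda>t :: real. ((2 + cos (3 * t)) *\<^sub>R cis (2 * t), sin (3 * t))"
  have "(trefoil_path t, cos (pi * t)) = ?f (pi/6 + pi * t / 3)" for t
  proof -
    have "3 * (pi/6 + pi * t / 3) = pi * t + pi/2" "2 * (pi/6 + pi * t / 3) = pi/3 + 2 * pi * t / 3"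
      by (simp_all add: field_simps)
    then show ?thesis
      unfolding trefoil_path_def by (simp only: cos_add sin_add) (simp add: scaleR_conv_of_real)
  qed
  then have "curve_knot trefoil_path (\<lambda>t. cos (pi * t)) = ?f ` range (\<lambda>t. pi/6 + pi * t / 3)"
    unfolding curve_knot_def by (simp add: image_image)
  also have "range (\<lambda>t :: real. pi/6 + pi * t / 3) = UNIV"
  proof -
    have "x = pi/6 + pi * ((x - pi/6) * 3 / pi) / 3" for x by (simp add: field_simps)
    then show ?thesis by (metis (mono_tags, lifting) UNIV_eq_I rangeI)
  qed
  finally show ?thesis unfolding standard_trefoil_def .
qed

lemma range_trefoil_path: "range trefoil_path = trefoil_projection"
  unfolding trefoil_projection_def curve_knot_standard_trefoil [symmetric] curve_knot_def
  by (simp add: image_image)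

text \<open>The function \<open>f\<close> with \<open>f (cos (2 * x)) = sin (3 * x)\<close> for \<open>0 \<le> x \<le> pi\<close>.\<close>

definition lobe :: "real \<Rightarrow> real" where
  "lobe c = sqrt ((1 - c) / 2) * (1 + 2 * c)"

lemma lobe_cos:
  assumes "0 \<le> x" "x \<le> pi" shows "lobe (cos (2 * x)) = sin (3 * x)"
proof -
  have c: "cos (2 * x) = 1 - 2 * (sin x)\<^sup>2" by (rule cos_double_sin)
  have "sqrt ((1 - cos (2 * x)) / 2) = sin x"
    unfolding c using sin_ge_zero [OF assms] by simp
  moreover have "sin (3 * x) = sin x * (1 + 2 * cos (2 * x))"
  proof -
    have "sin (3 * x) = sin (2 * x + x)" by simp
    also have "\<dots> = 2 * sin x * (cos x)\<^sup>2 + cos (2 * x) * sin x"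
      unfolding sin_add sin_double by (simp add: power2_eq_square)
    also have "(cos x)\<^sup>2 = 1 - (sin x)\<^sup>2" by (simp add: cos_squared_eq)
    finally show ?thesis unfolding c by (simp add: algebra_simps)
  qed
  ultimately show ?thesis unfolding lobe_def by simp
qed

lemma abs_lobe_le:
  assumes "\<bar>c\<bar> \<le> 1" shows "\<bar>lobe c\<bar> \<le> 1"
proof -
  have c: "-1 \<le> c" "c \<le> 1" using assms by linarith+
  have "0 \<le> arccos c / 2" "arccos c / 2 \<le> pi"
    using arccos_lbound [OF c] arccos_ubound [OF c] pi_gt_zero by linarith+
  then have "lobe (cos (2 * (arccos c / 2))) = sin (3 * (arccos c / 2))" by (rule lobe_cos)
  moreover have "cos (2 * (arccos c / 2)) = c" using cos_arccos [OF c] by simp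
  ultimately show ?thesis by (metis abs_sin_le_one)
qed

lemma sin_pi_shift: "sin (pi * (of_int n + u)) = (if even n then 1 else -1) * sin (pi * u)"
proof -
  have "sin (pi * (of_int n + u)) = sin (pi * u + pi * of_int n)" by (simp add: algebra_simps)
  also have "\<dots> = sin (pi * u) * cos (pi * of_int n) + cos (pi * u) * sin (pi * of_int n)"
    by (rule sin_add)
  also have "sin (pi * of_int n) = 0" by (rule sin_npi_int)
  also have "cos (pi * of_int n) = (if even n then 1 else -1)"
    by (rule cos_npi_int)
  finally show ?thesis by simp
qed

text \<open>Modulus and argument fix the parameter up to multiples of 3, and an odd multiple is
  possible only where \<open>sin (pi * t) = 0\<close>. Separation is witnessed by a continuous
  function with zeros only on the loop and opposite signs at the two points.\<close>

lemma trefoil_curve_trefoil_path: "trefoil_curve trefoil_path"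
  unfolding trefoil_curve_def
proof (intro conjI allI ballI)
  show "continuous_on UNIV trefoil_path"
    unfolding trefoil_path_def cis_conv_exp by (intro continuous_intros) auto
  fix s t :: real
  have pos: "2 - sin x > 0" for x :: real using sin_le_one [of x] by linarith
  show "trefoil_path s = trefoil_path t \<longleftrightarrow>
      (\<exists>n::int. s - t = 6 * real_of_int n) \<or> (s \<in> \<int> \<and> t \<in> \<int> \<and> (\<exists>n::int. s - t = 3 * real_of_int n))"
  proof
    assume eq: "trefoil_path s = trefoil_path t"
    have "cmod (trefoil_path s) = cmod (trefoil_path t)" using eq by simp
    then have ss: "sin (pi * s) = sin (pi * t)"
      unfolding trefoil_path_def using pos [of "pi * s"] pos [of "pi * t"] by simp
    then have "cis (pi/3 + 2 * pi * s / 3) = cis (pi/3 + 2 * pi * t / 3)"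
      using eq pos [of "pi * t"] unfolding trefoil_path_def by simp
    then obtain m :: int where "pi/3 + 2 * pi * s / 3 = pi/3 + 2 * pi * t / 3 + 2 * pi * m"
      using sin_cos_eq_iff by (metis cis.simps)
    then have "pi * (s - t) = pi * (3 * m)" by (simp add: field_simps)
    then have m: "s - t = 3 * real_of_int m" by simp
    show "(\<exists>n::int. s - t = 6 * real_of_int n) \<or> (s \<in> \<int> \<and> t \<in> \<int> \<and> (\<exists>n::int. s - t = 3 * real_of_int n))"
    proof (cases "even m")
      case True
      then obtain k where "m = 2 * k" by blast
      then show ?thesis using m by (intro disjI1 exI [of _ k]) simp
    next
      case False
      have "s = of_int (3 * m) + t" using m by simp
      then have "sin (pi * s) = - sin (pi * t)"
        using sin_pi_shift [of "3 * m" t] False by simp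
      then have "sin (pi * t) = 0" using ss by simp
      then have t: "t \<in> \<int>" by (metis mult.commute sin_times_pi_eq_0)
      then have "s \<in> \<int>" using m by (metis Ints_add Ints_of_int \<open>s = of_int (3 * m) + t\<close>)
      then show ?thesis using t m by blast
    qed
  next
    assume r: "(\<exists>n::int. s - t = 6 * real_of_int n) \<or> (s \<in> \<int> \<and> t \<in> \<int> \<and> (\<exists>n::int. s - t = 3 * real_of_int n))"
    then obtain m :: int where m: "s - t = 3 * real_of_int m" "even m \<or> (s \<in> \<int> \<and> t \<in> \<int>)"
    proof (elim disjE exE conjE)
      fix n :: int assume "s - t = 6 * real_of_int n"
      then show thesis using that [of "2 * n"] by simp
    qed blast
    have s: "s = of_int (3 * m) + t" using m by simp
    have "sin (pi * s) = sin (pi * t)"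
    proof (cases "even m")
      case True
      then show ?thesis using sin_pi_shift [of "3 * m" t] s by simp
    next
      case False
      then have "sin (pi * s) = 0" "sin (pi * t) = 0"
        using m(2) sin_times_pi_eq_0 [of s] sin_times_pi_eq_0 [of t] by (auto simp: mult.commute)
      then show ?thesis by simp
    qed
    moreover have "cis (pi/3 + 2 * pi * s / 3) = cis (pi/3 + 2 * pi * t / 3)"
    proof -
      have "pi/3 + 2 * pi * s / 3 = (pi/3 + 2 * pi * t / 3) + 2 * pi * m" unfolding s by (simp add: field_simps)
      then have "cis (pi/3 + 2 * pi * s / 3) = cis (pi/3 + 2 * pi * t / 3) * cis (2 * pi * m)"
        by (simp only: cis_mult)
      then show ?thesis by (simp add: cis_multiple_2pi)
    qed
    ultimately show "trefoil_path s = trefoil_path t" unfolding trefoil_path_def by simp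
  qed
next
  fix n :: int and j :: real assume j: "j \<in> {1, 2}"
  \<comment> \<open>A shift by \<open>n\<close> multiplies the sine by \<open>\<sigma>\<close> and
    rotates the curve, which ends up turned by \<open>\<beta>\<close>, so one computation serves all
    six loops.\<close>
  define \<sigma> :: real where "\<sigma> = (if even n then 1 else -1)"
  have \<sigma>: "\<bar>\<sigma>\<bar> = 1" unfolding \<sigma>_def by simp
  define \<beta> where "\<beta> = pi/3 + 2 * pi * n / 3"
  have p1: "trefoil_path (of_int n + u) = (2 - \<sigma> * sin (pi * u)) *\<^sub>R cis (\<beta> + 2 * pi * u / 3)" for u
    unfolding trefoil_path_def sin_pi_shift \<sigma>_def \<beta>_def by (simp add: field_simps)
  have p2: "trefoil_path (of_int n + 3 + u) = (2 + \<sigma> * sin (pi * u)) *\<^sub>R cis (\<beta> + 2 * pi * u / 3)" for u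
  proof -
    have "\<beta> + 2 * pi * (3 + u) / 3 = (\<beta> + 2 * pi * u / 3) + 2 * pi" by (simp add: field_simps)
    then have "cis (\<beta> + 2 * pi * (3 + u) / 3) = cis (\<beta> + 2 * pi * u / 3) * cis (2 * pi)"
      by (simp only: cis_mult)
    then have c: "cis (\<beta> + 2 * pi * (3 + u) / 3) = cis (\<beta> + 2 * pi * u / 3)" by simp
    have "sin (pi * (3 + u)) = - sin (pi * u)"
      using sin_pi_shift [of 3 u] by simp
    then show ?thesis using p1 [of "3 + u"] c by (simp add: add.assoc)
  qed
  \<comment> \<open>In polar coordinates the loop is the graph
    \<open>r = 2 - \<sigma> * sin (3 * x)\<close> over the angle \<open>\<beta> + 2 * x\<close>, and
    \<open>\<psi>\<close> is the signed radial distance from it where the modulus is at least 1;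
    \<open>lobe\<close> makes the sine a function of the direction. The maximum with 1 prevents a
    division by 0, and every zero of \<open>\<psi>\<close> has modulus at least 1.\<close>
  define \<psi> where "\<psi> = (\<lambda>z. cmod z - 2 + \<sigma> * lobe (Re (z * cis (-\<beta>)) / max 1 (cmod z)))"
  have c\<psi>: "continuous_on S \<psi>" for S
    unfolding \<psi>_def lobe_def by (intro continuous_intros) auto
  have val: "\<psi> (r *\<^sub>R cis (\<beta> + 2 * x)) = r - 2 + \<sigma> * sin (3 * x)" if "r \<ge> 1" "0 \<le> x" "x \<le> pi" for r x
  proof -
    have "(r *\<^sub>R cis (\<beta> + 2 * x)) * cis (-\<beta>) = r *\<^sub>R cis (2 * x)"
      unfolding mult_scaleR_left cis_mult by simp
    then have "Re ((r *\<^sub>R cis (\<beta> + 2 * x)) * cis (-\<beta>)) = r * cos (2 * x)" by (simp only:) simp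
    moreover have "cmod (r *\<^sub>R cis (\<beta> + 2 * x)) = r" using that by simp
    ultimately show ?thesis unfolding \<psi>_def using that lobe_cos [OF that(2,3)] by simp
  qed
  let ?C = "trefoil_path ` {of_int n..of_int n + 3}"
  have zero: "z \<in> ?C" if z: "\<psi> z = 0" for z
  proof -
    have le: "\<bar>Re (z * cis (-\<beta>)) / max 1 (cmod z)\<bar> \<le> 1"
    proof -
      have "\<bar>Re (z * cis (-\<beta>))\<bar> \<le> cmod (z * cis (-\<beta>))" by (rule abs_Re_le_cmod)
      also have "\<dots> \<le> max 1 (cmod z)" by (simp add: norm_mult)
      finally show ?thesis by (simp add: abs_divide divide_le_eq)
    qed
    have "\<bar>\<sigma> * lobe (Re (z * cis (-\<beta>)) / max 1 (cmod z))\<bar> \<le> 1"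
      using abs_lobe_le [OF le] \<sigma> by (simp add: abs_mult)
    then have r: "cmod z \<ge> 1" using z unfolding \<psi>_def by linarith
    define x where "x = Arg2pi (z * cis (-\<beta>)) / 2"
    have x: "0 \<le> x" "x < pi" unfolding x_def using Arg2pi_ge_0 Arg2pi_lt_2pi [of "z * cis (-\<beta>)"] by simp_all
    have "z * cis (-\<beta>) = of_real (cmod z) * cis (2 * x)"
      using Arg2pi_eq [of "z * cis (-\<beta>)"] unfolding x_def by (simp add: norm_mult cis_conv_exp)
    then have "z * cis (-\<beta>) * cis \<beta> = of_real (cmod z) * cis (2 * x) * cis \<beta>" by simp
    then have zz: "z = cmod z *\<^sub>R cis (\<beta> + 2 * x)"
      by (simp add: mult.assoc cis_mult scaleR_conv_of_real add.commute)
    have "\<psi> z = cmod z - 2 + \<sigma> * sin (3 * x)"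
      using val [of "cmod z" x] r x zz by simp
    then have r2: "cmod z = 2 - \<sigma> * sin (3 * x)" using z by simp
    define u where "u = 3 * x / pi"
    have u: "0 \<le> u" "u \<le> 3" "pi * u = 3 * x" "2 * pi * u / 3 = 2 * x" unfolding u_def using x by (auto simp: field_simps)
    have "z = trefoil_path (of_int n + u)"
      unfolding p1 u(3,4) r2 [symmetric] using zz .
    then show ?thesis using u by auto
  qed
  have \<psi>v: "\<psi> (trefoil_path (of_int n + 3 + u)) = 2 * \<sigma> * sin (pi * u)" if "0 \<le> u" "u \<le> 3" for u
  proof -
    have "\<bar>\<sigma> * sin (pi * u)\<bar> \<le> 1" using \<sigma> abs_sin_le_one [of "pi * u"] by (simp add: abs_mult)
    then have "2 + \<sigma> * sin (pi * u) \<ge> 1" by linarith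
    moreover have "pi * u / 3 \<le> pi" using that by simp
    ultimately show ?thesis
      unfolding p2 using val [of "2 + \<sigma> * sin (pi * u)" "pi * u / 3"] that by (simp add: mult.assoc)
  qed
  have s12: "sin (pi * (1/2)) = 1" "sin (pi * (3/2)) = -1" "sin (pi * (5/2)) = 1"
    using sin_pi_shift [of 1 "1/2"] sin_pi_shift [of 2 "1/2"] by simp_all
  have opp: "\<psi> (trefoil_path (n + j + 5/2)) * \<psi> (trefoil_path (n + j + 7/2)) < 0"
  proof -
    have s2: "\<sigma> * \<sigma> = 1" unfolding \<sigma>_def by simp
    have e: "real_of_int n + 1 + 5/2 = of_int n + 3 + 1/2" "real_of_int n + 1 + 7/2 = of_int n + 3 + 3/2"
      "real_of_int n + 2 + 5/2 = of_int n + 3 + 3/2" "real_of_int n + 2 + 7/2 = of_int n + 3 + 5/2"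
      by simp_all
    show ?thesis
      using j
    proof (elim insertE emptyE)
      assume "j = 1"
      then show ?thesis
        unfolding \<open>j = 1\<close> e using \<psi>v [of "1/2"] \<psi>v [of "3/2"] s12 s2 by simp
    next
      assume "j = 2"
      then show ?thesis
        unfolding \<open>j = 2\<close> e using \<psi>v [of "3/2"] \<psi>v [of "5/2"] s12 s2 by simp
    qed
  qed
  show "\<not> connected_component (- ?C) (trefoil_path (n + j + 5/2)) (trefoil_path (n + j + 7/2))"
  proof
    assume "connected_component (- ?C) (trefoil_path (n + j + 5/2)) (trefoil_path (n + j + 7/2))"
    then obtain T where T: "connected T" "T \<subseteq> - ?C" "trefoil_path (n + j + 5/2) \<in> T" "trefoil_path (n + j + 7/2) \<in> T"
      unfolding connected_component_def by blast
    have con: "connected (\<psi> ` T)" using T(1) c\<psi> by (intro connected_continuous_image)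
    have "0 \<in> \<psi> ` T"
    proof (cases "\<psi> (trefoil_path (n + j + 5/2)) < 0")
      case True
      then have "\<psi> (trefoil_path (n + j + 7/2)) > 0" using opp by (metis mult_neg_neg mult_eq_0_iff not_less_iff_gr_or_eq)
      then have "0 \<in> {\<psi> (trefoil_path (n + j + 5/2))..\<psi> (trefoil_path (n + j + 7/2))}" using True by simp
      then show ?thesis using connected_contains_Icc [OF con] T(3,4) by blast
    next
      case False
      then have "\<psi> (trefoil_path (n + j + 7/2)) < 0" using opp by (metis mult_nonneg_nonneg not_less)
      then have "0 \<in> {\<psi> (trefoil_path (n + j + 7/2))..\<psi> (trefoil_path (n + j + 5/2))}" using False by simp
      then show ?thesis using connected_contains_Icc [OF con] T(3,4) by blast
    qed
    then obtain z where "z \<in> T" "\<psi> z = 0" by auto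
    then show False using zero T(2) by blast
  qed
qed

lemma height_function_standard: "height_function (\<lambda>t. cos (pi * t))"
  unfolding height_function_def
proof (intro conjI allI)
  show "continuous_on UNIV (\<lambda>t :: real. cos (pi * t))" by (intro continuous_intros)
  show "cos (pi * (t + 6)) = cos (pi * t)" for t
  proof -
    have "cos (pi * (t + 6)) = cos (pi * t) * cos (pi * of_int 6) - sin (pi * t) * sin (pi * of_int 6)"
      by (simp only: distrib_left cos_add of_int_numeral)
    then show ?thesis unfolding cos_npi_int sin_npi_int by simp
  qed
  show "cos (pi * of_int i) \<noteq> cos (pi * (of_int i + 3))" for i
  proof -
    have "cos (pi * (of_int i + 3)) = (if even (i + 3) then 1 else -1)"
      using cos_npi_int [of "i + 3"] by simp
    then show ?thesis unfolding cos_npi_int by simp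
  qed
qed

section \<open>The eight patterns of signs\<close>

text \<open>Antisymmetric under the shift by 3 and positive at 0, 1, 2: starting from 0, every
  double point is passed first above and then below, the pattern of a descending diagram.\<close>

definition unknot_height :: "real \<Rightarrow> real" where
  "unknot_height t = cos (pi * (t - 1) / 3)"

lemma height_function_unknot:
  "height_function unknot_height"
  "unknot_height 0 > unknot_height 3" "unknot_height 1 > unknot_height 4" "unknot_height 2 > unknot_height 5"
proof -
  have s: "unknot_height (t + 3) = - unknot_height t" for t
  proof -
    have e: "pi * (t + 3 - 1) / 3 = pi * (t - 1) / 3 + pi" by (simp add: field_simps)
    show ?thesis unfolding unknot_height_def e by (rule cos_periodic_pi)
  qed
  have v: "unknot_height 0 = 1/2" "unknot_height 1 = 1" "unknot_height 2 = 1/2"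
    unfolding unknot_height_def by (simp_all add: cos_60)
  show "unknot_height 0 > unknot_height 3" "unknot_height 1 > unknot_height 4" "unknot_height 2 > unknot_height 5"
    using s [of 0] s [of 1] s [of 2] v by simp_all
  have nz: "unknot_height (real_of_int i) \<noteq> 0" for i
  proof
    assume "unknot_height (real_of_int i) = 0"
    then obtain k :: int where "pi * (real_of_int i - 1) / 3 = of_int k * pi + pi/2"
      unfolding unknot_height_def cos_zero_iff_int2 by blast
    then have "pi * (2 * (real_of_int i - 1)) = pi * (3 * (2 * of_int k + 1))" by (simp add: field_simps)
    then have "2 * (real_of_int i - 1) = 3 * (2 * of_int k + 1)" by simp
    then have "2 * (i - 1) = 3 * (2 * k + 1)" by (simp flip: of_int_eq_iff)
    then show False by presburger
  qed
  show "height_function unknot_height"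
    unfolding height_function_def
  proof (intro conjI allI)
    show "continuous_on UNIV unknot_height"
      unfolding unknot_height_def by (intro continuous_intros) auto
    show "unknot_height (t + 6) = unknot_height t" for t
    proof -
      have "unknot_height (t + 6) = unknot_height (t + 3 + 3)" by (simp add: add.assoc)
      then show ?thesis by (simp only: s minus_minus)
    qed
    show "unknot_height (real_of_int i) \<noteq> unknot_height (real_of_int i + 3)" for i
      using s [of "real_of_int i"] nz [of i] by simp
  qed
qed

text \<open>Each horizontal plane \<open>h = cos x\<close> with \<open>\<bar>h\<bar> < 1\<close> meets this knot in the two points with
  parameters \<open>x\<close> and \<open>- x\<close>, which are moved to \<open>sin x\<close> and \<open>- sin x\<close> by a complex affine map that
  depends polynomially on \<open>h\<close>.\<close>

lemma trivial_knot_unknot_height: "trivial_knot (curve_knot trefoil_path unknot_height)"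
proof -
  \<comment> \<open>\<open>m\<close> and \<open>sin x * a\<close> are the parts of
    \<open>(2 + sin (3 * x)) * cis (2 * x)\<close> that are even and odd in \<open>sin x\<close>,
    written as polynomials in \<open>h = cos x\<close>. The imaginary part of \<open>a\<close>
    vanishes only for \<open>h = 0\<close>, where the real part is 1, so division by
    \<open>a\<close> is possible.\<close>
  define a where "a = (\<lambda>h::real. Complex ((4 * h\<^sup>2 - 1) * (2 * h\<^sup>2 - 1)) (4 * h))"
  define m where "m = (\<lambda>h::real. Complex (2 * (2 * h\<^sup>2 - 1)) ((4 * h\<^sup>2 - 1) * (2 * h) * (1 - h\<^sup>2)))"
  have a0: "a h \<noteq> 0" for h
    unfolding a_def by (auto simp: complex_eq_iff)
  have ca: "continuous_on UNIV (\<lambda>x :: complex \<times> real. a (snd x))" "continuous_on UNIV (\<lambda>x :: complex \<times> real. m (snd x))"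
    unfolding a_def m_def Complex_eq by (intro continuous_intros)+
  define F where "F = (\<lambda>x :: complex \<times> real. ((- fst x - m (snd x)) / a (snd x), snd x))"
  define F' where "F' = (\<lambda>x :: complex \<times> real. (- (a (snd x) * fst x) - m (snd x), snd x))"
  have hF: "homeomorphism UNIV UNIV F F'"
  proof (rule homeomorphismI)
    show "continuous_on UNIV F" unfolding F_def using a0 by (intro continuous_intros ca) auto
    show "continuous_on UNIV F'" unfolding F'_def by (intro continuous_intros ca)
  qed (use a0 in \<open>auto simp: F_def F'_def field_simps\<close>)
  define G where "G = (\<lambda>x :: complex \<times> real. (Complex (Re (fst x)) (snd x), Im (fst x)))"
  have hG: "homeomorphism UNIV UNIV G G"
  proof (rule homeomorphismI)
    show "continuous_on UNIV G" unfolding G_def Complex_eq by (intro continuous_intros)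
    then show "continuous_on UNIV G" .
  qed (auto simp: G_def)
  have pt: "(trefoil_path t, unknot_height t) = (- ((2 + sin (3 * x)) *\<^sub>R cis (2 * x)), cos x)" if "x = pi * (t - 1) / 3" for t x
  proof -
    have e: "pi * t = 3 * x + pi" "pi/3 + 2 * pi * t / 3 = 2 * x + pi" unfolding that by (simp_all add: field_simps)
    have "sin (pi * t) = - sin (3 * x)" unfolding e by (rule sin_periodic_pi)
    moreover have "cis (pi/3 + 2 * pi * t / 3) = - cis (2 * x)" unfolding e by (simp add: complex_eq_iff)
    ultimately show ?thesis
      unfolding trefoil_path_def unknot_height_def that [symmetric] by simp
  qed
  have dec: "(2 + sin (3 * x)) *\<^sub>R cis (2 * x) = m (cos x) + sin x *\<^sub>R a (cos x)" for x
  proof -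
    have s2: "(sin x)\<^sup>2 = 1 - (cos x)\<^sup>2" by (simp add: sin_squared_eq)
    have s3: "sin (3 * x) = sin x * (4 * (cos x)\<^sup>2 - 1)"
    proof -
      have "sin (3 * x) = sin (2 * x + x)" by simp
      also have "\<dots> = 2 * sin x * (cos x)\<^sup>2 + (2 * (cos x)\<^sup>2 - 1) * sin x"
        unfolding sin_add sin_double cos_double_cos by (simp add: power2_eq_square)
      finally show ?thesis by (simp add: algebra_simps)
    qed
    have c2: "cos (2 * x) = 2 * (cos x)\<^sup>2 - 1" by (rule cos_double_cos)
    have ss: "sin x * sin x = 1 - (cos x)\<^sup>2" using s2 by (simp add: power2_eq_square)
    have "(2 + sin x * (4 * (cos x)\<^sup>2 - 1)) * (2 * sin x * cos x)
        = (4 * (cos x)\<^sup>2 - 1) * (2 * cos x) * (sin x * sin x) + sin x * (4 * cos x)"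
      by (simp add: algebra_simps)
    then have im: "(2 + sin x * (4 * (cos x)\<^sup>2 - 1)) * (2 * sin x * cos x)
        = (4 * (cos x)\<^sup>2 - 1) * (2 * cos x) * (1 - (cos x)\<^sup>2) + sin x * (4 * cos x)"
      unfolding ss .
    show ?thesis
      unfolding complex_eq_iff m_def a_def using im
      by (simp add: s3 c2 sin_double) (simp add: algebra_simps)
  qed
  have FG: "G (F (trefoil_path t, unknot_height t)) = (Complex (sin x) (cos x), 0)" if "x = pi * (t - 1) / 3" for t x
  proof -
    have "F (trefoil_path t, unknot_height t) = (of_real (sin x), cos x)"
      unfolding pt [OF that] F_def fst_conv snd_conv dec using a0 by (simp add: scaleR_conv_of_real)
    then show ?thesis unfolding G_def by simp
  qed
  have "(G \<circ> F) ` curve_knot trefoil_path unknot_height = sphere 0 1 \<times> {0}"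
  proof (intro equalityI subsetI)
    fix y assume "y \<in> (G \<circ> F) ` curve_knot trefoil_path unknot_height"
    then obtain t where "y = G (F (trefoil_path t, unknot_height t))" unfolding curve_knot_def by auto
    then have "y = (Complex (sin (pi * (t - 1) / 3)) (cos (pi * (t - 1) / 3)), 0)" using FG by simp
    then show "y \<in> sphere 0 1 \<times> {0}" by (simp add: cmod_def)
  next
    fix y :: "complex \<times> real" assume y: "y \<in> sphere 0 1 \<times> {0}"
    then have "(Im (fst y))\<^sup>2 + (Re (fst y))\<^sup>2 = 1" by (auto simp: cmod_def)
    then obtain x where x: "Im (fst y) = cos x" "Re (fst y) = sin x" 
      using sincos_total_2pi [of "Im (fst y)" "Re (fst y)"] by blast
    define t where "t = 3 * x / pi + 1"
    have "x = pi * (t - 1) / 3" unfolding t_def by simp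
    then have "G (F (trefoil_path t, unknot_height t)) = (Complex (sin x) (cos x), 0)" by (rule FG)
    also have "\<dots> = y" using x y by (auto simp: prod_eq_iff complex_eq_iff)
    finally have "y = (G \<circ> F) (trefoil_path t, unknot_height t)" by simp
    moreover have "(trefoil_path t, unknot_height t) \<in> curve_knot trefoil_path unknot_height"
      unfolding curve_knot_def by blast
    ultimately show "y \<in> (G \<circ> F) ` curve_knot trefoil_path unknot_height" by (rule image_eqI)
  qed
  then show ?thesis
    unfolding trivial_knot_def knot_equivalent_def using homeomorphism_compose [OF hF hG] by blast
qed

lemma int_induct_mod_3:
  fixes P :: "int \<Rightarrow> bool"
  assumes "P 0" "P 1" "P 2" "\<And>i. P i \<longleftrightarrow> P (i + 3)"
  shows "P i"
proof -
  have up: "P (j + 3 * int n) \<longleftrightarrow> P j" for j n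
  proof (induction n)
    case (Suc n)
    have "j + 3 * int (Suc n) = j + 3 * int n + 3" by simp
    then show ?case using assms(4) [of "j + 3 * int n"] Suc by (simp only:)
  qed simp
  have "i = i mod 3 + 3 * (i div 3)" by simp
  moreover have "P (r + 3 * q) \<longleftrightarrow> P r" for r q
  proof (cases "q \<ge> 0")
    case True
    then show ?thesis using up [of r "nat q"] by simp
  next
    case False
    then show ?thesis using up [of "r + 3 * q" "nat (- q)"] by simp
  qed
  moreover have "i mod 3 = 0 \<or> i mod 3 = 1 \<or> i mod 3 = 2" by presburger
  ultimately show ?thesis using assms(1-3) by metis
qed

lemma height_function_flip:
  assumes "height_function \<eta>"
  shows "\<eta> (of_int i + 3) > \<eta> (of_int (i + 3) + 3) \<longleftrightarrow> \<not> \<eta> (of_int i) > \<eta> (of_int i + 3)"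
proof -
  have "\<eta> (of_int (i + 3) + 3) = \<eta> (of_int i)" "\<eta> (of_int i) \<noteq> \<eta> (of_int i + 3)"
    using assms unfolding height_function_def by (simp_all add: add.assoc)
  then show ?thesis by auto
qed

text \<open>A shift by 3 reverses the comparison for both height functions, so agreement at 0, 1, 2
  spreads to all integers.\<close>

lemma curve_knot_equivalent_012:
  assumes "trefoil_curve \<kappa>" "trefoil_curve \<kappa>'" and h: "height_function \<eta>" "height_function \<eta>'"
    and "\<eta> 0 > \<eta> 3 \<longleftrightarrow> \<eta>' 0 > \<eta>' 3" "\<eta> 1 > \<eta> 4 \<longleftrightarrow> \<eta>' 1 > \<eta>' 4" "\<eta> 2 > \<eta> 5 \<longleftrightarrow> \<eta>' 2 > \<eta>' 5"
  shows "knot_equivalent (curve_knot \<kappa> \<eta>) (curve_knot \<kappa>' \<eta>')"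
proof -
  have "\<eta> (of_int i) > \<eta> (of_int i + 3) \<longleftrightarrow> \<eta>' (of_int i) > \<eta>' (of_int i + 3)" for i
  proof (induction i rule: int_induct_mod_3)
    case (4 i)
    then show ?case using height_function_flip [OF h(1), of i] height_function_flip [OF h(2), of i] by auto
  qed (use assms(5-7) in auto)
  then show ?thesis by (intro curve_knot_equivalent [OF assms(1-4)]) auto
qed

text \<open>The signs \<open>+ - +\<close> are those of the standard trefoil. A shift by one turns
  \<open>- + -\<close> into \<open>+ - +\<close>, since the sign at 3 is opposite to that at 0. The
  homeomorphisms may reverse orientation, so both hands of the trefoil are covered.\<close>

lemma trefoil_curve_knot_alternating:
  assumes \<kappa>: "trefoil_curve \<kappa>" and \<eta>: "height_function \<eta>"
    and "(\<eta> 0 > \<eta> 3) \<noteq> (\<eta> 1 > \<eta> 4)" "(\<eta> 1 > \<eta> 4) \<noteq> (\<eta> 2 > \<eta> 5)"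
  shows "trefoil_knot (curve_knot \<kappa> \<eta>)"
proof -
  have c: "cos (pi * 0) = (1::real)" "cos (pi * 1) = (-1::real)" "cos (pi * 2) = (1::real)"
    "cos (pi * 3) = (-1::real)" "cos (pi * 4) = (1::real)" "cos (pi * 5) = (-1::real)"
    using cos_npi_int [of 2] cos_npi_int [of 3] cos_npi_int [of 4] cos_npi_int [of 5] by simp_all
  have std: "trefoil_knot (curve_knot \<kappa> \<eta>)"
    if "trefoil_curve \<kappa>" "height_function \<eta>" "\<eta> 0 > \<eta> 3" "\<not> \<eta> 1 > \<eta> 4" "\<eta> 2 > \<eta> 5" for \<kappa> \<eta>
    unfolding trefoil_knot_def curve_knot_standard_trefoil [symmetric]
    by (rule curve_knot_equivalent_012 [OF that(1) trefoil_curve_trefoil_path that(2) height_function_standard])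
       (use that c in auto)
  show ?thesis
  proof (cases "\<eta> 0 > \<eta> 3")
    case True
    then show ?thesis using std [OF \<kappa> \<eta>] assms by blast
  next
    case False
    then have "\<eta> 3 > \<eta> 6" using height_function_flip [OF \<eta>, of 0] by simp
    then have "trefoil_knot (curve_knot (\<lambda>t. \<kappa> (t + of_int 1)) (\<lambda>t. \<eta> (t + of_int 1)))"
      using assms False
      by (intro std trefoil_curve_shift height_function_shift \<kappa> \<eta>) auto
    then show ?thesis unfolding curve_knot_shift .
  qed
qed

text \<open>In a sequence with \<open>s (i + 3) = (\<not> s i)\<close> whose first three terms do
  not alternate, some three consecutive terms are true; starting there gives the pattern of
  \<open>unknot_height\<close>.\<close>

lemma trivial_knot_not_alternating:
  assumes \<kappa>: "trefoil_curve \<kappa>" and \<eta>: "height_function \<eta>"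
    and "(\<eta> 0 > \<eta> 3) = (\<eta> 1 > \<eta> 4) \<or> (\<eta> 1 > \<eta> 4) = (\<eta> 2 > \<eta> 5)"
  shows "trivial_knot (curve_knot \<kappa> \<eta>)"
proof -
  define s where "s = (\<lambda>i::int. \<eta> i > \<eta> (i + 3))"
  have s3: "s (i + 3) = (\<not> s i)" for i
    unfolding s_def using height_function_flip [OF \<eta>, of i] by simp
  have "trivial_knot (curve_knot \<kappa> \<eta>)" if k: "s k" "s (k + 1)" "s (k + 2)" for k
  proof -
    have "knot_equivalent (curve_knot (\<lambda>t. \<kappa> (t + of_int k)) (\<lambda>t. \<eta> (t + of_int k))) (curve_knot trefoil_path unknot_height)"
      by (rule curve_knot_equivalent_012 [OF trefoil_curve_shift [OF \<kappa>] trefoil_curve_trefoil_path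
            height_function_shift [OF \<eta>] height_function_unknot(1)])
         (use k height_function_unknot in \<open>auto simp: s_def add_ac\<close>)
    then show ?thesis
      using trivial_knot_unknot_height unfolding curve_knot_shift trivial_knot_def
      by (rule knot_equivalent_trans)
  qed
  moreover have "\<exists>k. s k \<and> s (k + 1) \<and> s (k + 2)"
  proof -
    have t: "s 3 = (\<not> s 0)" "s 4 = (\<not> s 1)" "s 5 = (\<not> s 2)" "s 6 = s 0" "s 7 = s 1"
      using s3 [of 0] s3 [of 1] s3 [of 2] s3 [of 3] s3 [of 4] by simp_all
    have "s 0 = s 1 \<or> s 1 = s 2" using assms(3) unfolding s_def by simp
    then consider "s 0 \<and> s 1 \<and> s 2" | "s 1 \<and> s 2 \<and> s 3" | "s 2 \<and> s 3 \<and> s 4" | "s 3 \<and> s 4 \<and> s 5"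
      | "s 4 \<and> s 5 \<and> s 6" | "s 5 \<and> s 6 \<and> s 7" using t by blast
    then show ?thesis
    proof cases
      case 1 then show ?thesis by (intro exI [of _ 0]) simp
    next
      case 2 then show ?thesis by (intro exI [of _ 1]) simp
    next
      case 3 then show ?thesis by (intro exI [of _ 2]) simp
    next
      case 4 then show ?thesis by (intro exI [of _ 3]) simp
    next
      case 5 then show ?thesis by (intro exI [of _ 4]) simp
    next
      case 6 then show ?thesis by (intro exI [of _ 5]) simp
    qed
  qed
  ultimately show ?thesis by blast
qed

section \<open>Crossings of plane curves\<close>

lemma continuous_on_floor_pieces:
  fixes P :: "int \<Rightarrow> real \<Rightarrow> 'a::topological_space"
  assumes cont: "\<And>i. continuous_on {0..1} (P i)" and join: "\<And>i. P i 1 = P (i + 1) 0"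
  shows "continuous_on UNIV (\<lambda>t. P \<lfloor>t\<rfloor> (frac t))"
proof -
  let ?f = "\<lambda>t. P \<lfloor>t\<rfloor> (frac t)"
  have piece: "?f t = P i (t - of_int i)" if "of_int i \<le> t" "t \<le> of_int i + 1" for t and i :: int
  proof (cases "t = of_int i + 1")
    case True
    then have "t = of_int (i + 1)" by simp
    then have "\<lfloor>t\<rfloor> = i + 1" by (simp only: floor_of_int)
    then show ?thesis using join [of i] True by (simp add: frac_def)
  next
    case False
    then have "\<lfloor>t\<rfloor> = i" using that by (intro floor_unique) auto
    then show ?thesis by (simp add: frac_def)
  qed
  have c1: "continuous_on {of_int i..of_int i + 1} ?f" for i
  proof (rule continuous_on_eq)
    show "continuous_on {of_int i..of_int i + 1} (\<lambda>t. P i (t - of_int i))"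
      by (rule continuous_on_compose2 [OF cont]) (auto intro!: continuous_intros)
  qed (use piece in auto)
  have "isCont ?f t" for t
  proof -
    define i where "i = \<lceil>t\<rceil> - 1"
    have i: "of_int i < t" "t \<le> of_int i + 1" unfolding i_def by linarith+
    have "{of_int i..of_int (i + 1) + 1} = {of_int i..of_int i + 1} \<union> {of_int (i + 1)..of_int (i + 1) + (1::real)}"
      by auto
    then have "continuous_on {of_int i..of_int (i + 1) + 1} ?f"
      using continuous_on_closed_Un [OF closed_atLeastAtMost closed_atLeastAtMost c1 [of i] c1 [of "i + 1"]] by simp
    moreover have "t \<in> interior {of_int i..of_int (i + 1) + (1::real)}"
      using i by (simp add: interior_atLeastAtMost_real)
    ultimately show ?thesis by (rule continuous_on_interior)
  qed
  then show ?thesis by (simp add: continuous_at_imp_continuous_on)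
qed

text \<open>After exchanging the coordinates the ends lie on the bottom edge of a box that contains
  both paths, and the interlacing form of the Fashoda meeting theorem applies.\<close>

lemma half_plane_interlace:
  fixes f g :: "real \<Rightarrow> complex"
  assumes "path f" "path g"
    and re: "\<And>z. z \<in> path_image f \<union> path_image g \<Longrightarrow> 1 \<le> Re z"
    and ends: "pathstart f = Complex 1 a" "pathfinish f = Complex 1 b" "pathstart g = Complex 1 c" "pathfinish g = Complex 1 d"
    and lt: "a < c" "c < b" "b < d"
  shows "path_image f \<inter> path_image g \<noteq> {}"
proof -
  define \<phi> :: "complex \<Rightarrow> real^2" where "\<phi> = (\<lambda>z. \<chi> i. if i = 1 then Im z else Re z)"
  have \<phi>: "\<phi> z $ 1 = Im z" "\<phi> z $ 2 = Re z" for z unfolding \<phi>_def by simp_all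
  have c\<phi>: "continuous_on S \<phi>" for S
    unfolding \<phi>_def
  proof (rule continuous_on_vec_lambda)
    fix i :: 2
    show "continuous_on S (\<lambda>z. if i = 1 then Im z else Re z)"
      by (cases "i = 1") (auto intro: continuous_intros)
  qed
  have "bounded (path_image f \<union> path_image g)"
    using assms(1,2) by (simp add: bounded_path_image)
  then obtain B where B: "\<And>z. z \<in> path_image f \<union> path_image g \<Longrightarrow> cmod z \<le> B"
    unfolding bounded_iff by blast
  define lo :: "real^2" where "lo = (\<chi> i. if i = 1 then - B else 1)"
  define hi :: "real^2" where "hi = (\<chi> i. B)"
  have box: "\<phi> z \<in> cbox lo hi" if "z \<in> path_image f \<union> path_image g" for z
  proof -
    have "\<bar>Re z\<bar> \<le> B" "\<bar>Im z\<bar> \<le> B" using B [OF that] abs_Re_le_cmod abs_Im_le_cmod order_trans by blast+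
    then show ?thesis
      using re [OF that] unfolding mem_box_cart forall_2 \<phi> lo_def hi_def by auto
  qed
  obtain z where z: "z \<in> path_image (\<phi> \<circ> f)" "z \<in> path_image (\<phi> \<circ> g)"
  proof (rule fashoda_interlace [of "\<phi> \<circ> f" "\<phi> \<circ> g" lo hi])
    show "path (\<phi> \<circ> f)" "path (\<phi> \<circ> g)"
      using assms(1,2) c\<phi> by (auto intro: path_continuous_image)
    show "path_image (\<phi> \<circ> f) \<subseteq> cbox lo hi" "path_image (\<phi> \<circ> g) \<subseteq> cbox lo hi"
      using box by (auto simp: path_image_compose)
  qed (use lt in \<open>auto simp: pathstart_compose pathfinish_compose ends \<phi> lo_def\<close>)
  then obtain x y where xy: "x \<in> path_image f" "y \<in> path_image g" "\<phi> x = \<phi> y"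
    by (auto simp: path_image_compose)
  then have "x = y" using \<phi> [of x] \<phi> [of y] by (simp add: complex_eq_iff)
  then show ?thesis using xy by blast
qed

text \<open>Following \<open>\<gamma>\<close> up to its point on \<open>d\<close>, and then
  \<open>d\<close> back to its start, gives a path from between the ends of \<open>e\<close> to a
  point beyond them, which has to meet \<open>e\<close>. As \<open>d\<close> misses
  \<open>e\<close>, the meeting is on \<open>\<gamma>\<close>. This forces the order of crossings
  along an arc.\<close>

lemma half_plane_meets_first:
  fixes \<gamma> e d :: "real \<Rightarrow> complex"
  assumes "path \<gamma>" "path e" "path d"
    and re: "\<And>z. z \<in> path_image \<gamma> \<union> path_image e \<union> path_image d \<Longrightarrow> 1 \<le> Re z"
    and \<gamma>: "pathstart \<gamma> = Complex 1 i" and e: "pathstart e = Complex 1 m" "pathfinish e = Complex 1 M"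
    and d: "pathstart d = Complex 1 k" and lt: "m < i" "i < M" "k < m \<or> M < k"
    and disj: "path_image d \<inter> path_image e = {}"
    and s: "s \<in> {0..1}" "\<gamma> s \<in> path_image d"
  shows "\<exists>u\<in>{0..s}. \<gamma> u \<in> path_image e"
proof (rule ccontr)
  assume no: "\<not> ?thesis"
  obtain t where t: "t \<in> {0..1}" "d t = \<gamma> s" using s(2) by (auto simp: path_image_def)
  define f where "f = subpath 0 s \<gamma> +++ subpath t 0 d"
  have j: "pathfinish (subpath 0 s \<gamma>) = pathstart (subpath t 0 d)" using t by simp
  have p: "path f" unfolding f_def using assms(1,3) s t j by (simp add: path_subpath)
  have im: "path_image f = path_image (subpath 0 s \<gamma>) \<union> path_image (subpath t 0 d)"
    unfolding f_def using j by (rule path_image_join)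
  have sub: "path_image (subpath 0 s \<gamma>) = \<gamma> ` {0..s}" "path_image (subpath 0 s \<gamma>) \<subseteq> path_image \<gamma>"
    "path_image (subpath t 0 d) \<subseteq> path_image d"
    using s t path_image_subpath_subset [of 0 s \<gamma>] path_image_subpath_subset [of t 0 d] by (auto simp: path_image_subpath)
  have fe: "path_image f \<inter> path_image e = {}"
    unfolding im using sub no disj by auto
  have ends: "pathstart f = Complex 1 i" "pathfinish f = Complex 1 k"
    unfolding f_def pathstart_join pathfinish_join pathstart_subpath pathfinish_subpath
    using \<gamma> d by (simp_all add: pathstart_def pathfinish_def)
  have re': "1 \<le> Re z" if "z \<in> path_image f \<union> path_image e" for z
    using that re sub im by blast
  show False
    using lt(3)
  proof
    assume "M < k"
    then show False
      using half_plane_interlace [OF assms(2) p _ e ends lt(1,2)] re' fe by blast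
  next
    assume "k < m"
    then show False
      using half_plane_interlace [of "reversepath f" e k i m M] assms(2) p e ends lt(1,2) re' fe by auto
  qed
qed

lemma crosses_at_mirror:
  assumes "crosses_at A B p"
  shows "crosses_at ((\<lambda>z. - cnj z) ` A) ((\<lambda>z. - cnj z) ` B) (- cnj p)"
proof -
  obtain U f g where U: "open U" "p \<in> U" "homeomorphism U (ball (0::complex) 1) f g" "f p = 0"
    "f ` (A \<inter> U) = {z \<in> ball 0 1. Im z = 0}" "f ` (B \<inter> U) = {z \<in> ball 0 1. Re z = 0}"
    using assms unfolding crosses_at_def by blast
  define s where "s = (\<lambda>z. - cnj z)"
  have cs: "continuous_on S s" for S unfolding s_def by (intro continuous_intros)
  have ss: "s (s z) = z" for z unfolding s_def by simp
  then have inj: "inj s" by (metis injI)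
  have sv: "s ` S = s -` S" for S
  proof
    show "s ` S \<subseteq> s -` S" using ss by auto
    show "s -` S \<subseteq> s ` S" using ss by (metis image_eqI subsetI vimageE)
  qed
  have h: "homeomorphism (s ` U) (ball 0 1) (f \<circ> s) (s \<circ> g)"
  proof (rule homeomorphism_compose)
    show "homeomorphism (s ` U) U s s"
      by (rule homeomorphismI) (auto simp: cs ss)
  qed (fact U(3))
  have im: "(f \<circ> s) ` (s ` S \<inter> s ` U) = f ` (S \<inter> U)" for S
  proof -
    have "s ` S \<inter> s ` U = s ` (S \<inter> U)" using inj by (rule image_Int [symmetric])
    then show ?thesis by (simp add: image_image ss)
  qed
  show ?thesis
    unfolding crosses_at_def s_def [symmetric]
  proof (intro exI conjI)
    show "open (s ` U)" unfolding sv using U(1) cs [of UNIV] by (auto intro: continuous_open_vimage simp: continuous_on_eq_continuous_at)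
    show "- cnj p \<in> s ` U" using U(2) unfolding s_def by blast
    show "homeomorphism (s ` U) (ball 0 1) (f \<circ> s) (s \<circ> g)" by (fact h)
    show "(f \<circ> s) (- cnj p) = 0" using U(4) by (simp add: s_def)
    show "(f \<circ> s) ` (s ` A \<inter> s ` U) = {z \<in> ball 0 1. Im z = 0}"
      "(f \<circ> s) ` (s ` B \<inter> s ` U) = {z \<in> ball 0 1. Re z = 0}"
      unfolding im by (fact U)+
  qed
qed

text \<open>At a crossing of two branches of a closed curve, the loop that starts at the crossing along one
  branch separates the two halves of the other branch.\<close>

lemma crossing_separates:
  fixes \<kappa> :: "real \<Rightarrow> complex" and N :: int and a b a' b' :: real
  assumes cont: "continuous_on UNIV \<kappa>"
    and eq: "\<And>s t. \<kappa> s = \<kappa> t \<longleftrightarrow> (\<exists>n::int. s - t = 6 * real_of_int n) \<or> (s \<in> \<int> \<and> t \<in> \<int> \<and> (\<exists>n::int. s - t = 3 * real_of_int n))"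
    and cr: "crosses_at A B (\<kappa> N)"
    and A: "A = \<kappa> ` {a..b}" "a < N" "N < b" and B: "B = \<kappa> ` {a'..b'}" "a' < of_int N + 3" "of_int N + 3 < b'"
    and j: "j = 1 \<or> j = (2::int)"
  shows "\<not> connected_component (- (\<kappa> ` {of_int (N - j)..of_int (N - j) + 3})) (\<kappa> (N + 5/2)) (\<kappa> (N + 7/2))"
proof
  define n where "n = N - j"
  define C where "C = \<kappa> ` {real_of_int n..real_of_int n + 3}"
  assume "connected_component (- (\<kappa> ` {of_int (N - j)..of_int (N - j) + 3})) (\<kappa> (N + 5/2)) (\<kappa> (N + 7/2))"
  then have cc: "connected_component (- C) (\<kappa> (N + 5/2)) (\<kappa> (N + 7/2))" unfolding C_def n_def .
  have nN: "real_of_int n + 1 \<le> N" "real_of_int N \<le> n + 2" unfolding n_def using j by auto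
  have contS: "continuous_on S \<kappa>" for S using cont continuous_on_subset by blast
  have close: "s = t" if close: "\<kappa> s = \<kappa> t" "\<bar>s - t\<bar> < 3" for s t
  proof -
    consider m :: int where "s - t = 6 * real_of_int m" | m :: int where "s - t = 3 * real_of_int m"
      using close(1) unfolding eq by blast
    then show ?thesis
    proof cases
      case (1 m)
      then have "m = 0" using close(2) by linarith
      then show ?thesis using 1 by simp
    next
      case (2 m)
      then have "m = 0" using close(2) by linarith
      then show ?thesis using 2 by simp
    qed
  qed
  define p where "p = \<kappa> N"
  have p3: "\<kappa> (of_int N + 3) = p" unfolding p_def eq by (intro disjI2 conjI exI [of _ 1]) auto
  define g where "g = (\<lambda>t. \<kappa> (of_int n + 3 * t))"
  have pg: "path_image g = C"
  proof -
    have "path_image g = \<kappa> ` (\<lambda>t. 3 * t + of_int n) ` {0..1}"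
      unfolding path_image_def g_def image_image by (simp add: add.commute)
    also have "(\<lambda>t::real. 3 * t + of_int n) ` {0..1} = {of_int n..of_int n + 3}"
      by (subst image_affinity_atLeastAtMost) (simp add: add.commute)
    finally show ?thesis unfolding C_def .
  qed
  have n3: "\<kappa> (of_int n + 3) = \<kappa> n" unfolding eq by (intro disjI2 conjI exI [of _ 1]) auto
  have sg: "simple_path g"
    unfolding simple_path_def loop_free_def path_def
  proof (intro conjI ballI impI)
    show "continuous_on {0..1} g"
      unfolding g_def by (rule continuous_on_compose2 [OF contS [of UNIV]]) (auto intro!: continuous_intros)
    fix s t assume st: "s \<in> {0..1::real}" "t \<in> {0..1::real}" "g s = g t"
    show "s = t \<or> s = 0 \<and> t = 1 \<or> s = 1 \<and> t = 0"
    proof (cases "\<bar>s - t\<bar> < 1")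
      case True
      then have "\<bar>(of_int n + 3 * s) - (of_int n + 3 * t)\<bar> < 3" by simp
      then show ?thesis using close st(3) unfolding g_def by fastforce
    next
      case False
      then show ?thesis using st(1,2) by auto
    qed
  qed
  have lg: "pathfinish g = pathstart g" unfolding g_def pathfinish_def pathstart_def using n3 by simp
  note J = Jordan_inside_outside [OF sg lg, unfolded pg]
  have clC: "closed C" using sg closed_simple_path_image pg by metis
  obtain U f h where U: "open U" "p \<in> U" "homeomorphism U (ball (0::complex) 1) f h" "f p = 0"
    "f ` (A \<inter> U) = {z \<in> ball 0 1. Im z = 0}" "f ` (B \<inter> U) = {z \<in> ball 0 1. Re z = 0}"
    using cr unfolding crosses_at_def p_def by blast
  have fh: "h (f x) = x" "f x \<in> ball 0 1" if "x \<in> U" for x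
    using U(3) that by (auto simp: homeomorphism_def)
  have hf: "f (h z) = z" "h z \<in> U" if "z \<in> ball 0 1" for z
    using U(3) that by (auto simp: homeomorphism_def)
  have inA: "x \<in> A \<longleftrightarrow> Im (f x) = 0" if "x \<in> U" for x
  proof
    assume "x \<in> A"
    then have "f x \<in> f ` (A \<inter> U)" using that by blast
    then show "Im (f x) = 0" unfolding U(5) by simp
  next
    assume "Im (f x) = 0"
    then have "f x \<in> f ` (A \<inter> U)" unfolding U(5) using fh(2) [OF that] by simp
    then obtain y where "y \<in> A" "y \<in> U" "f x = f y" by blast
    then show "x \<in> A" using fh(1) [OF that] fh(1) [of y] by metis
  qed
  have inB: "x \<in> B \<longleftrightarrow> Re (f x) = 0" if "x \<in> U" for x
  proof
    assume "x \<in> B"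
    then have "f x \<in> f ` (B \<inter> U)" using that by blast
    then show "Re (f x) = 0" unfolding U(6) by simp
  next
    assume "Re (f x) = 0"
    then have "f x \<in> f ` (B \<inter> U)" unfolding U(6) using fh(2) [OF that] by simp
    then obtain y where "y \<in> B" "y \<in> U" "f x = f y" by blast
    then show "x \<in> B" using fh(1) [OF that] fh(1) [of y] by metis
  qed
  define \<epsilon> where "\<epsilon> = Min {1/2, N - a, b - N, of_int N + 3 - a', b' - (of_int N + 3)}"
  have \<epsilon>: "0 < \<epsilon>" "\<epsilon> \<le> 1/2" "\<epsilon> \<le> N - a" "\<epsilon> \<le> b - N" "\<epsilon> \<le> of_int N + 3 - a'" "\<epsilon> \<le> b' - (of_int N + 3)"
    unfolding \<epsilon>_def using A B by (auto simp: min_def)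
  define I1 where "I1 = {of_int N - \<epsilon><..<of_int N + \<epsilon>}"
  define I2 where "I2 = {of_int N + 3 - \<epsilon><..<of_int N + 3 + \<epsilon>}"
  \<comment> \<open>The window from \<open>n\<close> to \<open>n + 6\<close> is one period with both
    passages through \<open>p\<close> in its interior. What remains of the curve is compact and
    misses \<open>p\<close>, so a small neighbourhood sees only the two branches.\<close>
  define Rest where "Rest = \<kappa> ` ({of_int n..of_int n + 6} - (I1 \<union> I2))"
  have cR: "closed Rest"
    unfolding Rest_def I1_def I2_def
    by (intro compact_imp_closed compact_continuous_image contS compact_diff) auto
  have pR: "p \<notin> Rest"
  proof
    assume "p \<in> Rest"
    then obtain t where "t \<in> {of_int n..of_int n + 6} - (I1 \<union> I2)" "p = \<kappa> t"
      unfolding Rest_def by blast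
    then have t: "of_int n \<le> t" "t \<le> of_int n + 6" "t \<notin> I1" "t \<notin> I2" "\<kappa> t = \<kappa> N"
      unfolding p_def by auto
    have "\<bar>t - (of_int N + 3)\<bar> < 3 \<or> \<bar>t - N\<bar> < 3" using t(1,2) nN by (auto simp: abs_less_iff) 
    then have "t = of_int N + 3 \<or> t = N" using close t(5) p3 unfolding p_def by metis
    then show False using t(3,4) \<epsilon>(1) unfolding I1_def I2_def by auto
  qed
  have win: "\<exists>t'\<in>{of_int n..of_int n + 6}. \<kappa> t' = \<kappa> t" for t
  proof -
    define k where "k = \<lfloor>(t - n) / 6\<rfloor>"
    have "of_int k \<le> (t - n) / 6" "(t - n) / 6 < of_int k + 1" unfolding k_def by linarith+
    then have "t - 6 * k \<in> {of_int n..of_int n + 6}" by auto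
    moreover have "\<kappa> (t - 6 * k) = \<kappa> t" unfolding eq by (intro disjI1 exI [of _ "-k"]) simp
    ultimately show ?thesis by blast
  qed
  have near: "x \<in> \<kappa> ` I1 \<or> x \<in> \<kappa> ` I2" if x: "x \<in> range \<kappa>" "x \<notin> Rest" for x
  proof -
    obtain t where "t \<in> {of_int n..of_int n + 6}" "x = \<kappa> t" using x(1) win by (metis imageE)
    then have "t \<in> I1 \<union> I2" using x(2) unfolding Rest_def by blast
    then show ?thesis using \<open>x = \<kappa> t\<close> by blast
  qed
  have I1A: "\<kappa> ` I1 \<subseteq> A" unfolding A(1) I1_def using \<epsilon> by (intro image_mono) auto
  have I2B: "\<kappa> ` I2 \<subseteq> B" unfolding B(1) I2_def using \<epsilon> by (intro image_mono) auto
  have I1C: "\<kappa> ` I1 \<subseteq> C" unfolding C_def I1_def using \<epsilon> nN by (intro image_mono) auto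
  have I2C: "t = of_int N + 3" if t: "t \<in> I2" "\<kappa> t \<in> C" for t
  proof -
    obtain s where s: "of_int n \<le> s" "s \<le> of_int n + 3" "\<kappa> t = \<kappa> s" using t(2) unfolding C_def by auto
    have r: "of_int n + 7/2 < t" "t < of_int n + 11/2" using t(1) nN \<epsilon>(2) unfolding I2_def by auto
    then have "\<nexists>m::int. t - s = 6 * real_of_int m"
    proof (intro notI, elim exE)
      fix m :: int assume "t - s = 6 * real_of_int m"
      then have "0 < 6 * real_of_int m" "6 * real_of_int m < 6" using r s by linarith+
      then have "0 < m" "m < 1" by linarith+
      then show False by linarith
    qed
    then have "t \<in> \<int>" using eq s(3) by blast
    then obtain m :: int where m: "t = m" by (auto elim: Ints_cases)
    then have "m = N + 3" using t(1) \<epsilon>(2) unfolding I2_def by auto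
    then show ?thesis using m by simp
  qed
  have opf: "open (f ` (U - Rest))"
  proof -
    have "openin (top_of_set (ball 0 1)) (f ` (U - Rest))"
      by (rule homeomorphism_imp_open_map [OF U(3)]) (use U(1) cR in \<open>auto intro: open_openin_trans open_Diff\<close>)
    then show ?thesis by (metis open_ball openin_open_eq)
  qed
  have "0 \<in> f ` (U - Rest)" using U(2,4) pR by (metis DiffI imageI)
  then obtain r where r: "r > 0" "ball 0 r \<subseteq> f ` (U - Rest)" using opf open_contains_ball by blast
  have rb: "z \<in> ball 0 1" if z: "z \<in> ball 0 r" for z :: complex
  proof -
    obtain y where "y \<in> U" "z = f y" using r(2) z by blast
    then show ?thesis using fh(2) by simp
  qed
  define V where "V = h ` ball 0 r"
  have VU: "x \<in> U" "x \<notin> Rest" "f x \<in> ball 0 r" if x: "x \<in> V" for x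
  proof -
    obtain z where z: "z \<in> ball 0 r" "x = h z" using x unfolding V_def by blast
    then obtain y where y: "y \<in> U" "y \<notin> Rest" "z = f y" using r(2) by blast
    then have "x = y" using z fh by simp
    then show "x \<in> U" "x \<notin> Rest" "f x \<in> ball 0 r" using y z by auto
  qed
  have VI: "x \<in> V" if "x \<in> U" "f x \<in> ball 0 r" for x
    unfolding V_def using that fh(1) by (metis imageI)
  have ch: "continuous_on S h" if "S \<subseteq> ball 0 1" for S
    using U(3) that homeomorphism_cont2 continuous_on_subset by blast
  have opV: "open V"
  proof -
    have "V = U \<inter> f -` ball 0 r" using VU VI by auto
    moreover have "open (U \<inter> f -` ball 0 r)"
      using U(1,3) by (intro continuous_open_preimage) (auto simp: homeomorphism_cont1)
    ultimately show ?thesis by simp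
  qed
  have pV: "p \<in> V" using VI U(2,4) r(1) by simp
  \<comment> \<open>Within \<open>V\<close> the loop is exactly the horizontal diameter, since of
    the second branch it contains only \<open>p\<close>.\<close>
  have VC: "x \<in> C \<longleftrightarrow> Im (f x) = 0" if x: "x \<in> V" for x
  proof
    assume xC: "x \<in> C"
    then have "x \<in> \<kappa> ` I1 \<or> x \<in> \<kappa> ` I2" using near VU(2) [OF x] unfolding C_def by blast
    then show "Im (f x) = 0"
    proof
      assume "x \<in> \<kappa> ` I1"
      then show ?thesis using I1A inA VU(1) [OF x] by blast
    next
      assume "x \<in> \<kappa> ` I2"
      then have "x = p" using I2C xC p3 by blast
      then show ?thesis using U(4) by simp
    qed
  next
    assume im: "Im (f x) = 0"
    then have "x \<in> A" using inA VU(1) [OF x] by blast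
    then have "x \<in> \<kappa> ` I1 \<or> x \<in> \<kappa> ` I2" using near VU(2) [OF x] unfolding A(1) by blast
    then show "x \<in> C"
    proof
      assume "x \<in> \<kappa> ` I2"
      then have "Re (f x) = 0" using I2B inB VU(1) [OF x] by blast
      then have "f x = f p" using im U(4) by (simp add: complex_eq_iff)
      then have "x = p" using fh(1) U(2) VU(1) [OF x] by metis
      then show ?thesis using I1C \<epsilon>(1) unfolding p_def I1_def by auto
    qed (use I1C in blast)
  qed
  define Up where "Up = h ` (ball 0 r \<inter> {z. Im z > 0})"
  define Dn where "Dn = h ` (ball 0 r \<inter> {z. Im z < 0})"
  have con: "connected (h ` (ball 0 r \<inter> H))" if "convex H" for H
    using rb that by (intro connected_continuous_image ch convex_connected convex_Int convex_ball) blast+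
  have conUD: "connected Up" "connected Dn"
    unfolding Up_def Dn_def by (intro con convex_halfspace_Im_gt convex_halfspace_Im_lt)+
  have UDI: "x \<in> V \<Longrightarrow> Im (f x) > 0 \<Longrightarrow> x \<in> Up" "x \<in> V \<Longrightarrow> Im (f x) < 0 \<Longrightarrow> x \<in> Dn" for x
    unfolding Up_def Dn_def using VU fh(1) by (metis IntI imageI mem_Collect_eq)+
  have UDC: "Up \<inter> C = {}" "Dn \<inter> C = {}"
  proof -
    have "h z \<in> V" "f (h z) = z" if "z \<in> ball 0 r" for z
      using that hf(1) [OF rb] unfolding V_def by auto
    then show "Up \<inter> C = {}" "Dn \<inter> C = {}" unfolding Up_def Dn_def using VC by fastforce+
  qed
  have "open (\<kappa> -` V)" using opV cont by (rule open_vimage)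
  moreover have "of_int N + 3 \<in> \<kappa> -` V" using pV p3 by simp
  ultimately obtain \<delta>0 where \<delta>0: "\<delta>0 > 0" "\<And>t. dist t (of_int N + 3) < \<delta>0 \<Longrightarrow> \<kappa> t \<in> V"
    unfolding open_dist by blast
  define \<delta> where "\<delta> = min (\<delta>0 / 2) (\<epsilon> / 2)"
  have \<delta>: "0 < \<delta>" "\<delta> < \<delta>0" "\<delta> < \<epsilon>" unfolding \<delta>_def using \<delta>0 \<epsilon> by (auto simp: min_def)
  let ?l = "of_int N + 3 - \<delta>" and ?m = "of_int N + (3::real)" and ?u = "of_int N + 3 + \<delta>"
  have inV: "\<kappa> t \<in> V" if "t \<in> {?l..?u}" for t
    using \<delta>0(2) [of t] that \<delta> by (auto simp: dist_real_def abs_less_iff)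
  define q where "q = (\<lambda>t. Im (f (\<kappa> t)))"
  have Re0: "Re (f (\<kappa> t)) = 0" if "t \<in> {?l..?u}" for t
  proof -
    have "t \<in> I2" using that \<delta> unfolding I2_def by auto
    then show ?thesis using I2B inB VU(1) [OF inV [OF that]] by blast
  qed
  \<comment> \<open>Along the second branch \<open>f\<close> is purely imaginary and injective, so
    its imaginary part is strictly monotone and changes sign at \<open>p\<close>: the branch passes
    from one half disc to the other.\<close>
  have "(q ?l < q ?m \<and> q ?m < q ?u) \<or> (q ?u < q ?m \<and> q ?m < q ?l)"
  proof -
    have lmu: "?l < ?m" "?m < ?u" using \<delta> by auto
    have "continuous_on {?l..?u} (\<lambda>t. f (\<kappa> t))"
      by (rule continuous_on_compose2 [OF homeomorphism_cont1 [OF U(3)] contS]) (use inV VU(1) in blast)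
    then have cq: "continuous_on {?l..?u} q" unfolding q_def by (intro continuous_intros)
    have "inj_on q {?l..?u}"
    proof (rule inj_onI)
      fix s t assume st: "s \<in> {?l..?u}" "t \<in> {?l..?u}" "q s = q t"
      then have "f (\<kappa> s) = f (\<kappa> t)" using Re0 unfolding q_def by (simp add: complex_eq_iff)
      then have "\<kappa> s = \<kappa> t" using fh(1) VU(1) inV st by metis
      moreover have "\<bar>s - t\<bar> < 3" using st(1,2) \<delta>(3) \<epsilon>(2) by (auto simp: abs_less_iff)
      ultimately show "s = t" by (rule close)
    qed
    then show ?thesis by (rule continuous_inj_imp_mono [OF lmu cq])
  qed
  moreover have "q ?m = 0" unfolding q_def using p3 U(4) by simp
  ultimately have ud: "\<kappa> ?l \<in> Up \<and> \<kappa> ?u \<in> Dn \<or> \<kappa> ?l \<in> Dn \<and> \<kappa> ?u \<in> Up"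
    using UDI inV [of ?l] inV [of ?u] \<delta>(1) unfolding q_def by force
  have offC: "\<kappa> t \<notin> C" if "t \<in> {of_int N + 5/2..?l} \<union> {?u..of_int N + 7/2}" for t
  proof
    assume "\<kappa> t \<in> C"
    then obtain s where s: "of_int n \<le> s" "s \<le> of_int n + 3" "\<kappa> t = \<kappa> s" unfolding C_def by auto
    have tr: "of_int n + 7/2 \<le> t" "t \<le> of_int n + 11/2" "t \<noteq> of_int N + 3" "of_int N + 5/2 \<le> t" "t \<le> of_int N + 7/2"
      using that nN \<delta>(1) \<delta>(3) \<epsilon>(2) by auto
    have "\<nexists>m::int. t - s = 6 * real_of_int m"
    proof (intro notI, elim exE)
      fix m :: int assume "t - s = 6 * real_of_int m"
      then have "0 < 6 * real_of_int m" "6 * real_of_int m < 6" using tr s by linarith+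
      then have "0 < m" "m < 1" by linarith+
      then show False by linarith
    qed
    then have "t \<in> \<int>" using eq s(3) by blast
    then obtain m :: int where m: "t = m" by (auto elim: Ints_cases)
    then have "N + 2 < m" "m < N + 4" using tr by linarith+
    then have "m = N + 3" by linarith
    then have "t = of_int N + 3" using m by simp
    then show False using tr(3) by contradiction
  qed
  \<comment> \<open>If one component \<open>Z\<close> contained both outer points, it would contain
    both half discs and thus everything off the loop near \<open>p\<close>; but the inside and the
    outside of the loop both come arbitrarily close to \<open>p\<close>.\<close>
  define Z where "Z = connected_component_set (- C) (\<kappa> (of_int N + 5/2))"
  have inZ: "S \<subseteq> Z" if "connected S" "S \<inter> C = {}" "x \<in> S" "x \<in> Z" for S x
    using that unfolding Z_def
    by (metis ComplI connected_component_eq connected_component_maximal disjoint_iff mem_Collect_eq subsetI)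
  have dr: "\<delta> < 1/2" using \<delta>(3) \<epsilon>(2) by simp
  have "\<kappa> (of_int N + 5/2) \<notin> C" by (rule offC) (use dr in auto)
  then have z1: "\<kappa> (of_int N + 5/2) \<in> Z" unfolding Z_def by simp
  have z2: "\<kappa> (of_int N + 7/2) \<in> Z" using cc unfolding Z_def by simp
  have "\<kappa> ` {of_int N + 5/2..?l} \<subseteq> Z"
    by (rule inZ [OF _ _ _ z1]) (use offC dr in \<open>auto intro!: connected_continuous_image contS\<close>)
  then have lZ: "\<kappa> ?l \<in> Z" using dr by auto
  have "\<kappa> ` {?u..of_int N + 7/2} \<subseteq> Z"
    by (rule inZ [OF _ _ _ z2]) (use offC dr in \<open>auto intro!: connected_continuous_image contS\<close>)
  then have uZ: "\<kappa> ?u \<in> Z" using dr by auto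
  have "Up \<subseteq> Z" "Dn \<subseteq> Z" using ud lZ uZ inZ conUD UDC by metis+
  have VZ: "V - C \<subseteq> Z"
  proof
    fix x assume x: "x \<in> V - C"
    then have "Im (f x) > 0 \<or> Im (f x) < 0" using VC [of x] by auto
    then show "x \<in> Z" using UDI [of x] x \<open>Up \<subseteq> Z\<close> \<open>Dn \<subseteq> Z\<close> by blast
  qed
  have pC: "p \<in> C" using VC pV U(4) by simp
  have "p \<in> closure (inside C)" "p \<in> closure (outside C)"
    using J pC by (metis UnCI closure_Un_frontier)+
  then have "V \<inter> inside C \<noteq> {}" "V \<inter> outside C \<noteq> {}"
    using pV open_Int_closure_eq_empty [OF opV, of "inside C"] open_Int_closure_eq_empty [OF opV, of "outside C"] by blast+
  then obtain x y where xy: "x \<in> inside C" "x \<in> V" "y \<in> outside C" "y \<in> V" by blast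
  then have "x \<in> Z" "y \<in> Z" using VZ inside_no_overlap [of C] outside_no_overlap [of C] by blast+
  moreover have "connected Z" "Z \<subseteq> - C" unfolding Z_def by (auto simp: connected_component_subset)
  ultimately show False
    using connectedD [of Z "inside C" "outside C"] J xy inside_Int_outside [of C] inside_Un_outside [of C] by blast
qed

section \<open>Tied six-blades\<close>

lemma shift_multiple:
  fixes f :: "real \<Rightarrow> real"
  assumes "\<And>t. f (t + p) = f t + q"
  shows "f (t + p * of_int n) = f t + q * of_int n"
proof (induction n)
  case (nonneg n)
  show ?case
  proof (induction n)
    case (Suc n)
    then show ?case using assms [of "t + p * real n"] by (simp add: algebra_simps)
  qed simp
next
  case (neg n)
  show ?case
  proof (induction n)
    case 0
    show ?case using assms [of "t - p"] by simp
  next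
    case (Suc n)
    then show ?case using assms [of "t - p * (real n + 2)"] by (simp add: algebra_simps)
  qed
qed

lemma strict_mono_interpolation:
  fixes E :: "int \<Rightarrow> real"
  assumes less: "\<And>i. E i < E (i + 1)" and per: "\<And>i. E (i + 6) = E i + 12"
  obtains g :: "real \<Rightarrow> real" where "continuous_on UNIV g" "strict_mono g" "\<And>i. g (of_int i) = E i" "\<And>t. g (t + 6) = g t + 12"
proof -
  define g where "g = (\<lambda>t::real. (1 - frac t) * E \<lfloor>t\<rfloor> + frac t * E (\<lfloor>t\<rfloor> + 1))"
  have le: "E i \<le> E j" if "i \<le> j" for i j
    using that
  proof (induction j rule: int_ge_induct)
    case (step j)
    then show ?case using less [of j] by linarith
  qed simp
  show ?thesis
  proof
    show "continuous_on UNIV g"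
      unfolding g_def
      by (rule continuous_on_floor_pieces [of "\<lambda>i u. (1 - u) * E i + u * E (i + 1)"]) (auto intro!: continuous_intros)
    show "g (of_int i) = E i" for i unfolding g_def by simp
    show "g (t + 6) = g t + 12" for t
    proof -
      have "\<lfloor>t + 6\<rfloor> = \<lfloor>t\<rfloor> + 6" by linarith
      moreover from this have "frac (t + 6) = frac t" unfolding frac_def by simp
      moreover have "E (\<lfloor>t\<rfloor> + 6 + 1) = E (\<lfloor>t\<rfloor> + 1) + 12" using per [of "\<lfloor>t\<rfloor> + 1"] by (simp add: algebra_simps)
      ultimately show ?thesis unfolding g_def using per [of "\<lfloor>t\<rfloor>"] by (simp add: algebra_simps)
    qed
    show "strict_mono g"
    proof (rule strict_monoI)
      fix s t :: real assume st: "s < t"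
      have g: "g t = E \<lfloor>t\<rfloor> + frac t * (E (\<lfloor>t\<rfloor> + 1) - E \<lfloor>t\<rfloor>)" for t
        unfolding g_def by (simp add: algebra_simps)
      show "g s < g t"
      proof (cases "\<lfloor>s\<rfloor> = \<lfloor>t\<rfloor>")
        case True
        then have "frac s < frac t" using st unfolding frac_def by simp
        then show ?thesis unfolding g True using less [of "\<lfloor>t\<rfloor>"] by simp
      next
        case False
        moreover have "\<lfloor>s\<rfloor> \<le> \<lfloor>t\<rfloor>" using st by (intro floor_mono) simp
        ultimately have "\<lfloor>s\<rfloor> + 1 \<le> \<lfloor>t\<rfloor>" by linarith
        then have "E (\<lfloor>s\<rfloor> + 1) \<le> E \<lfloor>t\<rfloor>" by (rule le)
        moreover have "g s < E (\<lfloor>s\<rfloor> + 1)"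
        proof -
          have "frac s * (E (\<lfloor>s\<rfloor> + 1) - E \<lfloor>s\<rfloor>) < 1 * (E (\<lfloor>s\<rfloor> + 1) - E \<lfloor>s\<rfloor>)"
            using less [of "\<lfloor>s\<rfloor>"] frac_lt_1 [of s] by (intro mult_strict_right_mono) simp_all
          then show ?thesis unfolding g by simp
        qed
        moreover have "E \<lfloor>t\<rfloor> \<le> g t"
          unfolding g using less [of "\<lfloor>t\<rfloor>"] frac_ge_0 [of t] by simp
        ultimately show ?thesis by linarith
      qed
    qed
  qed
qed

lemma continuous_strict_mono_surj:
  fixes g :: "real \<Rightarrow> real"
  assumes c: "continuous_on UNIV g" and per: "\<And>t. g (t + 6) = g t + 12"
  shows "surj g"
proof -
  have "\<exists>t. y = g t" for y
  proof -
    define n where "n = \<lfloor>(y - g 0) / 12\<rfloor>"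
    have n: "of_int n \<le> (y - g 0) / 12" "(y - g 0) / 12 < of_int n + 1" unfolding n_def by linarith+
    have "g (6 * of_int n) \<le> y" "y \<le> g (6 * of_int n + 6)"
      using shift_multiple [of g 6 12 0 n] per n by auto
    then show ?thesis
      using IVT' [of g "6 * of_int n" y "6 * of_int n + 6"] continuous_on_subset [OF c] by auto
  qed
  then show ?thesis unfolding surj_def by blast
qed

section \<open>Closed curves made of twelve pieces\<close>

text \<open>The twelve pieces \<open>P i\<close> of a closed curve, alternately blades and arcs, together with the six
  passages through crossings in the order in which the curve makes them: the passage \<open>k\<close> is on the
  piece \<open>js k\<close> at the parameter \<open>us k\<close>, and the passages \<open>k\<close> and \<open>k + 3\<close> are through the same
  crossing.\<close>

locale strand_cycle =
  fixes X Y :: tying and L R :: "nat set \<Rightarrow> real \<Rightarrow> complex"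
    and P :: "nat \<Rightarrow> real \<Rightarrow> complex" and S :: "nat \<Rightarrow> strand" and js :: "nat \<Rightarrow> nat" and us :: "nat \<Rightarrow> real"
  assumes cont_P: "i < 12 \<Longrightarrow> continuous_on {0..1} (P i)"
    and inj_P: "i < 12 \<Longrightarrow> inj_on (P i) {0..1}"
    and join_P: "i < 12 \<Longrightarrow> P i 1 = P ((i + 1) mod 12) 0"
    and image_P: "i < 12 \<Longrightarrow> P i ` {0..1} = strand_curve L R (S i)"
    and inj_S: "inj_on S {..<12}" and image_S: "S ` {..<12} = strands X Y"
    and meet: "\<lbrakk>i < 12; j < 12; i \<noteq> j; 0 \<le> s; s < 1; 0 \<le> t; t < 1; P i s = P j t\<rbrakk> \<Longrightarrow> {S i, S j} \<in> crossings X Y"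
    and crossings_eq: "crossings X Y = (\<lambda>k. {S (js k), S (js (k + 3))}) ` {..<3}"
    and js: "k < 6 \<Longrightarrow> js k < 12" "k < 6 \<Longrightarrow> odd (js k)" and js3: "k < 3 \<Longrightarrow> js k \<noteq> js (k + 3)"
    and us: "k < 6 \<Longrightarrow> 0 < us k" "k < 6 \<Longrightarrow> us k < 1"
    and cross: "k < 6 \<Longrightarrow> P (js k) ` {0..1} \<inter> P (js ((k + 3) mod 6)) ` {0..1} = {P (js k) (us k)}"
    and cross_at: "k < 6 \<Longrightarrow> crosses_at (P (js k) ` {0..1}) (P (js ((k + 3) mod 6)) ` {0..1}) (P (js k) (us k))"
    and order: "k < 5 \<Longrightarrow> real (js k) + us k < real (js (k + 1)) + us (k + 1)"
begin

text \<open>Each piece takes a half-open unit of time, so a joint belongs to the piece that starts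
  there; the period is 12.\<close>

definition \<kappa>0 :: "real \<Rightarrow> complex" where "\<kappa>0 t = P (nat (\<lfloor>t\<rfloor> mod 12)) (frac t)"

text \<open>The time of the passage \<open>k\<close> on the scale of
  \<open>\<kappa>0\<close>.\<close>

definition ev :: "nat \<Rightarrow> real" where "ev k = real (js k) + us k"

definition x :: "nat \<Rightarrow> strand set" where "x k = {S (js k), S (js (k + 3))}"

lemma real_decomposition:
  obtains i u n where "i < (12::nat)" "0 \<le> u" "u < 1" "t = real i + u + 12 * of_int n"
proof
  show "nat (\<lfloor>t\<rfloor> mod 12) < 12" by (simp add: nat_less_iff)
  have "real (nat (\<lfloor>t\<rfloor> mod 12)) = of_int (\<lfloor>t\<rfloor> mod 12)" by simp
  moreover have "of_int (\<lfloor>t\<rfloor> mod 12) + 12 * of_int (\<lfloor>t\<rfloor> div 12) = (of_int \<lfloor>t\<rfloor> :: real)"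
    by (metis mod_mult_div_eq of_int_add of_int_mult of_int_numeral)
  ultimately show "t = real (nat (\<lfloor>t\<rfloor> mod 12)) + frac t + 12 * of_int (\<lfloor>t\<rfloor> div 12)"
    unfolding frac_def by linarith
qed (auto simp: frac_lt_1)

lemma nat_mod_Suc: "nat ((i + 1) mod 12) = (nat (i mod 12) + 1) mod 12"
proof -
  have "int (nat ((i + 1) mod 12)) = int ((nat (i mod 12) + 1) mod 12)"
    unfolding zmod_int by simp presburger
  then show ?thesis by linarith
qed

lemma \<kappa>0_half_open:
  assumes "i < 12" "0 \<le> u" "u < 1" shows "\<kappa>0 (real i + u + 12 * of_int n) = P i u"
proof -
  have f: "\<lfloor>real i + u + 12 * of_int n\<rfloor> = int i + 12 * n" using assms by (intro floor_unique) auto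
  have "frac (real i + u + 12 * of_int n) = u" unfolding frac_def f by simp
  then show ?thesis unfolding \<kappa>0_def f using assms by simp
qed

lemma \<kappa>0_piece:
  assumes "i < 12" "0 \<le> u" "u \<le> 1" shows "\<kappa>0 (real i + u + 12 * of_int n) = P i u"
proof (cases "u = 1")
  case True
  show ?thesis
  proof (cases "i = 11")
    case True
    have "real i + u + 12 * of_int n = real 0 + 0 + 12 * of_int (n + 1)"
      using \<open>u = 1\<close> True by simp
    then have "\<kappa>0 (real i + u + 12 * of_int n) = P 0 0"
      using \<kappa>0_half_open [of 0 0 "n + 1"] by (simp only:)
    then show ?thesis using join_P [of 11] True \<open>u = 1\<close> by simp
  next
    case False
    then have "i + 1 < 12" using assms by simp
    then have "\<kappa>0 (real (i + 1) + 0 + 12 * of_int n) = P (i + 1) 0" by (intro \<kappa>0_half_open) auto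
    then show ?thesis using join_P [of i] assms \<open>i + 1 < 12\<close> \<open>u = 1\<close> by (simp add: add.commute)
  qed
qed (use \<kappa>0_half_open assms in auto)

lemma continuous_\<kappa>0: "continuous_on UNIV \<kappa>0"
proof -
  have "nat (i mod 12) < 12" for i :: int by (simp add: nat_less_iff)
  then show ?thesis
    unfolding \<kappa>0_def
    by (intro continuous_on_floor_pieces [of "\<lambda>i. P (nat (i mod 12))"]) (simp_all add: cont_P join_P nat_mod_Suc)
qed

lemma range_\<kappa>0: "range \<kappa>0 = projection X Y L R"
proof -
  have "range \<kappa>0 = (\<Union>i<12. P i ` {0..1})"
  proof (intro equalityI subsetI)
    fix z assume "z \<in> range \<kappa>0"
    then obtain t where "z = \<kappa>0 t" by blast
    moreover obtain i u n where "i < (12::nat)" "0 \<le> u" "u < 1" "t = real i + u + 12 * of_int n"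
      by (rule real_decomposition)
    ultimately show "z \<in> (\<Union>i<12. P i ` {0..1})" using \<kappa>0_half_open by fastforce
  next
    fix z assume "z \<in> (\<Union>i<12. P i ` {0..1})"
    then obtain i u where "i < 12" "0 \<le> u" "u \<le> 1" "z = P i u" by auto
    then show "z \<in> range \<kappa>0" using \<kappa>0_piece [of i u 0] by (metis rangeI)
  qed
  also have "\<dots> = projection X Y L R"
    unfolding projection_def image_S [symmetric] by (simp add: image_P)
  finally show ?thesis .
qed

lemma cross_sym: "k < 6 \<Longrightarrow> P (js ((k + 3) mod 6)) (us ((k + 3) mod 6)) = P (js k) (us k)"
proof -
  assume k: "k < 6"
  then have "((k + 3) mod 6 + 3) mod 6 = k" "(k + 3) mod 6 < 6" by presburger+
  then have "{P (js ((k + 3) mod 6)) (us ((k + 3) mod 6))} = {P (js k) (us k)}"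
    using cross [OF k] cross [of "(k + 3) mod 6"] by (simp add: Int_commute)
  then show ?thesis by simp
qed

lemma crossing_index:
  assumes "i < 12" "j < 12" "{S i, S j} \<in> crossings X Y"
  obtains k where "k < 6" "i = js k" "j = js ((k + 3) mod 6)"
proof -
  obtain k where k: "k < 3" "{S i, S j} = {S (js k), S (js (k + 3))}"
    using assms(3) unfolding crossings_eq by auto
  have S: "S a = S b \<longleftrightarrow> a = b" if "a < 12" "b < 12" for a b
    using inj_S that by (auto simp: inj_on_def)
  have "js k < 12" "js (k + 3) < 12" using js k by simp_all
  then consider "i = js k" "j = js (k + 3)" | "i = js (k + 3)" "j = js k"
    using k(2) assms(1,2) S by (auto simp: doubleton_eq_iff)
  then show ?thesis
  proof cases
    case 1
    then show ?thesis using k(1) by (intro that [of k]) auto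
  next
    case 2
    have "(k + 3 + 3) mod 6 = k" using k(1) by presburger
    then show ?thesis using 2 k(1) by (intro that [of "k + 3"]) auto
  qed
qed

lemma \<kappa>0_eqD:
  assumes "\<kappa>0 s = \<kappa>0 t"
  shows "(\<exists>n. s - t = 12 * of_int n) \<or>
    (\<exists>k<6. \<exists>m n. s = ev k + 12 * of_int m \<and> t = ev ((k + 3) mod 6) + 12 * of_int n)"
proof -
  obtain i u m where i: "i < (12::nat)" "0 \<le> u" "u < 1" "s = real i + u + 12 * of_int m"
    by (rule real_decomposition)
  obtain j v n where j: "j < (12::nat)" "0 \<le> v" "v < 1" "t = real j + v + 12 * of_int n"
    by (rule real_decomposition)
  have eq: "P i u = P j v" using assms i j \<kappa>0_half_open by simp
  show ?thesis
  proof (cases "i = j")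
    case True
    then have "u = v" using eq inj_P [OF i(1)] i j by (auto simp: inj_on_def)
    then have "s - t = 12 * of_int (m - n)" using i j True by simp
    then show ?thesis by blast
  next
    case False
    then have "{S i, S j} \<in> crossings X Y" using meet i j eq by blast
    then obtain k where k: "k < 6" "i = js k" "j = js ((k + 3) mod 6)" using crossing_index i(1) j(1) by blast
    have "P i u \<in> P (js k) ` {0..1}" using i k(2) by simp
    moreover have "P i u \<in> P (js ((k + 3) mod 6)) ` {0..1}" unfolding eq using j k(3) by simp
    ultimately have p: "P i u = P (js k) (us k)" using cross [OF k(1)] by blast
    then have "u = us k" using inj_P [OF i(1)] i us [OF k(1)] k(2) by (auto simp: inj_on_def)
    moreover have "v = us ((k + 3) mod 6)"
      using p eq cross_sym [OF k(1)] inj_P [OF j(1)] j us [of "(k + 3) mod 6"] k(3) by (auto simp: inj_on_def)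
    ultimately show ?thesis using i(4) j(4) k unfolding ev_def by blast
  qed
qed

lemma \<kappa>0_period: "\<kappa>0 (t + 12 * of_int n) = \<kappa>0 t"
proof -
  obtain i u m where i: "i < (12::nat)" "0 \<le> u" "u < 1" "t = real i + u + 12 * of_int m"
    by (rule real_decomposition)
  have "t + 12 * of_int n = real i + u + 12 * of_int (m + n)" using i by simp
  then show ?thesis using i \<kappa>0_half_open by (simp only:)
qed

lemma \<kappa>0_ev: "k < 6 \<Longrightarrow> \<kappa>0 (ev k + 12 * of_int n) = P (js k) (us k)"
  unfolding ev_def using js us by (intro \<kappa>0_half_open) (auto intro: less_imp_le)

text \<open>A change of time that puts the passages at the integers and turns the period 12 into 6.
  It exists because the times \<open>ev k\<close> increase and lie strictly between 0 and
  12.\<close>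

lemma traversal:
  obtains g :: "real \<Rightarrow> real" where "continuous_on UNIV g" "strict_mono g" "surj g" "\<And>t. g (t + 6) = g t + 12"
    "\<And>k n. k < 6 \<Longrightarrow> g (real k + 6 * of_int n) = ev k + 12 * of_int n"
proof -
  define E where "E = (\<lambda>i::int. ev (nat (i mod 6)) + 12 * of_int (i div 6))"
  have E: "E (int k + 6 * n) = ev k + 12 * of_int n" if "k < 6" for k n
    unfolding E_def using that by simp
  have ev: "0 < ev k" "ev k < 12" if "k < 6" for k
    unfolding ev_def using js [OF that] us [OF that] by simp_all
  have less: "E i < E (i + 1)" for i
  proof -
    define k where "k = nat (i mod 6)"
    have k: "k < 6" "i = int k + 6 * (i div 6)" unfolding k_def by (simp_all add: nat_less_iff)
    show ?thesis
    proof (cases "k = 5")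
      case True
      then have i1: "i + 1 = int 0 + 6 * (i div 6 + 1)" using k(2) by simp
      show ?thesis
        using E [of 5 "i div 6"] E [of 0 "i div 6 + 1"] ev [of 5] ev [of 0] True k(2) unfolding i1 [symmetric] by simp
    next
      case False
      then have i1: "i + 1 = int (k + 1) + 6 * (i div 6)" using k(2) by simp
      have "k < 5" using False k(1) by simp
      then have "ev k < ev (k + 1)" unfolding ev_def by (rule order)
      moreover have "E (i + 1) = ev (k + 1) + 12 * of_int (i div 6)"
        unfolding i1 by (rule E) (use \<open>k < 5\<close> in simp)
      moreover have "E i = ev k + 12 * of_int (i div 6)"
        by (subst k(2)) (rule E [OF k(1)])
      ultimately show ?thesis by simp
    qed
  qed
  have per: "E (i + 6) = E i + 12" for i unfolding E_def by simp
  obtain g :: "real \<Rightarrow> real" where g: "continuous_on UNIV g" "strict_mono g" "\<And>i. g (of_int i) = E i" "\<And>t. g (t + 6) = g t + 12"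
    using strict_mono_interpolation [of E] less per by blast
  show ?thesis
  proof (rule that [OF g(1,2) continuous_strict_mono_surj [OF g(1,4)] g(4)])
    fix k :: nat and n :: int assume "k < 6"
    then show "g (real k + 6 * of_int n) = ev k + 12 * of_int n"
      using g(3) [of "int k + 6 * n"] E by simp
  qed
qed

text \<open>Chosen once, so that all later statements refer to the same parametrisation.\<close>

definition g :: "real \<Rightarrow> real" where
  "g = (SOME g. continuous_on UNIV g \<and> strict_mono g \<and> surj g \<and> (\<forall>t. g (t + 6) = g t + 12) \<and>
      (\<forall>k n. k < 6 \<longrightarrow> g (real k + 6 * of_int n) = ev k + 12 * of_int n))"

lemma g:
  "continuous_on UNIV g" "strict_mono g" "surj g" "g (t + 6) = g t + 12"
  "k < 6 \<Longrightarrow> g (real k + 6 * of_int n) = ev k + 12 * of_int n"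
proof -
  have "\<exists>g. continuous_on UNIV g \<and> strict_mono g \<and> surj g \<and> (\<forall>t. g (t + 6) = g t + 12) \<and>
      (\<forall>k n. k < 6 \<longrightarrow> g (real k + 6 * of_int n) = ev k + 12 * of_int n)"
    by (rule traversal) blast
  then have "continuous_on UNIV g \<and> strict_mono g \<and> surj g \<and> (\<forall>t. g (t + 6) = g t + 12) \<and>
      (\<forall>k n. k < 6 \<longrightarrow> g (real k + 6 * of_int n) = ev k + 12 * of_int n)"
    unfolding g_def by (rule someI_ex)
  then show "continuous_on UNIV g" "strict_mono g" "surj g" "g (t + 6) = g t + 12"
    "k < 6 \<Longrightarrow> g (real k + 6 * of_int n) = ev k + 12 * of_int n" by blast+
qed

lemma g_period: "g (t + 6 * of_int n) = g t + 12 * of_int n"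
  using g(4) by (rule shift_multiple)

lemma g_eq_iff: "g s = g t \<longleftrightarrow> s = t"
  using strict_mono_eq [OF g(2)] .

lemma g_Icc: "g ` {a..b} = {g a..g b}"
proof (intro equalityI subsetI)
  fix y assume y: "y \<in> {g a..g b}"
  obtain t where "y = g t" using g(3) by (metis surjD)
  then show "y \<in> g ` {a..b}" using y strict_mono_less_eq [OF g(2)] by auto
qed (use strict_mono_less_eq [OF g(2)] in auto)

definition \<kappa> :: "real \<Rightarrow> complex" where "\<kappa> t = \<kappa>0 (g t)"

lemma continuous_\<kappa>: "continuous_on UNIV \<kappa>"
  unfolding \<kappa>_def by (rule continuous_on_compose2 [OF continuous_\<kappa>0 g(1)]) simp

lemma range_\<kappa>: "range \<kappa> = projection X Y L R"
proof -
  have "range \<kappa> = \<kappa>0 ` range g" unfolding \<kappa>_def by (simp only: image_image)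
  then show ?thesis using g(3) range_\<kappa>0 by simp
qed

lemma \<kappa>_passage: "k < 6 \<Longrightarrow> \<kappa> (real k + 6 * of_int n) = P (js k) (us k)"
  unfolding \<kappa>_def using g(5) \<kappa>0_ev by simp

lemma int_decomposition:
  obtains k n where "k < (6::nat)" "i = int k + 6 * n"
proof
  show "nat (i mod 6) < 6" by (simp add: nat_less_iff)
  show "i = int (nat (i mod 6)) + 6 * (i div 6)" by simp
qed

lemma \<kappa>_eq_iff:
  "\<kappa> s = \<kappa> t \<longleftrightarrow> (\<exists>n::int. s - t = 6 * real_of_int n) \<or> (s \<in> \<int> \<and> t \<in> \<int> \<and> (\<exists>n::int. s - t = 3 * real_of_int n))"
proof
  assume "\<kappa> s = \<kappa> t"
  then consider n where "g s - g t = 12 * of_int n"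
    | k m n where "k < 6" "g s = ev k + 12 * of_int m" "g t = ev ((k + 3) mod 6) + 12 * of_int n"
    unfolding \<kappa>_def using \<kappa>0_eqD by blast
  then show "(\<exists>n::int. s - t = 6 * real_of_int n) \<or> (s \<in> \<int> \<and> t \<in> \<int> \<and> (\<exists>n::int. s - t = 3 * real_of_int n))"
  proof cases
    case (1 n)
    then have "g s = g (t + 6 * of_int n)" using g_period by simp
    then have "s - t = 6 * real_of_int n" unfolding g_eq_iff by simp
    then show ?thesis by blast
  next
    case (2 k m n)
    have "g s = g (real k + 6 * of_int m)" "g t = g (real ((k + 3) mod 6) + 6 * of_int n)"
      using 2 g(5) by simp_all
    then have st: "s = real k + 6 * of_int m" "t = real ((k + 3) mod 6) + 6 * of_int n"
      unfolding g_eq_iff by simp_all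
    have "\<exists>q::int. int k - int ((k + 3) mod 6) = 3 * q" using \<open>k < 6\<close> by presburger
    then obtain q :: int where "int k - int ((k + 3) mod 6) = 3 * q" by blast
    then have "real k - real ((k + 3) mod 6) = 3 * of_int q"
      by (metis of_int_diff of_int_mult of_int_numeral of_int_of_nat_eq)
    then have "s - t = 3 * real_of_int (q + 2 * m - 2 * n)" unfolding st by simp
    moreover have "s \<in> \<int>" "t \<in> \<int>" unfolding st by auto
    ultimately show ?thesis by blast
  qed
next
  assume "(\<exists>n::int. s - t = 6 * real_of_int n) \<or> (s \<in> \<int> \<and> t \<in> \<int> \<and> (\<exists>n::int. s - t = 3 * real_of_int n))"
  then show "\<kappa> s = \<kappa> t"
  proof (elim disjE exE conjE)
    fix n :: int assume "s - t = 6 * real_of_int n"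
    then have "s = t + 6 * of_int n" by simp
    then show ?thesis unfolding \<kappa>_def using g_period \<kappa>0_period by simp
  next
    fix n :: int assume st: "s \<in> \<int>" "t \<in> \<int>" "s - t = 3 * real_of_int n"
    obtain i j :: int where ij: "s = of_int i" "t = of_int j" using st by (auto elim!: Ints_cases)
    then have "real_of_int (i - j) = real_of_int (3 * n)" using st(3) by simp
    then have d: "i - j = 3 * n" by (simp only: of_int_eq_iff)
    obtain k m where k: "k < 6" "i = int k + 6 * m" by (rule int_decomposition)
    obtain k' m' where k': "k' < 6" "j = int k' + 6 * m'" by (rule int_decomposition)
    have "k' = k \<or> k' = (k + 3) mod 6" using d k k' by presburger
    moreover have "\<kappa> s = P (js k) (us k)" "\<kappa> t = P (js k') (us k')"
      using \<kappa>_passage [OF k(1), of m] \<kappa>_passage [OF k'(1), of m'] unfolding ij k(2) k'(2) by simp_all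
    ultimately show ?thesis using cross_sym [OF k(1)] by auto
  qed
qed

lemma \<kappa>_strand:
  assumes "k < 6"
  obtains a b where "a < real k + 6 * of_int n" "real k + 6 * of_int n < b" "P (js k) ` {0..1} = \<kappa> ` {a..b}"
proof -
  obtain a where a: "g a = real (js k) + 12 * of_int n" using g(3) by (metis surjD)
  obtain b where b: "g b = real (js k) + 1 + 12 * of_int n" using g(3) by (metis surjD)
  have gk: "g (real k + 6 * of_int n) = real (js k) + us k + 12 * of_int n"
    using g(5) [OF assms] unfolding ev_def .
  show ?thesis
  proof
    show "a < real k + 6 * of_int n" "real k + 6 * of_int n < b"
      using us [OF assms] strict_mono_less [OF g(2), of a "real k + 6 * of_int n"]
        strict_mono_less [OF g(2), of "real k + 6 * of_int n" b] unfolding a b gk by simp_all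
    have "\<kappa> ` {a..b} = \<kappa>0 ` {g a..g b}" unfolding \<kappa>_def g_Icc [symmetric] by (simp only: image_image)
    also have "{g a..g b} = (\<lambda>u. real (js k) + u + 12 * of_int n) ` {0..1}"
    proof (intro equalityI subsetI)
      fix y assume "y \<in> {g a..g b}"
      then show "y \<in> (\<lambda>u. real (js k) + u + 12 * of_int n) ` {0..1}"
        unfolding a b by (intro image_eqI [of _ _ "y - real (js k) - 12 * of_int n"]) auto
    qed (auto simp: a b)
    also have "\<kappa>0 ` \<dots> = P (js k) ` {0..1}"
      unfolding image_image using \<kappa>0_piece js [OF assms] by (intro image_cong) auto
    finally show "P (js k) ` {0..1} = \<kappa> ` {a..b}" ..
  qed
qed

text \<open>For the change of sides, \<open>crossing_separates\<close> is applied at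
  \<open>N = n + j\<close>; the strands carrying the passages \<open>N\<close> and
  \<open>N + 3\<close> provide the two branches.\<close>

lemma trefoil_curve_\<kappa>: "trefoil_curve \<kappa>"
  unfolding trefoil_curve_def
proof (intro conjI allI ballI)
  show "continuous_on UNIV \<kappa>" by (rule continuous_\<kappa>)
  show "\<kappa> s = \<kappa> t \<longleftrightarrow> (\<exists>n::int. s - t = 6 * real_of_int n) \<or> (s \<in> \<int> \<and> t \<in> \<int> \<and> (\<exists>n::int. s - t = 3 * real_of_int n))" for s t
    by (rule \<kappa>_eq_iff)
  fix n :: int and j :: real assume "j \<in> {1, 2}"
  then obtain j' :: int where j': "j = of_int j'" "j' = 1 \<or> j' = 2"
    by (metis insert_iff of_int_1 of_int_numeral singletonD)
  define N where "N = n + j'"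
  obtain k m where k: "k < 6" "N = int k + 6 * m" by (rule int_decomposition)
  obtain k' m' where k': "k' < 6" "N + 3 = int k' + 6 * m'" by (rule int_decomposition)
  have kk: "k' = (k + 3) mod 6" using k k' by presburger
  have N: "real_of_int N = real k + 6 * of_int m" "real_of_int N + 3 = real k' + 6 * of_int m'"
    using k(2) arg_cong [OF k'(2), of real_of_int] by simp_all
  obtain a b where ab: "a < real k + 6 * of_int m" "real k + 6 * of_int m < b" "P (js k) ` {0..1} = \<kappa> ` {a..b}"
    using \<kappa>_strand [OF k(1)] by blast
  obtain a' b' where ab': "a' < real k' + 6 * of_int m'" "real k' + 6 * of_int m' < b'" "P (js k') ` {0..1} = \<kappa> ` {a'..b'}"
    using \<kappa>_strand [OF k'(1)] by blast
  have "crosses_at (P (js k) ` {0..1}) (P (js k') ` {0..1}) (\<kappa> N)"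
    using cross_at [OF k(1)] \<kappa>_passage [OF k(1), of m] N(1) kk by simp
  from crossing_separates [OF continuous_\<kappa> \<kappa>_eq_iff this ab(3) _ _ ab'(3) _ _ j'(2)]
  have "\<not> connected_component (- (\<kappa> ` {of_int (N - j')..of_int (N - j') + 3})) (\<kappa> (N + 5/2)) (\<kappa> (N + 7/2))"
    using ab(1,2) ab'(1,2) N by simp
  then show "\<not> connected_component (- (\<kappa> ` {of_int n..of_int n + 3})) (\<kappa> (n + j + 5/2)) (\<kappa> (n + j + 7/2))"
    unfolding N_def j'(1) by simp
qed

lemma same_on_sphere_projection: "same_on_sphere (projection X Y L R) trefoil_projection"
proof -
  obtain \<Phi> \<Psi> where P: "homeomorphism sphere2 sphere2 \<Phi> \<Psi>" "\<And>t. \<Phi> (to_sphere (\<kappa> t)) = to_sphere (trefoil_path t)"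
    using trefoil_curves_equivalent [OF trefoil_curve_\<kappa> trefoil_curve_trefoil_path] by blast
  have "\<Phi> ` to_sphere ` range \<kappa> = to_sphere ` range trefoil_path"
    unfolding image_image using P(2) by simp
  then show ?thesis
    unfolding same_on_sphere_def range_\<kappa> range_trefoil_path using P(1) by blast
qed

lemma x_point:
  assumes "k < 3" "i < 12" "j < 12" "i \<noteq> j" "x k = {S i, S j}"
  shows "P i ` {0..1} \<inter> P j ` {0..1} = {\<kappa> (real k)}"
proof -
  have "js k < 12" "js (k + 3) < 12" using js assms(1) by simp_all
  then have "i = js k \<and> j = js (k + 3) \<or> i = js (k + 3) \<and> j = js k"
    using assms inj_S unfolding x_def by (auto simp: doubleton_eq_iff inj_on_def)
  moreover have "P (js k) ` {0..1} \<inter> P (js (k + 3)) ` {0..1} = {\<kappa> (real k)}"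
    using cross [of k] \<kappa>_passage [of k 0] assms(1) by simp
  ultimately show ?thesis by (metis Int_commute)
qed

lemma \<kappa>_neq: "k < 3 \<Longrightarrow> l < 3 \<Longrightarrow> \<kappa> (real k) = \<kappa> (real l) \<longleftrightarrow> k = l"
  using trefoil_curve_of_int_eq_iff [OF trefoil_curve_\<kappa>, of "int k" "int l"] by auto

lemma x_eq_iff: "k < 3 \<Longrightarrow> l < 3 \<Longrightarrow> x k = x l \<longleftrightarrow> k = l"
proof
  assume k: "k < 3" and l: "l < 3" and "x k = x l"
  moreover have "js k < 12" "js (k + 3) < 12" "js k \<noteq> js (k + 3)" using js js3 k by simp_all
  ultimately have "{\<kappa> (real k)} = {\<kappa> (real l)}"
    using x_point [OF k, of "js k" "js (k + 3)"] x_point [OF l, of "js k" "js (k + 3)"] unfolding x_def by auto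
  then show "k = l" using \<kappa>_neq [OF k l] by simp
qed simp

lemma crossings_x: "crossings X Y = x ` {..<3}"
  unfolding crossings_eq x_def ..

lemma card_crossings: "card (crossings X Y) = 3"
  unfolding crossings_x using x_eq_iff by (subst card_image) (auto simp: inj_on_def)

lemma card_x: "k < 3 \<Longrightarrow> card (x k) = 2"
proof -
  assume k: "k < 3"
  then have "S (js k) \<noteq> S (js (k + 3))"
    using js [of k] js [of "k + 3"] js3 [of k] inj_S by (auto simp: inj_on_def)
  then show ?thesis unfolding x_def by simp
qed

lemma card_over_choices: "card (over_choices X Y) = 8"
proof -
  have "card (over_choices X Y) = (\<Prod>y\<in>crossings X Y. card y)"
    unfolding over_choices_def crossings_x by (simp add: card_PiE)
  also have "\<dots> = (\<Prod>y\<in>crossings X Y. 2)"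
    using card_x by (intro prod.cong) (auto simp: crossings_x)
  finally show ?thesis by (simp add: card_crossings)
qed

lemma finite_over_choices: "finite (over_choices X Y)"
  using card_over_choices card_gt_0_iff by fastforce

text \<open>Only pieces of odd index cross, while consecutive pieces have different parity. So the
  heights of consecutive strands agree at their joint, and they fit together to one periodic height
  function.\<close>

lemma has_diagram_curve_knot:
  assumes c: "c \<in> over_choices X Y" and K: "has_diagram X Y L R c K"
  obtains \<eta> where "height_function \<eta>" "K = curve_knot \<kappa> \<eta>"
    "\<And>k. k < 3 \<Longrightarrow> \<eta> (real k) > \<eta> (real k + 3) \<longleftrightarrow> c (x k) = S (js k)"
proof -
  obtain h where hc: "\<And>s. s \<in> strands X Y \<Longrightarrow> continuous_on (strand_curve L R s) (h s)"
    and hh: "\<And>s s' z. \<lbrakk>s \<in> strands X Y; s' \<in> strands X Y; s \<noteq> s'; z \<in> strand_curve L R s \<inter> strand_curve L R s'\<rbrakk> \<Longrightarrow>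
        if {s, s'} \<in> crossings X Y then (if c {s, s'} = s then h s z > h s' z else h s z < h s' z) else h s z = h s' z"
    and Kh: "K = (\<Union>s \<in> strands X Y. (\<lambda>z. (z, h s z)) ` strand_curve L R s)"
    using K unfolding has_diagram_def by blast
  have St: "S i \<in> strands X Y" if "i < 12" for i using image_S that by blast
  define H where "H = (\<lambda>i u. h (S i) (P i u))"
  have Hc: "continuous_on {0..1} (H i)" if "i < 12" for i
    unfolding H_def
    by (rule continuous_on_compose2 [OF hc [OF St [OF that]] cont_P [OF that]]) (simp add: image_P [OF that])
  have Hj: "H i 1 = H ((i + 1) mod 12) 0" if i: "i < 12" for i
  proof -
    let ?j = "(i + 1) mod 12"
    have j: "?j < 12" "?j \<noteq> i" "odd i \<longleftrightarrow> even ?j" using i by presburger+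
    have "S i \<noteq> S ?j" using inj_S i j by (auto simp: inj_on_def)
    moreover have "{S i, S ?j} \<notin> crossings X Y"
    proof
      assume "{S i, S ?j} \<in> crossings X Y"
      then obtain k where "k < 6" "i = js k" "?j = js ((k + 3) mod 6)" using crossing_index i j(1) by metis
      then show False using js(2) [of k] js(2) [of "(k + 3) mod 6"] j(3) by simp
    qed
    moreover have "P i 1 \<in> strand_curve L R (S i) \<inter> strand_curve L R (S ?j)"
      using image_P [OF i] image_P [OF j(1)] join_P [OF i] by (metis IntI atLeastAtMost_iff imageI order_refl zero_le_one)
    ultimately have "h (S i) (P i 1) = h (S ?j) (P i 1)" using hh St i j(1) by metis
    then show ?thesis unfolding H_def join_P [OF i] .
  qed
  define \<eta>0 where "\<eta>0 = (\<lambda>t. H (nat (\<lfloor>t\<rfloor> mod 12)) (frac t))"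
  have \<eta>0: "\<eta>0 (real i + u + 12 * of_int n) = H i u" if "i < 12" "0 \<le> u" "u < 1" for i u n
  proof -
    have f: "\<lfloor>real i + u + 12 * of_int n\<rfloor> = int i + 12 * n" using that by (intro floor_unique) auto
    have "frac (real i + u + 12 * of_int n) = u" unfolding frac_def f by simp
    then show ?thesis unfolding \<eta>0_def f using that by simp
  qed
  have c\<eta>0: "continuous_on UNIV \<eta>0"
  proof -
    have "nat (i mod 12) < 12" for i :: int by (simp add: nat_less_iff)
    then show ?thesis
      unfolding \<eta>0_def
      by (intro continuous_on_floor_pieces [of "\<lambda>i. H (nat (i mod 12))"]) (simp_all add: Hc Hj nat_mod_Suc)
  qed
  have p\<eta>0: "\<eta>0 (t + 12) = \<eta>0 t" for t
  proof -
    obtain i u m where i: "i < (12::nat)" "0 \<le> u" "u < 1" "t = real i + u + 12 * of_int m"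
      by (rule real_decomposition)
    have "t + 12 = real i + u + 12 * of_int (m + 1)" using i by simp
    then show ?thesis using i \<eta>0 by (simp only:)
  qed
  define \<eta> where "\<eta> = (\<lambda>t. \<eta>0 (g t))"
  have \<eta>p: "\<eta> (real k + 6 * of_int n) = h (S (js k)) (P (js k) (us k))" if "k < 6" for k n
    unfolding \<eta>_def g(5) [OF that] ev_def using \<eta>0 [of "js k" "us k" n] js us that by (simp add: H_def less_imp_le)
  have at: "if c (x k) = S (js k) then \<eta> (real k) > \<eta> (real k + 3) else \<eta> (real k) < \<eta> (real k + 3)" if k: "k < 3" for k
  proof -
    have j: "js k < 12" "js (k + 3) < 12" "js k \<noteq> js (k + 3)" using js js3 k by simp_all
    let ?z = "P (js k) (us k)"
    have z: "?z \<in> strand_curve L R (S (js k)) \<inter> strand_curve L R (S (js (k + 3)))"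
      using cross [of k] k image_P j by auto
    have x: "{S (js k), S (js (k + 3))} = x k" "x k \<in> crossings X Y" unfolding crossings_x x_def using k by auto
    have ne: "S (js k) \<noteq> S (js (k + 3))" using inj_S j by (auto simp: inj_on_def)
    have e: "\<eta> (real k) = h (S (js k)) ?z" "\<eta> (real k + 3) = h (S (js (k + 3))) ?z"
      using \<eta>p [of k 0] \<eta>p [of "k + 3" 0] cross_sym [of k] k by (simp_all add: add.commute)
    show ?thesis unfolding e using hh [OF St [OF j(1)] St [OF j(2)] ne z] unfolding x(1) using x(2) by simp
  qed
  have p\<eta>: "\<eta> (t + 6) = \<eta> t" for t unfolding \<eta>_def g(4) by (rule p\<eta>0)
  show ?thesis
  proof
    show "height_function \<eta>"
      unfolding height_function_def
    proof (intro conjI allI)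
      show "continuous_on UNIV \<eta>" unfolding \<eta>_def by (rule continuous_on_compose2 [OF c\<eta>0 g(1)]) simp
      show "\<eta> (t + 6) = \<eta> t" for t by (rule p\<eta>)
      fix i :: int
      have per: "\<eta> (t + 6 * of_int n) = \<eta> t" for t n
        using shift_multiple [of \<eta> 6 0 t n] p\<eta> by simp
      obtain k n where k: "k < 6" "i = int k + 6 * n" by (rule int_decomposition)
      have i: "\<eta> (of_int i) = \<eta> (real k)" "\<eta> (of_int i + 3) = \<eta> (real k + 3)"
        using per [of "real k" n] per [of "real k + 3" n] unfolding k(2) by (simp_all add: algebra_simps)
      show "\<eta> (of_int i) \<noteq> \<eta> (of_int i + 3)"
      proof (cases "k < 3")
        case True
        then show ?thesis unfolding i using at [OF True] by (auto split: if_splits)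
      next
        case False
        define l where "l = k - 3"
        have l: "l < 3" "real k = real l + 3" using False k(1) unfolding l_def by auto
        have "\<eta> (real k + 3) = \<eta> (real l)" using p\<eta> [of "real l"] l(2) by (simp add: add.assoc)
        then show ?thesis unfolding i using at [OF l(1)] l(2) by (auto split: if_splits)
      qed
    qed
    show "\<eta> (real k) > \<eta> (real k + 3) \<longleftrightarrow> c (x k) = S (js k)" if "k < 3" for k
      using at [OF that] by (auto split: if_splits)
    have "curve_knot \<kappa> \<eta> = (\<lambda>t. (\<kappa>0 t, \<eta>0 t)) ` range g"
      unfolding curve_knot_def \<kappa>_def \<eta>_def by (simp only: image_image)
    also have "\<dots> = range (\<lambda>t. (\<kappa>0 t, \<eta>0 t))" using g(3) by simp
    also have "\<dots> = (\<Union>i<12. (\<lambda>u. (P i u, H i u)) ` {0..1})"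
    proof (intro equalityI subsetI)
      fix z assume "z \<in> range (\<lambda>t. (\<kappa>0 t, \<eta>0 t))"
      then obtain t where t: "z = (\<kappa>0 t, \<eta>0 t)" by blast
      obtain i u n where i: "i < (12::nat)" "0 \<le> u" "u < 1" "t = real i + u + 12 * of_int n"
        by (rule real_decomposition)
      then have "z = (P i u, H i u)" using t \<kappa>0_half_open \<eta>0 by simp
      moreover have "(P i u, H i u) \<in> (\<lambda>u. (P i u, H i u)) ` {0..1}" using i by (intro imageI) simp
      ultimately show "z \<in> (\<Union>i<12. (\<lambda>u. (P i u, H i u)) ` {0..1})" using i(1) by blast
    next
      fix z assume "z \<in> (\<Union>i<12. (\<lambda>u. (P i u, H i u)) ` {0..1})"
      then obtain i u where i: "i < 12" "0 \<le> u" "u \<le> 1" "z = (P i u, H i u)" by auto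
      have mem: "(P j v, H j v) \<in> range (\<lambda>t. (\<kappa>0 t, \<eta>0 t))" if "j < 12" "0 \<le> v" "v < 1" for j v
        using \<kappa>0_half_open [OF that, of 0] \<eta>0 [OF that, of 0]
        by (intro range_eqI [of _ _ "real j + v"]) simp
      show "z \<in> range (\<lambda>t. (\<kappa>0 t, \<eta>0 t))"
      proof (cases "u = 1")
        case True
        then have "z = (P ((i + 1) mod 12) 0, H ((i + 1) mod 12) 0)" using i join_P Hj by simp
        then show ?thesis using mem [of "(i + 1) mod 12" 0] by simp
      qed (use i mem in auto)
    qed
    also have "\<dots> = (\<Union>i<12. (\<lambda>z. (z, h (S i) z)) ` strand_curve L R (S i))"
      unfolding H_def by (intro SUP_cong) (auto simp flip: image_P)
    also have "\<dots> = K" unfolding Kh image_S [symmetric] by simp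
    finally show "K = curve_knot \<kappa> \<eta>" ..
  qed
qed

text \<open>The weight \<open>w k\<close> is a product of distances: zero at all joints and at the
  other crossings, positive at the crossing \<open>k\<close>. Giving it to the strand chosen at
  \<open>k\<close> lifts that strand above the other one and disturbs nothing elsewhere that
  matters.\<close>

lemma has_diagram_exists:
  assumes c: "c \<in> over_choices X Y"
  shows "\<exists>K. has_diagram X Y L R c K"
proof -
  define w where "w = (\<lambda>k z. (\<Prod>i<12. dist z (P i 0)) * (\<Prod>l\<in>{..<3} - {k}. dist z (\<kappa> (real l))))"
  define h where "h = (\<lambda>s z. \<Sum>k<3. if c (x k) = s then w k z else 0)"
  have hc: "continuous_on A (h s)" for A s
    unfolding h_def w_def
  proof (intro continuous_on_sum)
    show "continuous_on A (\<lambda>z. if c (x k) = s then (\<Prod>i<12. dist z (P i 0)) * (\<Prod>l\<in>{..<3} - {k}. dist z (\<kappa> (real l))) else 0)" for k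
      by (cases "c (x k) = s") (auto intro!: continuous_intros)
  qed
  have h0: "h s (P i 0) = 0" if "i < 12" for s i
  proof -
    have "(\<Prod>j<12. dist (P i 0) (P j 0)) = 0" using that by (intro prod_zero) auto
    then have "w k (P i 0) = 0" for k unfolding w_def by (simp only: mult_zero_left)
    then show ?thesis unfolding h_def by (auto intro!: sum.neutral)
  qed
  \<comment> \<open>A joint has an integer time on the scale of \<open>\<kappa>0\<close>; a passage
    has not, since \<open>us\<close> is strictly between 0 and 1.\<close>
  have pz: "P i 0 \<noteq> \<kappa> (real k)" if k: "k < 3" and i: "i < 12" for k i
  proof
    assume eq: "P i 0 = \<kappa> (real k)"
    have "\<kappa>0 (real i) = P i 0" using \<kappa>0_half_open [OF i, of 0 0] by simp
    moreover obtain t where t: "g t = real i" using g(3) by (metis surjD)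
    ultimately have "\<kappa> t = \<kappa> (real k)" using eq unfolding \<kappa>_def by simp
    then have "t \<in> \<int>"
      unfolding \<kappa>_eq_iff
    proof (elim disjE exE conjE)
      fix n :: int assume "t - real k = 6 * real_of_int n"
      then have "t = real_of_int (int k + 6 * n)" by simp
      then show ?thesis by (simp only: Ints_of_int)
    qed
    then obtain j :: int where "t = of_int j" by (auto elim: Ints_cases)
    moreover obtain l m where l: "l < 6" "j = int l + 6 * m" by (rule int_decomposition)
    ultimately have "real i = real (js l) + us l + 12 * of_int m"
      using t g(5) [OF l(1), of m] unfolding ev_def by simp
    then have "us l = real_of_int (int i - int (js l) - 12 * m)" by simp
    then show False using us [OF l(1)] by (metis of_int_0_less_iff of_int_less_1_iff zero_less_iff_neq_zero int_one_le_iff_zero_less not_le)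
  qed
  have w: "w k (\<kappa> (real l)) = 0" if "k \<noteq> l" "l < 3" for k l
  proof -
    have "(\<Prod>l'\<in>{..<3} - {k}. dist (\<kappa> (real l)) (\<kappa> (real l'))) = 0" using that by (intro prod_zero) auto
    then show ?thesis unfolding w_def by (simp only: mult_zero_right)
  qed
  have wp: "w k (\<kappa> (real k)) > 0" if "k < 3" for k
    unfolding w_def using that pz \<kappa>_neq by (intro mult_pos_pos prod_pos) (auto simp: eq_commute)
  have hp: "h s (\<kappa> (real k)) = (if c (x k) = s then w k (\<kappa> (real k)) else 0)" if "k < 3" for s k
  proof -
    have "h s (\<kappa> (real k)) = (\<Sum>l<3. if l = k then (if c (x k) = s then w k (\<kappa> (real k)) else 0) else 0)"
      unfolding h_def using w that by (intro sum.cong) auto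
    then show ?thesis using that by simp
  qed
  have "if {s, s'} \<in> crossings X Y then (if c {s, s'} = s then h s z > h s' z else h s z < h s' z) else h s z = h s' z"
    if s: "s \<in> strands X Y" "s' \<in> strands X Y" "s \<noteq> s'" and z: "z \<in> strand_curve L R s \<inter> strand_curve L R s'" for s s' z
  proof -
    obtain i where i: "i < 12" "s = S i" using s(1) unfolding image_S [symmetric] by blast
    obtain j where j: "j < 12" "s' = S j" using s(2) unfolding image_S [symmetric] by blast
    have ij: "i \<noteq> j" using s(3) i j by blast
    have z': "z \<in> P i ` {0..1} \<inter> P j ` {0..1}" using z i j image_P by simp
    show ?thesis
    proof (cases "{s, s'} \<in> crossings X Y")
      case True
      then obtain k where k: "k < 3" "x k = {s, s'}" unfolding crossings_x by auto
      have "z = \<kappa> (real k)" using x_point [OF k(1) i(1) j(1) ij] k(2) i(2) j(2) z' by auto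
      moreover have "c {s, s'} \<in> {s, s'}" using c True unfolding over_choices_def by auto
      ultimately show ?thesis using True hp [OF k(1)] wp [OF k(1)] k(2) s(3) by auto
    next
      case False
      obtain u v where uv: "0 \<le> u" "u \<le> 1" "0 \<le> v" "v \<le> 1" "z = P i u" "z = P j v" using z' by auto
      have "u = 1 \<or> v = 1"
        using meet [of i j u v] i j ij uv False by fastforce
      then have "\<exists>l<12. z = P l 0"
        using uv(5,6) join_P [OF i(1)] join_P [OF j(1)] by (metis mod_less_divisor zero_less_numeral)
      then show ?thesis using False h0 by auto
    qed
  qed
  then have "has_diagram X Y L R c (\<Union>s \<in> strands X Y. (\<lambda>z. (z, h s z)) ` strand_curve L R s)"
    unfolding has_diagram_def using hc by (intro exI [of _ h] conjI) blast+
  then show ?thesis by blast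
qed

text \<open>At each crossing: whether the strand of the earlier passage is the upper one. The two
  alternating codes give the trefoil.\<close>

definition code :: "(strand set \<Rightarrow> strand) \<Rightarrow> bool \<times> bool \<times> bool" where
  "code c = (c (x 0) = S (js 0), c (x 1) = S (js 1), c (x 2) = S (js 2))"

lemma bij_code: "bij_betw code (over_choices X Y) UNIV"
proof -
  have inj: "inj_on code (over_choices X Y)"
  proof (rule inj_onI)
    fix c c' assume c: "c \<in> over_choices X Y" "c' \<in> over_choices X Y" "code c = code c'"
    have "c (x k) = c' (x k)" if k: "k < 3" for k
    proof -
      have "x k \<in> crossings X Y" unfolding crossings_x using k by simp
      then have "c (x k) \<in> x k" "c' (x k) \<in> x k" using c(1,2) unfolding over_choices_def by auto
      moreover have "k = 0 \<or> k = 1 \<or> k = 2" using k by linarith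
      then have "c (x k) = S (js k) \<longleftrightarrow> c' (x k) = S (js k)" using c(3) unfolding code_def by auto
      ultimately show ?thesis unfolding x_def by auto
    qed
    then have "c y = c' y" if "y \<in> crossings X Y" for y using that unfolding crossings_x by auto
    then show "c = c'" using c(1,2) unfolding over_choices_def by (metis PiE_ext)
  qed
  have "card (code ` over_choices X Y) = card (UNIV :: (bool \<times> bool \<times> bool) set)"
    unfolding card_image [OF inj] card_over_choices by (simp add: card_prod)
  then have "code ` over_choices X Y = UNIV" by (intro card_subset_eq) auto
  then show ?thesis using inj unfolding bij_betw_def by blast
qed

text \<open>The code decides the kind of every knot with the diagram. The converses hold because
  each choice has at least one diagram and no knot is both trivial and a trefoil.\<close>

lemma diagram_knots:
  assumes c: "c \<in> over_choices X Y"
  shows "(\<exists>K. has_diagram X Y L R c K \<and> trefoil_knot K) \<longleftrightarrow> code c \<in> {(True, False, True), (False, True, False)}"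
    and "(\<exists>K. has_diagram X Y L R c K \<and> trivial_knot K) \<longleftrightarrow> code c \<notin> {(True, False, True), (False, True, False)}"
proof -
  have tref: "trefoil_knot K" if K: "has_diagram X Y L R c K" and "code c \<in> {(True, False, True), (False, True, False)}" for K
  proof -
    obtain \<eta> where \<eta>: "height_function \<eta>" "K = curve_knot \<kappa> \<eta>"
      "\<And>k. k < 3 \<Longrightarrow> \<eta> (real k) > \<eta> (real k + 3) \<longleftrightarrow> c (x k) = S (js k)"
      using has_diagram_curve_knot [OF c K] by blast
    show ?thesis
      unfolding \<eta>(2)
      by (rule trefoil_curve_knot_alternating [OF trefoil_curve_\<kappa> \<eta>(1)])
         (use \<eta>(3) [of 0] \<eta>(3) [of 1] \<eta>(3) [of 2] that(2) in \<open>auto simp: code_def\<close>)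
  qed
  have triv: "trivial_knot K" if K: "has_diagram X Y L R c K" and "code c \<notin> {(True, False, True), (False, True, False)}" for K
  proof -
    obtain \<eta> where \<eta>: "height_function \<eta>" "K = curve_knot \<kappa> \<eta>"
      "\<And>k. k < 3 \<Longrightarrow> \<eta> (real k) > \<eta> (real k + 3) \<longleftrightarrow> c (x k) = S (js k)"
      using has_diagram_curve_knot [OF c K] by blast
    show ?thesis
      unfolding \<eta>(2)
      by (rule trivial_knot_not_alternating [OF trefoil_curve_\<kappa> \<eta>(1)])
         (use \<eta>(3) [of 0] \<eta>(3) [of 1] \<eta>(3) [of 2] that(2) in \<open>auto simp: code_def\<close>)
  qed
  have excl: "\<not> (trefoil_knot K \<and> trivial_knot K)" for K
    using trefoil_not_trivial knot_equivalent_sym knot_equivalent_trans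
    unfolding trefoil_knot_def trivial_knot_def by blast
  obtain K where "has_diagram X Y L R c K" using has_diagram_exists [OF c] by blast
  then show "(\<exists>K. has_diagram X Y L R c K \<and> trefoil_knot K) \<longleftrightarrow> code c \<in> {(True, False, True), (False, True, False)}"
    and "(\<exists>K. has_diagram X Y L R c K \<and> trivial_knot K) \<longleftrightarrow> code c \<notin> {(True, False, True), (False, True, False)}"
    using tref triv excl by blast+
qed

lemma card_trefoil: "card {c \<in> over_choices X Y. \<exists>K. has_diagram X Y L R c K \<and> trefoil_knot K} = 2"
proof -
  let ?T = "{(True, False, True), (False, True, False)}"
  have "{c \<in> over_choices X Y. \<exists>K. has_diagram X Y L R c K \<and> trefoil_knot K} = {c \<in> over_choices X Y. code c \<in> ?T}"
    using diagram_knots(1) by blast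
  moreover have "code ` {c \<in> over_choices X Y. code c \<in> ?T} = code ` over_choices X Y \<inter> ?T" by blast
  ultimately have "code ` {c \<in> over_choices X Y. \<exists>K. has_diagram X Y L R c K \<and> trefoil_knot K} = ?T"
    using bij_betw_imp_surj_on [OF bij_code] by simp
  moreover have "inj_on code {c \<in> over_choices X Y. \<exists>K. has_diagram X Y L R c K \<and> trefoil_knot K}"
    using bij_betw_imp_inj_on [OF bij_code] by (rule inj_on_subset) blast
  ultimately show ?thesis using card_image by fastforce
qed

lemma card_trivial: "card {c \<in> over_choices X Y. \<exists>K. has_diagram X Y L R c K \<and> trivial_knot K} = 6"
proof -
  have "{c \<in> over_choices X Y. \<exists>K. has_diagram X Y L R c K \<and> trivial_knot K}
      = over_choices X Y - {c \<in> over_choices X Y. \<exists>K. has_diagram X Y L R c K \<and> trefoil_knot K}"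
    using diagram_knots by blast
  then show ?thesis
    using card_Diff_subset [of "{c \<in> over_choices X Y. \<exists>K. has_diagram X Y L R c K \<and> trefoil_knot K}" "over_choices X Y"]
      finite_over_choices card_trefoil card_over_choices by simp
qed

end

section \<open>Blades and tying arcs as the twelve pieces\<close>

definition orient :: "(nat set \<Rightarrow> real \<Rightarrow> complex) \<Rightarrow> nat \<Rightarrow> nat \<Rightarrow> real \<Rightarrow> complex" where
  "orient F a b = (if a < b then F {a, b} else reversepath (F {a, b}))"

lemma path_image_orient [simp]: "path_image (orient F a b) = path_image (F {a, b})"
  unfolding orient_def by simp

lemma meets_in_order_reversepath:
  assumes "meets_in_order \<gamma> A B" shows "meets_in_order (reversepath \<gamma>) B A"
proof -
  obtain s t where "0 \<le> s" "s < t" "t \<le> 1" "\<gamma> s \<in> A" "\<gamma> t \<in> B"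
    using assms unfolding meets_in_order_def by blast
  then show ?thesis
    unfolding meets_in_order_def reversepath_def by (intro exI [of _ "1 - t"] exI [of _ "1 - s"]) auto
qed

text \<open>The properties shared by the drawings on the two sides, where \<open>\<sigma>\<close> is the abscissa of the ends.\<close>

definition side_drawing :: "real \<Rightarrow> tying \<Rightarrow> (nat set \<Rightarrow> real \<Rightarrow> complex) \<Rightarrow> bool" where
  "side_drawing \<sigma> Y R \<longleftrightarrow>
     (\<forall>e \<in> pairs Y. arc (R e) \<and>
        R e 0 = Complex \<sigma> (real (Min e)) \<and> R e 1 = Complex \<sigma> (real (Max e)) \<and>
        (\<forall>t \<in> {0<..<1}. \<sigma> * Re (R e t) > 1)) \<and>
     (\<forall>e \<in> pairs Y. \<forall>e' \<in> pairs Y. e \<noteq> e' \<longrightarrow>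
        (if interleave e e'
         then \<exists>p. path_image (R e) \<inter> path_image (R e') = {p} \<and>
                  crosses_at (path_image (R e)) (path_image (R e')) p
         else path_image (R e) \<inter> path_image (R e') = {}))"

lemma side_drawing_right: "right_drawing Y R \<Longrightarrow> side_drawing 1 Y R"
  unfolding right_drawing_def side_drawing_def pathstart_def pathfinish_def by simp

lemma side_drawing_left:
  assumes "left_drawing X L" shows "side_drawing (- 1) X L"
proof -
  define m where "m = (\<lambda>z. - cnj z)"
  define L' where "L' = (\<lambda>e t. - cnj (L e t))"
  have s: "side_drawing 1 X L'"
    using assms unfolding left_drawing_def L'_def by (rule side_drawing_right)
  have mm: "m (m z) = z" for z unfolding m_def by simp
  have inj: "inj m" using mm by (metis injI)
  have cm: "continuous_on A m" for A unfolding m_def by (intro continuous_intros)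
  have L: "L e = m \<circ> L' e" for e unfolding L'_def m_def by auto
  have im: "path_image (L e) = m ` path_image (L' e)" for e unfolding L by (rule path_image_compose)
  have int: "path_image (L e) \<inter> path_image (L e') = m ` (path_image (L' e) \<inter> path_image (L' e'))" for e e'
    unfolding im using inj by (rule image_Int [symmetric])
  show ?thesis
    unfolding side_drawing_def
  proof (intro conjI ballI impI)
    fix e assume "e \<in> pairs X"
    then have e: "arc (L' e)" "L' e 0 = Complex 1 (real (Min e))" "L' e 1 = Complex 1 (real (Max e))"
      "\<And>t. t \<in> {0<..<1} \<Longrightarrow> Re (L' e t) > 1"
      using s unfolding side_drawing_def by auto
    show "arc (L e)"
      unfolding L arc_def
    proof
      show "path (m \<circ> L' e)" using e(1) cm by (intro path_continuous_image arc_imp_path)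
      show "inj_on (m \<circ> L' e) {0..1}"
        using e(1) inj unfolding arc_def by (intro comp_inj_on) (auto intro: inj_on_subset)
    qed
    show "L e 0 = Complex (- 1) (real (Min e))" "L e 1 = Complex (- 1) (real (Max e))"
      using e(2,3) unfolding L by (simp_all add: m_def complex_eq_iff)
    show "- 1 * Re (L e t) > 1" if "t \<in> {0<..<1}" for t
      using e(4) [OF that] unfolding L by (simp add: m_def)
  next
    fix e e' assume e: "e \<in> pairs X" "e' \<in> pairs X" "e \<noteq> e'"
    show "if interleave e e'
         then \<exists>p. path_image (L e) \<inter> path_image (L e') = {p} \<and>
                  crosses_at (path_image (L e)) (path_image (L e')) p
         else path_image (L e) \<inter> path_image (L e') = {}"
    proof (cases "interleave e e'")
      case True
      then obtain p where "path_image (L' e) \<inter> path_image (L' e') = {p}"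
        "crosses_at (path_image (L' e)) (path_image (L' e')) p"
        using s e unfolding side_drawing_def by meson
      then have "path_image (L e) \<inter> path_image (L e') = {m p}" "crosses_at (path_image (L e)) (path_image (L e')) (m p)"
        unfolding int using crosses_at_mirror unfolding im m_def by auto
      then show ?thesis using True by auto
    next
      case False
      then have "path_image (L' e) \<inter> path_image (L' e') = {}"
        using s e unfolding side_drawing_def by meson
      then show ?thesis using False unfolding int by simp
    qed
  qed
qed

lemma orient_side_drawing:
  assumes "side_drawing \<sigma> Y R" "{a, b} \<in> pairs Y" "a \<noteq> b"
  shows "arc (orient R a b)" "orient R a b 0 = Complex \<sigma> (real a)" "orient R a b 1 = Complex \<sigma> (real b)"
    "0 < t \<Longrightarrow> t < 1 \<Longrightarrow> \<sigma> * Re (orient R a b t) > 1"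
proof -
  have e: "arc (R {a, b})" "R {a, b} 0 = Complex \<sigma> (real (Min {a, b}))" "R {a, b} 1 = Complex \<sigma> (real (Max {a, b}))"
    "\<And>t. t \<in> {0<..<1} \<Longrightarrow> \<sigma> * Re (R {a, b} t) > 1"
    using assms(1,2) unfolding side_drawing_def by auto
  show "arc (orient R a b)" unfolding orient_def using e(1) arc_reversepath [OF e(1)] by simp
  show "orient R a b 0 = Complex \<sigma> (real a)" "orient R a b 1 = Complex \<sigma> (real b)"
    unfolding orient_def reversepath_def using e(2,3) assms(3) by (auto simp: min_def max_def)
  show "0 < t \<Longrightarrow> t < 1 \<Longrightarrow> \<sigma> * Re (orient R a b t) > 1"
    unfolding orient_def reversepath_def using e(4) by simp
qed

text \<open>Successors modulo 6 change parity, so arcs that follow two different blades of equal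
  parity join four different blades.\<close>

lemma neighbours_mod_6:
  fixes m m' :: nat
  assumes "m < 6" "m' < 6" "m \<noteq> m'" "even m \<longleftrightarrow> even m'" "l = m \<or> l = (m + 1) mod 6"
  shows "l \<noteq> m' \<and> l \<noteq> (m' + 1) mod 6"
proof -
  have succ: "(x + 1) mod 6 = (if x = 5 then 0 else x + 1)" if "x < 6" for x :: nat
    using that by auto
  show ?thesis
    using assms(3-5) unfolding succ [OF assms(1)] succ [OF assms(2)] by (auto split: if_splits intro: odd_pos)
qed

text \<open>The curve runs through the blades \<open>b 0, \<dots>, b 5\<close> in this order, the blade \<open>b m\<close> to the right
  if \<open>m\<close> is even and to the left if \<open>m\<close> is odd; the passage \<open>k\<close> through a crossing is on the arc that
  follows the blade \<open>b (ms k)\<close>.\<close>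

locale tied_blades =
  fixes X Y :: tying and L R :: "nat set \<Rightarrow> real \<Rightarrow> complex" and b ms :: "nat \<Rightarrow> nat"
  assumes left: "left_drawing X L" and right: "right_drawing Y R"
    and inj_b: "inj_on b {..<6}" and image_b: "b ` {..<6} = {1..6}"
    and pairs_X: "pairs X = {{b 1, b 2}, {b 3, b 4}, {b 5, b 0}}"
    and pairs_Y: "pairs Y = {{b 0, b 1}, {b 2, b 3}, {b 4, b 5}}"
    and ms: "k < 6 \<Longrightarrow> ms k < 6" and ms3: "k < 3 \<Longrightarrow> ms k \<noteq> ms (k + 3)"
    and parity: "k < 3 \<Longrightarrow> even (ms k) \<longleftrightarrow> even (ms (k + 3))"
    and inter: "k < 3 \<Longrightarrow> interleave {b (ms k), b ((ms k + 1) mod 6)} {b (ms (k + 3)), b ((ms (k + 3) + 1) mod 6)}"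
    and crossings_ms: "crossings X Y = (\<lambda>k.
        {(if even (ms k) then Right_Arc else Left_Arc) {b (ms k), b ((ms k + 1) mod 6)},
         (if even (ms (k + 3)) then Right_Arc else Left_Arc) {b (ms (k + 3)), b ((ms (k + 3) + 1) mod 6)}}) ` {..<3}"
    and mono: "k < 5 \<Longrightarrow> ms k < ms (k + 1) \<or> ms k = ms (k + 1) \<and> even (ms k) \<and>
        meets_in_order (orient R (b (ms k)) (b ((ms k + 1) mod 6)))
          (path_image (R {b (ms ((k + 3) mod 6)), b ((ms ((k + 3) mod 6) + 1) mod 6)}))
          (path_image (R {b (ms ((k + 4) mod 6)), b ((ms ((k + 4) mod 6) + 1) mod 6)}))"
begin

definition e :: "nat \<Rightarrow> nat set" where "e m = {b m, b ((m + 1) mod 6)}"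

text \<open>The abscissa of the side on which blade \<open>b m\<close> is left and the next arc
  drawn; \<open>F m\<close> and \<open>T m\<close> are the drawing and the pattern of that
  side.\<close>

definition \<sigma> :: "nat \<Rightarrow> real" where "\<sigma> m = (if even m then 1 else - 1)"

definition F :: "nat \<Rightarrow> nat set \<Rightarrow> real \<Rightarrow> complex" where "F m = (if even m then R else L)"

definition T :: "nat \<Rightarrow> tying" where "T m = (if even m then Y else X)"

definition side_arc :: "nat \<Rightarrow> real \<Rightarrow> complex" where
  "side_arc m = orient (F m) (b m) (b ((m + 1) mod 6))"

definition side_strand :: "nat \<Rightarrow> strand" where
  "side_strand m = (if even m then Right_Arc else Left_Arc) (e m)"

text \<open>Piece \<open>2 * m\<close> is the blade \<open>b m\<close>, run towards the side
  \<open>\<sigma> m\<close>; piece \<open>2 * m + 1\<close> is the arc that leaves it.\<close>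

definition piece :: "nat \<Rightarrow> real \<Rightarrow> complex" where
  "piece i t = (if even i then Complex (\<sigma> (i div 2) * (2 * t - 1)) (real (b (i div 2))) else side_arc (i div 2) t)"

definition strand_of :: "nat \<Rightarrow> strand" where
  "strand_of i = (if even i then Blade (b (i div 2)) else side_strand (i div 2))"

lemma \<sigma>: "\<sigma> m = 1 \<or> \<sigma> m = - 1" "\<sigma> m = \<sigma> m' \<longleftrightarrow> (even m \<longleftrightarrow> even m')" "\<sigma> ((m + 1) mod 6) = - \<sigma> m"
proof -
  have "even ((m + 1) mod 6) \<longleftrightarrow> odd m" by presburger
  then show "\<sigma> m = 1 \<or> \<sigma> m = - 1" "\<sigma> m = \<sigma> m' \<longleftrightarrow> (even m \<longleftrightarrow> even m')" "\<sigma> ((m + 1) mod 6) = - \<sigma> m"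
    unfolding \<sigma>_def by auto
qed

lemma b_eq_iff: "m < 6 \<Longrightarrow> m' < 6 \<Longrightarrow> b m = b m' \<longleftrightarrow> m = m'"
  using inj_b by (auto simp: inj_on_def)

lemma less_6: "m < 6 \<Longrightarrow> m = 0 \<or> m = 1 \<or> m = 2 \<or> m = 3 \<or> m = 4 \<or> m = (5::nat)"
  by linarith

lemma pairs_T: "pairs (T m) = e ` {m'. m' < 6 \<and> (even m' \<longleftrightarrow> even m)}"
proof -
  have "{m'. m' < 6 \<and> even m'} = {0, 2, 4::nat}" "{m'. m' < 6 \<and> odd m'} = {1, 3, 5::nat}"
    by (auto dest!: less_6)
  moreover have "e 0 = {b 0, b 1}" "e 1 = {b 1, b 2}" "e 2 = {b 2, b 3}" "e 3 = {b 3, b 4}" "e 4 = {b 4, b 5}" "e 5 = {b 5, b 0}"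
    unfolding e_def by simp_all (simp add: numeral_2_eq_2)
  ultimately show ?thesis
    by (cases "even m") (simp_all add: T_def pairs_X pairs_Y)
qed

lemma e_in: "m < 6 \<Longrightarrow> e m \<in> pairs (T m)"
  unfolding pairs_T by blast

lemma e_eq:
  assumes "m < 6" "m' < 6" "e m = e m'" "even m \<longleftrightarrow> even m'" shows "m = m'"
proof -
  have "(m + 1) mod 6 < 6" "(m' + 1) mod 6 < 6" by simp_all
  then have "m = m' \<or> m = (m' + 1) mod 6"
    using assms(1-3) b_eq_iff unfolding e_def by (auto simp: doubleton_eq_iff)
  moreover have "m \<noteq> (m' + 1) mod 6" using assms(4) by presburger
  ultimately show ?thesis by blast
qed

lemma drawing: "side_drawing (\<sigma> m) (T m) (F m)"
  unfolding \<sigma>_def T_def F_def using left right side_drawing_left side_drawing_right by simp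

lemma side_arc:
  assumes "m < 6"
  shows "arc (side_arc m)" "side_arc m 0 = Complex (\<sigma> m) (real (b m))"
    "side_arc m 1 = Complex (\<sigma> m) (real (b ((m + 1) mod 6)))"
    "0 < t \<Longrightarrow> t < 1 \<Longrightarrow> \<sigma> m * Re (side_arc m t) > 1"
    "path_image (side_arc m) = path_image (F m (e m))"
proof -
  have "b m \<noteq> b ((m + 1) mod 6)"
  proof -
    have "m \<noteq> (m + 1) mod 6" by presburger
    then show ?thesis using b_eq_iff assms by simp
  qed
  note o = orient_side_drawing [OF drawing e_in [OF assms, unfolded e_def] this, folded side_arc_def]
  show "arc (side_arc m)" "side_arc m 0 = Complex (\<sigma> m) (real (b m))"
    "side_arc m 1 = Complex (\<sigma> m) (real (b ((m + 1) mod 6)))"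
    "0 < t \<Longrightarrow> t < 1 \<Longrightarrow> \<sigma> m * Re (side_arc m t) > 1"
    by (fact o)+
  show "path_image (side_arc m) = path_image (F m (e m))"
    unfolding side_arc_def e_def by (rule path_image_orient)
qed

lemma side_arcs_Int:
  assumes "m < 6" "m' < 6" "m \<noteq> m'" "even m \<longleftrightarrow> even m'"
  shows "if interleave (e m) (e m')
    then \<exists>p. path_image (side_arc m) \<inter> path_image (side_arc m') = {p} \<and>
      crosses_at (path_image (side_arc m)) (path_image (side_arc m')) p
    else path_image (side_arc m) \<inter> path_image (side_arc m') = {}"
proof -
  have "T m' = T m" "F m' = F m" unfolding T_def F_def using assms(4) by simp_all
  moreover from this have "e m \<in> pairs (T m)" "e m' \<in> pairs (T m)" "e m \<noteq> e m'"
    using e_in [OF assms(1)] e_in [OF assms(2)] e_eq assms by auto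
  ultimately show ?thesis
    using drawing [of m] unfolding side_drawing_def side_arc(5) [OF assms(1)] side_arc(5) [OF assms(2)] by metis
qed

lemma interleave_sym: "interleave c d \<longleftrightarrow> interleave d c"
  unfolding interleave_def by blast

lemma interleave_crossing:
  assumes "m < 6" "m' < 6" "even m \<longleftrightarrow> even m'" "interleave (e m) (e m')"
  shows "{side_strand m, side_strand m'} \<in> crossings X Y"
  using e_in [OF assms(1)] e_in [OF assms(2)] assms(3,4)
  unfolding crossings_def side_strand_def T_def by (cases "even m") auto

lemma side_arc_Re:
  assumes "m < 6" "0 \<le> t" "t < 1"
  shows "\<sigma> m * Re (side_arc m t) \<ge> 1" "\<sigma> m * Re (side_arc m t) = 1 \<Longrightarrow> side_arc m t = Complex (\<sigma> m) (real (b m))"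
proof -
  have "t = 0 \<and> side_arc m t = Complex (\<sigma> m) (real (b m)) \<or> \<sigma> m * Re (side_arc m t) > 1"
    using side_arc(2,4) [OF assms(1)] assms(2,3) by (cases "t = 0") auto
  moreover have "\<sigma> m * \<sigma> m = 1" using \<sigma>(1) [of m] by auto
  ultimately show "\<sigma> m * Re (side_arc m t) \<ge> 1" "\<sigma> m * Re (side_arc m t) = 1 \<Longrightarrow> side_arc m t = Complex (\<sigma> m) (real (b m))"
    by auto
qed

text \<open>With the far ends excluded by \<open>s < 1\<close> and \<open>t < 1\<close>, only the
  start of a blade could be the start of an arc; but that blade would leave on the other side, so it
  is not the blade preceding the arc and has another number.\<close>

lemma blade_side_arc:
  assumes "m < 6" "m' < 6" "0 \<le> s" "s < 1" "0 \<le> t" "t < 1"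
  shows "Complex (\<sigma> m * (2 * s - 1)) (real (b m)) \<noteq> side_arc m' t"
proof
  assume eq: "Complex (\<sigma> m * (2 * s - 1)) (real (b m)) = side_arc m' t"
  then have re: "Re (side_arc m' t) = \<sigma> m * (2 * s - 1)" and im: "Im (side_arc m' t) = real (b m)"
    by (metis complex.sel)+
  have ge: "\<sigma> m' * (\<sigma> m * (2 * s - 1)) \<ge> 1" using side_arc_Re(1) [OF assms(2,5,6)] re by simp
  then have "\<sigma> m' * \<sigma> m = - 1 \<and> s = 0" using \<sigma>(1) [of m] \<sigma>(1) [of m'] assms(3,4) by auto
  then have "side_arc m' t = Complex (\<sigma> m') (real (b m'))" "m \<noteq> m'"
    using side_arc_Re(2) [OF assms(2,5,6)] re \<sigma>(1) [of m] by auto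
  then show False using im b_eq_iff assms(1,2) by simp
qed

lemma div2: "i < 12 \<Longrightarrow> i div 2 < (6::nat)"
  by simp

lemma piece_meet:
  assumes "i < 12" "j < 12" "i \<noteq> j" "0 \<le> s" "s < 1" "0 \<le> t" "t < 1" "piece i s = piece j t"
  shows "{strand_of i, strand_of j} \<in> crossings X Y"
proof -
  define m m' where "m = i div 2" and "m' = j div 2"
  have m: "m < 6" "m' < 6" unfolding m_def m'_def using assms(1,2) by auto
  show ?thesis
  proof (cases "even i"; cases "even j")
    assume "even i" "even j"
    then have "b m = b m'" using assms(8) unfolding piece_def m_def m'_def by simp
    then have "m = m'" using b_eq_iff m by simp
    then show ?thesis using \<open>even i\<close> \<open>even j\<close> assms(3) unfolding m_def m'_def by (metis dvd_div_mult_self)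
  next
    assume "even i" "odd j"
    then show ?thesis using assms(8) blade_side_arc [OF m assms(4-7)] unfolding piece_def m_def m'_def by simp
  next
    assume "odd i" "even j"
    then show ?thesis using assms(8) blade_side_arc [OF m(2,1) assms(6,7,4,5)] unfolding piece_def m_def m'_def by simp
  next
    assume odd: "odd i" "odd j"
    have mm: "m \<noteq> m'" using odd assms(3) unfolding m_def m'_def by (metis odd_two_times_div_two_succ)
    have eq: "side_arc m s = side_arc m' t" using odd assms(8) unfolding piece_def m_def m'_def by simp
    have par: "even m \<longleftrightarrow> even m'"
    proof (rule ccontr)
      assume "\<not> ?thesis"
      then have "\<sigma> m' = - \<sigma> m" using \<sigma>(2) [of m m'] \<sigma>(1) [of m] \<sigma>(1) [of m'] by auto
      then show False
        using side_arc_Re(1) [OF m(1) assms(4,5)] side_arc_Re(1) [OF m(2) assms(6,7)] eq by simp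
    qed
    have "side_arc m s \<in> path_image (side_arc m)" unfolding path_image_def using assms(4,5) by simp
    moreover have "side_arc m s \<in> path_image (side_arc m')" unfolding eq path_image_def using assms(6,7) by simp
    ultimately have "interleave (e m) (e m')" using side_arcs_Int [OF m mm par] by (auto split: if_splits)
    then have "{side_strand m, side_strand m'} \<in> crossings X Y" using interleave_crossing m par by blast
    then show ?thesis using odd unfolding strand_of_def m_def m'_def by simp
  qed
qed

lemma passages:
  assumes "k < 6"
  shows "ms ((k + 3) mod 6) < 6" "ms k \<noteq> ms ((k + 3) mod 6)" "even (ms k) \<longleftrightarrow> even (ms ((k + 3) mod 6))"
    "interleave (e (ms k)) (e (ms ((k + 3) mod 6)))"
proof -
  show "ms ((k + 3) mod 6) < 6" by (rule ms) simp
  have sym3: "P l (l + 3) \<and> P (l + 3) l \<Longrightarrow> k = l \<or> k = l + 3 \<Longrightarrow> l < 3 \<Longrightarrow> P k ((k + 3) mod 6)"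
    for P :: "nat \<Rightarrow> nat \<Rightarrow> bool" and l
    by auto
  define l where "l = k mod 3"
  have l: "k = l \<or> k = l + 3" "l < 3" unfolding l_def using assms by presburger+
  show "ms k \<noteq> ms ((k + 3) mod 6)"
    by (rule sym3 [of "\<lambda>i j. ms i \<noteq> ms j", OF _ l]) (use ms3 [OF l(2)] in auto)
  show "even (ms k) \<longleftrightarrow> even (ms ((k + 3) mod 6))"
    by (rule sym3 [of "\<lambda>i j. even (ms i) \<longleftrightarrow> even (ms j)", OF _ l]) (use parity [OF l(2)] in auto)
  show "interleave (e (ms k)) (e (ms ((k + 3) mod 6)))"
    by (rule sym3 [of "\<lambda>i j. interleave (e (ms i)) (e (ms j))", OF _ l])
       (use inter [OF l(2)] interleave_sym in \<open>auto simp: e_def\<close>)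
qed

definition us :: "nat \<Rightarrow> real" where
  "us k = (SOME u. u \<in> {0..1} \<and> side_arc (ms k) u \<in> path_image (side_arc (ms ((k + 3) mod 6))))"

text \<open>The crossing is not at an end of the arc: the other arc reaches the line of the blade
  ends only at its own ends, which belong to other blades.\<close>

lemma us:
  assumes "k < 6"
  shows "us k \<in> {0..1}" "path_image (side_arc (ms k)) \<inter> path_image (side_arc (ms ((k + 3) mod 6))) = {side_arc (ms k) (us k)}"
    "crosses_at (path_image (side_arc (ms k))) (path_image (side_arc (ms ((k + 3) mod 6)))) (side_arc (ms k) (us k))"
    "0 < us k" "us k < 1"
    "u \<in> {0..1} \<Longrightarrow> side_arc (ms k) u \<in> path_image (side_arc (ms ((k + 3) mod 6))) \<Longrightarrow> u = us k"
proof -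
  let ?m = "ms k" and ?m' = "ms ((k + 3) mod 6)"
  note p = passages [OF assms]
  have m: "?m < 6" using ms assms by blast
  have "\<exists>z. path_image (side_arc ?m) \<inter> path_image (side_arc ?m') = {z} \<and>
      crosses_at (path_image (side_arc ?m)) (path_image (side_arc ?m')) z"
    using side_arcs_Int [OF m p(1-3)] p(4) by (simp only: if_True)
  then obtain z where z: "path_image (side_arc ?m) \<inter> path_image (side_arc ?m') = {z}"
    "crosses_at (path_image (side_arc ?m)) (path_image (side_arc ?m')) z"
    by blast
  have "z \<in> path_image (side_arc ?m) \<inter> path_image (side_arc ?m')" unfolding z(1) by simp
  then have zm: "z \<in> side_arc ?m ` {0..1}" "z \<in> path_image (side_arc ?m')" unfolding path_image_def by simp_all
  obtain u where "z = side_arc ?m u" "u \<in> {0..1}" by (rule imageE [OF zm(1)])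
  then have "u \<in> {0..1} \<and> side_arc ?m u \<in> path_image (side_arc ?m')" using zm(2) by simp
  then have u: "us k \<in> {0..1} \<and> side_arc ?m (us k) \<in> path_image (side_arc ?m')"
    unfolding us_def by (rule someI)
  then have "side_arc ?m (us k) \<in> path_image (side_arc ?m) \<inter> path_image (side_arc ?m')"
    unfolding path_image_def by blast
  then have zu: "z = side_arc ?m (us k)" unfolding z(1) by simp
  show "us k \<in> {0..1}" using u by blast
  show "path_image (side_arc ?m) \<inter> path_image (side_arc ?m') = {side_arc ?m (us k)}"
    "crosses_at (path_image (side_arc ?m)) (path_image (side_arc ?m')) (side_arc ?m (us k))"
    using z zu by simp_all
  show "u \<in> {0..1} \<Longrightarrow> side_arc ?m u \<in> path_image (side_arc ?m') \<Longrightarrow> u = us k" for u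
  proof -
    assume a: "u \<in> {0..1}" "side_arc ?m u \<in> path_image (side_arc ?m')"
    then have "side_arc ?m u \<in> path_image (side_arc ?m) \<inter> path_image (side_arc ?m')"
      unfolding path_image_def by blast
    then have "side_arc ?m u = side_arc ?m (us k)" unfolding z(1) zu by simp
    then show "u = us k" using side_arc(1) [OF m] a(1) u unfolding arc_def inj_on_def by blast
  qed
  obtain v where v: "v \<in> {0..1}" "side_arc ?m (us k) = side_arc ?m' v"
    using u unfolding path_image_def by blast
  have end_pt: "side_arc l t = Complex (\<sigma> l) (real (b l)) \<or> side_arc l t = Complex (\<sigma> l) (real (b ((l + 1) mod 6))) \<or> \<sigma> l * Re (side_arc l t) > 1"
    if l: "l < 6" and t: "t \<in> {0..1}" for l t
  proof -
    consider "t = 0" | "t = 1" | "0 < t" "t < 1" using t by fastforce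
    then show ?thesis
    proof cases
      case 1
      then show ?thesis using side_arc(2) [OF l] by simp
    next
      case 2
      then show ?thesis using side_arc(3) [OF l] by simp
    next
      case 3
      then show ?thesis using side_arc(4) [OF l] by blast
    qed
  qed
  have s: "\<sigma> ?m = \<sigma> ?m'" using p(3) \<sigma>(2) [of ?m ?m'] by blast
  have s2: "\<sigma> ?m * \<sigma> ?m = 1" using \<sigma>(1) [of ?m] by (elim disjE) simp_all
  have no: "b l \<noteq> b ?m'" "b l \<noteq> b ((?m' + 1) mod 6)" if "l = ?m \<or> l = (?m + 1) mod 6" for l
  proof -
    have "l < 6" using that m by auto
    moreover have "l \<noteq> ?m'" "l \<noteq> (?m' + 1) mod 6"
      using neighbours_mod_6 [OF m p(1,2,3) that] by blast+
    ultimately show "b l \<noteq> b ?m'" "b l \<noteq> b ((?m' + 1) mod 6)" using b_eq_iff p(1) by simp_all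
  qed
  have False if "side_arc ?m (us k) = Complex (\<sigma> ?m) (real (b l))" "l = ?m \<or> l = (?m + 1) mod 6" for l
  proof -
    have c: "side_arc ?m' v = Complex (\<sigma> ?m) (real (b l))" using that(1) v(2) by simp
    show False
      using end_pt [OF p(1) v(1)] unfolding c
      by (elim disjE) (use no [OF that(2)] s s2 in simp_all)
  qed
  then have "us k \<noteq> 0" "us k \<noteq> 1" using side_arc(2,3) [OF m] by metis+
  then show "0 < us k" "us k < 1" using u by auto
qed

lemma image_bij_strand_of: "inj_on strand_of {..<12}" "strand_of ` {..<12} = strands X Y"
proof -
  have odd_strand: "strand_of (2 * m) = Blade (b m)" "strand_of (2 * m + 1) = side_strand m" for m
    unfolding strand_of_def by simp_all
  show "inj_on strand_of {..<12}"
  proof (rule inj_onI)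
    fix i j assume ij: "i \<in> {..<12}" "j \<in> {..<12::nat}" "strand_of i = strand_of j"
    have m: "i div 2 < 6" "j div 2 < 6" using ij by auto
    have ss: "side_strand p = side_strand q \<Longrightarrow> (even p \<longleftrightarrow> even q) \<and> e p = e q" "Blade n \<noteq> side_strand q" "side_strand q \<noteq> Blade n" for p q n
      unfolding side_strand_def by (auto split: if_splits)
    have par: "even i \<longleftrightarrow> even j" using ij(3) ss(2,3) unfolding strand_of_def by metis
    have "i div 2 = j div 2"
    proof (cases "even i")
      case True
      then have "b (i div 2) = b (j div 2)" using ij(3) par unfolding strand_of_def by simp
      then show ?thesis using b_eq_iff m by simp
    next
      case False
      then have "side_strand (i div 2) = side_strand (j div 2)" using ij(3) par unfolding strand_of_def by simp
      then show ?thesis using ss(1) e_eq m by blast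
    qed
    then show "i = j" using par by presburger
  qed
  have "{..<12} = (\<lambda>m. 2 * m) ` {..<6} \<union> (\<lambda>m. 2 * m + 1) ` {..<6::nat}"
  proof (intro equalityI subsetI)
    fix i :: nat assume "i \<in> {..<12}"
    then have "i div 2 < 6" "i = 2 * (i div 2) \<or> i = 2 * (i div 2) + 1" by auto
    then show "i \<in> (\<lambda>m. 2 * m) ` {..<6} \<union> (\<lambda>m. 2 * m + 1) ` {..<6}" by blast
  qed auto
  then have "strand_of ` {..<12} = Blade ` b ` {..<6} \<union> side_strand ` {..<6}"
    by (simp only: image_Un image_image odd_strand)
  also have "side_strand ` {..<6} = Left_Arc ` pairs X \<union> Right_Arc ` pairs Y"
  proof -
    have Xe: "pairs X = e ` {m. m < 6 \<and> odd m}" "pairs Y = e ` {m. m < 6 \<and> even m}"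
      using pairs_T [of 1] pairs_T [of 0] unfolding T_def by simp_all
    have six: "{..<6} = {m. m < 6 \<and> odd m} \<union> {m. m < 6 \<and> even m}" by auto
    have "side_strand ` {..<6} = side_strand ` {m. m < 6 \<and> odd m} \<union> side_strand ` {m. m < 6 \<and> even m}"
      by (subst six) (rule image_Un)
    also have "\<dots> = Left_Arc ` e ` {m. m < 6 \<and> odd m} \<union> Right_Arc ` e ` {m. m < 6 \<and> even m}"
      unfolding image_image by (intro arg_cong2 [of _ _ _ _ "(\<union>)"] image_cong) (simp_all add: side_strand_def)
    finally show ?thesis unfolding Xe .
  qed
  finally show "strand_of ` {..<12} = strands X Y"
    unfolding strands_def image_b by (simp only: Un_assoc)
qed

lemma piece_image:
  assumes "i < 12" shows "piece i ` {0..1} = strand_curve L R (strand_of i)"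
proof (cases "even i")
  case True
  define m where "m = i div 2"
  have "piece i ` {0..1} = blade (b m)"
  proof (intro equalityI subsetI)
    fix z assume "z \<in> piece i ` {0..1}"
    then obtain t where t: "0 \<le> t" "t \<le> 1" "z = Complex (\<sigma> m * (2 * t - 1)) (real (b m))"
      unfolding piece_def m_def using True by auto
    define u where "u = (if even m then t else 1 - t)"
    have "z = (1 - u) *\<^sub>R Complex (- 1) (real (b m)) + u *\<^sub>R Complex 1 (real (b m))" "0 \<le> u" "u \<le> 1"
      using t unfolding u_def \<sigma>_def by (auto simp: complex_eq_iff algebra_simps)
    then show "z \<in> blade (b m)" unfolding blade_def closed_segment_def by blast
  next
    fix z assume "z \<in> blade (b m)"
    then obtain u where u: "0 \<le> u" "u \<le> 1" "z = (1 - u) *\<^sub>R Complex (- 1) (real (b m)) + u *\<^sub>R Complex 1 (real (b m))"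
      unfolding blade_def closed_segment_def by blast
    define t where "t = (if even m then u else 1 - u)"
    have "z = piece i t" "t \<in> {0..1}"
      using u True unfolding t_def piece_def \<sigma>_def m_def [symmetric] by (auto simp: complex_eq_iff algebra_simps)
    then show "z \<in> piece i ` {0..1}" by blast
  qed
  then show ?thesis using True unfolding strand_of_def m_def by simp
next
  case False
  then have "piece i ` {0..1} = path_image (side_arc (i div 2))" unfolding piece_def path_image_def by simp
  then show ?thesis
    using False side_arc(5) [of "i div 2"] assms unfolding strand_of_def side_strand_def F_def by simp
qed

definition js :: "nat \<Rightarrow> nat" where "js k = 2 * ms k + 1"

lemma piece_js: "piece (js k) = side_arc (ms k)"
  unfolding piece_def js_def by auto

text \<open>Passages on different arcs are ordered by the arcs. For two passages on one arc the
  parameters given by \<open>meets_in_order\<close> are \<open>us k\<close> and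
  \<open>us (k + 1)\<close>, since two arcs meet only once.\<close>

lemma order:
  assumes "k < 5" shows "real (js k) + us k < real (js (k + 1)) + us (k + 1)"
  using mono [OF assms]
proof
  assume "ms k < ms (k + 1)"
  then have "real (js k) + 2 \<le> real (js (k + 1))" unfolding js_def by linarith
  then show ?thesis using us(5) [of k] us(4) [of "k + 1"] assms by simp
next
  assume m: "ms k = ms (k + 1) \<and> even (ms k) \<and>
    meets_in_order (orient R (b (ms k)) (b ((ms k + 1) mod 6)))
      (path_image (R {b (ms ((k + 3) mod 6)), b ((ms ((k + 3) mod 6) + 1) mod 6)}))
      (path_image (R {b (ms ((k + 4) mod 6)), b ((ms ((k + 4) mod 6) + 1) mod 6)}))"
  have k: "k < 6" "k + 1 < 6" "(k + 1 + 3) mod 6 = (k + 4) mod 6" using assms by (auto simp: add.commute)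
  have ev: "even (ms k)" "even (ms ((k + 3) mod 6))" "even (ms ((k + 4) mod 6))"
    using m passages(3) [OF k(1)] passages(3) [OF k(2)] k(3) by auto
  have F: "F (ms k) = R" "F (ms ((k + 3) mod 6)) = R" "F (ms ((k + 4) mod 6)) = R"
    unfolding F_def using ev by simp_all
  have "meets_in_order (side_arc (ms k)) (path_image (side_arc (ms ((k + 3) mod 6)))) (path_image (side_arc (ms ((k + 4) mod 6))))"
    using m unfolding side_arc_def F path_image_orient by blast
  then obtain s t where st: "0 \<le> s" "s < t" "t \<le> 1" "side_arc (ms k) s \<in> path_image (side_arc (ms ((k + 3) mod 6)))"
    "side_arc (ms k) t \<in> path_image (side_arc (ms ((k + 4) mod 6)))"
    unfolding meets_in_order_def by blast
  have "s = us k" using us(6) [OF k(1), of s] st by auto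
  moreover have "t = us (k + 1)" using us(6) [OF k(2), of t] st m k(3) by auto
  ultimately show ?thesis using st(2) m unfolding js_def by simp
qed

sublocale strand_cycle X Y L R piece strand_of js us
proof
  fix i j :: nat and s t :: real
  show "i < 12 \<Longrightarrow> continuous_on {0..1} (piece i)"
  proof (cases "even i")
    case True
    then have "piece i = (\<lambda>t. Complex (\<sigma> (i div 2) * (2 * t - 1)) (real (b (i div 2))))"
      unfolding piece_def by auto
    then show ?thesis unfolding Complex_eq by (auto intro!: continuous_intros)
  next
    case False
    assume "i < 12"
    then have "path (side_arc (i div 2))" by (intro arc_imp_path side_arc(1) div2)
    moreover have "piece i = side_arc (i div 2)" using False unfolding piece_def by auto
    ultimately show ?thesis unfolding path_def by simp
  qed
  show "i < 12 \<Longrightarrow> inj_on (piece i) {0..1}"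
  proof (cases "even i")
    case True
    then show ?thesis
      unfolding piece_def inj_on_def using \<sigma>(1) [of "i div 2"] by auto
  next
    case False
    assume "i < 12"
    then have "arc (side_arc (i div 2))" by (intro side_arc(1) div2)
    moreover have "piece i = side_arc (i div 2)" using False unfolding piece_def by auto
    ultimately show ?thesis unfolding arc_def by simp
  qed
  show "i < 12 \<Longrightarrow> piece i 1 = piece ((i + 1) mod 12) 0"
  proof (cases "even i")
    case True
    assume "i < 12"
    then have "(i + 1) mod 12 = i + 1" "(i + 1) div 2 = i div 2" using True by (auto elim!: evenE)
    then show ?thesis using True side_arc(2) [of "i div 2"] \<open>i < 12\<close> unfolding piece_def by simp
  next
    case False
    assume i: "i < 12"
    obtain m where m: "i = 2 * m + 1" using False by (elim oddE)
    have "(i + 1) mod 12 = 2 * ((i div 2 + 1) mod 6)"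
      using mult_mod_right [of 2 "m + 1" 6] unfolding m by simp
    then have "even ((i + 1) mod 12)" "((i + 1) mod 12) div 2 = (i div 2 + 1) mod 6" by simp_all
    then show ?thesis
      using False side_arc(3) [of "i div 2"] i \<sigma>(3) [of "i div 2"] unfolding piece_def by simp
  qed
  show "i < 12 \<Longrightarrow> piece i ` {0..1} = strand_curve L R (strand_of i)" by (rule piece_image)
  show "inj_on strand_of {..<12}" "strand_of ` {..<12} = strands X Y" by (rule image_bij_strand_of)+
  show "\<lbrakk>i < 12; j < 12; i \<noteq> j; 0 \<le> s; s < 1; 0 \<le> t; t < 1; piece i s = piece j t\<rbrakk> \<Longrightarrow> {strand_of i, strand_of j} \<in> crossings X Y"
    by (rule piece_meet)
  have "strand_of (js k) = side_strand (ms k)" for k unfolding strand_of_def js_def by simp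
  then show "crossings X Y = (\<lambda>k. {strand_of (js k), strand_of (js (k + 3))}) ` {..<3}"
    unfolding crossings_ms side_strand_def e_def by simp
  fix k :: nat
  show "k < 6 \<Longrightarrow> js k < 12" "odd (js k)" unfolding js_def using ms [of k] by auto
  show "k < 3 \<Longrightarrow> js k \<noteq> js (k + 3)" unfolding js_def using ms3 [of k] by simp
  show "k < 6 \<Longrightarrow> 0 < us k" "k < 6 \<Longrightarrow> us k < 1" using us(4,5) by blast+
  show "k < 6 \<Longrightarrow> piece (js k) ` {0..1} \<inter> piece (js ((k + 3) mod 6)) ` {0..1} = {piece (js k) (us k)}"
    unfolding piece_js by (rule us(2) [unfolded path_image_def])
  show "k < 6 \<Longrightarrow> crosses_at (piece (js k) ` {0..1}) (piece (js ((k + 3) mod 6)) ` {0..1}) (piece (js k) (us k))"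
    unfolding piece_js by (rule us(3) [unfolded path_image_def])
  show "k < 5 \<Longrightarrow> real (js k) + us k < real (js (k + 1)) + us (k + 1)" by (rule order)
qed

lemma conclusion:
  "same_on_sphere (projection X Y L R) trefoil_projection \<and>
   card (crossings X Y) = 3 \<and>
   card (over_choices X Y) = 8 \<and>
   card {c \<in> over_choices X Y. \<exists>K. has_diagram X Y L R c K \<and> trivial_knot K} = 6 \<and>
   card {c \<in> over_choices X Y. \<exists>K. has_diagram X Y L R c K \<and> trefoil_knot K} = 2"
  using same_on_sphere_projection card_crossings card_over_choices card_trivial card_trefoil by blast

end

section \<open>The six pairs of patterns\<close>

lemma interleave_iff:
  "interleave {a, b} {c, d} \<longleftrightarrow>
     min a b < min c d \<and> min c d < max a b \<and> max a b < max c d \<or>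
     min c d < min a b \<and> min a b < max c d \<and> max c d < max a b"
proof
  assume "interleave {a, b} {c, d}"
  then show "min a b < min c d \<and> min c d < max a b \<and> max a b < max c d \<or>
     min c d < min a b \<and> min a b < max c d \<and> max c d < max a b"
    unfolding interleave_def by (auto simp: doubleton_eq_iff)
next
  have mm: "{a, b} = {min a b, max a b}" for a b :: nat by (auto simp: min_def max_def)
  assume "min a b < min c d \<and> min c d < max a b \<and> max a b < max c d \<or>
     min c d < min a b \<and> min a b < max c d \<and> max c d < max a b"
  then show "interleave {a, b} {c, d}"
    unfolding interleave_def using mm [of a b] mm [of c d] by blast
qed

text \<open>The arc from \<open>m\<close> to \<open>M\<close> shields \<open>i\<close> from the arc
  that starts beyond it: by \<open>half_plane_meets_first\<close> it is met no later, and the two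
  arcs are disjoint, so strictly earlier.\<close>

lemma right_drawing_meets_in_order:
  assumes R: "right_drawing Y R"
    and pairs: "{i, x} \<in> pairs Y" "{m, M} \<in> pairs Y" "{k, l} \<in> pairs Y"
    and lt: "m < i" "i < M" "k < m \<or> M < k" and ne: "i \<noteq> x" "k \<noteq> l"
    and inter: "\<not> interleave {k, l} {m, M}" "interleave {i, x} {k, l}"
  shows "meets_in_order (orient R i x) (path_image (R {m, M})) (path_image (R {k, l}))"
proof -
  have sd: "side_drawing 1 Y R" using R by (rule side_drawing_right)
  have re: "1 \<le> Re z" if ab: "{a, b} \<in> pairs Y" "a \<noteq> b" and z: "z \<in> path_image (orient R a b)" for a b z
  proof -
    obtain t where t: "0 \<le> t" "t \<le> 1" "z = orient R a b t" using z unfolding path_image_def by auto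
    then show ?thesis
      using orient_side_drawing(2,3) [OF sd ab] orient_side_drawing(4) [OF sd ab, of t]
      by (cases "t = 0"; cases "t = 1") auto
  qed
  have mM: "m \<noteq> M" using lt by simp
  have p: "path (orient R a b)" "pathstart (orient R a b) = Complex 1 (real a)" "pathfinish (orient R a b) = Complex 1 (real b)"
    if "{a, b} \<in> pairs Y" "a \<noteq> b" for a b
    using orient_side_drawing(1-3) [OF sd that] by (auto simp: arc_imp_path pathstart_def pathfinish_def)
  have "{k, l} \<noteq> {m, M}" using lt by (auto simp: doubleton_eq_iff)
  then have dis: "path_image (R {k, l}) \<inter> path_image (R {m, M}) = {}"
    using sd pairs inter(1) unfolding side_drawing_def by meson
  have "{i, x} \<noteq> {k, l}" using inter(2) unfolding interleave_def by (auto simp: doubleton_eq_iff)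
  then have "path_image (R {i, x}) \<inter> path_image (R {k, l}) \<noteq> {}"
    using sd pairs inter(2) unfolding side_drawing_def by (metis insert_not_empty)
  then obtain z where z: "z \<in> path_image (orient R i x)" "z \<in> path_image (orient R k l)" by auto
  obtain s where "z = orient R i x s" "s \<in> {0..1}"
    using z(1) unfolding path_image_def by (rule imageE)
  then have s: "s \<in> {0..1}" "orient R i x s \<in> path_image (orient R k l)" using z(2) by simp_all
  have "\<exists>u\<in>{0..s}. orient R i x u \<in> path_image (orient R m M)"
  proof (rule half_plane_meets_first [OF p(1) [OF pairs(1) ne(1)] p(1) [OF pairs(2) mM] p(1) [OF pairs(3) ne(2)] _
        p(2) [OF pairs(1) ne(1)] p(2,3) [OF pairs(2) mM] p(2) [OF pairs(3) ne(2)] _ _ _ _ s])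
    fix z assume "z \<in> path_image (orient R i x) \<union> path_image (orient R m M) \<union> path_image (orient R k l)"
    then show "1 \<le> Re z" using re pairs ne mM by blast
  qed (use lt dis in auto)
  then obtain u where u: "0 \<le> u" "u \<le> s" "orient R i x u \<in> path_image (R {m, M})" by auto
  moreover have "u \<noteq> s" using u(3) s(2) dis by auto
  ultimately show ?thesis
    using s unfolding meets_in_order_def by (intro exI [of _ u] exI [of _ s]) auto
qed

lemma crossings_Un:
  "crossings X Y =
    (\<Union>e\<in>pairs X. \<Union>e'\<in>pairs X. if interleave e e' then {{Left_Arc e, Left_Arc e'}} else {}) \<union>
    (\<Union>e\<in>pairs Y. \<Union>e'\<in>pairs Y. if interleave e e' then {{Right_Arc e, Right_Arc e'}} else {})"
  unfolding crossings_def by (auto split: if_splits)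

lemma less_numeral_cases:
  fixes k :: nat
  shows "k < 3 \<Longrightarrow> k = 0 \<or> k = 1 \<or> k = 2"
    and "k < 5 \<Longrightarrow> k = 0 \<or> k = 1 \<or> k = 2 \<or> k = 3 \<or> k = 4"
  by linarith+

lemma lessThan_numeral_insert: "{..<3} = {0, 1, 2::nat}"
  by auto

text \<open>The locale assumptions for explicit lists with finite quantifiers, so that each pair of
  patterns is checked by evaluation.\<close>

lemma tied_bladesI:
  fixes bs ns :: "nat list"
  assumes "left_drawing X L" "right_drawing Y R"
    and "distinct bs" "length bs = 6" "set bs = {1, 2, 3, 4, 5, 6}"
    and "pairs X = {{bs ! 1, bs ! 2}, {bs ! 3, bs ! 4}, {bs ! 5, bs ! 0}}"
    and "pairs Y = {{bs ! 0, bs ! 1}, {bs ! 2, bs ! 3}, {bs ! 4, bs ! 5}}"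
    and "length ns = 6" "\<forall>n\<in>set ns. n < 6"
    and "\<forall>k\<in>{0, 1, 2}. ns ! k \<noteq> ns ! (k + 3) \<and> (even (ns ! k) \<longleftrightarrow> even (ns ! (k + 3))) \<and>
      interleave {bs ! (ns ! k), bs ! ((ns ! k + 1) mod 6)} {bs ! (ns ! (k + 3)), bs ! ((ns ! (k + 3) + 1) mod 6)}"
    and "crossings X Y = (\<lambda>k.
        {(if even (ns ! k) then Right_Arc else Left_Arc) {bs ! (ns ! k), bs ! ((ns ! k + 1) mod 6)},
         (if even (ns ! (k + 3)) then Right_Arc else Left_Arc) {bs ! (ns ! (k + 3)), bs ! ((ns ! (k + 3) + 1) mod 6)}}) ` {0, 1, 2}"
    and "\<forall>k\<in>{0, 1, 2, 3, 4}. ns ! k < ns ! (k + 1) \<or> ns ! k = ns ! (k + 1) \<and> even (ns ! k) \<and>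
        meets_in_order (orient R (bs ! (ns ! k)) (bs ! ((ns ! k + 1) mod 6)))
          (path_image (R {bs ! (ns ! ((k + 3) mod 6)), bs ! ((ns ! ((k + 3) mod 6) + 1) mod 6)}))
          (path_image (R {bs ! (ns ! ((k + 4) mod 6)), bs ! ((ns ! ((k + 4) mod 6) + 1) mod 6)}))"
  shows "tied_blades X Y L R ((!) bs) ((!) ns)"
proof
  fix k :: nat
  show "left_drawing X L" "right_drawing Y R" by (fact assms)+
  show "inj_on ((!) bs) {..<6}" using assms(3,4) by (metis inj_on_nth lessThan_iff)
  have "(!) bs ` {..<6} = set bs" using assms(4) by (auto simp: set_conv_nth)
  moreover have "{1..6} = {1, 2, 3, 4, 5, 6::nat}" by auto
  ultimately show "(!) bs ` {..<6} = {1..6}" using assms(5) by (simp only:)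
  show "pairs X = {{bs ! 1, bs ! 2}, {bs ! 3, bs ! 4}, {bs ! 5, bs ! 0}}"
    "pairs Y = {{bs ! 0, bs ! 1}, {bs ! 2, bs ! 3}, {bs ! 4, bs ! 5}}" by (fact assms)+
  show "k < 6 \<Longrightarrow> ns ! k < 6" using assms(8,9) by simp
  show "k < 3 \<Longrightarrow> ns ! k \<noteq> ns ! (k + 3)" "k < 3 \<Longrightarrow> even (ns ! k) \<longleftrightarrow> even (ns ! (k + 3))"
    "k < 3 \<Longrightarrow> interleave {bs ! (ns ! k), bs ! ((ns ! k + 1) mod 6)} {bs ! (ns ! (k + 3)), bs ! ((ns ! (k + 3) + 1) mod 6)}"
    using assms(10) by (auto dest!: less_numeral_cases(1))
  show "crossings X Y = (\<lambda>k.
        {(if even (ns ! k) then Right_Arc else Left_Arc) {bs ! (ns ! k), bs ! ((ns ! k + 1) mod 6)},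
         (if even (ns ! (k + 3)) then Right_Arc else Left_Arc) {bs ! (ns ! (k + 3)), bs ! ((ns ! (k + 3) + 1) mod 6)}}) ` {..<3}"
    unfolding lessThan_numeral_insert by (fact assms)
  assume "k < 5"
  then have "k \<in> {0, 1, 2, 3, 4}" using less_numeral_cases(2) by simp
  then show "ns ! k < ns ! (k + 1) \<or> ns ! k = ns ! (k + 1) \<and> even (ns ! k) \<and>
        meets_in_order (orient R (bs ! (ns ! k)) (bs ! ((ns ! k + 1) mod 6)))
          (path_image (R {bs ! (ns ! ((k + 3) mod 6)), bs ! ((ns ! ((k + 3) mod 6) + 1) mod 6)}))
          (path_image (R {bs ! (ns ! ((k + 4) mod 6)), bs ! ((ns ! ((k + 4) mod 6) + 1) mod 6)}))"
    using assms(12) by blast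
qed

lemma right_drawing_E1:
  assumes "right_drawing E1 R"
  shows "meets_in_order (R {1,4}) (path_image (R {2,5})) (path_image (R {3,6})) \<and>
    meets_in_order (R {2,5}) (path_image (R {1,4})) (path_image (R {3,6})) \<and>
    meets_in_order (R {3,6}) (path_image (R {1,4})) (path_image (R {2,5}))"
proof (rule mp)
  show "E1 = E1 \<longrightarrow> ?thesis" using assms unfolding right_drawing_def by (elim conjE)
qed (rule refl)

lemma right_drawing_E2:
  assumes "right_drawing E2 R"
  shows "meets_in_order (R {1,4}) (path_image (R {3,6})) (path_image (R {2,5})) \<and>
    meets_in_order (R {2,5}) (path_image (R {3,6})) (path_image (R {1,4})) \<and>
    meets_in_order (R {3,6}) (path_image (R {2,5})) (path_image (R {1,4}))"
proof (rule mp)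
  show "E2 = E2 \<longrightarrow> ?thesis" using assms unfolding right_drawing_def by (elim conjE)
qed (rule refl)

lemma tied_blades_cases:
  assumes "(X, Y) \<in> {(A1, E2), (A2, E1), (C1, D3), (C2, D1), (C3, D2), (C6, D2)}"
    and l: "left_drawing X L" and r: "right_drawing Y R"
  shows "\<exists>b ms. tied_blades X Y L R b ms"
proof -
  \<comment> \<open>In each case the first list is the order of the blades when the curve is traced
    from blade 1, run to the right; the second gives, for each of the six passages, the index of the
    arc that carries it. A repeated index is an arc with two crossings, for which the order along
    the arc has to be supplied.\<close>
  note simps = interleave_iff crossings_Un insert_commute orient_def
  consider "X = A1" "Y = E2" | "X = A2" "Y = E1" | "X = C1" "Y = D3" | "X = C2" "Y = D1" | "X = C3" "Y = D2" | "X = C6" "Y = D2"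
    using assms(1) by auto
  then show ?thesis
  proof cases
    case 1
    \<comment> \<open>The curve enters the arc 25 from blade 5, so the order prescribed along it is
      reversed; the same happens in the next case.\<close>
    have "meets_in_order (R {1,4}) (path_image (R {3,6})) (path_image (R {2,5}))"
      "meets_in_order (reversepath (R {2,5})) (path_image (R {1,4})) (path_image (R {3,6}))"
      "meets_in_order (R {3,6}) (path_image (R {2,5})) (path_image (R {1,4}))"
      using right_drawing_E2 [OF r [unfolded 1]] meets_in_order_reversepath by blast+
    then have "tied_blades X Y L R ((!) [1, 4, 3, 6, 5, 2]) ((!) [0, 0, 2, 2, 4, 4])"
      by - (rule tied_bladesI [OF l r]; simp add: 1 simps)
    then show ?thesis by blast
  next
    case 2
    have "meets_in_order (R {1,4}) (path_image (R {2,5})) (path_image (R {3,6}))"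
      "meets_in_order (reversepath (R {2,5})) (path_image (R {3,6})) (path_image (R {1,4}))"
      "meets_in_order (R {3,6}) (path_image (R {1,4})) (path_image (R {2,5}))"
      using right_drawing_E1 [OF r [unfolded 2]] meets_in_order_reversepath by blast+
    then have "tied_blades X Y L R ((!) [1, 4, 5, 2, 3, 6]) ((!) [0, 0, 2, 2, 4, 4])"
      by - (rule tied_bladesI [OF l r]; simp add: 2 simps)
    then show ?thesis by blast
  next
    case 3
    have "meets_in_order (orient R 3 6) (path_image (R {2,4})) (path_image (R {1,5}))"
      using r unfolding 3 by (rule right_drawing_meets_in_order) (auto simp: interleave_iff)
    then have "tied_blades X Y L R ((!) [1, 5, 3, 6, 4, 2]) ((!) [0, 1, 2, 2, 3, 4])"
      by - (rule tied_bladesI [OF l r]; simp add: 3 simps)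
    then show ?thesis by blast
  next
    case 4
    \<comment> \<open>The arc 35 shields the end 4 from the arc 26, whereas the curve runs from 1 to
      4; hence the reversal.\<close>
    have "meets_in_order (orient R 4 1) (path_image (R {3,5})) (path_image (R {2,6}))"
      using r unfolding 4 by (rule right_drawing_meets_in_order) (auto simp: interleave_iff insert_commute)
    from meets_in_order_reversepath [OF this]
    have "tied_blades X Y L R ((!) [1, 4, 6, 2, 3, 5]) ((!) [0, 0, 1, 2, 4, 5])"
      by - (rule tied_bladesI [OF l r]; simp add: 4 simps)
    then show ?thesis by blast
  next
    case 5
    have "meets_in_order (orient R 2 5) (path_image (R {1,3})) (path_image (R {4,6}))"
      using r unfolding 5 by (rule right_drawing_meets_in_order) (auto simp: interleave_iff)
    then have "tied_blades X Y L R ((!) [1, 3, 4, 6, 2, 5]) ((!) [0, 2, 3, 4, 4, 5])"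
      by - (rule tied_bladesI [OF l r]; simp add: 5 simps)
    then show ?thesis by blast
  next
    case 6
    have "meets_in_order (orient R 2 5) (path_image (R {1,3})) (path_image (R {4,6}))"
      using r unfolding 6 by (rule right_drawing_meets_in_order) (auto simp: interleave_iff)
    from meets_in_order_reversepath [OF this]
    have "tied_blades X Y L R ((!) [1, 3, 5, 2, 4, 6]) ((!) [0, 1, 2, 2, 3, 4])"
      by - (rule tied_bladesI [OF l r]; simp add: 6 simps)
    then show ?thesis by blast
  qed
qed

theorem lemma5:
  fixes X Y :: tying and L R :: "nat set \<Rightarrow> real \<Rightarrow> complex"
  assumes "(X, Y) \<in> {(A1, E2), (A2, E1), (C1, D3), (C2, D1), (C3, D2), (C6, D2)}"
    and "left_drawing X L" and "right_drawing Y R"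
  shows "same_on_sphere (projection X Y L R) trefoil_projection \<and>
         card (crossings X Y) = 3 \<and>
         card (over_choices X Y) = 8 \<and>
         card {c \<in> over_choices X Y. \<exists>K. has_diagram X Y L R c K \<and> trivial_knot K} = 6 \<and>
         card {c \<in> over_choices X Y. \<exists>K. has_diagram X Y L R c K \<and> trefoil_knot K} = 2"
  using tied_blades_cases [OF assms] tied_blades.conclusion by blast

end
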